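(* For persistent spaces $X_\bullet$ and $Y_\bullet$ with $\mathrm{q}$-tame persistent (co)homology, $$d_{\mathrm{E}}(\mathbf{cup}(X_\bullet),\mathbf{cup}(Y_\bullet))\leq d_{\mathrm{E}}\left(\mathbf{rk}(\Phi(X_\bullet)),\mathbf{rk}(\Phi(Y_\bullet))\right)\leq d_{\mathrm{HI}}(X_\bullet,Y_\bullet).$$ For the Vietoris-Rips filtrations $X_\bullet=\mathrm{VR}_\bullet(X)$ and $Y_\bullet=\mathrm{VR}_\bullet(Y)$ of two metric spaces $X$ and $Y$ (with $\mathrm{q}$-tame persistent (co)homology), the three quantities $d_{\mathrm{E}}(\mathbf{cup}(\mathrm{VR}_\bullet(X)),\mathbf{cup}(\mathrm{VR}_\bullet(Y)))$, $d_{\mathrm{E}}\left(\mathbf{rk}(\Phi(\mathrm{VR}_\bullet(X))),\mathbf{rk}(\Phi(\mathrm{VR}_\bullet(Y)))\right)$ and $d_{\mathrm{HI}}(\mathrm{VR}_\bullet(X),\mathrm{VR}_\bullet(Y))$ are all bounded above by $2\cdot d_{\mathrm{GH}}(X,Y)$.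
   Context: $\mathrm{Top}$ is the category of compactly generated weak Hausdorff spaces; a persistent space is a functor $X_\bullet:(\mathbb{R},\leq)\to\mathrm{Top}$. Cohomology is over a fixed field $K$. A persistence module is $\mathrm{q}$-tame if all its structure maps between indices $t<t'$ have finite rank; $X_\bullet$ has $\mathrm{q}$-tame persistent (co)homology if $\mathbf{H}^p(X_\bullet)$ is $\mathrm{q}$-tame for each $p$. Let $\mathrm{Int}$ be the set of closed intervals $[a,b]$, $a\leq b$ in $\mathbb{R}$. Persistent cup-length: for a graded ring $R$, $\mathbf{len}(R)$ is the largest $\ell\geq0$ such that some product of $\ell$ homogeneous positive-degree elements is nonzero ($0$ if there are no nonzero positive-degree elements, $\infty$ if no largest exists). $\mathbf{cup}(X_\bullet)([a,b])=\mathbf{len}(\mathrm{im}(\mathbf{H}^*(X_b)\to\mathbf{H}^*(X_a)))$. Persistent cup module: let $\mathbf{H}^+(X)=\bigoplus_{p\geq1}\mathbf{H}^p(X)$, and for $\ell\geq1$ let $(\mathbf{H}^+(X))^\ell$ be the graded subalgebra generated by (equivalently, the linear span of) all $\ell$-fold cup products of elements of $\mathbf{H}^+(X)$. $\Phi(X)$ is the graded flag $\mathbf{H}^+(X)\supseteq(\mathbf{H}^+(X))^2\supseteq(\mathbf{H}^+(X))^3\supseteq\cdots$, and $\Phi(X_\bullet)$ is the (contravariant) persistent graded flag $t\mapsto\Phi(X_t)$ with maps $\Phi(X_{t'})\to\Phi(X_t)$, $t\leq t'$, induced on cohomology. Its rank invariant is the matrix-valued function $\mathbf{rk}(\Phi(X_\bullet))([a,b])=\left(\dim\mathrm{im}\left(\deg_p((\mathbf{H}^+(X_b))^\ell)\to\deg_p((\mathbf{H}^+(X_a))^\ell)\right)\right)_{p\geq1,\ell\geq1}$,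 where $\deg_p$ denotes the degree-$p$ component; matrices are ordered entrywise (entries are finite when $a<b$, and are allowed to be $\infty$ when $a=b$). Erosion distance: order-reversing $\mathbf{J}_1,\mathbf{J}_2$ from $(\mathrm{Int},\subseteq)$ to a poset are $\epsilon$-eroded if $\mathbf{J}_1([a,b])\geq\mathbf{J}_2([a-\epsilon,b+\epsilon])$ and $\mathbf{J}_2([a,b])\geq\mathbf{J}_1([a-\epsilon,b+\epsilon])$ for all $[a,b]$; $d_{\mathrm{E}}(\mathbf{J}_1,\mathbf{J}_2)$ is the infimum of such $\epsilon\geq0$ ($\infty$ if none). Persistent spaces with transition maps $f_a^b,g_a^b$ are $\epsilon$-interleaved if there are maps $\varphi_t:X_t\to Y_{t+\epsilon}$, $\psi_t:Y_t\to X_{t+\epsilon}$, commuting with transition maps, with $\psi_{t+\epsilon}\circ\varphi_t=f_t^{t+2\epsilon}$, $\varphi_{t+\epsilon}\circ\psi_t=g_t^{t+2\epsilon}$; $d_{\mathrm{I}}^{\mathrm{Top}}$ is the infimum of such $\epsilon\geq0$. $X_\bullet\simeq X'_\bullet$ means there are a persistent space $Z_\bullet$ and natural transformations $Z_\bullet\Rightarrow X_\bullet$, $Z_\bullet\Rightarrow X'_\bullet$ that are objectwise weak homotopy equivalences. $d_{\mathrm{HI}}(X_\bullet,Y_\bullet)=\inf\{d_{\mathrm{I}}^{\mathrm{Top}}(X'_\bullet,Y'_\bullet): X'_\bullet\simeq X_\bullet,\ Y'_\bullet\simeq Y_\bullet\}$. $\mathrm{VR}_t(X)$ is the geometric realization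 of the simplicial complex of finite nonempty subsets of diameter at most $t$ (empty for $t<0$). $d_{\mathrm{GH}}$ is the Gromov-Hausdorff distance. *)

theory Defs
  imports "HOL-Analysis.Analysis" "HOL-Homology.Homology" "HOL-Algebra.QuotRing" "Jordan_Normal_Form.Missing_VectorSpace"
begin

section \<open>Compactly generated weak Hausdorff spaces\<close>

text \<open>
  The compact Hausdorff test spaces \<open>C\<close> range over topologies on \<^typ>\<open>'a set set\<close>. This is no
  restriction: for a continuous map \<open>u\<close> from any compact Hausdorff space \<open>C\<close> into \<open>X\<close>, choose one
  preimage of every point of \<open>u(C)\<close> and let \<open>C'\<close> be the closure of these choices; then
  \<open>u(C') = u(C)\<close>, and \<open>C'\<close>, being Hausdorff with a dense subset no larger than the type \<open>'a\<close>, has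
  at most as many points as \<^typ>\<open>'a set set\<close>. In a weak Hausdorff space, closedness of preimages
  under \<open>u\<close> can moreover be tested on the compact Hausdorff subspace \<open>u(C)\<close>.
\<close>

definition weak_Hausdorff_space :: "'a topology \<Rightarrow> bool" where
  "weak_Hausdorff_space X \<longleftrightarrow>
     (\<forall>(C :: 'a set set topology) u.
        compact_space C \<and> Hausdorff_space C \<and> continuous_map C X u
          \<longrightarrow> closedin X (u ` topspace C))"

definition compactly_generated_space :: "'a topology \<Rightarrow> bool" where
  "compactly_generated_space X \<longleftrightarrow>
     (\<forall>S \<subseteq> topspace X.
        (\<forall>(C :: 'a set set topology) u.
           compact_space C \<and> Hausdorff_space C \<and> continuous_map C X u
             \<longrightarrow> closedin C {c \<in> topspace C. u c \<in> S})
        \<longrightarrow> closedin X S)"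

definition cgwh_space :: "'a topology \<Rightarrow> bool" where
  "cgwh_space X \<longleftrightarrow> compactly_generated_space X \<and> weak_Hausdorff_space X"


section \<open>Persistent spaces, interleavings\<close>

record 'a pspace =
  space_at :: "real \<Rightarrow> 'a topology"
  trans_map :: "real \<Rightarrow> real \<Rightarrow> 'a \<Rightarrow> 'a"

definition persistent_space :: "'a pspace \<Rightarrow> bool" where
  "persistent_space X \<longleftrightarrow>
     (\<forall>t. cgwh_space (space_at X t)) \<and>
     (\<forall>s t. s \<le> t \<longrightarrow> continuous_map (space_at X s) (space_at X t) (trans_map X s t)) \<and>
     (\<forall>t. \<forall>x \<in> topspace (space_at X t). trans_map X t t x = x) \<and>
     (\<forall>s t u. s \<le> t \<and> t \<le> u \<longrightarrow>
        (\<forall>x \<in> topspace (space_at X s). trans_map X t u (trans_map X s t x) = trans_map X s u x))"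

text \<open>\<open>shifted_map e X Y \<phi>\<close>: the maps \<open>\<phi> t\<close> from \<open>X t\<close> to \<open>Y (t + e)\<close> commute with the
  transition maps.\<close>

definition shifted_map :: "real \<Rightarrow> 'a pspace \<Rightarrow> 'b pspace \<Rightarrow> (real \<Rightarrow> 'a \<Rightarrow> 'b) \<Rightarrow> bool" where
  "shifted_map e X Y \<phi> \<longleftrightarrow>
     (\<forall>t. continuous_map (space_at X t) (space_at Y (t + e)) (\<phi> t)) \<and>
     (\<forall>s t. s \<le> t \<longrightarrow>
        (\<forall>x \<in> topspace (space_at X s).
           \<phi> t (trans_map X s t x) = trans_map Y (s + e) (t + e) (\<phi> s x)))"

definition interleaved :: "real \<Rightarrow> 'a pspace \<Rightarrow> 'b pspace \<Rightarrow> bool" where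
  "interleaved e X Y \<longleftrightarrow>
     (\<exists>\<phi> \<psi>. shifted_map e X Y \<phi> \<and> shifted_map e Y X \<psi> \<and>
        (\<forall>t. \<forall>x \<in> topspace (space_at X t). \<psi> (t + e) (\<phi> t x) = trans_map X t (t + 2 * e) x) \<and>
        (\<forall>t. \<forall>y \<in> topspace (space_at Y t). \<phi> (t + e) (\<psi> t y) = trans_map Y t (t + 2 * e) y))"

definition interleaving_dist :: "'a pspace \<Rightarrow> 'b pspace \<Rightarrow> ennreal" where
  "interleaving_dist X Y = Inf {ennreal e | e. 0 \<le> e \<and> interleaved e X Y}"


section \<open>Weak homotopy equivalences\<close>

text \<open>Cubes live in \<open>\<real>\<^sup>\<infinity>\<close>, as do the standard simplices of the homology library.\<close>

definition unit_cube :: "nat \<Rightarrow> (nat \<Rightarrow> real) set" where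
  "unit_cube n = {u. (\<forall>i<n. 0 \<le> u i \<and> u i \<le> 1) \<and> (\<forall>i\<ge>n. u i = 0)}"

definition unit_cube_boundary :: "nat \<Rightarrow> (nat \<Rightarrow> real) set" where
  "unit_cube_boundary n = {u \<in> unit_cube n. \<exists>i<n. u i = 0 \<or> u i = 1}"

abbreviation cube_topology :: "nat \<Rightarrow> (nat \<Rightarrow> real) topology" where
  "cube_topology n \<equiv> subtopology (powertop_real UNIV) (unit_cube n)"

definition based_cubes :: "nat \<Rightarrow> 'a topology \<Rightarrow> 'a \<Rightarrow> ((nat \<Rightarrow> real) \<Rightarrow> 'a) set" where
  "based_cubes n X x =
     {g. continuous_map (cube_topology n) X g \<and> (\<forall>u \<in> unit_cube_boundary n. g u = x)}"

definition homotopy_class ::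
    "nat \<Rightarrow> 'a topology \<Rightarrow> 'a \<Rightarrow> ((nat \<Rightarrow> real) \<Rightarrow> 'a) \<Rightarrow> ((nat \<Rightarrow> real) \<Rightarrow> 'a) set" where
  "homotopy_class n X x g =
     {h. homotopic_with (\<lambda>k. \<forall>u \<in> unit_cube_boundary n. k u = x) (cube_topology n) X g h}"

definition homotopy_group ::
    "nat \<Rightarrow> 'a topology \<Rightarrow> 'a \<Rightarrow> ((nat \<Rightarrow> real) \<Rightarrow> 'a) set set" where
  "homotopy_group n X x = homotopy_class n X x ` based_cubes n X x"

definition homotopy_group_map ::
    "nat \<Rightarrow> 'b topology \<Rightarrow> ('a \<Rightarrow> 'b) \<Rightarrow> 'a \<Rightarrow> ((nat \<Rightarrow> real) \<Rightarrow> 'a) set \<Rightarrow> ((nat \<Rightarrow> real) \<Rightarrow> 'b) set"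
  where
  "homotopy_group_map n Y f x A = (\<Union>g \<in> A. homotopy_class n Y (f x) (f \<circ> g))"

text \<open>The maps induced on \<open>\<pi>\<^sub>n\<close>, \<open>n \<ge> 1\<close>, are automatically group homomorphisms, so
  bijectivity says that they are isomorphisms.\<close>

definition weak_homotopy_equivalence :: "'a topology \<Rightarrow> 'b topology \<Rightarrow> ('a \<Rightarrow> 'b) \<Rightarrow> bool" where
  "weak_homotopy_equivalence X Y f \<longleftrightarrow>
     continuous_map X Y f \<and>
     bij_betw (\<lambda>C. \<Union>x \<in> C. path_component_of_set Y (f x))
       (path_components_of X) (path_components_of Y) \<and>
     (\<forall>n\<ge>1. \<forall>x \<in> topspace X.
        bij_betw (homotopy_group_map n Y f x) (homotopy_group n X x) (homotopy_group n Y (f x)))"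


section \<open>Homotopy interleaving distance\<close>

text \<open>HOL cannot quantify over spaces of all types, so the type \<open>'u\<close> plays the role of the universe
  in which the category of spaces is formed: the auxiliary persistent spaces \<open>Z\<close>, \<open>X'\<close> and \<open>Y'\<close>
  have their points in \<open>'u\<close>. That a given persistent space belongs to the universe means that its
  underlying type injects into \<open>'u\<close>.\<close>

definition objectwise_weak_equivalence ::
    "'a pspace \<Rightarrow> 'b pspace \<Rightarrow> (real \<Rightarrow> 'a \<Rightarrow> 'b) \<Rightarrow> bool" where
  "objectwise_weak_equivalence Z X \<eta> \<longleftrightarrow>
     shifted_map 0 Z X \<eta> \<and>
     (\<forall>t. weak_homotopy_equivalence (space_at Z t) (space_at X t) (\<eta> t))"

definition weakly_equivalent :: "'u itself \<Rightarrow> 'a pspace \<Rightarrow> 'b pspace \<Rightarrow> bool" where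
  "weakly_equivalent U X X' \<longleftrightarrow>
     (\<exists>(Z :: 'u pspace) \<eta> \<eta>'. persistent_space Z \<and>
        objectwise_weak_equivalence Z X \<eta> \<and> objectwise_weak_equivalence Z X' \<eta>')"

definition homotopy_interleaving_dist :: "'u itself \<Rightarrow> 'a pspace \<Rightarrow> 'b pspace \<Rightarrow> ennreal" where
  "homotopy_interleaving_dist U X Y =
     Inf {interleaving_dist X' Y' | (X' :: 'u pspace) (Y' :: 'u pspace).
            persistent_space X' \<and> persistent_space Y' \<and>
            weakly_equivalent U X' X \<and> weakly_equivalent U Y' Y}"


section \<open>The singular cohomology algebra\<close>

text \<open>
  Elements of the direct sum of the singular cochain groups of \<open>X\<close> with coefficients in the field
  \<open>'k\<close>: \<open>c p s\<close> is the value on the singular \<open>p\<close>-simplex \<open>s\<close>, and is 0 if \<open>s\<close> is not one.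
\<close>

type_synonym ('a, 'k) cochain = "nat \<Rightarrow> ((nat \<Rightarrow> real) \<Rightarrow> 'a) \<Rightarrow> 'k"

definition cochains :: "'a topology \<Rightarrow> ('a, 'k::field) cochain set" where
  "cochains X =
     {c. (\<forall>p s. \<not> singular_simplex p X s \<longrightarrow> c p s = 0) \<and> finite {p. \<exists>s. c p s \<noteq> 0}}"

definition coboundary :: "'a topology \<Rightarrow> ('a, 'k::field) cochain \<Rightarrow> ('a, 'k) cochain" where
  "coboundary X c = (\<lambda>p s.
     if 1 \<le> p \<and> singular_simplex p X s
     then \<Sum>k\<le>p. (-1) ^ k * c (p - 1) (singular_face p k s) else 0)"

definition cocycles :: "'a topology \<Rightarrow> ('a, 'k::field) cochain set" where
  "cocycles X = {c \<in> cochains X. coboundary X c = (\<lambda>p s. 0)}"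

definition coboundaries :: "'a topology \<Rightarrow> ('a, 'k::field) cochain set" where
  "coboundaries X = coboundary X ` cochains X"

definition front_face :: "nat \<Rightarrow> ((nat \<Rightarrow> real) \<Rightarrow> 'a) \<Rightarrow> (nat \<Rightarrow> real) \<Rightarrow> 'a" where
  "front_face p s = restrict s (standard_simplex p)"

definition back_face :: "nat \<Rightarrow> nat \<Rightarrow> ((nat \<Rightarrow> real) \<Rightarrow> 'a) \<Rightarrow> (nat \<Rightarrow> real) \<Rightarrow> 'a" where
  "back_face p q s =
     restrict (\<lambda>x. s (\<lambda>i. if i < p then 0 else x (i - p))) (standard_simplex q)"

definition cup_product ::
    "'a topology \<Rightarrow> ('a, 'k::field) cochain \<Rightarrow> ('a, 'k) cochain \<Rightarrow> ('a, 'k) cochain" where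
  "cup_product X c d = (\<lambda>n s.
     if singular_simplex n X s
     then \<Sum>p\<le>n. c p (front_face p s) * d (n - p) (back_face p (n - p) s) else 0)"

definition cocycle_ring :: "'a topology \<Rightarrow> ('a, 'k::field) cochain ring" where
  "cocycle_ring X =
     \<lparr>carrier = cocycles X, mult = cup_product X,
      one = (\<lambda>p s. if p = 0 \<and> singular_simplex 0 X s then 1 else 0),
      zero = (\<lambda>p s. 0), add = (\<lambda>c d p s. c p s + d p s)\<rparr>"

definition cohomology_class ::
    "'a topology \<Rightarrow> ('a, 'k::field) cochain \<Rightarrow> ('a, 'k) cochain set" where
  "cohomology_class X c = coboundaries X +>\<^bsub>cocycle_ring X\<^esub> c"

text \<open>The graded-commutative cohomology ring together with its scalar multiplication; the record
  type is that of \<^locale>\<open>module\<close>, whose ring slots hold the cup product.\<close>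

definition cohomology :: "'a topology \<Rightarrow> ('k::field, ('a, 'k) cochain set) module" where
  "cohomology X =
     ring.extend (cocycle_ring X Quot coboundaries X)
       (module.fields (\<lambda>a A. \<Union>c \<in> A. cohomology_class X (\<lambda>p s. a * c p s)))"

definition cohomology_deg :: "nat \<Rightarrow> 'a topology \<Rightarrow> ('a, 'k::field) cochain set set" where
  "cohomology_deg p X = cohomology_class X ` {c \<in> cocycles X. \<forall>q. q \<noteq> p \<longrightarrow> c q = (\<lambda>s. 0)}"

definition positive_cohomology :: "'a topology \<Rightarrow> ('a, 'k::field) cochain set set" where
  "positive_cohomology X = cohomology_class X ` {c \<in> cocycles X. c 0 = (\<lambda>s. 0)}"

definition cochain_pullback ::
    "'a topology \<Rightarrow> ('a \<Rightarrow> 'b) \<Rightarrow> ('b, 'k::field) cochain \<Rightarrow> ('a, 'k) cochain" where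
  "cochain_pullback X f c =
     (\<lambda>p s. if singular_simplex p X s then c p (simplex_map p f s) else 0)"

text \<open>\<open>cohomology_map X f\<close> is the map into the cohomology of \<open>X\<close> induced by a map \<open>f\<close> out of \<open>X\<close>.\<close>

definition cohomology_map ::
    "'a topology \<Rightarrow> ('a \<Rightarrow> 'b) \<Rightarrow> ('b, 'k::field) cochain set \<Rightarrow> ('a, 'k) cochain set" where
  "cohomology_map X f A = (\<Union>c \<in> A. cohomology_class X (cochain_pullback X f c))"


section \<open>Dimension over the coefficient field\<close>

definition field_ring :: "'k::field ring" where
  "field_ring = \<lparr>carrier = UNIV, mult = (*), one = 1, zero = 0, add = (+)\<rparr>"

definition vdim :: "('k::field, 'v, 'm) module_scheme \<Rightarrow> 'v set \<Rightarrow> enat" where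
  "vdim V W =
     (if vectorspace.fin_dim field_ring (V\<lparr>carrier := W\<rparr>)
      then enat (vectorspace.dim field_ring (V\<lparr>carrier := W\<rparr>)) else \<infinity>)"

text \<open>The persistent cohomology of \<open>X\<close> over \<open>'k\<close> is q-tame.\<close>

definition q_tame :: "'k::field itself \<Rightarrow> 'a pspace \<Rightarrow> bool" where
  "q_tame K X \<longleftrightarrow>
     (\<forall>p s t. s < t \<longrightarrow>
        vdim (cohomology (space_at X s) :: ('k, ('a, 'k) cochain set) module)
          (cohomology_map (space_at X s) (trans_map X s t) ` cohomology_deg p (space_at X t)) \<noteq> \<infinity>)"


section \<open>Persistent cup-length\<close>

text \<open>\<open>D p\<close> is the set of homogeneous elements of degree \<open>p\<close> of the graded ring \<open>R\<close>. The supremum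
  is 0 if \<open>R\<close> has no nonzero elements of positive degree, and \<open>\<infinity>\<close> if there is no longest nonzero
  product.\<close>

definition ring_length :: "('r, 'm) ring_scheme \<Rightarrow> (nat \<Rightarrow> 'r set) \<Rightarrow> enat" where
  "ring_length R D =
     Sup {enat (length xs) | xs.
            (\<forall>x \<in> set xs. \<exists>p\<ge>1. x \<in> D p) \<and> foldr (\<otimes>\<^bsub>R\<^esub>) xs \<one>\<^bsub>R\<^esub> \<noteq> \<zero>\<^bsub>R\<^esub>}"

definition cup_length_invariant :: "'k::field itself \<Rightarrow> 'a pspace \<Rightarrow> real \<Rightarrow> real \<Rightarrow> enat" where
  "cup_length_invariant K X a b =
     (let H\<^sub>a = cohomology (space_at X a) :: ('k, ('a, 'k) cochain set) module;
          H\<^sub>b = cohomology (space_at X b) :: ('k, ('a, 'k) cochain set) module;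
          f = cohomology_map (space_at X a) (trans_map X a b)
      in ring_length (H\<^sub>a\<lparr>carrier := f ` carrier H\<^sub>b\<rparr>) (\<lambda>p. f ` cohomology_deg p (space_at X b)))"


section \<open>Persistent cup module\<close>

text \<open>\<open>cup_power l X\<close> is the linear span of the \<open>l\<close>-fold products of elements of positive
  cohomology; as it is a graded subspace, its degree-\<open>p\<close> component is its intersection with
  \<open>cohomology_deg p X\<close>.\<close>

definition cup_power :: "nat \<Rightarrow> 'a topology \<Rightarrow> ('a, 'k::field) cochain set set" where
  "cup_power l X =
     (let H = cohomology X :: ('k, ('a, 'k) cochain set) module
      in LinearCombinations.module.span field_ring H
           {foldr (\<otimes>\<^bsub>H\<^esub>) xs \<one>\<^bsub>H\<^esub> | xs. length xs = l \<and> set xs \<subseteq> positive_cohomology X})"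

text \<open>Matrix entries are indexed by the pairs \<open>(p, l)\<close> with \<open>p, l \<ge> 1\<close>; all others are set to 0.\<close>

definition cup_module_rank ::
    "'k::field itself \<Rightarrow> 'a pspace \<Rightarrow> real \<Rightarrow> real \<Rightarrow> nat \<Rightarrow> nat \<Rightarrow> enat" where
  "cup_module_rank K X a b = (\<lambda>p l.
     if 1 \<le> p \<and> 1 \<le> l
     then vdim (cohomology (space_at X a) :: ('k, ('a, 'k) cochain set) module)
            (cohomology_map (space_at X a) (trans_map X a b) `
               (cup_power l (space_at X b) \<inter> cohomology_deg p (space_at X b)))
     else 0)"


section \<open>Erosion distance\<close>

text \<open>A function on the closed intervals \<open>[a, b]\<close> is given as a function of \<open>a\<close> and \<open>b\<close>, of which
  only the values with \<open>a \<le> b\<close> matter.\<close>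

definition eroded :: "real \<Rightarrow> (real \<Rightarrow> real \<Rightarrow> 'p::order) \<Rightarrow> (real \<Rightarrow> real \<Rightarrow> 'p) \<Rightarrow> bool" where
  "eroded e J\<^sub>1 J\<^sub>2 \<longleftrightarrow>
     (\<forall>a b. a \<le> b \<longrightarrow> J\<^sub>1 a b \<ge> J\<^sub>2 (a - e) (b + e) \<and> J\<^sub>2 a b \<ge> J\<^sub>1 (a - e) (b + e))"

definition erosion_dist :: "(real \<Rightarrow> real \<Rightarrow> 'p::order) \<Rightarrow> (real \<Rightarrow> real \<Rightarrow> 'p) \<Rightarrow> ennreal" where
  "erosion_dist J\<^sub>1 J\<^sub>2 = Inf {ennreal e | e. 0 \<le> e \<and> eroded e J\<^sub>1 J\<^sub>2}"


section \<open>Geometric realization and Vietoris-Rips filtration\<close>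

text \<open>Points of the realization of a simplicial complex \<open>K\<close> are given by barycentric coordinates.
  The topology is the weak one, coherent with the closed simplices, each of which has its Euclidean
  topology (the subspace topology of the product topology on \<^typ>\<open>'a \<Rightarrow> real\<close>).\<close>

definition realization_points :: "'a set set \<Rightarrow> ('a \<Rightarrow> real) set" where
  "realization_points K =
     {x. (\<forall>v. 0 \<le> x v) \<and> {v. x v \<noteq> 0} \<in> K \<and> (\<Sum>v | x v \<noteq> 0. x v) = 1}"

definition closed_simplex :: "'a set set \<Rightarrow> 'a set \<Rightarrow> ('a \<Rightarrow> real) set" where
  "closed_simplex K \<sigma> = {x \<in> realization_points K. {v. x v \<noteq> 0} \<subseteq> \<sigma>}"

definition realization_open :: "'a set set \<Rightarrow> ('a \<Rightarrow> real) set \<Rightarrow> bool" where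
  "realization_open K U \<longleftrightarrow>
     U \<subseteq> realization_points K \<and>
     (\<forall>\<sigma> \<in> K. openin (top_of_set (closed_simplex K \<sigma>)) (U \<inter> closed_simplex K \<sigma>))"

definition realization :: "'a set set \<Rightarrow> ('a \<Rightarrow> real) topology" where
  "realization K = topology (realization_open K)"

lemma istopology_realization_open: "istopology (realization_open K)"
proof -
  have "realization_open K (S \<inter> T)" if "realization_open K S" "realization_open K T" for S T
  proof -
    have eq: "S \<inter> T \<inter> C = (S \<inter> C) \<inter> (T \<inter> C)" for C
      by blast
    show ?thesis
      using that unfolding realization_open_def eq by (blast intro: openin_Int)
  qed
  moreover have "realization_open K (\<Union>\<U>)" if "\<And>S. S \<in> \<U> \<Longrightarrow> realization_open K S" for \<U>
  proof -
    have eq: "\<Union>\<U> \<inter> C = (\<Union>S \<in> \<U>. S \<inter> C)" for C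
      by blast
    show ?thesis
      using that unfolding realization_open_def eq by (blast intro: openin_Union)
  qed
  ultimately show ?thesis
    by (simp add: istopology_def)
qed

lemma openin_realization: "openin (realization K) = realization_open K"
  by (simp add: realization_def istopology_realization_open topology_inverse')

definition vietoris_rips :: "'a metric \<Rightarrow> real \<Rightarrow> 'a set set" where
  "vietoris_rips M t =
     {\<sigma>. finite \<sigma> \<and> \<sigma> \<noteq> {} \<and> \<sigma> \<subseteq> mspace M \<and> (\<forall>x \<in> \<sigma>. \<forall>y \<in> \<sigma>. mdist M x y \<le> t)}"

definition VR :: "'a metric \<Rightarrow> ('a \<Rightarrow> real) pspace" where
  "VR M = \<lparr>space_at = (\<lambda>t. realization (vietoris_rips M t)), trans_map = (\<lambda>s t x. x)\<rparr>"


section \<open>Gromov-Hausdorff distance\<close>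

definition Hausdorff_dist :: "'a metric \<Rightarrow> 'a set \<Rightarrow> 'a set \<Rightarrow> ennreal" where
  "Hausdorff_dist Z A B =
     max (SUP a \<in> A. INF b \<in> B. ennreal (mdist Z a b)) (SUP b \<in> B. INF a \<in> A. ennreal (mdist Z a b))"

definition isometric_embedding :: "'a metric \<Rightarrow> 'b metric \<Rightarrow> ('a \<Rightarrow> 'b) \<Rightarrow> bool" where
  "isometric_embedding M Z f \<longleftrightarrow>
     f \<in> mspace M \<rightarrow> mspace Z \<and>
     (\<forall>x \<in> mspace M. \<forall>y \<in> mspace M. mdist Z (f x) (f y) = mdist M x y)"

text \<open>The ambient metric space \<open>Z\<close> may be restricted to the union of the two images, so that the
  sum type has room for it.\<close>

definition Gromov_Hausdorff_dist :: "'a metric \<Rightarrow> 'b metric \<Rightarrow> ennreal" where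
  "Gromov_Hausdorff_dist M N =
     Inf {Hausdorff_dist Z (f ` mspace M) (g ` mspace N) | (Z :: ('a + 'b) metric) f g.
            isometric_embedding M Z f \<and> isometric_embedding N Z g}"

end

theory Submission
  imports Defs
begin

text \<open>
  A weak homotopy equivalence \<open>f : X \<rightarrow> Y\<close> lets one choose, compatibly with faces, for every
  singular simplex of \<open>Y\<close> a singular simplex of \<open>X\<close> and a homotopy to its image under \<open>f\<close>
  (compression of cubes, done one simplex at a time). The prism operator turns these choices into a
  homotopy inverse of \<open>f\<close> on cochains, so weakly equivalent persistent spaces have the same
  cup module ranks. In an \<open>\<epsilon>\<close>-interleaving, the map induced by \<open>Y\<^bsub>a-\<epsilon>\<^esub> \<rightarrow> Y\<^bsub>b+\<epsilon>\<^esub>\<close> factors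
  through the one induced by \<open>X\<^bsub>a\<^esub> \<rightarrow> X\<^bsub>b\<^esub>\<close>, which gives the upper bound on the erosion distance
  of the ranks. The cup length is the largest \<open>l\<close> for which some rank with index \<open>l\<close> is nonzero,
  because the cup powers are spanned by products of homogeneous elements.

  For two metric spaces at Hausdorff distance less than \<open>r\<close>, the disjoint union \<open>V\<close> projects
  onto both by moving points less than \<open>r\<close>. Pulling the two Vietoris-Rips filtrations back to
  complexes with vertex set \<open>V\<close> does not change the weak homotopy type, since the projections have
  simplices as fibres, and makes them \<open>2r\<close>-interleaved by inclusions.
\<close>


section \<open>Dimension over the coefficient field\<close>

text \<open>A weak equivalence is known only through its bijections on path components and homotopy
  groups, so there is no map back from \<open>Y\<close> to \<open>X\<close>; an inverse exists only
  simplex by simplex. It is never asked to respect products: pullback along the weak equivalence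
  itself is multiplicative, so bijectivity together with control of degrees is all that has to be
  extracted, and cup powers then correspond.

  Dimensions may be infinite, so ranks are compared through surjections of subspaces, which also
  makes sense for the value \<infinity>.

  The Vietoris-Rips complexes of two metric spaces have different vertex sets, and approximate maps
  between the spaces do not compose to identities, so the maps they induce satisfy the interleaving
  identities only up to homotopy. On a common vertex set every map becomes an inclusion and the
  identities hold strictly. Moving both points of a pair by less than \<open>r\<close> changes their
  distance by less than \<open>2 * r\<close>, hence the factor 2.\<close>

lemma field_field_ring: "field (field_ring :: 'k::field ring)"
proof -
  have "cring (field_ring :: 'k ring)"
    by (rule cringI; (rule abelian_groupI comm_monoidI)?)
      (auto simp: field_ring_def algebra_simps intro: exI[of _ "- x" for x])
  then show ?thesis
    by (rule cring.cring_fieldI2) (auto simp: field_ring_def intro: exI[of _ "inverse x" for x] dest: right_inverse)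
qed

lemma field_ring_simps [simp]: "carrier field_ring = UNIV" "x \<otimes>\<^bsub>field_ring\<^esub> y = x * y" "x \<oplus>\<^bsub>field_ring\<^esub> y = x + y"
  "\<zero>\<^bsub>field_ring\<^esub> = 0" "\<one>\<^bsub>field_ring\<^esub> = 1"
  by (simp_all add: field_ring_def)

text \<open>Independence in \<open>P\<close> is independence in the whole space, so independent
  subsets of \<open>P\<close> have at most \<open>dim\<close> elements; a maximal one exists and is
  a basis of \<open>P\<close>.\<close>

lemma (in vectorspace) subspace_fin_dim:
  assumes P: "subspace K P V" and fd: "fin_dim"
  shows "vectorspace.fin_dim K (vs P)" "vectorspace.dim K (vs P) \<le> dim"
proof -
  interpret P: vectorspace K "vs P" by (rule subspace_is_vs[OF P])
  have sub: "submodule K P V" using P by simp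
  then have PV: "P \<subseteq> carrier V" by (simp add: submodule_def)
  have li: "finite A \<and> card A \<le> dim" if "A \<subseteq> carrier (vs P) \<and> P.lin_indpt A" for A
  proof -
    have A: "A \<subseteq> P" using that by simp
    then have "lin_indpt A" using span_li_not_depend(2)[OF A sub] that by simp
    then show ?thesis using li_le_dim[OF fd, of A] A PV by blast
  qed
  have "\<not> P.lin_dep {}" by (simp add: P.lin_dep_def)
  then obtain A where A: "finite A" "maximal A (\<lambda>S. S \<subseteq> carrier (vs P) \<and> P.lin_indpt S)"
    using maximal_exists[of "\<lambda>S. S \<subseteq> carrier (vs P) \<and> P.lin_indpt S" dim "{}", OF li] by blast
  have bas: "P.basis A" by (rule P.max_li_is_basis[OF A(2)])
  then show "P.fin_dim" using A(1) unfolding P.fin_dim_def P.basis_def by blast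
  have "P.dim = card A" by (rule P.dim_basis[OF A(1) bas])
  then show "P.dim \<le> dim" using li[of A] bas unfolding P.basis_def by auto
qed

text \<open>\<open>g\<close> is linear only on \<open>W\<close> and \<open>U\<close> is merely
  covered by its image, so that the inverse of an injective map on its range is admissible as
  \<open>g\<close>. Rank-nullity is applied to the restriction of \<open>g\<close> to the elements
  of \<open>W\<close> that land in \<open>U\<close>, a subspace which \<open>g\<close> maps onto
  \<open>U\<close>. If \<open>W\<close> has infinite dimension the bound is \<infinity>.\<close>

lemma vdim_le_image:
  fixes V1 :: "('k::field, 'v, 'm) module_scheme" and V2 :: "('k, 'w, 'n) module_scheme"
  assumes V1: "vectorspace field_ring V1" and V2: "vectorspace field_ring V2"
    and U: "subspace field_ring U V1" and W: "subspace field_ring W V2"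
    and gW: "\<And>w. w \<in> W \<Longrightarrow> g w \<in> carrier V1"
    and add: "\<And>v w. v \<in> W \<Longrightarrow> w \<in> W \<Longrightarrow> g (v \<oplus>\<^bsub>V2\<^esub> w) = g v \<oplus>\<^bsub>V1\<^esub> g w"
    and smult: "\<And>a w. w \<in> W \<Longrightarrow> g (a \<odot>\<^bsub>V2\<^esub> w) = a \<odot>\<^bsub>V1\<^esub> g w"
    and img: "U \<subseteq> g ` W"
  shows "vdim V1 U \<le> vdim V2 W"
proof (cases "vectorspace.fin_dim field_ring (V2\<lparr>carrier := W\<rparr>)")
  case True
  interpret V1: vectorspace field_ring V1 by (rule V1)
  interpret V2: vectorspace field_ring V2 by (rule V2)
  let ?B = "V2\<lparr>carrier := W\<rparr>" let ?P = "{w \<in> W. g w \<in> U}"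
  interpret B: vectorspace field_ring ?B by (rule V2.subspace_is_vs[OF W])
  interpret U: vectorspace field_ring "V1\<lparr>carrier := U\<rparr>" by (rule V1.subspace_is_vs[OF U])
  have subU: "submodule field_ring U V1" and subW: "submodule field_ring W V2" using U W by simp_all
  have zero: "g \<zero>\<^bsub>V2\<^esub> = \<zero>\<^bsub>V1\<^esub>"
  proof -
    have z: "\<zero>\<^bsub>V2\<^esub> \<in> W" using subW by (simp add: submodule_def)
    have "g \<zero>\<^bsub>V2\<^esub> = g (0 \<odot>\<^bsub>V2\<^esub> \<zero>\<^bsub>V2\<^esub>)" using V2.lmult_0[of "\<zero>\<^bsub>V2\<^esub>"] by simp
    also have "\<dots> = 0 \<odot>\<^bsub>V1\<^esub> g \<zero>\<^bsub>V2\<^esub>" by (rule smult[OF z])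
    also have "\<dots> = \<zero>\<^bsub>V1\<^esub>" using V1.lmult_0[OF gW[OF z]] by simp
    finally show ?thesis .
  qed
  have "submodule field_ring ?P ?B"
    using B.module_axioms subU subW add smult zero by (auto simp: submodule_def)
  then have P: "subspace field_ring ?P ?B"
    using B.vectorspace_axioms by (simp add: subspace_def)
  interpret P: vectorspace field_ring "V2\<lparr>carrier := ?P\<rparr>"
    using B.subspace_is_vs[OF P] by simp
  have dimP: "P.fin_dim" "P.dim \<le> B.dim" using B.subspace_fin_dim[OF P True] by simp_all
  interpret lm: linear_map field_ring "V2\<lparr>carrier := ?P\<rparr>" "V1\<lparr>carrier := U\<rparr>" g
    by unfold_locales (auto simp: module_hom_def add smult)
  have surj: "g ` carrier (V2\<lparr>carrier := ?P\<rparr>) = carrier (V1\<lparr>carrier := U\<rparr>)"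
    using img by auto
  have "U.fin_dim" by (rule lm.rank_nullity_main(2)[OF dimP(1) surj])
  moreover have "U.dim \<le> P.dim"
    using lm.rank_nullity_main(1)[OF dimP(1)] lm.surj_imp_imT_carrier[OF surj] by simp
  ultimately show ?thesis using True dimP(2) by (simp add: vdim_def)
qed (simp add: vdim_def)

text \<open>The zero space is the span of the empty basis. This lets the nonvanishing of a product
  be read off from a rank.\<close>

lemma vdim_eq_0_iff:
  fixes V :: "('k::field, 'v, 'm) module_scheme"
  assumes V: "vectorspace field_ring V" and W: "subspace field_ring W V"
  shows "vdim V W = 0 \<longleftrightarrow> W = {\<zero>\<^bsub>V\<^esub>}"
proof -
  interpret V: vectorspace field_ring V by (rule V)
  interpret W: vectorspace field_ring "V\<lparr>carrier := W\<rparr>" by (rule V.subspace_is_vs[OF W])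
  have empty: "W.span {} = {\<zero>\<^bsub>V\<^esub>}" by (auto simp: W.span_def W.lincomb_def)
  show ?thesis
  proof
    assume 0: "vdim V W = 0"
    then have fd: "W.fin_dim" "W.dim = 0" by (simp_all add: vdim_def zero_enat_def split: if_splits)
    obtain \<beta> where \<beta>: "finite \<beta>" "W.basis \<beta>" using W.finite_basis_exists[OF fd(1)] by blast
    then have "\<beta> = {}" using W.dim_basis[OF \<beta>] fd(2) by simp
    then show "W = {\<zero>\<^bsub>V\<^esub>}" using \<beta>(2) empty by (simp add: W.basis_def)
  next
    assume W0: "W = {\<zero>\<^bsub>V\<^esub>}"
    then have gen: "W.gen_set {}" using empty by simp
    then have "W.fin_dim" unfolding W.fin_dim_def by blast
    moreover have "W.dim = 0" using W.gen_ge_dim[of "{}"] gen by simp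
    ultimately show "vdim V W = 0" by (simp add: vdim_def zero_enat_def)
  qed
qed

section \<open>Homotopy theory: compressing cubes along a weak equivalence\<close>

section \<open>Maps out of subsets of Euclidean type into abstract spaces\<close>

lemma continuous_map_compose_on:
  assumes "continuous_map (top_of_set T) X g" "continuous_on S k" "\<And>x. x \<in> S \<Longrightarrow> k x \<in> T"
  shows "continuous_map (top_of_set S) X (\<lambda>x. g (k x))"
proof -
  have "continuous_map (top_of_set S) (top_of_set T) k"
    using assms by auto
  then show ?thesis
    using continuous_map_compose[OF _ assms(1), of "top_of_set S" k] by (simp only: o_def)
qed

lemma continuous_map_if_le:
  fixes p q :: "'c::topological_space \<Rightarrow> real"
  assumes "continuous_on S p" "continuous_on S q"
    and f: "continuous_map (top_of_set {x \<in> S. p x \<le> q x}) X f"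
    and g: "continuous_map (top_of_set {x \<in> S. q x \<le> p x}) X g"
    and "\<And>x. x \<in> S \<Longrightarrow> p x = q x \<Longrightarrow> f x = g x"
  shows "continuous_map (top_of_set S) X (\<lambda>x. if p x \<le> q x then f x else g x)"
proof (rule continuous_map_cases_le)
  show "continuous_map (top_of_set S) euclideanreal p" "continuous_map (top_of_set S) euclideanreal q"
    using assms by auto
  have "S \<inter> {x \<in> S. p x \<le> q x} = {x \<in> S. p x \<le> q x}" "S \<inter> {x \<in> S. q x \<le> p x} = {x \<in> S. q x \<le> p x}"
    by auto
  then show "continuous_map (subtopology (top_of_set S) {x \<in> topspace (top_of_set S). p x \<le> q x}) X f"
    "continuous_map (subtopology (top_of_set S) {x \<in> topspace (top_of_set S). q x \<le> p x}) X g"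
    using f g by (simp_all add: subtopology_subtopology)
qed (use assms in auto)

lemma continuous_map_on_subset:
  "continuous_map (top_of_set T) X g \<Longrightarrow> S \<subseteq> T \<Longrightarrow> continuous_map (top_of_set S) X g"
  by (rule continuous_map_from_subtopology_mono)

lemma continuous_map_on_cong:
  "continuous_map (top_of_set S) X g \<Longrightarrow> (\<And>x. x \<in> S \<Longrightarrow> g x = h x) \<Longrightarrow> continuous_map (top_of_set S) X h"
  by (rule continuous_map_eq[of _ _ g]) auto

lemma continuous_map_on_mem:
  "continuous_map (top_of_set S) X g \<Longrightarrow> x \<in> S \<Longrightarrow> g x \<in> topspace X"
  by (auto simp: continuous_map_def)

text \<open>With \<open>T \<subseteq> S\<close> the condition on \<open>T\<close> only sees values
  over \<open>S\<close>, so \<open>k\<close> has to meet its prescribed ends on \<open>S\<close>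
  alone and may be arbitrary elsewhere.\<close>

lemma homotopic_with_relI:
  assumes "continuous_map (top_of_set ({0..1::real} \<times> S)) X k" "T \<subseteq> S"
    and "\<And>u. u \<in> S \<Longrightarrow> k (0, u) = f u" "\<And>u. u \<in> S \<Longrightarrow> k (1, u) = f' u"
    and "\<And>s u. s \<in> {0..1} \<Longrightarrow> u \<in> T \<Longrightarrow> k (s, u) = g u"
  shows "homotopic_with (\<lambda>k. \<forall>u \<in> T. k u = g u) (top_of_set S) X f f'"
proof -
  have "homotopic_with (\<lambda>k. \<forall>u \<in> T. k u = g u) (top_of_set S) X f f' \<longleftrightarrow>
    (\<exists>h. continuous_map (prod_topology (subtopology euclideanreal {0..1}) (top_of_set S)) X h \<and>
              (\<forall>x \<in> topspace (top_of_set S). h(0,x) = f x) \<and>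
              (\<forall>x \<in> topspace (top_of_set S). h(1,x) = f' x) \<and>
              (\<forall>t \<in> {0..1}. \<forall>u\<in>T. h(t, u) = g u))"
    by (subst homotopic_with) (use assms(2) in \<open>auto simp: subset_iff\<close>)
  then show ?thesis
    using assms by (auto simp: prod_topology_subtopology_eu)
qed

lemma homotopic_with_relE:
  assumes "homotopic_with (\<lambda>k. \<forall>u \<in> T. k u = g u) (top_of_set S) X f f'"
  obtains k where "continuous_map (top_of_set ({0..1::real} \<times> S)) X k"
    "\<And>u. k (0, u) = f u" "\<And>u. k (1, u) = f' u"
    "\<And>s u. s \<in> {0..1} \<Longrightarrow> u \<in> T \<Longrightarrow> k (s, u) = g u"
proof -
  obtain k where "continuous_map (prod_topology (subtopology euclideanreal {0..1}) (top_of_set S)) X k"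
    "\<forall>x. k (0, x) = f x" "\<forall>x. k (1, x) = f' x" "\<forall>t\<in>{0..1}. \<forall>u\<in>T. k (t, u) = g u"
    using assms unfolding homotopic_with_def by blast
  then show ?thesis
    by (intro that[of k]) (auto simp: prod_topology_subtopology_eu)
qed

lemma cube_topology_eq: "cube_topology n = top_of_set (unit_cube n)"
  by (simp add: euclidean_product_topology)

section \<open>Radial coordinates on cubes\<close>

text \<open>Twice the sup distance of the first \<open>n\<close> coordinates from 1/2: the cube is
  the unit ball and its boundary the unit sphere. \<open>cube_scale\<close> is the homothety about
  the centre. Most maps and homotopies of cubes below are given by radial formulas in these
  two.\<close>

primrec cube_norm :: "nat \<Rightarrow> (nat \<Rightarrow> real) \<Rightarrow> real" where
  "cube_norm 0 u = 0"
| "cube_norm (Suc n) u = max (cube_norm n u) \<bar>2 * u n - 1\<bar>"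

definition cube_scale :: "nat \<Rightarrow> real \<Rightarrow> (nat \<Rightarrow> real) \<Rightarrow> nat \<Rightarrow> real" where
  "cube_scale n r u = (\<lambda>i. if i < n then 1/2 + r * (u i - 1/2) else 0)"

declare continuous_on_coordinatewise_then_product [continuous_intros del]

lemma continuous_on_coordinate:
  fixes u :: "'c::topological_space \<Rightarrow> nat \<Rightarrow> real"
  shows "continuous_on S u \<Longrightarrow> continuous_on S (\<lambda>x. u x i)"
  by (rule continuous_on_product_then_coordinatewise)

lemma continuous_on_cube_norm [continuous_intros]:
  "continuous_on S u \<Longrightarrow> continuous_on S (\<lambda>x. cube_norm n (u x))"
  by (induction n) (auto intro!: continuous_intros continuous_on_coordinate[of S u])

lemma continuous_on_cube_scale [continuous_intros]:
  assumes "continuous_on S r" "continuous_on S u"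
  shows "continuous_on S (\<lambda>x. cube_scale n (r x) (u x))"
  unfolding cube_scale_def
proof (rule continuous_on_coordinatewise_then_product)
  fix i
  show "continuous_on S (\<lambda>x. if i < n then 1 / 2 + r x * (u x i - 1 / 2) else 0)"
    using assms by (cases "i < n") (auto intro!: continuous_intros continuous_on_coordinate[of S u])
qed

lemma cube_norm_nonneg: "0 \<le> cube_norm n u"
  by (induction n) auto

lemma abs_cube_norm [simp]: "\<bar>cube_norm n u\<bar> = cube_norm n u"
  by (simp add: cube_norm_nonneg)

lemma cube_norm_cong: "(\<And>i. i < n \<Longrightarrow> u i = v i) \<Longrightarrow> cube_norm n u = cube_norm n v"
  by (induction n) auto

text \<open>The dimensions of norm and homothety are kept apart so that the induction can run on
  \<open>m\<close> with the homothety fixed.\<close>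

lemma cube_norm_scale: "m \<le> n \<Longrightarrow> cube_norm m (cube_scale n r u) = \<bar>r\<bar> * cube_norm m u"
proof (induction m)
  case (Suc m)
  have "2 * cube_scale n r u m - 1 = r * (2 * u m - 1)"
    using Suc by (simp add: cube_scale_def algebra_simps)
  then show ?case
    using Suc by (simp add: abs_mult max_mult_distrib_left)
qed simp

lemma cube_norm_le_iff: "0 \<le> r \<Longrightarrow> cube_norm n u \<le> r \<longleftrightarrow> (\<forall>i<n. \<bar>2 * u i - 1\<bar> \<le> r)"
  by (induction n) (auto simp: less_Suc_eq)

lemma unit_cube_iff: "u \<in> unit_cube n \<longleftrightarrow> cube_norm n u \<le> 1 \<and> (\<forall>i\<ge>n. u i = 0)"
  unfolding unit_cube_def by (auto simp: cube_norm_le_iff abs_le_iff)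

lemma cube_norm_eq_1_iff:
  "cube_norm n u \<le> 1 \<Longrightarrow> cube_norm n u = 1 \<longleftrightarrow> (\<exists>i<n. u i = 0 \<or> u i = 1)"
proof (induction n)
  case (Suc n)
  then have "\<bar>2 * u n - 1\<bar> \<le> 1" "cube_norm n u \<le> 1" by auto
  then have "\<bar>2 * u n - 1\<bar> = 1 \<longleftrightarrow> u n = 0 \<or> u n = 1" by auto
  with Suc \<open>cube_norm n u \<le> 1\<close> \<open>\<bar>2 * u n - 1\<bar> \<le> 1\<close> show ?case
    by (auto simp: less_Suc_eq max_def split: if_splits)
qed simp

lemma unit_cube_boundary_iff:
  "u \<in> unit_cube_boundary n \<longleftrightarrow> cube_norm n u = 1 \<and> (\<forall>i\<ge>n. u i = 0)"
  unfolding unit_cube_boundary_def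
  using cube_norm_eq_1_iff[of n u] by (auto simp: unit_cube_iff)

lemma unit_cube_boundary_subset: "unit_cube_boundary n \<subseteq> unit_cube n"
  by (auto simp: unit_cube_boundary_def)

lemma cube_scale_in_cube: "\<bar>r\<bar> * cube_norm n u \<le> 1 \<Longrightarrow> cube_scale n r u \<in> unit_cube n"
  by (auto simp: unit_cube_iff cube_norm_scale) (auto simp: cube_scale_def)

lemma cube_scale_in_boundary: "\<bar>r\<bar> * cube_norm n u = 1 \<Longrightarrow> cube_scale n r u \<in> unit_cube_boundary n"
  by (auto simp: unit_cube_boundary_iff cube_norm_scale) (auto simp: cube_scale_def)

lemma cube_scale_scale: "cube_scale n r (cube_scale n s u) = cube_scale n (r * s) u"
  by (auto simp: cube_scale_def)

lemma cube_scale_1: "u \<in> unit_cube n \<Longrightarrow> cube_scale n 1 u = u"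
  by (auto simp: cube_scale_def unit_cube_def)

lemma cube_scale_0: "cube_scale n 0 u = cube_scale n 0 v"
  by (auto simp: cube_scale_def)

text \<open>A product of intervals and points, hence compact although the ambient space has
  infinitely many coordinates.\<close>

lemma compact_unit_cube: "compact (unit_cube n)"
proof -
  have eq: "unit_cube n = (\<Pi>\<^sub>E i\<in>UNIV. if i < n then {0..1::real} else {0})"
  proof (intro equalityI subsetI)
    fix u :: "nat \<Rightarrow> real" assume u: "u \<in> (\<Pi>\<^sub>E i\<in>UNIV. if i < n then {0..1::real} else {0})"
    have "u i \<in> (if i < n then {0..1} else {0})" for i
      using PiE_mem[OF u] by blast
    then have "if i < n then u i \<in> {0..1} else u i = 0" for i
      by (metis singletonD)
    then show "u \<in> unit_cube n"
      unfolding unit_cube_def by (smt (verit) atLeastAtMost_iff mem_Collect_eq not_less)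
  qed (auto simp: unit_cube_def)
  have "compactin (powertop_real UNIV) (unit_cube n)"
    unfolding eq by (subst compactin_PiE) auto
  then show ?thesis
    by (simp add: euclidean_product_topology)
qed

section \<open>The homotopy groups in terms of rel-boundary homotopies\<close>

text \<open>Being based makes \<open>g\<close> homotopic to itself under the boundary condition, so
  that \<open>g\<close> lies in its own class.\<close>

lemma homotopy_class_eq_iff:
  assumes "g \<in> based_cubes n X x"
  shows "homotopy_class n X x g = homotopy_class n X x h \<longleftrightarrow>
    homotopic_with (\<lambda>k. \<forall>u \<in> unit_cube_boundary n. k u = x) (cube_topology n) X g h"
    (is "_ \<longleftrightarrow> ?H g h")
proof
  assume eq: "homotopy_class n X x g = homotopy_class n X x h"
  have "?H g g"
    using assms by (auto simp: based_cubes_def)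
  then have "g \<in> homotopy_class n X x g"
    by (simp add: homotopy_class_def)
  with eq show "?H g h"
    by (simp add: homotopy_class_def homotopic_with_sym)
next
  assume "?H g h"
  then show "homotopy_class n X x g = homotopy_class n X x h"
    unfolding homotopy_class_def
    by (auto intro: homotopic_with_trans homotopic_with_symD)
qed

lemma based_cubes_comp:
  "g \<in> based_cubes n X x \<Longrightarrow> continuous_map X Y f \<Longrightarrow> f \<circ> g \<in> based_cubes n Y (f x)"
  by (auto simp: based_cubes_def intro: continuous_map_compose)

text \<open>The classes in the union defining \<open>homotopy_group_map\<close> all coincide,
  because composition with \<open>f\<close> preserves homotopies relative to the boundary.\<close>

lemma homotopy_group_map_class:
  assumes f: "continuous_map X Y f" and g: "g \<in> based_cubes n X x"
  shows "homotopy_group_map n Y f x (homotopy_class n X x g) = homotopy_class n Y (f x) (f \<circ> g)"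
proof -
  have *: "homotopy_class n Y (f x) (f \<circ> h) = homotopy_class n Y (f x) (f \<circ> g)"
    if "h \<in> homotopy_class n X x g" for h
  proof -
    have "homotopic_with (\<lambda>k. \<forall>u \<in> unit_cube_boundary n. k u = f x) (cube_topology n) Y (f \<circ> g) (f \<circ> h)"
      using that unfolding homotopy_class_def mem_Collect_eq
      by (rule homotopic_with_compose_continuous_map_left) (use f in auto)
    then show ?thesis
      using homotopy_class_eq_iff[OF based_cubes_comp[OF g f], of "f \<circ> h"] by simp
  qed
  have "g \<in> homotopy_class n X x g"
    using g by (auto simp: homotopy_class_def based_cubes_def)
  with * show ?thesis
    unfolding homotopy_group_map_def by blast
qed

lemma weak_homotopy_equivalence_surjective:
  assumes w: "weak_homotopy_equivalence X Y f" and n: "1 \<le> n" and x: "x \<in> topspace X"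
    and g: "g \<in> based_cubes n Y (f x)"
  obtains h where "h \<in> based_cubes n X x"
    "homotopic_with (\<lambda>k. \<forall>u \<in> unit_cube_boundary n. k u = f x) (top_of_set (unit_cube n)) Y g (f \<circ> h)"
proof -
  have f: "continuous_map X Y f"
    and bij: "bij_betw (homotopy_group_map n Y f x) (homotopy_group n X x) (homotopy_group n Y (f x))"
    using w n x by (auto simp: weak_homotopy_equivalence_def)
  have "homotopy_class n Y (f x) g \<in> homotopy_group n Y (f x)"
    using g by (simp add: homotopy_group_def)
  then obtain h where h: "h \<in> based_cubes n X x"
    "homotopy_class n Y (f x) g = homotopy_group_map n Y f x (homotopy_class n X x h)"
    using bij unfolding bij_betw_def homotopy_group_def by (smt (verit) imageE)
  then have "homotopic_with (\<lambda>k. \<forall>u \<in> unit_cube_boundary n. k u = f x) (cube_topology n) Y g (f \<circ> h)"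
    using homotopy_class_eq_iff[OF g] homotopy_group_map_class[OF f h(1)] by simp
  with h that show ?thesis by (simp add: cube_topology_eq)
qed

lemma weak_homotopy_equivalence_injective:
  assumes w: "weak_homotopy_equivalence X Y f" and n: "1 \<le> n" and x: "x \<in> topspace X"
    and g: "g \<in> based_cubes n X x" and h: "h \<in> based_cubes n X x"
    and fgh: "homotopic_with (\<lambda>k. \<forall>u \<in> unit_cube_boundary n. k u = f x) (top_of_set (unit_cube n)) Y (f \<circ> g) (f \<circ> h)"
  shows "homotopic_with (\<lambda>k. \<forall>u \<in> unit_cube_boundary n. k u = x) (top_of_set (unit_cube n)) X g h"
proof -
  have f: "continuous_map X Y f"
    and inj: "inj_on (homotopy_group_map n Y f x) (homotopy_group n X x)"
    using w n x by (auto simp: weak_homotopy_equivalence_def bij_betw_def)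
  have "homotopy_class n Y (f x) (f \<circ> g) = homotopy_class n Y (f x) (f \<circ> h)"
    using homotopy_class_eq_iff[OF based_cubes_comp[OF g f]] fgh by (simp add: cube_topology_eq)
  then have "homotopy_class n X x g = homotopy_class n X x h"
    by (intro inj_onD[OF inj]) (use g h homotopy_group_map_class[OF f] in \<open>simp_all add: homotopy_group_def\<close>)
  then show ?thesis
    using homotopy_class_eq_iff[OF g] by (simp add: cube_topology_eq)
qed

lemma path_component_of_iff_path:
  "path_component_of X x y \<longleftrightarrow> (\<exists>g. continuous_map (top_of_set {0..1::real}) X g \<and> g 0 = x \<and> g 1 = y)"
  by (simp add: path_component_of_def pathin_def)

lemma weak_homotopy_equivalence_path_component_map:
  assumes f: "continuous_map X Y f" and x: "x \<in> topspace X"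
  shows "(\<Union>z \<in> path_component_of_set X x. path_component_of_set Y (f z)) = path_component_of_set Y (f x)"
proof -
  have "path_component_of Y (f x) (f z)" if "path_component_of X x z" for z
    using that continuous_map_compose[OF _ f] unfolding path_component_of_iff_path
    by (metis comp_apply)
  then have *: "path_component_of_set Y (f z) = path_component_of_set Y (f x)" if "z \<in> path_component_of_set X x" for z
    using that by (metis mem_Collect_eq path_component_of_equiv)
  have "x \<in> path_component_of_set X x"
    using x by (simp add: path_component_of_refl)
  with * show ?thesis by blast
qed

lemma weak_homotopy_equivalence_path_surjective:
  assumes w: "weak_homotopy_equivalence X Y f" and y: "y \<in> topspace Y"
  obtains x where "x \<in> topspace X" "path_component_of Y y (f x)"
proof -
  have f: "continuous_map X Y f" and
    bij: "bij_betw (\<lambda>C. \<Union>x \<in> C. path_component_of_set Y (f x))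
       (path_components_of X) (path_components_of Y)"
    using w by (auto simp: weak_homotopy_equivalence_def)
  have "path_component_of_set Y y \<in> path_components_of Y"
    using y by (auto simp: path_components_of_def)
  then obtain C where "C \<in> path_components_of X" "path_component_of_set Y y = (\<Union>x \<in> C. path_component_of_set Y (f x))"
    using bij unfolding bij_betw_def by (metis (no_types, lifting) imageE)
  moreover from this(1) obtain x where "x \<in> topspace X" "C = path_component_of_set X x"
    unfolding path_components_of_def by blast
  ultimately have x: "x \<in> topspace X" "path_component_of_set Y y = path_component_of_set Y (f x)"
    using weak_homotopy_equivalence_path_component_map[OF f] by simp_all
  have "f x \<in> topspace Y"
    using continuous_map_image_subset_topspace[OF f] x by blast
  then have "f x \<in> path_component_of_set Y (f x)"
    by (simp add: path_component_of_refl)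
  then have "path_component_of Y y (f x)"
    using x(2) by (metis mem_Collect_eq)
  with x that show ?thesis by blast
qed

lemma weak_homotopy_equivalence_path_injective:
  assumes w: "weak_homotopy_equivalence X Y f" and x: "x \<in> topspace X" "x' \<in> topspace X"
    and "path_component_of Y (f x) (f x')"
  shows "path_component_of X x x'"
proof -
  have f: "continuous_map X Y f" and
    inj: "inj_on (\<lambda>C. \<Union>x \<in> C. path_component_of_set Y (f x)) (path_components_of X)"
    using w by (auto simp: weak_homotopy_equivalence_def bij_betw_def)
  have "path_component_of_set Y (f x) = path_component_of_set Y (f x')"
    using assms(4) by (simp add: path_component_of_equiv)
  then have "path_component_of_set X x = path_component_of_set X x'"
    by (intro inj_onD[OF inj])
      (use x weak_homotopy_equivalence_path_component_map[OF f] in \<open>simp_all add: path_components_of_def\<close>)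
  then show ?thesis
    using x(2) path_component_of_refl[of X x'] by blast
qed

section \<open>Compression of cubes along a weak homotopy equivalence\<close>

text \<open>\<open>wrap m\<close> is the quotient map \<open>I\<^sup>m \<rightarrow> \<partial>I\<^sup>m\<^sup>+\<^sup>1\<close> collapsing \<open>\<partial>I\<^sup>m\<close> to the centre of the
  bottom face: the part \<open>N \<le> 1/2\<close> of the cube covers the top face, the part \<open>1/2 \<le> N \<le> 3/4\<close> the
  side faces and the rest the bottom face, where \<open>N\<close> is the norm.\<close>

definition wrap_radius :: "real \<Rightarrow> real" where
  "wrap_radius N = min 2 (min 1 (4 - 4 * N) / max N (1/4))"

definition wrap_height :: "real \<Rightarrow> real" where
  "wrap_height N = max 0 (min 1 (3 - 4 * N))"

definition wrap :: "nat \<Rightarrow> (nat \<Rightarrow> real) \<Rightarrow> nat \<Rightarrow> real" where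
  "wrap m u = (cube_scale m (wrap_radius (cube_norm m u)) u)(m := wrap_height (cube_norm m u))"

definition bottom_centre :: "nat \<Rightarrow> nat \<Rightarrow> real" where
  "bottom_centre m = (\<lambda>i. if i < m then 1/2 else 0)"

text \<open>The radial profile of \<open>wrap\<close>: it rises to 1 on the top face, stays 1 along
  the sides and falls to 0 on the bottom face. The \<open>max N (1/4)\<close> avoids a division by 0
  and does not show, since for small \<open>N\<close> the outer minimum with 2 is attained.\<close>

lemma wrap_radius_times: "0 \<le> N \<Longrightarrow> N \<le> 1 \<Longrightarrow> wrap_radius N * N = min (2 * N) (min 1 (4 - 4 * N))"
proof -
  assume N: "0 \<le> N" "N \<le> 1"
  consider "N \<le> 1/4" | "1/4 \<le> N" "N \<le> 1/2" | "1/2 \<le> N" "N \<le> 3/4" | "3/4 \<le> N" by linarith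
  then show ?thesis
    using N by cases (auto simp: wrap_radius_def min_def max_def field_simps)
qed

lemma wrap_radius_nonneg: "0 \<le> N \<Longrightarrow> N \<le> 1 \<Longrightarrow> 0 \<le> wrap_radius N"
  by (auto simp: wrap_radius_def)

lemma wrap_radius_pos: "0 \<le> N \<Longrightarrow> N < 1 \<Longrightarrow> 0 < wrap_radius N"
  by (auto simp: wrap_radius_def)

lemma continuous_on_fun_upd:
  fixes u :: "'c::topological_space \<Rightarrow> nat \<Rightarrow> real"
  assumes "continuous_on S u" "continuous_on S r"
  shows "continuous_on S (\<lambda>x. (u x)(m := r x))"
proof (rule continuous_on_coordinatewise_then_product)
  fix i show "continuous_on S (\<lambda>x. ((u x)(m := r x)) i)"
    using assms continuous_on_coordinate[OF assms(1)] by (cases "i = m") auto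
qed

lemma continuous_on_wrap: "continuous_on S u \<Longrightarrow> continuous_on S (\<lambda>x. wrap m (u x))"
  unfolding wrap_def wrap_radius_def wrap_height_def
  by (intro continuous_on_fun_upd continuous_on_cube_scale continuous_on_min continuous_on_max
      continuous_on_divide continuous_on_diff continuous_on_mult continuous_on_const continuous_on_cube_norm)
    (auto simp: max_def)

lemma cube_norm_wrap:
  "cube_norm (Suc m) (wrap m u) = max (\<bar>wrap_radius (cube_norm m u)\<bar> * cube_norm m u) \<bar>2 * wrap_height (cube_norm m u) - 1\<bar>"
proof -
  have "cube_norm m (wrap m u) = cube_norm m (cube_scale m (wrap_radius (cube_norm m u)) u)"
    by (rule cube_norm_cong) (simp add: wrap_def)
  then show ?thesis
    by (simp add: cube_norm_scale wrap_def)
qed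

text \<open>The height is 1 for \<open>N \<le> 1/2\<close>, the radial part has norm 1 for
  \<open>1/2 \<le> N \<le> 3/4\<close>, and the height is 0 beyond.\<close>

lemma wrap_in_boundary:
  assumes "u \<in> unit_cube m" shows "wrap m u \<in> unit_cube_boundary (Suc m)"
proof -
  let ?N = "cube_norm m u"
  have N: "0 \<le> ?N" "?N \<le> 1" using assms by (auto simp: unit_cube_iff cube_norm_nonneg)
  have "max (wrap_radius ?N * ?N) \<bar>2 * wrap_height ?N - 1\<bar> = 1"
    using N by (simp add: wrap_radius_times wrap_height_def) (auto simp: min_def max_def)
  moreover have "\<forall>i\<ge>Suc m. wrap m u i = 0"
    by (auto simp: wrap_def cube_scale_def)
  ultimately show ?thesis
    using N by (simp add: unit_cube_boundary_iff cube_norm_wrap wrap_radius_nonneg del: cube_norm.simps)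
qed

lemma wrap_boundary: "u \<in> unit_cube_boundary m \<Longrightarrow> wrap m u = bottom_centre m"
  by (auto simp: unit_cube_boundary_iff wrap_def wrap_radius_def wrap_height_def cube_scale_def bottom_centre_def)

text \<open>The height tells top and bottom apart and is strictly decreasing along the sides, while
  the radial norm is strictly monotone on each of the other two parts; together they determine
  \<open>N\<close>. For \<open>N < 1\<close> the scaling factor is positive and can be
  cancelled.\<close>

lemma wrap_injective:
  assumes u: "u \<in> unit_cube m" and v: "v \<in> unit_cube m" and eq: "wrap m u = wrap m v"
  shows "u = v \<or> (u \<in> unit_cube_boundary m \<and> v \<in> unit_cube_boundary m)"
proof -
  let ?M = "cube_norm m u" let ?N = "cube_norm m v"
  have N: "0 \<le> ?M" "?M \<le> 1" "0 \<le> ?N" "?N \<le> 1" using u v by (auto simp: unit_cube_iff cube_norm_nonneg)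
  have h: "wrap_height ?M = wrap_height ?N"
    using fun_cong[OF eq, of m] by (simp add: wrap_def)
  have *: "cube_norm m (wrap m w) = \<bar>wrap_radius (cube_norm m w)\<bar> * cube_norm m w" for w
    by (subst cube_norm_scale[symmetric, of m m]) (auto intro: cube_norm_cong simp: wrap_def)
  have "wrap_radius ?M * ?M = wrap_radius ?N * ?N"
    using *[of u] *[of v] eq N by (simp add: wrap_radius_nonneg)
  then have MN: "?M = ?N"
    using N h unfolding wrap_height_def
    by (simp add: wrap_radius_times) (simp add: min_def max_def split: if_splits)?
  show ?thesis
  proof (cases "?M = 1")
    case True
    then show ?thesis using MN u v by (auto simp: unit_cube_boundary_iff unit_cube_iff)
  next
    case False
    then have r: "wrap_radius ?M > 0" using N by (intro wrap_radius_pos) auto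
    have "u i = v i" for i
    proof (cases "i < m")
      case True
      then show ?thesis
        using fun_cong[OF eq, of i] r MN by (simp add: wrap_def cube_scale_def)
    next
      case False
      then show ?thesis using u v by (simp add: unit_cube_def)
    qed
    then show ?thesis by blast
  qed
qed

text \<open>Preimages are sought on the ray through \<open>w\<close>. The hypothesis
  \<open>1 \<le> m\<close> provides a boundary point that hits the centre of the bottom face, where
  the ray degenerates.\<close>

lemma wrap_surjective:
  assumes m: "1 \<le> m" and w: "w \<in> unit_cube_boundary (Suc m)"
  obtains u where "u \<in> unit_cube m" "wrap m u = w"
proof -
  let ?P = "cube_norm m w"
  have w0: "\<And>i. i \<ge> Suc m \<Longrightarrow> w i = 0" and P1: "max ?P \<bar>2 * w m - 1\<bar> = 1"
    using w by (auto simp: unit_cube_boundary_iff)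
  have P: "0 \<le> ?P" "?P \<le> 1" and wm: "0 \<le> w m" "w m \<le> 1" using P1 by (auto simp: cube_norm_nonneg)
  have *: "\<exists>u. u \<in> unit_cube m \<and> wrap m u = w"
    if r: "0 \<le> r" "r * ?P \<le> 1" "wrap_radius (r * ?P) * r = 1" "wrap_height (r * ?P) = w m" for r
  proof (intro exI conjI)
    show "cube_scale m r w \<in> unit_cube m" using r by (intro cube_scale_in_cube) auto
    have N: "cube_norm m (cube_scale m r w) = r * ?P" using r by (simp add: cube_norm_scale)
    show "wrap m (cube_scale m r w) = w"
      unfolding wrap_def N cube_scale_scale r(3) r(4)
      using w0 by (auto simp: cube_scale_def fun_eq_iff not_less_eq less_Suc_eq)
  qed
  \<comment> \<open>Top, sides, bottom and its centre. The factors \<open>1/2\<close>,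
    \<open>(3 - w m)/4\<close> and \<open>(1 - ?P/4) / ?P\<close> solve \<open>2 * N = ?P\<close>,
    \<open>3 - 4 * N = w m\<close> and \<open>4 - 4 * N = ?P\<close> for
    \<open>N = r * ?P\<close>.\<close>
  consider "w m = 1" | "?P = 1" "w m < 1" "0 < w m" | "w m = 0" "?P > 0" | "w m = 0" "?P = 0"
    using P1 wm P by (auto simp: max_def abs_if split: if_splits) linarith+
  then have "\<exists>u. u \<in> unit_cube m \<and> wrap m u = w"
  proof cases
    case 1
    have "wrap_radius (1/2 * ?P) * (1/2) = 1" "wrap_height (1/2 * ?P) = w m"
      using P 1 unfolding wrap_radius_def wrap_height_def by (auto simp: min_def max_def field_simps)
    then show ?thesis using P by (intro *[of "1/2"]) auto
  next
    case 2
    have "wrap_radius ((3 - w m)/4 * ?P) * ((3 - w m)/4) = 1" "wrap_height ((3 - w m)/4 * ?P) = w m"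
      using 2 wm unfolding wrap_radius_def wrap_height_def by (auto simp: min_def max_def field_simps)
    then show ?thesis using 2 by (intro *[of "(3 - w m)/4"]) auto
  next
    case 3
    let ?r = "(1 - ?P/4) / ?P"
    have N: "?r * ?P = 1 - ?P/4" using 3 by simp
    have "wrap_radius (?r * ?P) * ?r = 1"
    proof -
      have "wrap_radius (1 - ?P/4) = ?P / (1 - ?P/4)"
        using P 3 unfolding wrap_radius_def by (auto simp: min_def max_def field_simps)
      moreover have "1 - ?P/4 \<noteq> 0" using P by simp
      ultimately show ?thesis unfolding N using 3 by simp
    qed
    moreover have "wrap_height (?r * ?P) = w m"
      using P 3 unfolding N wrap_height_def by (auto simp: min_def max_def)
    ultimately show ?thesis using P 3 N by (intro *[of ?r]) auto
  next
    case 4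
    define u :: "nat \<Rightarrow> real" where "u = (\<lambda>i. 0)"
    have u: "u \<in> unit_cube_boundary m"
      using m by (auto simp: unit_cube_boundary_def unit_cube_def u_def intro: exI[of _ 0])
    have "\<forall>i<m. \<bar>2 * w i - 1\<bar> \<le> 0" using 4 cube_norm_le_iff[of 0 m w] by simp
    then have "w = bottom_centre m"
      using 4 w0 by (auto simp: bottom_centre_def fun_eq_iff) (metis not_less_eq_eq le_antisym not_less)
    with u show ?thesis
      using wrap_boundary unit_cube_boundary_subset by blast
  qed
  with that show ?thesis by blast
qed

lemma Hausdorff_space_nat_real: "Hausdorff_space (top_of_set (S :: (nat \<Rightarrow> real) set))"
  by (intro Hausdorff_space_subtopology) (simp add: Hausdorff_space_euclidean)

lemma bottom_centre_norm: "cube_norm (Suc m) (bottom_centre m) = 1"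
proof -
  have "cube_norm m (bottom_centre m) = 0"
    using cube_norm_le_iff[of 0 m "bottom_centre m"] cube_norm_nonneg[of m "bottom_centre m"]
    by (auto simp: bottom_centre_def)
  then show ?thesis by (simp add: bottom_centre_def)
qed

text \<open>The cube is the cone over its boundary: \<open>(s, u)\<close> goes to the point at norm
  \<open>1 - s\<close> on the ray through \<open>wrap m u\<close>. The null homotopy is constant on
  everything this identifies, namely the end \<open>s = 1\<close> and the boundary of the
  \<open>u\<close>-cube, so it descends to the cube and restricts to \<open>a\<close> at
  \<open>s = 0\<close>.\<close>

lemma extends_from_null_homotopy:
  assumes m: "1 \<le> m" and a: "continuous_map (top_of_set (unit_cube_boundary (Suc m))) X a"
    and null: "homotopic_with (\<lambda>k. \<forall>u \<in> unit_cube_boundary m. k u = x0) (top_of_set (unit_cube m)) X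
      (a \<circ> wrap m) (\<lambda>u. x0)"
  obtains A where "continuous_map (top_of_set (unit_cube (Suc m))) X A"
    "\<And>u. u \<in> unit_cube_boundary (Suc m) \<Longrightarrow> A u = a u"
proof -
  obtain H where H: "continuous_map (top_of_set ({0..1::real} \<times> unit_cube m)) X H"
    "\<And>u. H (0, u) = a (wrap m u)" "\<And>u. H (1, u) = x0"
    "\<And>s u. s \<in> {0..1} \<Longrightarrow> u \<in> unit_cube_boundary m \<Longrightarrow> H (s, u) = x0"
    using homotopic_with_relE[OF null] unfolding o_def by metis
  define Q where "Q = (\<lambda>p. cube_scale (Suc m) (1 - fst p) (wrap m (snd p)))"
  let ?D = "{0..1::real} \<times> unit_cube m" let ?C = "unit_cube (Suc m)"
  have norm_wrap: "cube_norm (Suc m) (wrap m u) = 1" if "u \<in> unit_cube m" for u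
    using wrap_in_boundary[OF that] by (simp only: unit_cube_boundary_iff)
  have normQ: "cube_norm (Suc m) (Q p) = 1 - fst p" if "p \<in> ?D" for p
    using that norm_wrap by (auto simp: Q_def cube_norm_scale simp del: cube_norm.simps)
  have contQ: "continuous_on ?D Q"
    unfolding Q_def by (intro continuous_intros continuous_on_wrap)
  have "Q ` ?D = ?C"
  proof (intro equalityI subsetI)
    fix v assume v: "v \<in> ?C"
    let ?N = "cube_norm (Suc m) v"
    have N: "0 \<le> ?N" "?N \<le> 1" using v cube_norm_nonneg by (auto simp only: unit_cube_iff)
    show "v \<in> Q ` ?D"
    proof (cases "?N = 0")
      case True
      then have "\<forall>i<Suc m. \<bar>2 * v i - 1\<bar> \<le> 0" by (simp only: cube_norm_le_iff[symmetric] order_refl)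
      then have "v = cube_scale (Suc m) 0 u" for u
        using v by (auto simp: cube_scale_def fun_eq_iff unit_cube_def)
      then have "v = Q (1, \<lambda>i. 0)" by (simp add: Q_def)
      moreover have "(1, \<lambda>i. 0) \<in> ?D" by (auto simp: unit_cube_def)
      ultimately show ?thesis by blast
    next
      case False
      then have "cube_scale (Suc m) (1 / ?N) v \<in> unit_cube_boundary (Suc m)"
        using N by (intro cube_scale_in_boundary) simp
      then obtain u where u: "u \<in> unit_cube m" "wrap m u = cube_scale (Suc m) (1 / ?N) v"
        using wrap_surjective[OF m] by blast
      then have "Q (1 - ?N, u) = v"
        using False v by (simp add: Q_def cube_scale_scale cube_scale_1 del: cube_norm.simps)
      with u N show ?thesis by (intro image_eqI[of _ _ "(1 - ?N, u)"]) auto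
    qed
  next
    fix v assume "v \<in> Q ` ?D"
    then obtain s u where su: "s \<in> {0..1}" "u \<in> unit_cube m" "v = Q (s, u)" by auto
    have "cube_scale (Suc m) (1 - s) (wrap m u) \<in> ?C"
      by (intro cube_scale_in_cube) (use su norm_wrap in \<open>auto simp del: cube_norm.simps\<close>)
    then show "v \<in> ?C" by (simp add: Q_def su)
  qed
  moreover have "compact_space (top_of_set ?D)"
    using compact_Times[OF compact_Icc compact_unit_cube] by (simp add: compact_space_subtopology)
  \<comment> \<open>A continuous surjection from a compact space to a Hausdorff space is a quotient
    map.\<close>
  ultimately have quot: "quotient_map (top_of_set ?D) (top_of_set ?C) Q"
    using contQ by (intro T1_Spaces.continuous_imp_quotient_map Hausdorff_space_nat_real) auto
  \<comment> \<open>The norm of \<open>Q p\<close> determines \<open>s\<close>; for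
    \<open>s \<noteq> 1\<close> rescaling recovers \<open>wrap m u\<close>, and
    \<open>wrap_injective\<close> applies.\<close>
  have compat: "H p = H p'" if p: "p \<in> ?D" "p' \<in> ?D" and eq: "Q p = Q p'" for p p'
  proof -
    obtain s u s' u' where pq: "p = (s, u)" "p' = (s', u')" by (metis surj_pair)
    have s: "s = s'" using normQ[OF p(1)] normQ[OF p(2)] eq pq by simp
    show ?thesis
    proof (cases "s = 1")
      case True then show ?thesis using H(3) pq s by simp
    next
      case False
      have *: "cube_scale (Suc m) (1 / (1 - s)) (Q (s, w)) = wrap m w" if "w \<in> unit_cube m" for w
        using False wrap_in_boundary[OF that] unit_cube_boundary_subset[of "Suc m"]
        by (simp add: Q_def cube_scale_scale cube_scale_1 subset_iff)
      have "wrap m u = wrap m u'"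
        using *[of u] *[of u'] p pq s eq by auto
      then have "u = u' \<or> (u \<in> unit_cube_boundary m \<and> u' \<in> unit_cube_boundary m)"
        using p pq by (intro wrap_injective) auto
      then show ?thesis using H(4) p pq s by auto
    qed
  qed
  obtain A where A: "continuous_map (top_of_set ?C) X A" "A ` topspace (top_of_set ?C) = H ` topspace (top_of_set ?D)"
    "\<And>p. p \<in> topspace (top_of_set ?D) \<Longrightarrow> A (Q p) = H p"
    using quotient_map_lift_exists[OF quot H(1)] compat by (metis topspace_euclidean_subtopology)
  show ?thesis
  proof (rule that[OF A(1)])
    fix w assume w: "w \<in> unit_cube_boundary (Suc m)"
    then obtain u where u: "u \<in> unit_cube m" "wrap m u = w" using wrap_surjective[OF m] by blast
    have "Q (0, u) = w"
      using u(2) w unit_cube_boundary_subset[of "Suc m"] cube_scale_1[of w "Suc m"]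
      by (simp add: Q_def subset_iff)
    then show "A w = a w" using A(3)[of "(0, u)"] u H(2) by auto
  qed
qed

text \<open>The cube is convex: slide \<open>wrap m u\<close> along the segment to
  \<open>bottom_centre m\<close>, where \<open>wrap\<close> sends the boundary anyway.\<close>

lemma null_homotopy_from_extension:
  assumes B: "continuous_map (top_of_set (unit_cube (Suc m))) Y B"
  shows "homotopic_with (\<lambda>k. \<forall>u \<in> unit_cube_boundary m. k u = B (bottom_centre m)) (top_of_set (unit_cube m)) Y
      (B \<circ> wrap m) (\<lambda>u. B (bottom_centre m))"
proof (rule homotopic_with_relI[OF _ unit_cube_boundary_subset])
  define L where "L = (\<lambda>p i. (1 - fst p) * wrap m (snd p) i + fst p * bottom_centre m i :: real)"
  have "continuous_on ({0..1} \<times> unit_cube m) L"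
    unfolding L_def
    by (rule continuous_on_coordinatewise_then_product)
      (intro continuous_intros continuous_on_coordinate[OF continuous_on_wrap])
  moreover have "L p \<in> unit_cube (Suc m)" if "p \<in> {0..1} \<times> unit_cube m" for p
  proof -
    have "wrap m (snd p) \<in> unit_cube (Suc m)"
      using that wrap_in_boundary[of "snd p"] unit_cube_boundary_subset[of "Suc m"] by auto
    moreover have "bottom_centre m \<in> unit_cube (Suc m)"
      by (auto simp: bottom_centre_def unit_cube_def)
    ultimately show ?thesis
      using that by (auto simp: L_def unit_cube_def convex_bound_le mult_nonneg_nonneg)
  qed
  ultimately show "continuous_map (top_of_set ({0..1} \<times> unit_cube m)) Y (\<lambda>p. B (L p))"
    by (intro continuous_map_compose_on[OF B])
  show "B (L (s, u)) = B (bottom_centre m)" if "u \<in> unit_cube_boundary m" for s u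
    using wrap_boundary[OF that] by (simp add: L_def algebra_simps)
qed (auto simp: o_def)

text \<open>Composing \<open>a\<close> with \<open>wrap m\<close> turns it into an element of the
  homotopy group in degree \<open>n - 1\<close>; the filling \<open>b\<close> makes its image in
  \<open>Y\<close> trivial, so it is trivial and \<open>a\<close> extends. For \<open>n = 1\<close>
  the boundary consists of two points and injectivity on path components takes over. The extension
  bears no relation to \<open>b\<close> beyond the boundary.\<close>

lemma extends_along_weak_equivalence:
  assumes w: "weak_homotopy_equivalence X Y f"
    and a: "continuous_map (top_of_set (unit_cube_boundary n)) X a"
    and b: "continuous_map (top_of_set (unit_cube n)) Y b"
    and ab: "\<And>u. u \<in> unit_cube_boundary n \<Longrightarrow> b u = f (a u)"
    and n: "1 \<le> n"
  obtains A where "continuous_map (top_of_set (unit_cube n)) X A"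
    "\<And>u. u \<in> unit_cube_boundary n \<Longrightarrow> A u = a u"
proof -
  obtain m where m: "n = Suc m" using n by (cases n) auto
  have f: "continuous_map X Y f" using w by (simp add: weak_homotopy_equivalence_def)
  show ?thesis
  proof (cases "m = 0")
    case True
    define e where "e = (\<lambda>t::real. (\<lambda>i::nat. if i = 0 then t else 0))"
    have e: "e t \<in> unit_cube 1" if "t \<in> {0..1}" for t
      using that by (auto simp: e_def unit_cube_def)
    have bd: "u \<in> unit_cube_boundary 1 \<longleftrightarrow> u = e 0 \<or> u = e 1" for u
    proof
      assume u: "u \<in> unit_cube_boundary 1"
      then have "u i = 0" if "i \<noteq> 0" for i
        using that by (auto simp: unit_cube_boundary_def unit_cube_def)
      moreover have "u 0 = 0 \<or> u 0 = 1"
        using u by (auto simp: unit_cube_boundary_def)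
      ultimately show "u = e 0 \<or> u = e 1"
        unfolding e_def fun_eq_iff by metis
    qed (auto simp: unit_cube_boundary_def unit_cube_def e_def)
    have "continuous_on {0..1} e"
    proof (rule continuous_on_coordinatewise_then_product)
      show "continuous_on {0..1} (\<lambda>t. e t i)" for i
        by (cases "i = 0") (auto simp: e_def)
    qed
    then have "continuous_map (top_of_set {0..1}) Y (\<lambda>t. b (e t))"
      using b e m True by (intro continuous_map_compose_on[OF b]) auto
    then have "path_component_of Y (f (a (e 0))) (f (a (e 1)))"
      unfolding path_component_of_iff_path using ab bd m True by (intro exI[of _ "\<lambda>t. b (e t)"]) auto
    moreover have "a (e 0) \<in> topspace X" "a (e 1) \<in> topspace X"
      using continuous_map_on_mem[OF a] bd m True by auto
    ultimately have "path_component_of X (a (e 0)) (a (e 1))"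
      using weak_homotopy_equivalence_path_injective[OF w] by blast
    then obtain g where g: "continuous_map (top_of_set {0..1::real}) X g" "g 0 = a (e 0)" "g 1 = a (e 1)"
      by (auto simp: path_component_of_iff_path)
    have "continuous_map (top_of_set (unit_cube n)) X (\<lambda>u. g (u 0))"
      using m by (intro continuous_map_compose_on[OF g(1)])
        (auto simp: unit_cube_def intro!: continuous_on_coordinate continuous_intros)
    then show ?thesis
      using g bd m True by (intro that[of "\<lambda>u. g (u 0)"]) (auto simp: e_def)
  next
    case False
    then have m1: "1 \<le> m" by simp
    let ?x0 = "a (bottom_centre m)"
    have bc: "bottom_centre m \<in> unit_cube_boundary (Suc m)"
      using bottom_centre_norm by (auto simp only: unit_cube_boundary_iff) (auto simp: bottom_centre_def)
    have x0: "?x0 \<in> topspace X" using continuous_map_on_mem[OF a] bc m by auto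
    have cw: "continuous_on (unit_cube m) (wrap m)"
      using continuous_on_wrap[OF continuous_on_id] by simp
    have aw: "a \<circ> wrap m \<in> based_cubes m X ?x0"
      using continuous_map_compose_on[OF a[unfolded m] cw wrap_in_boundary] wrap_boundary
      by (auto simp: based_cubes_def cube_topology_eq o_def)
    have const: "(\<lambda>u. ?x0) \<in> based_cubes m X ?x0"
      using x0 by (auto simp: based_cubes_def)
    have "homotopic_with (\<lambda>k. \<forall>u \<in> unit_cube_boundary m. k u = f ?x0) (top_of_set (unit_cube m)) Y
      (b \<circ> wrap m) (\<lambda>u. f ?x0)"
      using null_homotopy_from_extension[OF b[unfolded m]] ab[of "bottom_centre m"] bc m by simp
    then have "homotopic_with (\<lambda>k. \<forall>u \<in> unit_cube_boundary m. k u = f ?x0) (top_of_set (unit_cube m)) Y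
      (f \<circ> (a \<circ> wrap m)) (f \<circ> (\<lambda>u. ?x0))"
      by (rule homotopic_with_eq)
        (use ab m wrap_in_boundary unit_cube_boundary_subset in \<open>auto simp: subset_iff\<close>)
    then have "homotopic_with (\<lambda>k. \<forall>u \<in> unit_cube_boundary m. k u = ?x0) (top_of_set (unit_cube m)) X
      (a \<circ> wrap m) (\<lambda>u. ?x0)"
      by (rule weak_homotopy_equivalence_injective[OF w m1 x0 aw const])
    then obtain A where "continuous_map (top_of_set (unit_cube (Suc m))) X A"
      "\<And>u. u \<in> unit_cube_boundary (Suc m) \<Longrightarrow> A u = a u"
      using extends_from_null_homotopy[OF m1 a[unfolded m]] by blast
    with that m show ?thesis by blast
  qed
qed

lemma cube_scale_norm_in_boundary: "cube_norm n u > 0 \<Longrightarrow> cube_scale n (1 / cube_norm n u) u \<in> unit_cube_boundary n"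
  by (rule cube_scale_in_boundary) simp

text \<open>An extension \<open>A\<close> of \<open>b|\<partial>I\<^sup>n\<close> is corrected by the element of \<open>\<pi>\<^sub>n(X)\<close> whose image is the
  difference of \<open>b\<close> and \<open>f \<circ> A\<close>.\<close>

lemma compression_correct:
  assumes w: "weak_homotopy_equivalence X Y f" and n: "1 \<le> n"
    and A: "continuous_map (top_of_set (unit_cube n)) X A"
    and b: "continuous_map (top_of_set (unit_cube n)) Y b"
    and Ab: "\<And>u. u \<in> unit_cube_boundary n \<Longrightarrow> b u = f (A u)"
  obtains a' where "continuous_map (top_of_set (unit_cube n)) X a'"
    "\<And>u. u \<in> unit_cube_boundary n \<Longrightarrow> a' u = A u"
    "homotopic_with (\<lambda>k. \<forall>u \<in> unit_cube_boundary n. k u = b u) (top_of_set (unit_cube n)) Y b (f \<circ> a')"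
proof -
  let ?I = "unit_cube n" and ?N = "cube_norm n" and ?sc = "cube_scale n"
  have f: "continuous_map X Y f" using w by (simp add: weak_homotopy_equivalence_def)
  have fA: "continuous_map (top_of_set ?I) Y (\<lambda>u. f (A u))"
    using continuous_map_compose[OF A f] by (simp add: o_def)
  define c where "c = ?sc 0 (\<lambda>i. 0)"
  have c: "?sc 0 u = c" for u unfolding c_def by (rule cube_scale_0)
  have cI: "c \<in> ?I" unfolding c_def by (intro cube_scale_in_cube) simp
  let ?x0 = "A c"
  have x0: "?x0 \<in> topspace X" using continuous_map_on_mem[OF A cI] .
  have N0: "0 \<le> ?N u" for u by (rule cube_norm_nonneg)
  have NI: "?N u \<le> 1" if "u \<in> ?I" for u using that by (simp add: unit_cube_iff)
  \<comment> \<open>The difference of \<open>b\<close> and \<open>f \<circ> A\<close>, glued along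
    their common boundary: \<open>b\<close> fills the inner half, and the outer half follows each
    ray of \<open>f \<circ> A\<close> back from the boundary to the centre.\<close>
  define \<beta> where "\<beta> = (\<lambda>u. if ?N u \<le> 1/2 then b (?sc 2 u) else f (A (?sc ((2 - 2 * ?N u) / ?N u) u)))"
  have "continuous_map (top_of_set ?I) Y \<beta>"
    unfolding \<beta>_def
  proof (rule continuous_map_if_le)
    show "continuous_map (top_of_set {x \<in> ?I. ?N x \<le> 1/2}) Y (\<lambda>u. b (?sc 2 u))"
      by (rule continuous_map_compose_on[OF b]) (auto intro!: continuous_intros cube_scale_in_cube)
    show "continuous_map (top_of_set {x \<in> ?I. 1/2 \<le> ?N x}) Y (\<lambda>u. f (A (?sc ((2 - 2 * ?N u) / ?N u) u)))"
      by (rule continuous_map_compose_on[OF fA])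
        (auto intro!: continuous_intros cube_scale_in_cube simp: NI)
    fix u assume "u \<in> ?I" and N: "?N u = 1/2"
    show "b (?sc 2 u) = f (A (?sc ((2 - 2 * ?N u) / ?N u) u))"
      using Ab[of "?sc 2 u"] unfolding N by (simp add: cube_scale_in_boundary N)
  qed (auto intro!: continuous_intros)
  moreover have "\<beta> u = f ?x0" if "u \<in> unit_cube_boundary n" for u
    using that by (simp add: \<beta>_def unit_cube_boundary_iff c)
  ultimately have "\<beta> \<in> based_cubes n Y (f ?x0)"
    by (auto simp: based_cubes_def cube_topology_eq)
  then obtain \<omega> where \<omega>: "\<omega> \<in> based_cubes n X ?x0"
    "homotopic_with (\<lambda>k. \<forall>u \<in> unit_cube_boundary n. k u = f ?x0) (top_of_set ?I) Y \<beta> (f \<circ> \<omega>)"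
    using weak_homotopy_equivalence_surjective[OF w n x0] by blast
  then obtain \<kappa> where \<kappa>: "continuous_map (top_of_set ({0..1::real} \<times> ?I)) Y \<kappa>"
    "\<And>u. \<kappa> (0, u) = \<beta> u" "\<And>u. \<kappa> (1, u) = f (\<omega> u)"
    "\<And>s u. s \<in> {0..1} \<Longrightarrow> u \<in> unit_cube_boundary n \<Longrightarrow> \<kappa> (s, u) = f ?x0"
    by (auto elim!: homotopic_with_relE)
  have \<omega>c: "continuous_map (top_of_set ?I) X \<omega>" and \<omega>b: "\<And>u. u \<in> unit_cube_boundary n \<Longrightarrow> \<omega> u = ?x0"
    using \<omega>(1) by (auto simp: based_cubes_def cube_topology_eq)
  \<comment> \<open>\<open>\<omega>\<close> realizes the difference on the ball of norm 2/3 and is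
    followed outwards by the rays of \<open>A\<close>; the two meet in
    \<open>?x0 = A c\<close>.\<close>
  define a' where "a' = (\<lambda>u. if ?N u \<le> 2/3 then \<omega> (?sc (3/2) u) else A (?sc ((3 * ?N u - 2) / ?N u) u))"
  have a'c: "continuous_map (top_of_set ?I) X a'"
    unfolding a'_def
  proof (rule continuous_map_if_le)
    show "continuous_map (top_of_set {x \<in> ?I. ?N x \<le> 2/3}) X (\<lambda>u. \<omega> (?sc (3/2) u))"
      by (rule continuous_map_compose_on[OF \<omega>c]) (auto intro!: continuous_intros cube_scale_in_cube)
    show "continuous_map (top_of_set {x \<in> ?I. 2/3 \<le> ?N x}) X (\<lambda>u. A (?sc ((3 * ?N u - 2) / ?N u) u))"
      by (rule continuous_map_compose_on[OF A])
        (auto intro!: continuous_intros cube_scale_in_cube simp: NI)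
    fix u assume "u \<in> ?I" and N: "?N u = 2/3"
    show "\<omega> (?sc (3/2) u) = A (?sc ((3 * ?N u - 2) / ?N u) u)"
      unfolding N by (simp add: cube_scale_in_boundary N \<omega>b c)
  qed (auto intro!: continuous_intros)
  have a'b: "a' u = A u" if "u \<in> unit_cube_boundary n" for u
    using that unit_cube_boundary_subset[of n] by (auto simp: a'_def unit_cube_boundary_iff cube_scale_1 unit_cube_iff)
  \<comment> \<open>The intermediate map: homotopic to \<open>f \<circ> a'\<close> by applying
    \<open>\<kappa>\<close> inside norm 2/3, and to \<open>b\<close> by retracting the excursion
    along the rays.\<close>
  define \<beta>' where "\<beta>' = (\<lambda>u. if ?N u \<le> 2/3 then \<beta> (?sc (3/2) u) else f (A (?sc ((3 * ?N u - 2) / ?N u) u)))"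
  have h1: "homotopic_with (\<lambda>k. \<forall>u \<in> unit_cube_boundary n. k u = b u) (top_of_set ?I) Y \<beta>' (f \<circ> a')"
  proof (rule homotopic_with_relI[OF _ unit_cube_boundary_subset])
    let ?k = "\<lambda>p::real\<times>(nat\<Rightarrow>real). if ?N (snd p) \<le> 2/3 then \<kappa> (fst p, ?sc (3/2) (snd p))
      else f (A (?sc ((3 * ?N (snd p) - 2) / ?N (snd p)) (snd p)))"
    show "continuous_map (top_of_set ({0..1} \<times> ?I)) Y ?k"
    proof (rule continuous_map_if_le)
      show "continuous_map (top_of_set {x \<in> {0..1} \<times> ?I. ?N (snd x) \<le> 2/3}) Y (\<lambda>p. \<kappa> (fst p, ?sc (3/2) (snd p)))"
        by (rule continuous_map_compose_on[OF \<kappa>(1)]) (auto intro!: continuous_intros cube_scale_in_cube)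
      show "continuous_map (top_of_set {x \<in> {0..1} \<times> ?I. 2/3 \<le> ?N (snd x)}) Y
         (\<lambda>p. f (A (?sc ((3 * ?N (snd p) - 2) / ?N (snd p)) (snd p))))"
        by (rule continuous_map_compose_on[OF fA])
          (auto intro!: continuous_intros cube_scale_in_cube simp: NI)
      fix p :: "real \<times> (nat \<Rightarrow> real)" assume p: "p \<in> {0..1} \<times> ?I" and N: "?N (snd p) = 2/3"
      then show "\<kappa> (fst p, ?sc (3/2) (snd p)) = f (A (?sc ((3 * ?N (snd p) - 2) / ?N (snd p)) (snd p)))"
        using \<kappa>(4)[of "fst p" "?sc (3/2) (snd p)"] p unfolding N
        by (auto simp: cube_scale_in_boundary N c)
    qed (auto intro!: continuous_intros)
    fix s u assume "u \<in> unit_cube_boundary n"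
    then show "?k (s, u) = b u"
      using Ab[of u] unit_cube_boundary_subset[of n] by (auto simp: unit_cube_boundary_iff cube_scale_1 unit_cube_iff)
  qed (use \<kappa> in \<open>auto simp: a'_def \<beta>'_def\<close>)
  have h2: "homotopic_with (\<lambda>k. \<forall>u \<in> unit_cube_boundary n. k u = b u) (top_of_set ?I) Y \<beta>' b"
  proof (rule homotopic_with_relI[OF _ unit_cube_boundary_subset])
    \<comment> \<open>The radius of the region occupied by \<open>b\<close>, growing from 1/3 to 1.
      Outside it a ray of \<open>f \<circ> A\<close> is followed inwards and then back out to the
      boundary; the turning point, where the two arguments of \<open>min\<close> agree, moves
      outwards with \<open>?r\<close>, so that the excursion vanishes at the end.\<close>
    let ?r = "\<lambda>p::real\<times>(nat\<Rightarrow>real). (1 + 2 * fst p) / 3"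
    let ?k = "\<lambda>p. if ?N (snd p) \<le> ?r p then b (?sc (1 / ?r p) (snd p))
      else f (A (?sc ((1 - 3 * min (?N (snd p) - ?r p) (1 - ?N (snd p))) / ?N (snd p)) (snd p)))"
    show "continuous_map (top_of_set ({0..1} \<times> ?I)) Y ?k"
    proof (rule continuous_map_if_le)
      show "continuous_map (top_of_set {x \<in> {0..1} \<times> ?I. ?N (snd x) \<le> ?r x}) Y (\<lambda>p. b (?sc (1 / ?r p) (snd p)))"
        by (rule continuous_map_compose_on[OF b]) (auto intro!: continuous_intros cube_scale_in_cube simp: field_simps)
      show "continuous_map (top_of_set {x \<in> {0..1} \<times> ?I. ?r x \<le> ?N (snd x)}) Y
         (\<lambda>p. f (A (?sc ((1 - 3 * min (?N (snd p) - ?r p) (1 - ?N (snd p))) / ?N (snd p)) (snd p))))"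
      proof (rule continuous_map_compose_on[OF fA])
        fix p assume p: "p \<in> {x \<in> {0..1} \<times> ?I. ?r x \<le> ?N (snd x)}"
        then have "0 \<le> fst p" "?r p \<le> ?N (snd p)" "?N (snd p) \<le> 1" by (auto simp: NI)
        moreover from this have "0 \<le> 1 - 3 * min (?N (snd p) - ?r p) (1 - ?N (snd p))"
          "1 - 3 * min (?N (snd p) - ?r p) (1 - ?N (snd p)) \<le> 1" by (auto simp: min_def field_simps)
        moreover have "?N (snd p) > 0" using calculation by (auto simp: field_simps)
        ultimately show "?sc ((1 - 3 * min (?N (snd p) - ?r p) (1 - ?N (snd p))) / ?N (snd p)) (snd p) \<in> ?I"
          by (intro cube_scale_in_cube) auto
      qed (auto intro!: continuous_intros)
      fix p assume p: "p \<in> {0..1} \<times> ?I" and N: "?N (snd p) = ?r p"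
      have r: "0 < ?r p" "?r p \<le> 1" using p by auto
      have "?sc (1 / ?r p) (snd p) \<in> unit_cube_boundary n"
        by (rule cube_scale_in_boundary) (use r N in simp)
      then show "b (?sc (1 / ?r p) (snd p)) =
         f (A (?sc ((1 - 3 * min (?N (snd p) - ?r p) (1 - ?N (snd p))) / ?N (snd p)) (snd p)))"
        using Ab r unfolding N by simp
    qed (auto intro!: continuous_intros)
    show "?k (1, u) = b u" if u: "u \<in> ?I" for u
      using u by (simp add: NI cube_scale_1)
    show "?k (0, u) = \<beta>' u" for u
    proof -
      consider "?N u \<le> 1/3" | "1/3 < ?N u" "?N u \<le> 2/3" | "2/3 < ?N u" by linarith
      then show ?thesis
      proof cases
        case 1
        then show ?thesis by (simp add: \<beta>'_def \<beta>_def cube_norm_scale cube_scale_scale)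
      next
        case 2
        then have "min (?N u - 1/3) (1 - ?N u) = ?N u - 1/3" by auto
        moreover have "(2 - 2 * (3/2 * ?N u)) / (3/2 * ?N u) * (3/2) = (1 - 3 * (?N u - 1/3)) / ?N u"
          using 2 by (simp add: field_simps)
        ultimately show ?thesis using 2 by (simp add: \<beta>'_def \<beta>_def cube_norm_scale cube_scale_scale)
      next
        case 3
        then have "min (?N u - 1/3) (1 - ?N u) = 1 - ?N u" by auto
        then show ?thesis using 3 by (simp add: \<beta>'_def algebra_simps)
      qed
    qed
    fix s :: real and u assume "s \<in> {0..1}" "u \<in> unit_cube_boundary n"
    moreover have "?sc 1 u = u" using \<open>u \<in> unit_cube_boundary n\<close> unit_cube_boundary_subset[of n] cube_scale_1 by auto
    ultimately show "?k (s, u) = b u"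
      using Ab[of u] by (auto simp: unit_cube_boundary_iff min_def)
  qed
  have "homotopic_with (\<lambda>k. \<forall>u \<in> unit_cube_boundary n. k u = b u) (top_of_set ?I) Y b (f \<circ> a')"
    using homotopic_with_trans[OF homotopic_with_symD[OF h2] h1] .
  with that a'c a'b show ?thesis by blast
qed

lemma unit_cube_0: "unit_cube 0 = {\<lambda>i. 0}" "unit_cube_boundary 0 = {}"
  by (auto simp: unit_cube_def unit_cube_boundary_def)

text \<open>Injectivity one degree lower extends \<open>a\<close> over the cube and surjectivity in
  degree \<open>n\<close> corrects the extension. For \<open>n = 0\<close> the boundary is empty and
  surjectivity on path components remains.\<close>

lemma compression:
  assumes w: "weak_homotopy_equivalence X Y f"
    and a: "continuous_map (top_of_set (unit_cube_boundary n)) X a"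
    and b: "continuous_map (top_of_set (unit_cube n)) Y b"
    and ab: "\<And>u. u \<in> unit_cube_boundary n \<Longrightarrow> b u = f (a u)"
  obtains a' where "continuous_map (top_of_set (unit_cube n)) X a'"
    "\<And>u. u \<in> unit_cube_boundary n \<Longrightarrow> a' u = a u"
    "homotopic_with (\<lambda>k. \<forall>u \<in> unit_cube_boundary n. k u = b u) (top_of_set (unit_cube n)) Y b (f \<circ> a')"
proof (cases "n = 0")
  case True
  let ?o = "\<lambda>i::nat. 0::real"
  have "b ?o \<in> topspace Y" using continuous_map_on_mem[OF b] True by (simp add: unit_cube_0)
  then obtain x where x: "x \<in> topspace X" "path_component_of Y (b ?o) (f x)"
    using weak_homotopy_equivalence_path_surjective[OF w] by blast
  then obtain g where g: "continuous_map (top_of_set {0..1::real}) Y g" "g 0 = b ?o" "g 1 = f x"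
    by (auto simp: path_component_of_iff_path)
  have "homotopic_with (\<lambda>k. \<forall>u \<in> unit_cube_boundary n. k u = b u) (top_of_set (unit_cube n)) Y b (f \<circ> (\<lambda>u. x))"
  proof (rule homotopic_with_relI[OF _ unit_cube_boundary_subset])
    show "continuous_map (top_of_set ({0..1} \<times> unit_cube n)) Y (\<lambda>p. g (fst p))"
      by (rule continuous_map_compose_on[OF g(1)]) (auto intro!: continuous_intros)
  qed (use g True in \<open>auto simp: unit_cube_0\<close>)
  moreover have "continuous_map (top_of_set (unit_cube n)) X (\<lambda>u. x)" using x by simp
  ultimately show ?thesis using that[of "\<lambda>u. x"] True by (simp add: unit_cube_0)
next
  case False
  then have n: "1 \<le> n" by simp
  obtain A where A: "continuous_map (top_of_set (unit_cube n)) X A"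
    "\<And>u. u \<in> unit_cube_boundary n \<Longrightarrow> A u = a u"
    using extends_along_weak_equivalence[OF w a b ab n] by blast
  obtain a' where "continuous_map (top_of_set (unit_cube n)) X a'"
    "\<And>u. u \<in> unit_cube_boundary n \<Longrightarrow> a' u = A u"
    "homotopic_with (\<lambda>k. \<forall>u \<in> unit_cube_boundary n. k u = b u) (top_of_set (unit_cube n)) Y b (f \<circ> a')"
    using compression_correct[OF w n A(1) b] A(2) ab by auto
  with that A(2) show ?thesis by simp
qed

text \<open>Here the boundary commutes only up to the homotopy \<open>h\<close>. A collar absorbs
  \<open>h\<close> to reach the strictly commuting case, and a second collar restores the time scale
  so that the result restricts to \<open>h\<close> itself, which compatibility between neighbouring
  simplices demands.\<close>

lemma compression_homotopy:
  assumes w: "weak_homotopy_equivalence X Y f"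
    and a: "continuous_map (top_of_set (unit_cube_boundary n)) X a"
    and b: "continuous_map (top_of_set (unit_cube n)) Y b"
    and h: "continuous_map (top_of_set ({0..1::real} \<times> unit_cube_boundary n)) Y h"
    and h0: "\<And>u. u \<in> unit_cube_boundary n \<Longrightarrow> h (0, u) = b u"
    and h1: "\<And>u. u \<in> unit_cube_boundary n \<Longrightarrow> h (1, u) = f (a u)"
  obtains a' h' where "continuous_map (top_of_set (unit_cube n)) X a'"
    "\<And>u. u \<in> unit_cube_boundary n \<Longrightarrow> a' u = a u"
    "continuous_map (top_of_set ({0..1::real} \<times> unit_cube n)) Y h'"
    "\<And>u. u \<in> unit_cube n \<Longrightarrow> h' (0, u) = b u"
    "\<And>u. u \<in> unit_cube n \<Longrightarrow> h' (1, u) = f (a' u)"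
    "\<And>s u. s \<in> {0..1} \<Longrightarrow> u \<in> unit_cube_boundary n \<Longrightarrow> h' (s, u) = h (s, u)"
proof -
  let ?I = "unit_cube n" and ?N = "cube_norm n" and ?sc = "cube_scale n"
  let ?B = "unit_cube_boundary n"
  have N0: "0 \<le> ?N u" for u by (rule cube_norm_nonneg)
  have NI: "?N u \<le> 1" if "u \<in> ?I" for u using that by (simp add: unit_cube_iff)
  have NB: "?N u = 1" "?sc 1 u = u" if "u \<in> ?B" for u
    using that subsetD[OF unit_cube_boundary_subset that] cube_scale_1[of u n]
    by (simp_all add: unit_cube_boundary_iff)
  \<comment> \<open>A collar of width \<open>fst p / 2\<close> in norm grows at the boundary and
    shows \<open>h\<close> up to the present time, so at time 1 the boundary value is
    \<open>f \<circ> a\<close>.\<close>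
  define B1 where "B1 = (\<lambda>p::real\<times>(nat\<Rightarrow>real). if ?N (snd p) \<le> 1 - fst p / 2 then b (?sc (1 / (1 - fst p / 2)) (snd p))
      else h (min 1 (2 * (?N (snd p) - (1 - fst p / 2))), ?sc (1 / ?N (snd p)) (snd p)))"
  have B1c: "continuous_map (top_of_set ({0..1} \<times> ?I)) Y B1"
    unfolding B1_def
  proof (rule continuous_map_if_le)
    show "continuous_map (top_of_set {p \<in> {0..1} \<times> ?I. ?N (snd p) \<le> 1 - fst p / 2}) Y (\<lambda>p. b (?sc (1 / (1 - fst p / 2)) (snd p)))"
      by (rule continuous_map_compose_on[OF b]) (auto intro!: continuous_intros cube_scale_in_cube simp: field_simps)
    show "continuous_map (top_of_set {p \<in> {0..1} \<times> ?I. 1 - fst p / 2 \<le> ?N (snd p)}) Y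
       (\<lambda>p. h (min 1 (2 * (?N (snd p) - (1 - fst p / 2))), ?sc (1 / ?N (snd p)) (snd p)))"
    proof (rule continuous_map_compose_on[OF h])
      fix p assume "p \<in> {p \<in> {0..1} \<times> ?I. 1 - fst p / 2 \<le> ?N (snd p)}"
      moreover from this have "?N (snd p) > 0" by auto
      ultimately show "(min 1 (2 * (?N (snd p) - (1 - fst p / 2))), ?sc (1 / ?N (snd p)) (snd p)) \<in> {0..1} \<times> ?B"
        by (auto simp: cube_scale_norm_in_boundary)
    qed (auto intro!: continuous_intros)
    fix p assume p: "p \<in> {0..1} \<times> ?I" "?N (snd p) = 1 - fst p / 2"
    then have "?N (snd p) > 0" by auto
    then show "b (?sc (1 / (1 - fst p / 2)) (snd p)) = h (min 1 (2 * (?N (snd p) - (1 - fst p / 2))), ?sc (1 / ?N (snd p)) (snd p))"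
      using p(2) h0[OF cube_scale_norm_in_boundary, of "snd p"] by simp
  qed (auto intro!: continuous_intros)
  have B1_0: "B1 (0, u) = b u" if "u \<in> ?I" for u
    using that by (simp add: B1_def NI cube_scale_1)
  have B1_B: "B1 (s, u) = h (s, u)" if "s \<in> {0..1}" "u \<in> ?B" for s u
    using that NB[of u] h0[of u] by (cases "s = 0") (auto simp: B1_def)
  have "continuous_map (top_of_set ?I) Y (\<lambda>u. B1 (1, u))"
    by (rule continuous_map_compose_on[OF B1c]) (auto intro!: continuous_intros)
  moreover have "B1 (1, u) = f (a u)" if "u \<in> ?B" for u
    using B1_B[of 1 u] h1[of u] that by simp
  ultimately obtain a1 where a1: "continuous_map (top_of_set ?I) X a1" "\<And>u. u \<in> ?B \<Longrightarrow> a1 u = a u"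
    "homotopic_with (\<lambda>k. \<forall>u \<in> ?B. k u = B1 (1, u)) (top_of_set ?I) Y (\<lambda>u. B1 (1, u)) (f \<circ> a1)"
    using compression[OF w a, of "\<lambda>u. B1 (1, u)"] by blast
  obtain k where k: "continuous_map (top_of_set ({0..1::real} \<times> ?I)) Y k"
    "\<And>u. k (0, u) = B1 (1, u)" "\<And>u. k (1, u) = f (a1 u)"
    "\<And>s u. s \<in> {0..1} \<Longrightarrow> u \<in> ?B \<Longrightarrow> k (s, u) = B1 (1, u)"
    using homotopic_with_relE[OF a1(3)] unfolding o_def by metis
  define G where "G = (\<lambda>p. if fst p \<le> 1/2 then B1 (2 * fst p, snd p) else k (2 * fst p - 1, snd p))"
  have Gc: "continuous_map (top_of_set ({0..1} \<times> ?I)) Y G"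
    unfolding G_def
  proof (rule continuous_map_if_le)
    show "continuous_map (top_of_set {x \<in> {0..1} \<times> ?I. fst x \<le> 1/2}) Y (\<lambda>p. B1 (2 * fst p, snd p))"
      by (rule continuous_map_compose_on[OF B1c]) (auto intro!: continuous_intros)
    show "continuous_map (top_of_set {x \<in> {0..1} \<times> ?I. 1/2 \<le> fst x}) Y (\<lambda>p. k (2 * fst p - 1, snd p))"
      by (rule continuous_map_compose_on[OF k(1)]) (auto intro!: continuous_intros)
    fix p :: "real \<times> (nat \<Rightarrow> real)" assume p: "fst p = 1/2"
    show "B1 (2 * fst p, snd p) = k (2 * fst p - 1, snd p)"
      unfolding p by (simp add: k)
  qed (auto intro!: continuous_intros)
  \<comment> \<open>The concatenation runs through \<open>h\<close> at double speed on the boundary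
    and then rests.\<close>
  have G_B: "G (s, u) = h (min 1 (2 * s), u)" if "s \<in> {0..1}" "u \<in> ?B" for s u
    using that B1_B[of "2 * s" u] B1_B[of 1 u] k(4)[of "2 * s - 1" u] by (cases "s \<le> 1/2") (auto simp: G_def min.absorb1 min.absorb2)
  have G0: "G (0, u) = b u" if "u \<in> ?I" for u
    using that by (simp add: G_def B1_0)
  have G1: "G (1, u) = f (a1 u)" for u
    by (simp add: G_def k)
  \<comment> \<open>At time \<open>s\<close> the second collar interpolates between the time
    \<open>min 1 (2 * s)\<close> at its inner rim, matching \<open>G\<close>, and \<open>s\<close>
    at the boundary. At \<open>s = 1\<close> it is \<open>f \<circ> a\<close> along every ray, hence
    the radial outer part of \<open>a'\<close>.\<close>
  define h' where "h' = (\<lambda>p::real\<times>(nat\<Rightarrow>real). if ?N (snd p) \<le> 1 - fst p / 2 then G (fst p, ?sc (1 / (1 - fst p / 2)) (snd p))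
      else h (min 1 (fst p + 2 * (1 - ?N (snd p))), ?sc (1 / ?N (snd p)) (snd p)))"
  have h'c: "continuous_map (top_of_set ({0..1} \<times> ?I)) Y h'"
    unfolding h'_def
  proof (rule continuous_map_if_le)
    show "continuous_map (top_of_set {p \<in> {0..1} \<times> ?I. ?N (snd p) \<le> 1 - fst p / 2}) Y (\<lambda>p. G (fst p, ?sc (1 / (1 - fst p / 2)) (snd p)))"
      by (rule continuous_map_compose_on[OF Gc]) (auto intro!: continuous_intros cube_scale_in_cube simp: field_simps)
    show "continuous_map (top_of_set {p \<in> {0..1} \<times> ?I. 1 - fst p / 2 \<le> ?N (snd p)}) Y
       (\<lambda>p. h (min 1 (fst p + 2 * (1 - ?N (snd p))), ?sc (1 / ?N (snd p)) (snd p)))"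
    proof (rule continuous_map_compose_on[OF h])
      fix p assume p: "p \<in> {p \<in> {0..1} \<times> ?I. 1 - fst p / 2 \<le> ?N (snd p)}"
      moreover from this have "?N (snd p) > 0" "?N (snd p) \<le> 1" using NI by auto
      ultimately show "(min 1 (fst p + 2 * (1 - ?N (snd p))), ?sc (1 / ?N (snd p)) (snd p)) \<in> {0..1} \<times> ?B"
        by (auto simp: cube_scale_norm_in_boundary)
    qed (auto intro!: continuous_intros)
    fix p assume p: "p \<in> {0..1} \<times> ?I" "?N (snd p) = 1 - fst p / 2"
    then have "?N (snd p) > 0" by auto
    then show "G (fst p, ?sc (1 / (1 - fst p / 2)) (snd p)) = h (min 1 (fst p + 2 * (1 - ?N (snd p))), ?sc (1 / ?N (snd p)) (snd p))"
      using p G_B[OF _ cube_scale_norm_in_boundary, of "fst p" "snd p"] by auto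
  qed (auto intro!: continuous_intros)
  define a' where "a' = (\<lambda>u. if ?N u \<le> 1/2 then a1 (?sc 2 u) else a (?sc (1 / ?N u) u))"
  have a'c: "continuous_map (top_of_set ?I) X a'"
    unfolding a'_def
  proof (rule continuous_map_if_le)
    show "continuous_map (top_of_set {x \<in> ?I. ?N x \<le> 1/2}) X (\<lambda>u. a1 (?sc 2 u))"
      by (rule continuous_map_compose_on[OF a1(1)]) (auto intro!: continuous_intros cube_scale_in_cube)
    show "continuous_map (top_of_set {x \<in> ?I. 1/2 \<le> ?N x}) X (\<lambda>u. a (?sc (1 / ?N u) u))"
      by (rule continuous_map_compose_on[OF a])
        (auto intro!: continuous_intros cube_scale_in_boundary)
    fix u assume "u \<in> ?I" and N: "?N u = 1/2"
    show "a1 (?sc 2 u) = a (?sc (1 / ?N u) u)"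
      unfolding N by (simp add: cube_scale_in_boundary N a1(2))
  qed (auto intro!: continuous_intros)
  have "h' (1, u) = f (a' u)" if "u \<in> ?I" for u
    using h1[OF cube_scale_norm_in_boundary, of u] by (auto simp: h'_def a'_def G1 min_def NI[OF that])
  moreover have "h' (s, u) = h (s, u)" if s: "s \<in> {0..1}" and u: "u \<in> ?B" for s u
  proof (cases "s = 0")
    case True
    then show ?thesis using u NB[of u] h0[of u] G_B[of 0 u] by (simp add: h'_def)
  next
    case False
    then show ?thesis using s NB[OF u] by (auto simp: h'_def)
  qed
  moreover have "h' (0, u) = b u" if "u \<in> ?I" for u
    using that by (simp add: h'_def NI cube_scale_1 G0)
  moreover have "a' u = a u" if "u \<in> ?B" for u
    using NB[OF that] by (simp add: a'_def)
  ultimately show ?thesis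
    by (intro that[OF a'c _ h'c])
qed

section \<open>Pairs homeomorphic to a cube and its boundary\<close>

text \<open>A continuous bijection is enough for a homeomorphism here, as \<open>Z\<close> is
  compact and the cube is Hausdorff.\<close>

definition cube_pair :: "nat \<Rightarrow> 'c::topological_space set \<Rightarrow> 'c set \<Rightarrow> bool" where
  "cube_pair n Z B \<longleftrightarrow> compact Z \<and> B \<subseteq> Z \<and>
     (\<exists>e. continuous_on Z e \<and> bij_betw e Z (unit_cube n) \<and> e ` B = unit_cube_boundary n)"

lemma compression_pair:
  fixes Z :: "'c::topological_space set"
  assumes w: "weak_homotopy_equivalence X Y f" and pair: "cube_pair n Z B"
    and a: "continuous_map (top_of_set B) X a"
    and b: "continuous_map (top_of_set Z) Y b"
    and h: "continuous_map (top_of_set ({0..1::real} \<times> B)) Y h"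
    and h0: "\<And>u. u \<in> B \<Longrightarrow> h (0, u) = b u"
    and h1: "\<And>u. u \<in> B \<Longrightarrow> h (1, u) = f (a u)"
  obtains a' h' where "continuous_map (top_of_set Z) X a'"
    "\<And>u. u \<in> B \<Longrightarrow> a' u = a u"
    "continuous_map (top_of_set ({0..1::real} \<times> Z)) Y h'"
    "\<And>u. u \<in> Z \<Longrightarrow> h' (0, u) = b u"
    "\<And>u. u \<in> Z \<Longrightarrow> h' (1, u) = f (a' u)"
    "\<And>s u. s \<in> {0..1} \<Longrightarrow> u \<in> B \<Longrightarrow> h' (s, u) = h (s, u)"
proof -
  obtain e where e: "continuous_on Z e" "bij_betw e Z (unit_cube n)" "e ` B = unit_cube_boundary n"
    and Z: "compact Z" "B \<subseteq> Z"
    using pair by (auto simp: cube_pair_def)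
  define g where "g = the_inv_into Z e"
  have ge: "g (e z) = z" if "z \<in> Z" for z
    using that e(2) by (simp add: g_def bij_betw_def the_inv_into_f_f)
  have eZ: "e ` Z = unit_cube n" using e(2) by (simp add: bij_betw_def)
  have gc: "continuous_on (unit_cube n) g"
    using continuous_on_inv[OF e(1) Z(1)] ge eZ by auto
  have gZ: "g u \<in> Z" if "u \<in> unit_cube n" for u
    using that eZ ge by (metis imageE)
  have gB: "g u \<in> B" if "u \<in> unit_cube_boundary n" for u
    using that e(3) ge Z(2) by (metis imageE subsetD)
  have gcB: "continuous_on (unit_cube_boundary n) g"
    using continuous_on_subset[OF gc unit_cube_boundary_subset] .
  obtain a' h' where ah: "continuous_map (top_of_set (unit_cube n)) X a'"
    "\<And>u. u \<in> unit_cube_boundary n \<Longrightarrow> a' u = a (g u)"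
    "continuous_map (top_of_set ({0..1::real} \<times> unit_cube n)) Y h'"
    "\<And>u. u \<in> unit_cube n \<Longrightarrow> h' (0, u) = b (g u)"
    "\<And>u. u \<in> unit_cube n \<Longrightarrow> h' (1, u) = f (a' u)"
    "\<And>s u. s \<in> {0..1} \<Longrightarrow> u \<in> unit_cube_boundary n \<Longrightarrow> h' (s, u) = h (s, g u)"
  proof (rule compression_homotopy[OF w, of n "\<lambda>u. a (g u)" "\<lambda>u. b (g u)" "\<lambda>p. h (fst p, g (snd p))"])
    show "continuous_map (top_of_set (unit_cube_boundary n)) X (\<lambda>u. a (g u))"
      by (rule continuous_map_compose_on[OF a gcB gB])
    show "continuous_map (top_of_set (unit_cube n)) Y (\<lambda>u. b (g u))"
      by (rule continuous_map_compose_on[OF b gc gZ])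
    show "continuous_map (top_of_set ({0..1} \<times> unit_cube_boundary n)) Y (\<lambda>p. h (fst p, g (snd p)))"
      by (rule continuous_map_compose_on[OF h])
        (auto intro!: continuous_on_Pair continuous_on_fst continuous_on_id continuous_on_compose2[OF gcB] continuous_on_snd gB)
  qed (use h0 h1 gB in auto)
  have eB: "e u \<in> unit_cube_boundary n" if "u \<in> B" for u using that e(3) by blast
  have eZ': "e u \<in> unit_cube n" if "u \<in> Z" for u using that eZ by blast
  show ?thesis
  proof (rule that[of "\<lambda>u. a' (e u)" "\<lambda>p. h' (fst p, e (snd p))"])
    show "continuous_map (top_of_set Z) X (\<lambda>u. a' (e u))"
      by (rule continuous_map_compose_on[OF ah(1) e(1) eZ'])
    show "continuous_map (top_of_set ({0..1} \<times> Z)) Y (\<lambda>p. h' (fst p, e (snd p)))"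
      by (rule continuous_map_compose_on[OF ah(3)])
        (auto intro!: continuous_on_Pair continuous_on_fst continuous_on_id continuous_on_compose2[OF e(1)] continuous_on_snd eZ')
  qed (use ah ge Z(2) eB eZ' in auto)
qed

section \<open>From cubes to simplices: lifts and deformations compatible with faces\<close>

section \<open>Simplices as cubes\<close>

abbreviation simplex_boundary :: "nat \<Rightarrow> (nat \<Rightarrow> real) set" where
  "simplex_boundary p \<equiv> {x \<in> standard_simplex p. \<exists>i\<le>p. x i = 0}"

primrec coord_max :: "nat \<Rightarrow> (nat \<Rightarrow> real) \<Rightarrow> real" where
  "coord_max 0 z = 0"
| "coord_max (Suc n) z = max (coord_max n z) (z n)"

lemma coord_max_nonneg: "0 \<le> coord_max n z"
  by (induction n) auto

lemma coord_max_ge: "i < n \<Longrightarrow> z i \<le> coord_max n z"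
proof (induction n)
  case (Suc n)
  then show ?case by (cases "i = n") (simp_all add: le_max_iff_disj)
qed simp

lemma coord_max_cong: "(\<And>i. i < n \<Longrightarrow> y i = z i) \<Longrightarrow> coord_max n y = coord_max n z"
  by (induction n) auto

lemma coord_max_scale: "0 \<le> r \<Longrightarrow> coord_max n (\<lambda>i. z i * r) = coord_max n z * r"
  by (induction n) (auto simp: max_mult_distrib_right)

lemma coord_max_attained: "coord_max n z = 0 \<or> (\<exists>i<n. coord_max n z = z i)"
  by (induction n) (auto simp: max_def less_Suc_eq)

lemma coord_max_le_iff: "0 \<le> r \<Longrightarrow> coord_max n z \<le> r \<longleftrightarrow> (\<forall>i<n. z i \<le> r)"
  by (induction n) (auto simp: less_Suc_eq)

lemma continuous_on_coord_max:
  fixes u :: "'c::topological_space \<Rightarrow> nat \<Rightarrow> real"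
  assumes "continuous_on S u" shows "continuous_on S (\<lambda>x. coord_max n (u x))"
  by (induction n) (auto intro!: continuous_intros continuous_on_coordinate[OF assms])

text \<open>At a zero of \<open>d\<close> the quotient is 0 by convention, and \<open>c\<close>,
  which vanishes there, forces this limit. It serves for the vertex of the simplex at which the
  radial formula degenerates.\<close>

lemma continuous_on_quotient_squeeze:
  fixes g d c :: "'c::topological_space \<Rightarrow> real"
  assumes g: "continuous_on S g" and d: "continuous_on S d" and c: "continuous_on S c"
    and le: "\<And>x. x \<in> S \<Longrightarrow> \<bar>g x / d x\<bar> \<le> c x" and z: "\<And>x. x \<in> S \<Longrightarrow> d x = 0 \<Longrightarrow> c x = 0"
  shows "continuous_on S (\<lambda>x. g x / d x)"
  unfolding continuous_on_def
proof
  fix x assume x: "x \<in> S"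
  have lim: "(g \<longlongrightarrow> g x) (at x within S)" "(d \<longlongrightarrow> d x) (at x within S)" "(c \<longlongrightarrow> c x) (at x within S)"
    using g d c x by (auto simp: continuous_on_def)
  show "((\<lambda>x. g x / d x) \<longlongrightarrow> g x / d x) (at x within S)"
  proof (cases "d x = 0")
    case False then show ?thesis using lim by (intro tendsto_divide)
  next
    case True
    have "((\<lambda>x. g x / d x) \<longlongrightarrow> 0) (at x within S)"
    proof (rule Lim_null_comparison)
      show "\<forall>\<^sub>F x in at x within S. norm (g x / d x) \<le> c x"
        using le by (auto simp: eventually_at_filter)
      show "(c \<longlongrightarrow> 0) (at x within S)" using lim(3) z[OF x True] by simp
    qed
    then show ?thesis using True by simp
  qed
qed

text \<open>The last \<open>p\<close> coordinates identify the simplex with the points of the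
  positive orthant of sum at most 1. Each ray from the origin is rescaled so that the sum
  \<open>1 - x 0\<close> becomes the maximum, which stretches this corner onto the cube. At the
  origin the division by 0 gives the correct value 0.\<close>

definition simplex_to_cube :: "nat \<Rightarrow> (nat \<Rightarrow> real) \<Rightarrow> nat \<Rightarrow> real" where
  "simplex_to_cube p x = (\<lambda>i. if i < p then x (Suc i) * (1 - x 0) / coord_max p (\<lambda>i. x (Suc i)) else 0)"

lemma simplex_tail_sum:
  assumes "x \<in> standard_simplex p" shows "(\<Sum>i<p. x (Suc i)) = 1 - x 0"
proof -
  have "(\<Sum>i<Suc p. x i) = 1" using assms by (simp add: standard_simplex_def lessThan_Suc_atMost)
  then show ?thesis unfolding sum.lessThan_Suc_shift by simp
qed

lemma simplex_coord: "x \<in> standard_simplex p \<Longrightarrow> 0 \<le> x i" "x \<in> standard_simplex p \<Longrightarrow> x i \<le> 1"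
  "x \<in> standard_simplex p \<Longrightarrow> i > p \<Longrightarrow> x i = 0"
  by (auto simp: standard_simplex_def)

lemma simplex_tail_max_0:
  assumes x: "x \<in> standard_simplex p" and "coord_max p (\<lambda>i. x (Suc i)) = 0" shows "x 0 = 1"
proof -
  have "x (Suc i) = 0" if "i < p" for i
    using coord_max_ge[OF that, of "\<lambda>i. x (Suc i)"] simplex_coord(1)[OF x, of "Suc i"] assms(2) by simp
  then show ?thesis using simplex_tail_sum[OF x] by simp
qed

lemma coord_max_simplex_to_cube:
  assumes x: "x \<in> standard_simplex p" shows "coord_max p (simplex_to_cube p x) = 1 - x 0"
proof -
  let ?M = "coord_max p (\<lambda>i. x (Suc i))"
  have "coord_max p (simplex_to_cube p x) = coord_max p (\<lambda>i. x (Suc i) * ((1 - x 0) / ?M))"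
    by (rule coord_max_cong) (simp add: simplex_to_cube_def)
  also have "\<dots> = ?M * ((1 - x 0) / ?M)"
    by (rule coord_max_scale) (use simplex_coord(2)[OF x, of 0] coord_max_nonneg[of p "\<lambda>i. x (Suc i)"] in simp)
  finally show ?thesis using simplex_tail_max_0[OF x] by (cases "?M = 0") auto
qed

lemma simplex_to_cube_nonneg: "x \<in> standard_simplex p \<Longrightarrow> 0 \<le> simplex_to_cube p x i"
  using simplex_coord[of x p] coord_max_nonneg by (auto simp: simplex_to_cube_def)

lemma simplex_to_cube_in_cube: "x \<in> standard_simplex p \<Longrightarrow> simplex_to_cube p x \<in> unit_cube p"
proof -
  assume x: "x \<in> standard_simplex p"
  have "simplex_to_cube p x i \<le> 1" if "i < p" for i
    using coord_max_ge[OF that, of "simplex_to_cube p x"] coord_max_simplex_to_cube[OF x] simplex_coord(1)[OF x, of 0] by simp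
  with simplex_to_cube_nonneg[OF x] show ?thesis
    by (auto simp: unit_cube_def) (simp add: simplex_to_cube_def)
qed

lemma continuous_on_simplex_to_cube: "continuous_on (standard_simplex p) (simplex_to_cube p)"
proof (rule continuous_on_coordinatewise_then_product)
  fix i
  let ?M = "\<lambda>x. coord_max p (\<lambda>i. x (Suc i))"
  have tail: "continuous_on (standard_simplex p) (\<lambda>x i. x (Suc i))"
    by (rule continuous_on_coordinatewise_then_product) (rule continuous_on_coordinate[OF continuous_on_id])
  show "continuous_on (standard_simplex p) (\<lambda>x. simplex_to_cube p x i)"
  proof (cases "i < p")
    case True
    have "continuous_on (standard_simplex p) (\<lambda>x. (x (Suc i) * (1 - x 0)) / ?M x)"
    proof (rule continuous_on_quotient_squeeze[where c = "\<lambda>x. 1 - x 0"])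
      fix x assume x: "x \<in> standard_simplex p"
      have "simplex_to_cube p x i \<le> 1 - x 0"
        using coord_max_ge[OF True, of "simplex_to_cube p x"] coord_max_simplex_to_cube[OF x] by simp
      then show "\<bar>x (Suc i) * (1 - x 0) / ?M x\<bar> \<le> 1 - x 0"
        using simplex_to_cube_nonneg[OF x, of i] True by (simp add: simplex_to_cube_def)
      show "1 - x 0 = 0" if "?M x = 0" using simplex_tail_max_0[OF x that] by simp
    qed (intro continuous_on_mult continuous_on_diff continuous_on_const
        continuous_on_coordinate[OF continuous_on_id] continuous_on_coord_max[OF tail])+
    then show ?thesis using True by (simp add: simplex_to_cube_def)
  qed (simp add: simplex_to_cube_def)
qed

text \<open>The maximum of the image recovers \<open>x 0\<close>; the tails are then proportional
  with equal sums, so the factor \<open>r\<close> is 1.\<close>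

lemma inj_on_simplex_to_cube: "inj_on (simplex_to_cube p) (standard_simplex p)"
proof (rule inj_onI)
  fix x y assume x: "x \<in> standard_simplex p" and y: "y \<in> standard_simplex p"
    and eq: "simplex_to_cube p x = simplex_to_cube p y"
  let ?M = "\<lambda>x. coord_max p (\<lambda>i. x (Suc i))"
  have 0: "x 0 = y 0" using coord_max_simplex_to_cube[OF x] coord_max_simplex_to_cube[OF y] eq by simp
  have tail: "x (Suc i) = y (Suc i)" if i: "i < p" for i
  proof (cases "x 0 = 1")
    case True
    have "z (Suc i) = 0" if z: "z \<in> standard_simplex p" "z 0 = 1" for z
    proof -
      have "(\<Sum>i<p. z (Suc i)) = 0" using simplex_tail_sum[OF z(1)] z(2) by simp
      then show ?thesis using sum_nonneg_eq_0_iff[of "{..<p}" "\<lambda>i. z (Suc i)"] simplex_coord(1)[OF z(1)] i by auto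
    qed
    from this[OF x True] this[OF y] show ?thesis using 0 True by simp
  next
    case False
    then have M: "?M x \<noteq> 0" "?M y \<noteq> 0" using simplex_tail_max_0[OF x] simplex_tail_max_0[OF y] 0 by metis+
    define r where "r = ?M x / ?M y"
    have *: "x (Suc j) = y (Suc j) * r" if "j < p" for j
    proof -
      have "(x (Suc j) / ?M x) * (1 - y 0) = (y (Suc j) / ?M y) * (1 - y 0)"
        using fun_cong[OF eq, of j] that 0 by (simp add: simplex_to_cube_def)
      then have "x (Suc j) / ?M x = y (Suc j) / ?M y"
        by (subst (asm) mult_right_cancel) (use False 0 in auto)
      then show ?thesis using M by (simp add: r_def field_simps)
    qed
    have "(\<Sum>j<p. x (Suc j)) = (\<Sum>j<p. y (Suc j)) * r"
      by (simp add: * sum_distrib_right)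
    then have "r = 1"
      using simplex_tail_sum[OF x] simplex_tail_sum[OF y] 0 False by simp
    then show ?thesis using *[OF i] by simp
  qed
  show "x = y"
  proof
    fix i show "x i = y i"
    proof (cases i)
      case (Suc j)
      then show ?thesis
        using tail[of j] simplex_coord(3)[OF x, of i] simplex_coord(3)[OF y, of i] by (cases "j < p") auto
    qed (use 0 in simp)
  qed
qed

lemma simplex_to_cube_surj:
  assumes z: "z \<in> unit_cube p"
  obtains x where "x \<in> standard_simplex p" "simplex_to_cube p x = z"
proof -
  let ?m = "coord_max p z" let ?s = "\<Sum>i<p. z i"
  \<comment> \<open>The inverse rescaling: the tail is multiplied by maximum over sum, so that its
    sum becomes \<open>?m\<close>. For \<open>z = 0\<close> the quotient is 0 by convention.\<close>
  define x where "x = (\<lambda>i. case i of 0 \<Rightarrow> 1 - ?m | Suc j \<Rightarrow> if j < p then z j * (?m / ?s) else 0)"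
  have z01: "0 \<le> z i" "z i \<le> 1" for i using z by (cases "i < p"; auto simp: unit_cube_def)+
  have m: "0 \<le> ?m" "?m \<le> 1" using coord_max_nonneg z01 by (auto simp: coord_max_le_iff)
  have ms: "?m \<le> ?s"
    using coord_max_attained[of p z]
  proof
    assume "\<exists>i<p. ?m = z i"
    then obtain i where "i < p" "?m = z i" by blast
    then show ?thesis using member_le_sum[of i "{..<p}" z] z01 by simp
  qed (simp add: sum_nonneg z01)
  have s0: "z i = 0" if "?s = 0" "i < p" for i
    using that sum_nonneg_eq_0_iff[of "{..<p}" z] z01 by auto
  have tail: "(\<Sum>i<p. x (Suc i)) = ?m"
  proof -
    have "(\<Sum>i<p. x (Suc i)) = ?s * (?m / ?s)" by (simp add: x_def sum_distrib_right flip: sum_divide_distrib)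
    then show ?thesis using ms m by (cases "?s = 0") auto
  qed
  have x0: "0 \<le> x i" for i using m z01 sum_nonneg[of "{..<p}" z] by (auto simp: x_def split: nat.split)
  have sum1: "(\<Sum>i\<le>p. x i) = 1"
    using tail by (simp only: lessThan_Suc_atMost[symmetric] sum.lessThan_Suc_shift) (simp add: x_def)
  have xp: "x i = 0" if "i > p" for i using that by (auto simp: x_def split: nat.split)
  have "x i \<le> 1" for i
    using member_le_sum[of i "{..p}" x] x0 sum1 xp by (cases "i \<le> p") auto
  then have xin: "x \<in> standard_simplex p"
    using x0 sum1 xp by (auto simp: standard_simplex_def)
  have "coord_max p (\<lambda>i. x (Suc i)) = coord_max p (\<lambda>i. z i * (?m / ?s))"
    by (rule coord_max_cong) (simp add: x_def)
  then have M: "coord_max p (\<lambda>i. x (Suc i)) = ?m * (?m / ?s)"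
    using m ms by (simp add: coord_max_scale del: times_divide_eq_right)
  have "simplex_to_cube p x i = z i" for i
  proof (cases "i < p")
    case True
    show ?thesis
    proof (cases "?m = 0")
      case True
      then show ?thesis using coord_max_ge[OF \<open>i < p\<close>, of z] z01[of i] \<open>i < p\<close> by (simp add: simplex_to_cube_def x_def M)
    next
      case False
      then have "?s \<noteq> 0" using ms m by auto
      then show ?thesis using False True unfolding simplex_to_cube_def M by (simp add: x_def)
    qed
  next
    case False
    then show ?thesis using z by (simp add: simplex_to_cube_def unit_cube_def)
  qed
  with that xin show ?thesis by blast
qed

text \<open>The face \<open>x 0 = 0\<close> corresponds to the cube faces with a coordinate 1, and
  the face where \<open>x (Suc i)\<close> vanishes to the cube face where coordinate
  \<open>i\<close> is 0. The vertex \<open>x 0 = 1\<close> goes to the origin and is treated apart,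
  since the formula divides by 0 there.\<close>

lemma simplex_to_cube_boundary_iff:
  assumes x: "x \<in> standard_simplex p"
  shows "simplex_to_cube p x \<in> unit_cube_boundary p \<longleftrightarrow> (\<exists>i\<le>p. x i = 0)"
proof (cases "p = 0")
  case True
  then show ?thesis using x by (auto simp: unit_cube_0 standard_simplex_0)
next
  case False
  let ?M = "coord_max p (\<lambda>i. x (Suc i))" let ?e = "simplex_to_cube p x"
  have bd: "?e \<in> unit_cube_boundary p \<longleftrightarrow> (\<exists>i<p. ?e i = 0 \<or> ?e i = 1)"
    using simplex_to_cube_in_cube[OF x] by (simp add: unit_cube_boundary_def)
  show ?thesis
  proof (cases "x 0 = 1")
    case True
    have "(\<Sum>i<p. x (Suc i)) = 0" using simplex_tail_sum[OF x] True by simp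
    then have "x (Suc 0) = 0"
      using sum_nonneg_eq_0_iff[of "{..<p}" "\<lambda>i. x (Suc i)"] simplex_coord(1)[OF x] False by auto
    moreover have "?e 0 = 0" using True by (simp add: simplex_to_cube_def)
    ultimately have "\<exists>i<p. ?e i = 0 \<or> ?e i = 1" "\<exists>i\<le>p. x i = 0" using False by (auto intro: exI[of _ 0] exI[of _ "Suc 0"])
    then show ?thesis unfolding bd by simp
  next
    case x0: False
    have M: "?M \<noteq> 0" using simplex_tail_max_0[OF x] x0 by auto
    have e0: "?e i = 0 \<longleftrightarrow> x (Suc i) = 0" if "i < p" for i
      using that M x0 by (simp add: simplex_to_cube_def)
    have e1: "(\<exists>i<p. ?e i = 1) \<longleftrightarrow> x 0 = 0"
    proof
      assume "\<exists>i<p. ?e i = 1"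
      then obtain i where i: "i < p" "?e i = 1" by blast
      then have "1 \<le> 1 - x 0"
        using coord_max_ge[OF i(1), of ?e] coord_max_simplex_to_cube[OF x] by simp
      then show "x 0 = 0" using simplex_coord(1)[OF x, of 0] by simp
    next
      assume "x 0 = 0"
      then have "coord_max p ?e = 1" using coord_max_simplex_to_cube[OF x] by simp
      then show "\<exists>i<p. ?e i = 1" using coord_max_attained[of p ?e] by auto
    qed
    have "(\<exists>i\<le>p. x i = 0) \<longleftrightarrow> x 0 = 0 \<or> (\<exists>i<p. x (Suc i) = 0)"
    proof
      assume "\<exists>i\<le>p. x i = 0"
      then obtain i where "i \<le> p" "x i = 0" by blast
      then show "x 0 = 0 \<or> (\<exists>i<p. x (Suc i) = 0)" by (cases i) auto
    next
      assume "x 0 = 0 \<or> (\<exists>i<p. x (Suc i) = 0)"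
      then show "\<exists>i\<le>p. x i = 0" using Suc_leI by blast
    qed
    moreover have "(\<exists>i<p. ?e i = 0) \<longleftrightarrow> (\<exists>i<p. x (Suc i) = 0)" using e0 by auto
    ultimately show ?thesis unfolding bd using e1 by (simp only: ex_disj_distrib conj_disj_distribL disj_commute)
  qed
qed

lemma compact_standard_simplex: "compact (standard_simplex p)"
  using compactin_standard_simplex[of p] by (simp add: euclidean_product_topology)

lemma cube_pair_simplex: "cube_pair p (standard_simplex p) (simplex_boundary p)"
  unfolding cube_pair_def
proof (intro conjI exI[of _ "simplex_to_cube p"])
  have img: "simplex_to_cube p ` standard_simplex p = unit_cube p"
  proof (intro equalityI subsetI)
    fix u assume "u \<in> unit_cube p"
    then obtain x where "x \<in> standard_simplex p" "simplex_to_cube p x = u" using simplex_to_cube_surj by blast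
    then show "u \<in> simplex_to_cube p ` standard_simplex p" by blast
  qed (use simplex_to_cube_in_cube in blast)
  then show "bij_betw (simplex_to_cube p) (standard_simplex p) (unit_cube p)"
    by (simp add: bij_betw_def inj_on_simplex_to_cube)
  show "simplex_to_cube p ` simplex_boundary p = unit_cube_boundary p"
  proof (intro equalityI subsetI)
    fix u assume u: "u \<in> unit_cube_boundary p"
    then have "u \<in> unit_cube p" using unit_cube_boundary_subset by blast
    then obtain x where x: "x \<in> standard_simplex p" "simplex_to_cube p x = u" using simplex_to_cube_surj by blast
    then have "x \<in> simplex_boundary p" using u simplex_to_cube_boundary_iff[OF x(1)] by simp
    then show "u \<in> simplex_to_cube p ` simplex_boundary p" using x(2) by blast
  next
    fix u assume "u \<in> simplex_to_cube p ` simplex_boundary p"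
    then obtain x where x: "x \<in> standard_simplex p" "\<exists>i\<le>p. x i = 0" "u = simplex_to_cube p x" by blast
    then show "u \<in> unit_cube_boundary p" using simplex_to_cube_boundary_iff[OF x(1)] by simp
  qed
qed (auto simp: compact_standard_simplex continuous_on_simplex_to_cube)

lemma unit_cube_Suc_iff: "u \<in> unit_cube (Suc n) \<longleftrightarrow> u(n := 0) \<in> unit_cube n \<and> u n \<in> {0..1}"
proof
  assume "u \<in> unit_cube (Suc n)"
  then show "u(n := 0) \<in> unit_cube n \<and> u n \<in> {0..1}" by (simp add: unit_cube_def)
next
  assume u: "u(n := 0) \<in> unit_cube n \<and> u n \<in> {0..1}"
  have "0 \<le> u i \<and> u i \<le> 1" if "i < Suc n" for i
    using u that by (cases "i = n") (auto simp: unit_cube_def)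
  moreover have "u i = 0" if i: "i \<ge> Suc n" for i
  proof -
    have "\<forall>i\<ge>n. (u(n := 0)) i = 0" using conjunct1[OF u] unfolding unit_cube_def mem_Collect_eq by (rule conjunct2)
    then have "(u(n := 0)) i = 0" using Suc_leD[OF i] by (elim allE impE)
    then show ?thesis using i by simp
  qed
  ultimately show "u \<in> unit_cube (Suc n)" by (simp add: unit_cube_def)
qed

text \<open>The prism parameter is stored in coordinate \<open>n\<close>, which is 0 throughout
  \<open>unit_cube n\<close> and can therefore be overwritten and erased without loss.\<close>

lemma cube_pair_prism:
  fixes Z :: "'c::topological_space set"
  assumes "cube_pair n Z B"
  shows "cube_pair (Suc n) ({0..1::real} \<times> Z) ({0, 1} \<times> Z \<union> {0..1} \<times> B)"
proof -
  obtain e where e: "continuous_on Z e" "bij_betw e Z (unit_cube n)" "e ` B = unit_cube_boundary n"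
    and Z: "compact Z" "B \<subseteq> Z"
    using assms by (auto simp: cube_pair_def)
  let ?e = "\<lambda>p. (e (snd p))(n := fst p) :: nat \<Rightarrow> real"
  have eZ: "e z \<in> unit_cube n" "e z n = 0" if "z \<in> Z" for z
    using that e(2) by (auto simp: bij_betw_def unit_cube_def)
  have cont: "continuous_on ({0..1} \<times> Z) ?e"
    by (intro continuous_on_fun_upd continuous_on_compose2[OF e(1)] continuous_intros) auto
  have upd: "((e z)(n := t))(n := 0) = e z" if "z \<in> Z" for z t
    using eZ[OF that] by (auto simp: fun_eq_iff)
  have inj: "inj_on ?e ({0..1} \<times> Z)"
  proof (rule inj_onI)
    fix p q assume p: "p \<in> {0..1} \<times> Z" and q: "q \<in> {0..1} \<times> Z" and eq: "?e p = ?e q"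
    have "fst p = fst q" using fun_cong[OF eq, of n] by simp
    moreover have "e (snd p) = e (snd q)"
      using arg_cong[OF eq, of "\<lambda>u. u(n := 0)"] upd[of "snd p" "fst p"] upd[of "snd q" "fst q"] p q
      by (simp only: mem_Times_iff)
    then have "snd p = snd q" using e(2) p q by (auto simp: bij_betw_def inj_on_eq_iff)
    ultimately show "p = q" by (simp add: prod_eq_iff)
  qed
  have surj: "\<exists>t z. t \<in> {0..1} \<and> z \<in> Z \<and> u = ?e (t, z)" if u: "u \<in> unit_cube (Suc n)" for u
  proof -
    have "u(n := 0) \<in> e ` Z" using u e(2) by (simp add: unit_cube_Suc_iff bij_betw_def)
    then obtain z where z: "z \<in> Z" "u(n := 0) = e z" by auto
    have "u = (u(n := 0))(n := u n)" by simp
    then have "u = ?e (u n, z)" unfolding z(2) by simp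
    moreover have "u n \<in> {0..1}" using u by (simp only: unit_cube_Suc_iff)
    ultimately show ?thesis using z(1) by blast
  qed
  have mem: "?e (t, z) \<in> unit_cube (Suc n)" if "t \<in> {0..1}" "z \<in> Z" for t z
    using that eZ[OF that(2)] upd[OF that(2)] by (simp add: unit_cube_Suc_iff)
  have bd: "?e (t, z) \<in> unit_cube_boundary (Suc n) \<longleftrightarrow> t = 0 \<or> t = 1 \<or> z \<in> B" if "t \<in> {0..1}" "z \<in> Z" for t z
  proof -
    have "?e (t, z) \<in> unit_cube_boundary (Suc n) \<longleftrightarrow> t = 0 \<or> t = 1 \<or> (\<exists>i<n. e z i = 0 \<or> e z i = 1)"
      using mem[OF that] by (auto simp: unit_cube_boundary_def less_Suc_eq)
    also have "(\<exists>i<n. e z i = 0 \<or> e z i = 1) \<longleftrightarrow> e z \<in> e ` B"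
      using eZ[OF that(2)] by (simp add: e(3) unit_cube_boundary_def)
    also have "\<dots> \<longleftrightarrow> z \<in> B"
      using inj_on_image_mem_iff[OF bij_betw_imp_inj_on[OF e(2)] that(2) Z(2)] .
    finally show ?thesis .
  qed
  show ?thesis
    unfolding cube_pair_def
  proof (intro conjI exI[of _ ?e] cont)
    show "compact ({0..1::real} \<times> Z)" using compact_Times[OF compact_Icc Z(1)] .
    show "bij_betw ?e ({0..1} \<times> Z) (unit_cube (Suc n))"
    proof -
      have "?e ` ({0..1} \<times> Z) = unit_cube (Suc n)"
      proof (intro equalityI subsetI)
        fix u assume "u \<in> ?e ` ({0..1} \<times> Z)"
        then obtain t z where "t \<in> {0..1}" "z \<in> Z" "u = ?e (t, z)" by blast
        then show "u \<in> unit_cube (Suc n)" using mem by simp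
      next
        fix u assume u: "u \<in> unit_cube (Suc n)"
        from surj[OF u] obtain t z where tz: "t \<in> {0..1}" "z \<in> Z" "u = ?e (t, z)" by (elim exE conjE)
        show "u \<in> ?e ` ({0..1} \<times> Z)" unfolding tz(3) by (rule imageI) (use tz in simp)
      qed
      with inj show ?thesis by (simp add: bij_betw_def)
    qed
    show "?e ` ({0, 1} \<times> Z \<union> {0..1} \<times> B) = unit_cube_boundary (Suc n)" (is "?L = _")
    proof (intro equalityI subsetI)
      fix u assume "u \<in> ?L"
      then obtain t z where "(t, z) \<in> {0, 1} \<times> Z \<union> {0..1} \<times> B" "u = ?e (t, z)" by blast
      then show "u \<in> unit_cube_boundary (Suc n)" using bd[of t z] Z(2) by auto
    next
      fix u assume u: "u \<in> unit_cube_boundary (Suc n)"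
      from surj[OF subsetD[OF unit_cube_boundary_subset u]]
      obtain t z where tz: "t \<in> {0..1}" "z \<in> Z" "u = ?e (t, z)" by (elim exE conjE)
      then have "(t, z) \<in> {0, 1} \<times> Z \<union> {0..1} \<times> B" using bd[OF tz(1,2)] u by auto
      then show "u \<in> ?L" unfolding tz(3) by (rule imageI)
    qed
  qed (use Z(2) in auto)
qed

section \<open>Gluing along the faces of a simplex\<close>

definition simplex_del :: "nat \<Rightarrow> (nat \<Rightarrow> real) \<Rightarrow> nat \<Rightarrow> real" where
  "simplex_del k y = (\<lambda>i. if i < k then y i else y (Suc i))"

lemma simplex_del_face: "simplex_del k (simplical_face k x) = x"
  by (auto simp: simplex_del_def simplical_face_def)

lemma simplex_face_del: "y k = 0 \<Longrightarrow> simplical_face k (simplex_del k y) = y"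
  by (auto simp: simplex_del_def simplical_face_def fun_eq_iff)

lemma simplex_del_del:
  assumes "j < k" shows "simplex_del (k - 1) (simplex_del j y) = simplex_del j (simplex_del k y)"
proof
  fix i
  obtain m where k: "k = Suc m" using assms by (cases k) auto
  consider "i < j" | "j \<le> i" "i < m" | "m \<le> i" by linarith
  then show "simplex_del (k - 1) (simplex_del j y) i = simplex_del j (simplex_del k y) i"
    using assms unfolding k by cases (simp_all add: simplex_del_def)
qed

lemma simplical_face_face:
  assumes "j < k"
  shows "simplical_face k (simplical_face j x) = simplical_face j (simplical_face (k - 1) x)"
proof
  fix i
  obtain m where k: "k = Suc m" using assms by (cases k) auto
  show "simplical_face k (simplical_face j x) i = simplical_face j (simplical_face (k - 1) x) i"
  proof (cases i)
    case (Suc l)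
    consider "l < j" "i < j" | "i = j" | "j < i" "l < m" | "l = m" | "l > m" using Suc by linarith
    then show ?thesis
      using assms Suc unfolding k by cases (simp_all add: simplical_face_def)
  qed (use assms in \<open>simp add: simplical_face_def\<close>)
qed

lemma sum_simplical_face: "k \<le> Suc p \<Longrightarrow> (\<Sum>i\<le>Suc p. simplical_face k x i) = (\<Sum>i\<le>p. x i :: real)"
proof (induction p)
  case 0 then show ?case by (cases k) (auto simp: simplical_face_def)
next
  case (Suc p)
  show ?case
  proof (cases "k \<le> Suc p")
    case True
    have "(\<Sum>i\<le>Suc (Suc p). simplical_face k x i) = (\<Sum>i\<le>p. x i) + simplical_face k x (Suc (Suc p))"
      using Suc.IH[OF True] by simp
    with True show ?thesis by (simp add: simplical_face_def)
  next
    case False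
    then have "k = Suc (Suc p)" using Suc.prems by simp
    then show ?thesis by (simp add: simplical_face_def)
  qed
qed

lemma simplex_del_in_simplex:
  assumes y: "y \<in> standard_simplex (Suc p)" and k: "k \<le> Suc p" "y k = 0"
  shows "simplex_del k y \<in> standard_simplex p"
proof -
  have "(\<Sum>i\<le>p. simplex_del k y i) = 1"
    using sum_simplical_face[OF k(1), of "simplex_del k y"] simplex_face_del[of y, OF k(2)] y
    by (simp add: standard_simplex_def)
  then show ?thesis
    using y k(1) by (auto simp: standard_simplex_def simplex_del_def)
qed

lemma face_in_simplex: "k \<le> Suc p \<Longrightarrow> x \<in> standard_simplex p \<Longrightarrow> simplical_face k x \<in> standard_simplex (Suc p)"
  using simplical_face_in_standard_simplex[of "Suc p" k x] by simp

lemma face_in_boundary: "k \<le> Suc p \<Longrightarrow> x \<in> standard_simplex p \<Longrightarrow> simplical_face k x \<in> simplex_boundary (Suc p)"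
  using face_in_simplex[of k p x] by (auto simp: simplical_face_def intro!: exI[of _ k])

lemma simplex_boundaryE:
  assumes "y \<in> simplex_boundary (Suc p)"
  obtains k x where "k \<le> Suc p" "x \<in> standard_simplex p" "y = simplical_face k x"
proof -
  obtain k where k: "k \<le> Suc p" "y k = 0" and y: "y \<in> standard_simplex (Suc p)" using assms by auto
  show ?thesis
    by (rule that[OF k(1) simplex_del_in_simplex[OF y k] simplex_face_del[of y, OF k(2), symmetric]])
qed

lemma continuous_on_simplex_del:
  assumes "continuous_on S u" shows "continuous_on S (\<lambda>x. simplex_del k (u x))"
proof (rule continuous_on_coordinatewise_then_product)
  show "continuous_on S (\<lambda>x. simplex_del k (u x) i)" for i
    unfolding simplex_del_def by (cases "i < k") (simp_all add: continuous_on_coordinate[OF assms])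
qed

text \<open>The pieces are closed and meet where two coordinates vanish, in a face of codimension
  two; \<open>compat\<close> is the simplicial identity for it. The parameter space \<open>W\<close>
  is a point for simplices, an interval for prisms and a square for prisms of homotopies.\<close>

lemma glue_faces:
  fixes W :: "'w::topological_space set" and \<rho> :: "nat \<Rightarrow> 'w \<times> (nat \<Rightarrow> real) \<Rightarrow> 'z"
  assumes cont: "\<And>k. k \<le> Suc p \<Longrightarrow> continuous_map (top_of_set (W \<times> standard_simplex p)) Z (\<rho> k)"
    and compat: "\<And>j k w x. \<lbrakk>1 \<le> p; j < k; k \<le> Suc p; w \<in> W; x \<in> standard_simplex (p - 1)\<rbrakk>
      \<Longrightarrow> \<rho> k (w, simplical_face j x) = \<rho> j (w, simplical_face (k - 1) x)"
  obtains g where "continuous_map (top_of_set (W \<times> simplex_boundary (Suc p))) Z g"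
    "\<And>k w x. \<lbrakk>k \<le> Suc p; w \<in> W; x \<in> standard_simplex p\<rbrakk> \<Longrightarrow> g (w, simplical_face k x) = \<rho> k (w, x)"
proof -
  let ?D = "W \<times> simplex_boundary (Suc p)"
  define T where "T = (\<lambda>k. {z \<in> ?D. snd z k = 0})"
  define F where "F = (\<lambda>k z. \<rho> k (fst z, simplex_del k (snd z)))"
  \<comment> \<open>Any vanishing coordinate would do; choosing the least one makes the pasted map a
    function.\<close>
  define l where "l = (\<lambda>z::'w \<times> (nat \<Rightarrow> real). LEAST k. k \<le> Suc p \<and> snd z k = 0)"
  have agree1: "F k z = F j z" if jk: "j < k" "k \<le> Suc p" and z: "z \<in> T j \<inter> T k" for j k z
  proof -
    obtain w y where wy: "z = (w, y)" "w \<in> W" "y \<in> standard_simplex (Suc p)" "y j = 0" "y k = 0"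
      using z by (cases z) (auto simp: T_def)
    \<comment> \<open>The two end points of an edge are distinct, so in this dimension nothing has
      to match.\<close>
    have "p \<noteq> 0"
    proof
      assume "p = 0"
      then have "k = 1" "j = 0" using jk by auto
      then show False using wy(3-5) \<open>p = 0\<close> by (simp add: standard_simplex_def)
    qed
    then obtain q where q: "p = Suc q" by (cases p) auto
    define x where "x = simplex_del j (simplex_del k y)"
    have yk: "simplex_del k y j = 0" using jk wy by (simp add: simplex_del_def)
    have yj: "simplex_del j y (k - 1) = 0" using jk wy by (simp add: simplex_del_def)
    have 1: "simplex_del k y = simplical_face j x"
      unfolding x_def by (rule simplex_face_del[of "simplex_del k y", OF yk, symmetric])
    have 2: "simplex_del j y = simplical_face (k - 1) x"
      unfolding x_def simplex_del_del[OF jk(1), symmetric] by (rule simplex_face_del[of "simplex_del j y", OF yj, symmetric])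
    have "simplex_del k y \<in> standard_simplex (Suc q)"
      using simplex_del_in_simplex[OF wy(3) jk(2) wy(5)] q by simp
    then have "x \<in> standard_simplex q"
      unfolding x_def by (rule simplex_del_in_simplex) (use jk yk q in auto)
    then show ?thesis
      using compat[of j k w x] jk wy q by (simp add: F_def 1 2)
  qed
  have agree: "F i z = F j z" if "i \<in> {..Suc p}" "j \<in> {..Suc p}" "z \<in> topspace (top_of_set ?D) \<inter> T i \<inter> T j" for i j z
    using agree1[of i j z] agree1[of j i z] that by (cases i j rule: linorder_cases) auto
  have l: "l z \<le> Suc p \<and> z \<in> T (l z)" if "z \<in> ?D" for z
  proof -
    have "\<exists>k. k \<le> Suc p \<and> snd z k = 0" using that by auto
    from LeastI_ex[OF this] that show ?thesis by (simp add: l_def T_def)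
  qed
  have contT: "continuous_map (subtopology (top_of_set ?D) (T k)) Z (F k)" if k: "k \<in> {..Suc p}" for k
  proof -
    have "continuous_map (top_of_set (T k)) Z (F k)"
      unfolding F_def
    proof (rule continuous_map_compose_on[OF cont])
      show "continuous_on (T k) (\<lambda>z. (fst z, simplex_del k (snd z)))"
        by (intro continuous_on_Pair continuous_on_simplex_del continuous_on_fst continuous_on_snd continuous_on_id)
    qed (use k simplex_del_in_simplex in \<open>auto simp: T_def\<close>)
    moreover have "?D \<inter> T k = T k" by (auto simp: T_def)
    ultimately show ?thesis by (simp add: subtopology_subtopology)
  qed
  have closedT: "closedin (top_of_set ?D) (T k)" for k
  proof -
    have "continuous_on ?D (\<lambda>z. snd z k)"
      by (rule continuous_on_coordinate[OF continuous_on_snd[OF continuous_on_id]])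
    from continuous_closedin_preimage[OF this, of "{0}"] show ?thesis
      by (simp add: T_def vimage_def Int_def)
  qed
  have "continuous_map (top_of_set ?D) Z (\<lambda>z. F (l z) z)"
  proof (rule pasting_lemma_closed[where I = "{..Suc p}" and T = T and f = F])
    show "\<exists>j. j \<in> {..Suc p} \<and> z \<in> T j \<and> F (l z) z = F j z" if "z \<in> topspace (top_of_set ?D)" for z
      using l[of z] that by auto
    show "F i x = F j x" if "i \<in> {..Suc p}" "j \<in> {..Suc p}" "x \<in> topspace (top_of_set ?D) \<inter> T i \<inter> T j" for i j x
      by (rule agree[OF that])
  qed (simp_all add: contT closedT)
  moreover have "F (l (w, simplical_face k x)) (w, simplical_face k x) = \<rho> k (w, x)"
    if kwx: "k \<le> Suc p" "w \<in> W" "x \<in> standard_simplex p" for k w x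
  proof -
    let ?z = "(w, simplical_face k x)"
    have z: "?z \<in> ?D" using face_in_boundary[OF kwx(1,3)] kwx(2) by (rule_tac SigmaI)
    have "simplical_face k x k = 0" by (simp add: simplical_face_def)
    with z have "?z \<in> T k" unfolding T_def by (intro CollectI conjI) (simp_all only: snd_conv)
    moreover have "?z \<in> topspace (top_of_set ?D)" using z by (simp only: topspace_euclidean_subtopology)
    ultimately have "F (l ?z) ?z = F k ?z"
      using l[OF z] kwx(1) by (intro agree IntI) (simp_all only: atMost_iff)
    then show ?thesis by (simp add: F_def simplex_del_face)
  qed
  ultimately show ?thesis by (rule that)
qed

text \<open>Assembles a map on the boundary of a prism from the two ends and the sides;
  \<open>u\<close> is the prism parameter and \<open>D2\<close> the sides.\<close>

lemma paste_ends:
  fixes D :: "'d::topological_space set" and u :: "'d \<Rightarrow> real"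
  assumes u: "continuous_on D u" and D2: "closedin (top_of_set D) D2"
    and cover: "\<And>d. d \<in> D \<Longrightarrow> u d = 0 \<or> u d = 1 \<or> d \<in> D2"
    and f0: "continuous_map (top_of_set {d \<in> D. u d = 0}) Z f0"
    and f1: "continuous_map (top_of_set {d \<in> D. u d = 1}) Z f1"
    and g: "continuous_map (top_of_set D2) Z g"
    and "\<And>d. d \<in> D2 \<Longrightarrow> u d = 0 \<Longrightarrow> f0 d = g d" "\<And>d. d \<in> D2 \<Longrightarrow> u d = 1 \<Longrightarrow> f1 d = g d"
  shows "continuous_map (top_of_set D) Z (\<lambda>d. if u d = 0 then f0 d else if u d = 1 then f1 d else g d)"
proof -
  define T where "T = (\<lambda>i::nat. if i = 0 then {d \<in> D. u d = 0} else if i = 1 then {d \<in> D. u d = 1} else D2)"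
  define F where "F = (\<lambda>i::nat. if i = 0 then f0 else if i = 1 then f1 else g)"
  have D2D: "D2 \<subseteq> D" using closedin_subset[OF D2] by simp
  have Int: "D \<inter> T i = T i" for i using D2D by (auto simp: T_def)
  have cl: "closedin (top_of_set D) {d \<in> D. u d = c}" for c
    using continuous_closedin_preimage[OF u, of "{c}"] by (simp add: vimage_def Int_def)
  show ?thesis
  proof (rule pasting_lemma_closed[where I = "{0, 1, 2}" and T = T and f = F])
    show "continuous_map (subtopology (top_of_set D) (T i)) Z (F i)" if "i \<in> {0, 1, 2}" for i
      unfolding subtopology_subtopology Int using that f0 f1 g by (auto simp: T_def F_def)
    show "closedin (top_of_set D) (T i)" for i
      unfolding T_def using D2 cl by auto
    show "F i x = F j x" if "i \<in> {0, 1, 2}" "j \<in> {0, 1, 2}" "x \<in> topspace (top_of_set D) \<inter> T i \<inter> T j" for i j x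
      using that assms(7)[of x] assms(8)[of x] by (auto simp: T_def F_def split: if_splits)
    show "\<exists>j. j \<in> {0, 1, 2} \<and> x \<in> T j \<and> (if u x = 0 then f0 x else if u x = 1 then f1 x else g x) = F j x"
      if "x \<in> topspace (top_of_set D)" for x
    proof -
      have "x \<in> D" using that by simp
      consider "u x = 0" | "u x = 1" | "u x \<noteq> 0" "u x \<noteq> 1" by blast
      then show ?thesis
      proof cases
        case 1 then show ?thesis using \<open>x \<in> D\<close> by (intro exI[of _ 0]) (auto simp: T_def F_def)
      next
        case 2 then show ?thesis using \<open>x \<in> D\<close> by (intro exI[of _ 1]) (auto simp: T_def F_def)
      next
        case 3 then show ?thesis using cover[OF \<open>x \<in> D\<close>] by (intro exI[of _ 2]) (auto simp: T_def F_def)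
      qed
    qed
  qed auto
qed

section \<open>Compatible choices on all simplices\<close>

text \<open>A simplex is a face of many others, so in each dimension the choice is a function on all
  simplices, and dependent choice runs over the dimension. The statement is abstract because it is
  used for lifts and again for deformations.\<close>

lemma simplexwise_choice:
  fixes good :: "nat \<Rightarrow> 's \<Rightarrow> 'r \<Rightarrow> bool" and res :: "nat \<Rightarrow> nat \<Rightarrow> 'r \<Rightarrow> 'r"
    and face :: "nat \<Rightarrow> nat \<Rightarrow> 's \<Rightarrow> 's" and S :: "nat \<Rightarrow> 's set"
  assumes face_in: "\<And>p k \<sigma>. \<sigma> \<in> S (Suc p) \<Longrightarrow> k \<le> Suc p \<Longrightarrow> face (Suc p) k \<sigma> \<in> S p"
    and face_face: "\<And>p j k \<sigma>. \<sigma> \<in> S (Suc p) \<Longrightarrow> 1 \<le> p \<Longrightarrow> j < k \<Longrightarrow> k \<le> Suc p \<Longrightarrow>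
      face p j (face (Suc p) k \<sigma>) = face p (k - 1) (face (Suc p) j \<sigma>)"
    and base: "\<And>\<sigma>. \<sigma> \<in> S 0 \<Longrightarrow> \<exists>r. good 0 \<sigma> r"
    and step: "\<And>p \<sigma> \<rho>. \<sigma> \<in> S (Suc p) \<Longrightarrow> (\<And>k. k \<le> Suc p \<Longrightarrow> good p (face (Suc p) k \<sigma>) (\<rho> k)) \<Longrightarrow>
      (\<And>j k. 1 \<le> p \<Longrightarrow> j < k \<Longrightarrow> k \<le> Suc p \<Longrightarrow> res p j (\<rho> k) = res p (k - 1) (\<rho> j)) \<Longrightarrow>
      \<exists>r. good (Suc p) \<sigma> r \<and> (\<forall>k\<le>Suc p. res (Suc p) k r = \<rho> k)"
  obtains R where "\<And>p \<sigma>. \<sigma> \<in> S p \<Longrightarrow> good p \<sigma> (R p \<sigma>)"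
    "\<And>p \<sigma> k. \<sigma> \<in> S (Suc p) \<Longrightarrow> k \<le> Suc p \<Longrightarrow> res (Suc p) k (R (Suc p) \<sigma>) = R p (face (Suc p) k \<sigma>)"
proof -
  \<comment> \<open>The second half says that the restriction to a face depends on that face only,
    also across different simplices. It supplies the compatibility hypothesis of
    \<open>step\<close>.\<close>
  define P where "P = (\<lambda>n F. (\<forall>\<sigma>\<in>S n. good n \<sigma> (F \<sigma>)) \<and> (1 \<le> n \<longrightarrow> (\<forall>\<sigma>\<in>S n. \<forall>\<sigma>'\<in>S n. \<forall>j\<le>n. \<forall>k\<le>n.
    face n j \<sigma> = face n k \<sigma>' \<longrightarrow> res n j (F \<sigma>) = res n k (F \<sigma>'))))"
  define Q where "Q = (\<lambda>n F F'. \<forall>\<sigma>\<in>S (Suc n). \<forall>k\<le>Suc n. res (Suc n) k (F' \<sigma>) = F (face (Suc n) k \<sigma>))"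
  have 0: "\<exists>F. P 0 F"
  proof -
    have "\<forall>\<sigma>\<in>S 0. \<exists>r. good 0 \<sigma> r" using base by (rule ballI)
    from bchoice[OF this] obtain F where "\<forall>\<sigma>\<in>S 0. good 0 \<sigma> (F \<sigma>)" ..
    then show ?thesis by (intro exI[of _ F]) (simp add: P_def)
  qed
  have Suc: "\<exists>F'. P (Suc n) F' \<and> Q n F F'" if P: "P n F" for n F
  proof -
    have "\<exists>r. good (Suc n) \<sigma> r \<and> (\<forall>k\<le>Suc n. res (Suc n) k r = F (face (Suc n) k \<sigma>))" if \<sigma>: "\<sigma> \<in> S (Suc n)" for \<sigma>
    proof (rule step[OF \<sigma>])
      show "good n (face (Suc n) k \<sigma>) (F (face (Suc n) k \<sigma>))" if "k \<le> Suc n" for k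
        using P face_in[OF \<sigma> that] by (simp add: P_def)
      fix j k assume jk: "1 \<le> n" "j < k" "k \<le> Suc n"
      have mem: "face (Suc n) k \<sigma> \<in> S n" "face (Suc n) j \<sigma> \<in> S n" using face_in[OF \<sigma>] jk by auto
      have le: "j \<le> n" "k - 1 \<le> n" using jk by auto
      have inv: "res n j' (F \<tau>) = res n k' (F \<tau>')"
        if "\<tau> \<in> S n" "\<tau>' \<in> S n" "j' \<le> n" "k' \<le> n" "face n j' \<tau> = face n k' \<tau>'" for \<tau> \<tau>' j' k'
      proof -
        have "\<forall>\<sigma>\<in>S n. \<forall>\<sigma>'\<in>S n. \<forall>j\<le>n. \<forall>k\<le>n. face n j \<sigma> = face n k \<sigma>' \<longrightarrow> res n j (F \<sigma>) = res n k (F \<sigma>')"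
          using conjunct2[OF P[unfolded P_def]] jk(1) by (rule mp)
        from this[rule_format, OF that] show ?thesis .
      qed
      show "res n j (F (face (Suc n) k \<sigma>)) = res n (k - 1) (F (face (Suc n) j \<sigma>))"
        by (rule inv[OF mem le face_face[OF \<sigma> jk]])
    qed
    then have "\<forall>\<sigma>\<in>S (Suc n). \<exists>r. good (Suc n) \<sigma> r \<and> (\<forall>k\<le>Suc n. res (Suc n) k r = F (face (Suc n) k \<sigma>))"
      by (rule ballI)
    from bchoice[OF this] obtain F' where
      "\<forall>\<sigma>\<in>S (Suc n). good (Suc n) \<sigma> (F' \<sigma>) \<and> (\<forall>k\<le>Suc n. res (Suc n) k (F' \<sigma>) = F (face (Suc n) k \<sigma>))" ..
    then show ?thesis
      by (intro exI[of _ F']) (simp add: P_def Q_def)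
  qed
  from dependent_nat_choice[of P Q, OF 0 Suc]
  obtain R where R: "\<forall>n. P n (R n) \<and> Q n (R n) (R (Suc n))" ..
  show ?thesis
  proof (rule that[of R])
    show "good p \<sigma> (R p \<sigma>)" if "\<sigma> \<in> S p" for p \<sigma>
    proof -
      have "P p (R p)" using R by simp
      then show ?thesis using that unfolding P_def by simp
    qed
    show "res (Suc p) k (R (Suc p) \<sigma>) = R p (face (Suc p) k \<sigma>)" if "\<sigma> \<in> S (Suc p)" "k \<le> Suc p" for p \<sigma> k
    proof -
      have "Q p (R p) (R (Suc p))" using R by simp
      then show ?thesis using that unfolding Q_def by simp
    qed
  qed
qed

lemma singular_face_singular_face:
  assumes "j < k" "k \<le> Suc p" "1 \<le> p"
  shows "singular_face p j (singular_face (Suc p) k \<sigma>) = singular_face p (k - 1) (singular_face (Suc p) j \<sigma>)"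
proof
  fix x
  show "singular_face p j (singular_face (Suc p) k \<sigma>) x = singular_face p (k - 1) (singular_face (Suc p) j \<sigma>) x"
  proof (cases "x \<in> standard_simplex (p - Suc 0)")
    case True
    then have "simplical_face j x \<in> standard_simplex p" "simplical_face (k - 1) x \<in> standard_simplex p"
      using assms by (auto intro!: simplical_face_in_standard_simplex)
    then show ?thesis using True simplical_face_face[OF assms(1), of x] by (simp add: singular_face_def)
  qed (simp add: singular_face_def)
qed

lemma singular_simplex_face: "singular_simplex (Suc p) X \<sigma> \<Longrightarrow> k \<le> Suc p \<Longrightarrow> singular_simplex p X (singular_face (Suc p) k \<sigma>)"
  using singular_simplex_singular_face[of "Suc p" X \<sigma> k] by simp

lemma singular_simplex_iff:
  "singular_simplex p X \<sigma> \<longleftrightarrow> continuous_map (top_of_set (standard_simplex p)) X \<sigma> \<and> \<sigma> \<in> extensional (standard_simplex p)"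
  by (simp add: singular_simplex_def euclidean_product_topology)

lemma singular_simplex_restrict:
  "continuous_map (top_of_set (standard_simplex p)) X \<sigma> \<Longrightarrow> singular_simplex p X (restrict \<sigma> (standard_simplex p))"
  by (auto simp: singular_simplex_iff intro: continuous_map_on_cong)

section \<open>Simplexwise deformation along a weak homotopy equivalence\<close>

text \<open>Values off the smaller prism are cut off, so that agreement along a face is an equation
  between functions.\<close>

definition prism_face :: "nat \<Rightarrow> nat \<Rightarrow> (real \<times> (nat \<Rightarrow> real) \<Rightarrow> 'z) \<Rightarrow> real \<times> (nat \<Rightarrow> real) \<Rightarrow> 'z" where
  "prism_face p k H = restrict (\<lambda>z. H (fst z, simplical_face k (snd z))) ({0..1} \<times> standard_simplex (p - 1))"

definition double_prism_face ::
    "nat \<Rightarrow> nat \<Rightarrow> (real \<times> real \<times> (nat \<Rightarrow> real) \<Rightarrow> 'z) \<Rightarrow> real \<times> real \<times> (nat \<Rightarrow> real) \<Rightarrow> 'z" where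
  "double_prism_face p k K = restrict (\<lambda>z. K (fst z, fst (snd z), simplical_face k (snd (snd z))))
     ({0..1} \<times> {0..1} \<times> standard_simplex (p - 1))"

lemma simplex_boundary_0: "simplex_boundary 0 = {}"
  by (auto simp: standard_simplex_0)

lemma continuous_map_on_empty: "continuous_map (top_of_set {}) X g"
  by (simp add: continuous_map_on_empty2)

lemma glue_simplices:
  assumes \<rho>: "\<And>k. k \<le> Suc p \<Longrightarrow> singular_simplex p X (\<rho> k)"
    and compat: "\<And>j k. 1 \<le> p \<Longrightarrow> j < k \<Longrightarrow> k \<le> Suc p \<Longrightarrow> singular_face p j (\<rho> k) = singular_face p (k - 1) (\<rho> j)"
  obtains g where "continuous_map (top_of_set (simplex_boundary (Suc p))) X g"
    "\<And>k x. k \<le> Suc p \<Longrightarrow> x \<in> standard_simplex p \<Longrightarrow> g (simplical_face k x) = \<rho> k x"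
proof -
  have 1: "continuous_map (top_of_set ({0::real} \<times> standard_simplex p)) X (\<lambda>z. \<rho> k (snd z))" if "k \<le> Suc p" for k
  proof (rule continuous_map_compose_on[where T = "standard_simplex p" and g = "\<rho> k" and k = snd])
    show "continuous_map (top_of_set (standard_simplex p)) X (\<rho> k)"
      using \<rho>[OF that] by (simp only: singular_simplex_iff)
  qed (auto intro!: continuous_on_snd continuous_on_id)
  have 2: "\<rho> k (snd (w, simplical_face j x)) = \<rho> j (snd (w, simplical_face (k - 1) x))"
    if "1 \<le> p" "j < k" "k \<le> Suc p" "w \<in> {0::real}" "x \<in> standard_simplex (p - 1)" for j k w x
    using fun_cong[OF compat[OF that(1-3)], of x] that(5) by (simp add: singular_face_def)
  obtain g where g: "continuous_map (top_of_set ({0::real} \<times> simplex_boundary (Suc p))) X g"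
    "\<And>k w x. \<lbrakk>k \<le> Suc p; w \<in> {0::real}; x \<in> standard_simplex p\<rbrakk> \<Longrightarrow> g (w, simplical_face k x) = \<rho> k (snd (w, x))"
    using glue_faces[where W = "{0::real}" and \<rho> = "\<lambda>k z. \<rho> k (snd z)" and Z = X and p = p, OF 1 2] by blast
  show ?thesis
  proof (rule that)
    show "continuous_map (top_of_set (simplex_boundary (Suc p))) X (\<lambda>x. g (0, x))"
      by (rule continuous_map_compose_on[OF g(1)]) (auto intro!: continuous_on_Pair continuous_on_const continuous_on_id)
    show "g (0, simplical_face k x) = \<rho> k x" if "k \<le> Suc p" "x \<in> standard_simplex p" for k x
      using g(2)[of k 0 x] that by simp
  qed
qed

lemma glue_prisms:
  assumes \<rho>: "\<And>k. k \<le> Suc p \<Longrightarrow> continuous_map (top_of_set ({0..1} \<times> standard_simplex p)) X (\<rho> k)"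
    and compat: "\<And>j k. 1 \<le> p \<Longrightarrow> j < k \<Longrightarrow> k \<le> Suc p \<Longrightarrow> prism_face p j (\<rho> k) = prism_face p (k - 1) (\<rho> j)"
  obtains g where "continuous_map (top_of_set ({0..1::real} \<times> simplex_boundary (Suc p))) X g"
    "\<And>k s x. k \<le> Suc p \<Longrightarrow> s \<in> {0..1} \<Longrightarrow> x \<in> standard_simplex p \<Longrightarrow> g (s, simplical_face k x) = \<rho> k (s, x)"
proof -
  have 2: "\<rho> k (w, simplical_face j x) = \<rho> j (w, simplical_face (k - 1) x)"
    if "1 \<le> p" "j < k" "k \<le> Suc p" "w \<in> {0..1}" "x \<in> standard_simplex (p - 1)" for j k w x
    using fun_cong[OF compat[OF that(1-3)], of "(w, x)"] that(4,5) by (simp add: prism_face_def)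
  show ?thesis
    by (rule glue_faces[where W = "{0..1::real}" and \<rho> = \<rho> and Z = X and p = p, OF \<rho> 2 that])
qed

lemma glue_double_prisms:
  assumes \<rho>: "\<And>k. k \<le> Suc p \<Longrightarrow> continuous_map (top_of_set ({0..1} \<times> {0..1} \<times> standard_simplex p)) X (\<rho> k)"
    and compat: "\<And>j k. 1 \<le> p \<Longrightarrow> j < k \<Longrightarrow> k \<le> Suc p \<Longrightarrow> double_prism_face p j (\<rho> k) = double_prism_face p (k - 1) (\<rho> j)"
  obtains g where "continuous_map (top_of_set ({0..1::real} \<times> {0..1::real} \<times> simplex_boundary (Suc p))) X g"
    "\<And>k s u x. k \<le> Suc p \<Longrightarrow> s \<in> {0..1} \<Longrightarrow> u \<in> {0..1} \<Longrightarrow> x \<in> standard_simplex p \<Longrightarrow>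
      g (s, u, simplical_face k x) = \<rho> k (s, u, x)"
proof -
  let ?assoc = "\<lambda>z::(real \<times> real) \<times> (nat \<Rightarrow> real). (fst (fst z), snd (fst z), snd z)"
  let ?unassoc = "\<lambda>z::real \<times> real \<times> (nat \<Rightarrow> real). ((fst z, fst (snd z)), snd (snd z))"
  let ?W = "{0..1::real} \<times> {0..1::real}"
  have 1: "continuous_map (top_of_set (?W \<times> standard_simplex p)) X (\<lambda>z. \<rho> k (?assoc z))" if "k \<le> Suc p" for k
    by (rule continuous_map_compose_on[OF \<rho>[OF that]])
      (auto intro!: continuous_on_Pair continuous_on_fst continuous_on_snd continuous_on_id)
  have 2: "\<rho> k (?assoc (w, simplical_face j x)) = \<rho> j (?assoc (w, simplical_face (k - 1) x))"
    if "1 \<le> p" "j < k" "k \<le> Suc p" "w \<in> ?W" "x \<in> standard_simplex (p - 1)" for j k w x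
    using fun_cong[OF compat[OF that(1-3)], of "?assoc (w, x)"] that(4,5) by (cases w) (simp add: double_prism_face_def)
  obtain g where g: "continuous_map (top_of_set (?W \<times> simplex_boundary (Suc p))) X g"
    "\<And>k w x. \<lbrakk>k \<le> Suc p; w \<in> ?W; x \<in> standard_simplex p\<rbrakk> \<Longrightarrow> g (w, simplical_face k x) = \<rho> k (?assoc (w, x))"
    using glue_faces[where W = ?W and \<rho> = "\<lambda>k z. \<rho> k (?assoc z)" and Z = X and p = p, OF 1 2] by blast
  show ?thesis
  proof (rule that)
    show "continuous_map (top_of_set ({0..1::real} \<times> {0..1::real} \<times> simplex_boundary (Suc p))) X (\<lambda>z. g (?unassoc z))"
      by (rule continuous_map_compose_on[OF g(1)])
        (auto intro!: continuous_on_Pair continuous_on_fst continuous_on_snd continuous_on_id)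
    show "g (?unassoc (s, u, simplical_face k x)) = \<rho> k (s, u, x)"
      if "k \<le> Suc p" "s \<in> {0..1}" "u \<in> {0..1}" "x \<in> standard_simplex p" for k s u x
      using g(2)[of k "(s, u)" x] that by simp
  qed
qed

lemma simplexwise_choice_singular:
  fixes good :: "nat \<Rightarrow> ((nat \<Rightarrow> real) \<Rightarrow> 'b) \<Rightarrow> 'r \<Rightarrow> bool" and res :: "nat \<Rightarrow> nat \<Rightarrow> 'r \<Rightarrow> 'r"
  assumes base: "\<And>\<sigma>. singular_simplex 0 Y \<sigma> \<Longrightarrow> \<exists>r. good 0 \<sigma> r"
    and step: "\<And>p \<sigma> \<rho>. singular_simplex (Suc p) Y \<sigma> \<Longrightarrow> (\<And>k. k \<le> Suc p \<Longrightarrow> good p (singular_face (Suc p) k \<sigma>) (\<rho> k)) \<Longrightarrow>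
      (\<And>j k. 1 \<le> p \<Longrightarrow> j < k \<Longrightarrow> k \<le> Suc p \<Longrightarrow> res p j (\<rho> k) = res p (k - 1) (\<rho> j)) \<Longrightarrow>
      \<exists>r. good (Suc p) \<sigma> r \<and> (\<forall>k\<le>Suc p. res (Suc p) k r = \<rho> k)"
  obtains R where "\<And>p \<sigma>. \<sigma> \<in> Collect (singular_simplex p Y) \<Longrightarrow> good p \<sigma> (R p \<sigma>)"
    "\<And>p \<sigma> k. \<sigma> \<in> Collect (singular_simplex (Suc p) Y) \<Longrightarrow> k \<le> Suc p \<Longrightarrow> res (Suc p) k (R (Suc p) \<sigma>) = R p (singular_face (Suc p) k \<sigma>)"
proof -
  have 1: "singular_face (Suc p) k \<sigma> \<in> Collect (singular_simplex p Y)"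
    if "\<sigma> \<in> Collect (singular_simplex (Suc p) Y)" "k \<le> Suc p" for p k \<sigma>
    using that by (simp add: singular_simplex_face)
  have 2: "singular_face p j (singular_face (Suc p) k \<sigma>) = singular_face p (k - 1) (singular_face (Suc p) j \<sigma>)"
    if "\<sigma> \<in> Collect (singular_simplex (Suc p) Y)" "1 \<le> p" "j < k" "k \<le> Suc p" for p j k \<sigma>
    by (rule singular_face_singular_face[OF that(3,4,2)])
  have 4: "\<exists>r. good (Suc p) \<sigma> r \<and> (\<forall>k\<le>Suc p. res (Suc p) k r = \<rho> k)"
    if "\<sigma> \<in> Collect (singular_simplex (Suc p) Y)"
      "\<And>k. k \<le> Suc p \<Longrightarrow> good p (singular_face (Suc p) k \<sigma>) (\<rho> k)"
      "\<And>j k. 1 \<le> p \<Longrightarrow> j < k \<Longrightarrow> k \<le> Suc p \<Longrightarrow> res p j (\<rho> k) = res p (k - 1) (\<rho> j)" for p \<sigma> \<rho>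
    by (rule step[OF _ that(2,3)]) (use that(1) in simp_all)
  have 3: "\<exists>r. good 0 \<sigma> r" if "\<sigma> \<in> Collect (singular_simplex 0 Y)" for \<sigma>
    by (rule base[OF CollectD[OF that]])
  show ?thesis
    by (rule simplexwise_choice[where S = "\<lambda>p. Collect (singular_simplex p Y)" and face = singular_face
        and good = good and res = res, OF 1 2 3 4 that])
qed

definition lift_data :: "'a topology \<Rightarrow> 'b topology \<Rightarrow> ('a \<Rightarrow> 'b) \<Rightarrow> nat \<Rightarrow> ((nat \<Rightarrow> real) \<Rightarrow> 'b) \<Rightarrow>
    ((nat \<Rightarrow> real) \<Rightarrow> 'a) \<times> (real \<times> (nat \<Rightarrow> real) \<Rightarrow> 'b) \<Rightarrow> bool" where
  "lift_data X Y f p \<sigma> r \<longleftrightarrow> singular_simplex p X (fst r) \<and>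
     continuous_map (top_of_set ({0..1} \<times> standard_simplex p)) Y (snd r) \<and>
     snd r \<in> extensional ({0..1} \<times> standard_simplex p) \<and>
     (\<forall>x \<in> standard_simplex p. snd r (0, x) = \<sigma> x \<and> snd r (1, x) = f (fst r x))"

lemma lift_data_exists:
  assumes w: "weak_homotopy_equivalence X Y f" and \<sigma>: "singular_simplex p Y \<sigma>"
    and g: "continuous_map (top_of_set (simplex_boundary p)) X g"
    and h: "continuous_map (top_of_set ({0..1::real} \<times> simplex_boundary p)) Y h"
    and h01: "\<And>x. x \<in> simplex_boundary p \<Longrightarrow> h (0, x) = \<sigma> x \<and> h (1, x) = f (g x)"
  shows "\<exists>r. lift_data X Y f p \<sigma> r \<and> (\<forall>x \<in> simplex_boundary p. fst r x = g x \<and> (\<forall>s \<in> {0..1}. snd r (s, x) = h (s, x)))"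
proof -
  let ?D = "standard_simplex p"
  have \<sigma>c: "continuous_map (top_of_set ?D) Y \<sigma>" using \<sigma> by (simp only: singular_simplex_iff)
  obtain a' h' where ah: "continuous_map (top_of_set ?D) X a'"
    "\<And>u. u \<in> simplex_boundary p \<Longrightarrow> a' u = g u"
    "continuous_map (top_of_set ({0..1::real} \<times> ?D)) Y h'"
    "\<And>u. u \<in> ?D \<Longrightarrow> h' (0, u) = \<sigma> u"
    "\<And>u. u \<in> ?D \<Longrightarrow> h' (1, u) = f (a' u)"
    "\<And>s u. s \<in> {0..1} \<Longrightarrow> u \<in> simplex_boundary p \<Longrightarrow> h' (s, u) = h (s, u)"
    using compression_pair[OF w cube_pair_simplex g \<sigma>c h conjunct1[OF h01] conjunct2[OF h01]] by blast
  let ?r = "(restrict a' ?D, restrict h' ({0..1} \<times> ?D))"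
  have bD: "x \<in> simplex_boundary p \<Longrightarrow> x \<in> ?D" for x by simp
  have A: "lift_data X Y f p \<sigma> ?r"
    unfolding lift_data_def
    using ah by (auto intro: singular_simplex_restrict continuous_map_on_cong)
  have B: "\<forall>x \<in> simplex_boundary p. fst ?r x = g x \<and> (\<forall>s \<in> {0..1}. snd ?r (s, x) = h (s, x))"
  proof
    fix x assume x: "x \<in> simplex_boundary p"
    show "fst ?r x = g x \<and> (\<forall>s \<in> {0..1}. snd ?r (s, x) = h (s, x))"
      using ah(2)[OF x] ah(6)[OF _ x] bD[OF x] by simp
  qed
  show ?thesis by (rule exI[of _ ?r]) (rule conjI[OF A B])
qed

lemma continuous_map_boundary_0: "continuous_map (top_of_set (simplex_boundary 0)) X g"
  "continuous_map (top_of_set (W \<times> simplex_boundary 0)) X g'"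
  unfolding simplex_boundary_0 Times_empty by (simp_all add: continuous_map_on_empty Times_empty)

lemma simplexwise_lift:
  assumes w: "weak_homotopy_equivalence X Y f"
  obtains T H where
    "\<And>p \<sigma>. singular_simplex p Y \<sigma> \<Longrightarrow> lift_data X Y f p \<sigma> (T p \<sigma>, H p \<sigma>)"
    "\<And>p \<sigma> k. singular_simplex (Suc p) Y \<sigma> \<Longrightarrow> k \<le> Suc p \<Longrightarrow>
      singular_face (Suc p) k (T (Suc p) \<sigma>) = T p (singular_face (Suc p) k \<sigma>)"
    "\<And>p \<sigma> k. singular_simplex (Suc p) Y \<sigma> \<Longrightarrow> k \<le> Suc p \<Longrightarrow>
      prism_face (Suc p) k (H (Suc p) \<sigma>) = H p (singular_face (Suc p) k \<sigma>)"
proof -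
  define res where "res = (\<lambda>p k (r::((nat \<Rightarrow> real) \<Rightarrow> 'a) \<times> (real \<times> (nat \<Rightarrow> real) \<Rightarrow> 'b)).
    (singular_face p k (fst r), prism_face p k (snd r)))"
  have step: "\<exists>r. lift_data X Y f (Suc p) \<sigma> r \<and> (\<forall>k\<le>Suc p. res (Suc p) k r = \<rho> k)"
    if \<sigma>: "singular_simplex (Suc p) Y \<sigma>"
      and \<rho>: "\<And>k. k \<le> Suc p \<Longrightarrow> lift_data X Y f p (singular_face (Suc p) k \<sigma>) (\<rho> k)"
      and compat: "\<And>j k. 1 \<le> p \<Longrightarrow> j < k \<Longrightarrow> k \<le> Suc p \<Longrightarrow> res p j (\<rho> k) = res p (k - 1) (\<rho> j)" for p \<sigma> \<rho>
  proof -
    have \<rho>1: "singular_simplex p X (fst (\<rho> k))" if "k \<le> Suc p" for k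
      using \<rho>[OF that] by (simp add: lift_data_def)
    have \<rho>2: "continuous_map (top_of_set ({0..1} \<times> standard_simplex p)) Y (snd (\<rho> k))" if "k \<le> Suc p" for k
      using \<rho>[OF that] by (simp add: lift_data_def)
    have \<rho>ext: "snd (\<rho> k) \<in> extensional ({0..1} \<times> standard_simplex p)" if "k \<le> Suc p" for k
      using \<rho>[OF that] by (simp add: lift_data_def)
    have c1: "singular_face p j (fst (\<rho> k)) = singular_face p (k - 1) (fst (\<rho> j))"
      and c2: "prism_face p j (snd (\<rho> k)) = prism_face p (k - 1) (snd (\<rho> j))"
      if "1 \<le> p" "j < k" "k \<le> Suc p" for j k
      using compat[OF that] by (simp_all add: res_def)
    obtain g where g: "continuous_map (top_of_set (simplex_boundary (Suc p))) X g"
      "\<And>k x. k \<le> Suc p \<Longrightarrow> x \<in> standard_simplex p \<Longrightarrow> g (simplical_face k x) = fst (\<rho> k) x"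
      using glue_simplices[of p X "\<lambda>k. fst (\<rho> k)", OF \<rho>1 c1] by blast
    obtain h where h: "continuous_map (top_of_set ({0..1::real} \<times> simplex_boundary (Suc p))) Y h"
      "\<And>k s x. k \<le> Suc p \<Longrightarrow> s \<in> {0..1} \<Longrightarrow> x \<in> standard_simplex p \<Longrightarrow> h (s, simplical_face k x) = snd (\<rho> k) (s, x)"
      using glue_prisms[of p Y "\<lambda>k. snd (\<rho> k)", OF \<rho>2 c2] by blast
    have "h (0, y) = \<sigma> y \<and> h (1, y) = f (g y)" if y: "y \<in> simplex_boundary (Suc p)" for y
    proof -
      obtain k x where kx: "k \<le> Suc p" "x \<in> standard_simplex p" "y = simplical_face k x"
        using simplex_boundaryE[OF y] .
      then show ?thesis
        using \<rho>[OF kx(1)] g(2)[OF kx(1,2)] h(2)[OF kx(1) _ kx(2)]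
        by (simp add: lift_data_def singular_face_def)
    qed
    from lift_data_exists[OF w \<sigma> g(1) h(1) this] obtain r where r: "lift_data X Y f (Suc p) \<sigma> r"
      "\<And>x. x \<in> simplex_boundary (Suc p) \<Longrightarrow> fst r x = g x"
      "\<And>x s. x \<in> simplex_boundary (Suc p) \<Longrightarrow> s \<in> {0..1} \<Longrightarrow> snd r (s, x) = h (s, x)"
      by blast
    have "res (Suc p) k r = \<rho> k" if k: "k \<le> Suc p" for k
    proof -
      have "singular_face (Suc p) k (fst r) = fst (\<rho> k)"
        unfolding singular_face_def
        by (rule extensionalityI[of _ "standard_simplex p"])
          (use \<rho>1[OF k] r(2)[OF face_in_boundary[OF k]] g(2)[OF k] in \<open>simp_all add: singular_simplex_iff\<close>)
      moreover have "prism_face (Suc p) k (snd r) = snd (\<rho> k)"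
        unfolding prism_face_def
        by (rule extensionalityI[of _ "{0..1} \<times> standard_simplex p"])
          (use \<rho>ext[OF k] r(3)[OF face_in_boundary[OF k]] h(2)[OF k] in auto)
      ultimately show ?thesis by (simp add: res_def)
    qed
    with r(1) show ?thesis by (intro exI[of _ r] conjI allI impI)
  qed
  have base: "\<exists>r. lift_data X Y f 0 \<sigma> r" if "singular_simplex 0 Y \<sigma>" for \<sigma>
  proof -
    have "x \<in> simplex_boundary 0 \<Longrightarrow> undefined (0, x) = \<sigma> x \<and> undefined (1, x) = f (undefined x)" for x
      unfolding simplex_boundary_0 by simp
    from lift_data_exists[OF w that continuous_map_boundary_0 this] show ?thesis by blast
  qed
  obtain R where R: "\<And>p \<sigma>. \<sigma> \<in> Collect (singular_simplex p Y) \<Longrightarrow> lift_data X Y f p \<sigma> (R p \<sigma>)"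
    "\<And>p \<sigma> k. \<sigma> \<in> Collect (singular_simplex (Suc p) Y) \<Longrightarrow> k \<le> Suc p \<Longrightarrow> res (Suc p) k (R (Suc p) \<sigma>) = R p (singular_face (Suc p) k \<sigma>)"
    using simplexwise_choice_singular[of Y "lift_data X Y f" res, OF base step] by blast
  show ?thesis
  proof (rule that[of "\<lambda>p \<sigma>. fst (R p \<sigma>)" "\<lambda>p \<sigma>. snd (R p \<sigma>)"])
    show "lift_data X Y f p \<sigma> (fst (R p \<sigma>), snd (R p \<sigma>))" if "singular_simplex p Y \<sigma>" for p \<sigma>
      using R(1)[of \<sigma> p] that by simp
    fix p \<sigma> k assume "singular_simplex (Suc p) Y \<sigma>" "k \<le> Suc p"
    then have "res (Suc p) k (R (Suc p) \<sigma>) = R p (singular_face (Suc p) k \<sigma>)" using R(2) by simp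
    then show "singular_face (Suc p) k (fst (R (Suc p) \<sigma>)) = fst (R p (singular_face (Suc p) k \<sigma>))"
      "prism_face (Suc p) k (snd (R (Suc p) \<sigma>)) = snd (R p (singular_face (Suc p) k \<sigma>))"
      unfolding res_def by (metis fst_conv, metis snd_conv)
  qed
qed

text \<open>The second homotopy \<open>K\<close> records that \<open>f \<circ> G\<close> is homotopic to \<open>H\<close> relative to the ends; it is
  what makes \<open>G\<close> extend from the boundary of a simplex to its interior.\<close>

definition deform_data :: "'a topology \<Rightarrow> 'b topology \<Rightarrow> ('a \<Rightarrow> 'b) \<Rightarrow> nat \<Rightarrow> ((nat \<Rightarrow> real) \<Rightarrow> 'a) \<Rightarrow>
    ((nat \<Rightarrow> real) \<Rightarrow> 'a) \<Rightarrow> (real \<times> (nat \<Rightarrow> real) \<Rightarrow> 'b) \<Rightarrow>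
    (real \<times> (nat \<Rightarrow> real) \<Rightarrow> 'a) \<times> (real \<times> real \<times> (nat \<Rightarrow> real) \<Rightarrow> 'b) \<Rightarrow> bool" where
  "deform_data X Y f p \<sigma> \<tau> H r \<longleftrightarrow>
     continuous_map (top_of_set ({0..1} \<times> standard_simplex p)) X (fst r) \<and>
     fst r \<in> extensional ({0..1} \<times> standard_simplex p) \<and>
     continuous_map (top_of_set ({0..1} \<times> {0..1} \<times> standard_simplex p)) Y (snd r) \<and>
     snd r \<in> extensional ({0..1} \<times> {0..1} \<times> standard_simplex p) \<and>
     (\<forall>x \<in> standard_simplex p. fst r (0, x) = \<sigma> x \<and> fst r (1, x) = \<tau> x) \<and>
     (\<forall>x \<in> standard_simplex p. \<forall>u \<in> {0..1}. snd r (0, u, x) = H (u, x) \<and> snd r (1, u, x) = f (fst r (u, x))) \<and>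
     (\<forall>x \<in> standard_simplex p. \<forall>s \<in> {0..1}. snd r (s, 0, x) = f (\<sigma> x) \<and> snd r (s, 1, x) = f (\<tau> x))"

lemma closed_simplex_boundary: "closed (simplex_boundary p)"
proof -
  have "simplex_boundary p = standard_simplex p \<inter> (\<Union>i\<in>{..p}. {x. x i = 0})" by auto
  moreover have "closed {x :: nat \<Rightarrow> real. x i = 0}" for i
    by (intro closed_Collect_eq continuous_on_const continuous_on_coordinate[OF continuous_on_id])
  ultimately show ?thesis
    by (simp only:) (intro closed_Int closed_UN compact_imp_closed[OF compact_standard_simplex] finite_atMost ballI)
qed

text \<open>The prism over the simplex is again a cube with boundary. Its bottom is mapped by
  \<open>\<sigma>\<close>, its top by \<open>\<tau>\<close> and its sides by \<open>g\<close>, and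
  compression moves \<open>H\<close> into \<open>X\<close> with these boundary values; the homotopy
  on the boundary is constant over the ends and \<open>k\<close> over the sides.\<close>

lemma deform_data_exists:
  assumes w: "weak_homotopy_equivalence X Y f"
    and \<sigma>: "continuous_map (top_of_set (standard_simplex p)) X \<sigma>"
    and \<tau>: "continuous_map (top_of_set (standard_simplex p)) X \<tau>"
    and H: "continuous_map (top_of_set ({0..1::real} \<times> standard_simplex p)) Y H"
    and H01: "\<And>x. x \<in> standard_simplex p \<Longrightarrow> H (0, x) = f (\<sigma> x) \<and> H (1, x) = f (\<tau> x)"
    and g: "continuous_map (top_of_set ({0..1::real} \<times> simplex_boundary p)) X g"
    and g01: "\<And>x. x \<in> simplex_boundary p \<Longrightarrow> g (0, x) = \<sigma> x \<and> g (1, x) = \<tau> x"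
    and k: "continuous_map (top_of_set ({0..1::real} \<times> {0..1::real} \<times> simplex_boundary p)) Y k"
    and k01: "\<And>x u. x \<in> simplex_boundary p \<Longrightarrow> u \<in> {0..1} \<Longrightarrow> k (0, u, x) = H (u, x) \<and> k (1, u, x) = f (g (u, x))"
    and ks: "\<And>x s. x \<in> simplex_boundary p \<Longrightarrow> s \<in> {0..1} \<Longrightarrow> k (s, 0, x) = f (\<sigma> x) \<and> k (s, 1, x) = f (\<tau> x)"
  shows "\<exists>r. deform_data X Y f p \<sigma> \<tau> H r \<and> (\<forall>x \<in> simplex_boundary p. \<forall>u \<in> {0..1}. fst r (u, x) = g (u, x) \<and>
    (\<forall>s \<in> {0..1}. snd r (s, u, x) = k (s, u, x)))"
proof -
  let ?D = "standard_simplex p" and ?d = "simplex_boundary p"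
  let ?Z = "{0..1::real} \<times> ?D" let ?B = "{0, 1} \<times> ?D \<union> {0..1::real} \<times> ?d"
  have f: "continuous_map X Y f" using w by (simp add: weak_homotopy_equivalence_def)
  have f\<sigma>: "continuous_map (top_of_set ?D) Y (\<lambda>x. f (\<sigma> x))" "continuous_map (top_of_set ?D) Y (\<lambda>x. f (\<tau> x))"
    using continuous_map_compose[OF \<sigma> f] continuous_map_compose[OF \<tau> f] by (simp_all add: o_def)
  define a where "a = (\<lambda>z. if fst z = 0 then \<sigma> (snd z) else if fst z = 1 then \<tau> (snd z) else g z)"
  \<comment> \<open>The first coordinate is the time of the compression, the second the prism
    parameter by which the ends are recognized.\<close>
  define h where "h = (\<lambda>z::real \<times> real \<times> (nat \<Rightarrow> real). if fst (snd z) = 0 then f (\<sigma> (snd (snd z)))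
    else if fst (snd z) = 1 then f (\<tau> (snd (snd z))) else k z)"
  have BD: "snd z \<in> ?D" if "z \<in> ?B" for z using that by auto
  have a: "continuous_map (top_of_set ?B) X a"
    unfolding a_def
  proof (rule paste_ends)
    have "closedin (top_of_set ?B) (?B \<inter> ({0..1} \<times> ?d))"
      by (intro closedin_closed_Int closed_Times closed_atLeastAtMost closed_simplex_boundary)
    moreover have "?B \<inter> ({0..1} \<times> ?d) = {0..1} \<times> ?d" by blast
    ultimately show "closedin (top_of_set ?B) ({0..1} \<times> ?d)" by simp
    show "continuous_map (top_of_set {z \<in> ?B. fst z = 0}) X (\<lambda>z. \<sigma> (snd z))"
      by (rule continuous_map_compose_on[OF \<sigma>]) (auto intro!: continuous_on_snd continuous_on_id)
    show "continuous_map (top_of_set {z \<in> ?B. fst z = 1}) X (\<lambda>z. \<tau> (snd z))"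
      by (rule continuous_map_compose_on[OF \<tau>]) (auto intro!: continuous_on_snd continuous_on_id)
    show "\<sigma> (snd z) = g z" if "z \<in> {0..1} \<times> ?d" "fst z = 0" for z
    proof -
      have "z = (0, snd z)" "snd z \<in> ?d" using that by (auto simp: prod_eq_iff)
      then show ?thesis using g01[of "snd z"] by metis
    qed
    show "\<tau> (snd z) = g z" if "z \<in> {0..1} \<times> ?d" "fst z = 1" for z
    proof -
      have "z = (1, snd z)" "snd z \<in> ?d" using that by (auto simp: prod_eq_iff)
      then show ?thesis using g01[of "snd z"] by metis
    qed
  qed (use g in \<open>auto intro!: continuous_on_fst continuous_on_id\<close>)
  have h: "continuous_map (top_of_set ({0..1} \<times> ?B)) Y h"
    unfolding h_def
  proof (rule paste_ends)
    let ?D2 = "{0..1::real} \<times> {0..1::real} \<times> ?d"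
    have "closedin (top_of_set ({0..1} \<times> ?B)) (({0..1} \<times> ?B) \<inter> ?D2)"
      by (intro closedin_closed_Int closed_Times closed_atLeastAtMost closed_simplex_boundary)
    moreover have "({0..1} \<times> ?B) \<inter> ?D2 = ?D2" by blast
    ultimately show "closedin (top_of_set ({0..1} \<times> ?B)) ?D2" by simp
    show "continuous_map (top_of_set {z \<in> {0..1} \<times> ?B. fst (snd z) = 0}) Y (\<lambda>z. f (\<sigma> (snd (snd z))))"
      by (rule continuous_map_compose_on[OF f\<sigma>(1)]) (auto intro!: continuous_on_snd continuous_on_id)
    show "continuous_map (top_of_set {z \<in> {0..1} \<times> ?B. fst (snd z) = 1}) Y (\<lambda>z. f (\<tau> (snd (snd z))))"
      by (rule continuous_map_compose_on[OF f\<sigma>(2)]) (auto intro!: continuous_on_snd continuous_on_id)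
    show "f (\<sigma> (snd (snd z))) = k z" if "z \<in> ?D2" "fst (snd z) = 0" for z
    proof -
      have "z = (fst z, 0, snd (snd z))" "snd (snd z) \<in> ?d" "fst z \<in> {0..1}" using that by (auto simp: prod_eq_iff)
      then show ?thesis using ks[of "snd (snd z)" "fst z"] by metis
    qed
    show "f (\<tau> (snd (snd z))) = k z" if "z \<in> ?D2" "fst (snd z) = 1" for z
    proof -
      have "z = (fst z, 1, snd (snd z))" "snd (snd z) \<in> ?d" "fst z \<in> {0..1}" using that by (auto simp: prod_eq_iff)
      then show ?thesis using ks[of "snd (snd z)" "fst z"] by metis
    qed
  qed (use k in \<open>auto intro!: continuous_on_fst continuous_on_snd continuous_on_id\<close>)
  have hH: "h (0, z) = H z \<and> h (1, z) = f (a z)" if z: "z \<in> ?B" for z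
  proof -
    have "fst z = 0 \<or> fst z = 1 \<or> fst z \<in> {0..1} \<and> snd z \<in> ?d" using z by auto
    then consider "fst z = 0" | "fst z = 1" | "fst z \<noteq> 0" "fst z \<noteq> 1" "fst z \<in> {0..1}" "snd z \<in> ?d" by blast
    then show ?thesis
    proof cases
      case 1
      then have "z = (0, snd z)" by (simp add: prod_eq_iff)
      then have "H z = f (\<sigma> (snd z))" using H01[OF BD[OF z]] by metis
      then show ?thesis using 1 by (simp add: h_def a_def)
    next
      case 2
      then have "z = (1, snd z)" by (simp add: prod_eq_iff)
      then have "H z = f (\<tau> (snd z))" using H01[OF BD[OF z]] by metis
      then show ?thesis using 2 by (simp add: h_def a_def)
    next
      case 3
      then show ?thesis using k01[OF 3(4,3)] by (simp add: h_def a_def)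
    qed
  qed
  obtain a' h' where ah: "continuous_map (top_of_set ?Z) X a'"
    "\<And>z. z \<in> ?B \<Longrightarrow> a' z = a z"
    "continuous_map (top_of_set ({0..1::real} \<times> ?Z)) Y h'"
    "\<And>z. z \<in> ?Z \<Longrightarrow> h' (0, z) = H z"
    "\<And>z. z \<in> ?Z \<Longrightarrow> h' (1, z) = f (a' z)"
    "\<And>s z. s \<in> {0..1} \<Longrightarrow> z \<in> ?B \<Longrightarrow> h' (s, z) = h (s, z)"
    using compression_pair[OF w cube_pair_prism[OF cube_pair_simplex] a H h conjunct1[OF hH] conjunct2[OF hH]] by blast
  let ?r = "(restrict a' ?Z, restrict h' ({0..1} \<times> ?Z))"
  have a'0: "a' (0, x) = \<sigma> x" "a' (1, x) = \<tau> x" if "x \<in> ?D" for x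
    using ah(2)[of "(0, x)"] ah(2)[of "(1, x)"] that by (simp_all add: a_def)
  have h'0: "h' (s, 0, x) = f (\<sigma> x)" "h' (s, 1, x) = f (\<tau> x)" if "x \<in> ?D" "s \<in> {0..1}" for x s
    using ah(6)[OF that(2), of "(0, x)"] ah(6)[OF that(2), of "(1, x)"] that(1) by (simp_all add: h_def)
  have "deform_data X Y f p \<sigma> \<tau> H ?r"
    unfolding deform_data_def fst_conv snd_conv
  proof (intro conjI ballI)
    show "continuous_map (top_of_set ?Z) X (restrict a' ?Z)"
      by (rule continuous_map_on_cong[OF ah(1)]) simp
    show "continuous_map (top_of_set ({0..1} \<times> ?Z)) Y (restrict h' ({0..1} \<times> ?Z))"
      by (rule continuous_map_on_cong[OF ah(3)]) simp
  qed (use ah(4,5) a'0 h'0 in simp_all)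
  then show ?thesis
  proof (intro exI[of _ ?r] conjI ballI)
    fix x u assume x: "x \<in> ?d" and u: "u \<in> {0..1::real}"
    have xD: "x \<in> ?D" and B: "(u, x) \<in> ?B" using x u by auto
    have "a (u, x) = g (u, x)" using g01[OF x] by (simp add: a_def)
    moreover have "h (s, u, x) = k (s, u, x)" if "s \<in> {0..1}" for s using ks[OF x that] by (simp add: h_def)
    ultimately show "fst ?r (u, x) = g (u, x)" "\<And>s. s \<in> {0..1} \<Longrightarrow> snd ?r (s, u, x) = k (s, u, x)"
      using ah(2)[OF B] ah(6)[OF _ B] xD u by simp_all
  qed
qed

lemma singular_simplex_simplex_map':
  "continuous_map X Y f \<Longrightarrow> singular_simplex p X \<sigma> \<Longrightarrow> singular_simplex p Y (simplex_map p f \<sigma>)"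
  by (rule singular_simplex_simplex_map)

lemma singular_face_simplex_map':
  assumes "k \<le> Suc p"
  shows "singular_face (Suc p) k (simplex_map (Suc p) f \<sigma>) = simplex_map p f (singular_face (Suc p) k \<sigma>)"
proof
  fix x
  show "singular_face (Suc p) k (simplex_map (Suc p) f \<sigma>) x = simplex_map p f (singular_face (Suc p) k \<sigma>) x"
    using face_in_simplex[OF assms, of x] by (simp add: singular_face_def simplex_map_def)
qed

text \<open>\<open>H\<close> at \<open>f \<circ> \<sigma>\<close> runs from
  \<open>f \<circ> \<sigma>\<close> to the image under \<open>f\<close> of \<open>T\<close> at
  \<open>f \<circ> \<sigma>\<close>, so both of its ends already come from \<open>X\<close> and only
  the homotopy has to be moved there. Since \<open>T\<close> and \<open>H\<close> commute with
  faces, the data of a face are the restrictions of the data of the simplex.\<close>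

lemma simplexwise_deformation:
  assumes w: "weak_homotopy_equivalence X Y f"
    and TH: "\<And>p \<sigma>. singular_simplex p Y \<sigma> \<Longrightarrow> lift_data X Y f p \<sigma> (T p \<sigma>, H p \<sigma>)"
    and Tface: "\<And>p \<sigma> k. singular_simplex (Suc p) Y \<sigma> \<Longrightarrow> k \<le> Suc p \<Longrightarrow>
      singular_face (Suc p) k (T (Suc p) \<sigma>) = T p (singular_face (Suc p) k \<sigma>)"
    and Hface: "\<And>p \<sigma> k. singular_simplex (Suc p) Y \<sigma> \<Longrightarrow> k \<le> Suc p \<Longrightarrow>
      prism_face (Suc p) k (H (Suc p) \<sigma>) = H p (singular_face (Suc p) k \<sigma>)"
  obtains G where
    "\<And>p \<sigma>. singular_simplex p X \<sigma> \<Longrightarrow> continuous_map (top_of_set ({0..1} \<times> standard_simplex p)) X (G p \<sigma>)"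
    "\<And>p \<sigma> x. singular_simplex p X \<sigma> \<Longrightarrow> x \<in> standard_simplex p \<Longrightarrow>
      G p \<sigma> (0, x) = \<sigma> x \<and> G p \<sigma> (1, x) = T p (simplex_map p f \<sigma>) x"
    "\<And>p \<sigma> k. singular_simplex (Suc p) X \<sigma> \<Longrightarrow> k \<le> Suc p \<Longrightarrow>
      prism_face (Suc p) k (G (Suc p) \<sigma>) = G p (singular_face (Suc p) k \<sigma>)"
proof -
  have f: "continuous_map X Y f" using w by (simp add: weak_homotopy_equivalence_def)
  define good where "good = (\<lambda>p \<sigma>. deform_data X Y f p \<sigma> (T p (simplex_map p f \<sigma>)) (H p (simplex_map p f \<sigma>)))"
  define res where "res = (\<lambda>p k (r::(real \<times> (nat \<Rightarrow> real) \<Rightarrow> 'a) \<times> (real \<times> real \<times> (nat \<Rightarrow> real) \<Rightarrow> 'b)).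
    (prism_face p k (fst r), double_prism_face p k (snd r)))"
  have cont: "continuous_map (top_of_set (standard_simplex p)) X \<sigma>"
    "continuous_map (top_of_set (standard_simplex p)) X (T p (simplex_map p f \<sigma>))"
    "continuous_map (top_of_set ({0..1::real} \<times> standard_simplex p)) Y (H p (simplex_map p f \<sigma>))"
    "\<And>x. x \<in> standard_simplex p \<Longrightarrow> H p (simplex_map p f \<sigma>) (0, x) = f (\<sigma> x) \<and>
      H p (simplex_map p f \<sigma>) (1, x) = f (T p (simplex_map p f \<sigma>) x)"
    if \<sigma>: "singular_simplex p X \<sigma>" for p \<sigma>
    using TH[OF singular_simplex_simplex_map'[OF f \<sigma>]] \<sigma>
    by (simp_all add: lift_data_def singular_simplex_iff simplex_map_def)
  have step: "\<exists>r. good (Suc p) \<sigma> r \<and> (\<forall>k\<le>Suc p. res (Suc p) k r = \<rho> k)"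
    if \<sigma>: "singular_simplex (Suc p) X \<sigma>"
      and \<rho>: "\<And>k. k \<le> Suc p \<Longrightarrow> good p (singular_face (Suc p) k \<sigma>) (\<rho> k)"
      and compat: "\<And>j k. 1 \<le> p \<Longrightarrow> j < k \<Longrightarrow> k \<le> Suc p \<Longrightarrow> res p j (\<rho> k) = res p (k - 1) (\<rho> j)" for p \<sigma> \<rho>
  proof -
    let ?fs = "simplex_map (Suc p) f \<sigma>" let ?D = "standard_simplex p"
    have fs: "singular_simplex (Suc p) Y ?fs" by (rule singular_simplex_simplex_map'[OF f \<sigma>])
    have fsk: "simplex_map p f (singular_face (Suc p) k \<sigma>) = singular_face (Suc p) k ?fs" if "k \<le> Suc p" for k
      by (rule singular_face_simplex_map'[OF that, symmetric])
    have \<rho>': "continuous_map (top_of_set ({0..1} \<times> ?D)) X (fst (\<rho> k))"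
      "fst (\<rho> k) \<in> extensional ({0..1} \<times> ?D)"
      "continuous_map (top_of_set ({0..1} \<times> {0..1} \<times> ?D)) Y (snd (\<rho> k))"
      "snd (\<rho> k) \<in> extensional ({0..1} \<times> {0..1} \<times> ?D)" if "k \<le> Suc p" for k
      using \<rho>[OF that] by (simp_all add: good_def deform_data_def)
    have c1: "prism_face p j (fst (\<rho> k)) = prism_face p (k - 1) (fst (\<rho> j))"
      and c2: "double_prism_face p j (snd (\<rho> k)) = double_prism_face p (k - 1) (snd (\<rho> j))"
      if "1 \<le> p" "j < k" "k \<le> Suc p" for j k
      using compat[OF that] by (simp_all add: res_def)
    obtain g where g: "continuous_map (top_of_set ({0..1::real} \<times> simplex_boundary (Suc p))) X g"
      "\<And>k s x. k \<le> Suc p \<Longrightarrow> s \<in> {0..1} \<Longrightarrow> x \<in> ?D \<Longrightarrow> g (s, simplical_face k x) = fst (\<rho> k) (s, x)"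
      using glue_prisms[of p X "\<lambda>k. fst (\<rho> k)", OF \<rho>'(1) c1] by blast
    obtain h where h: "continuous_map (top_of_set ({0..1::real} \<times> {0..1::real} \<times> simplex_boundary (Suc p))) Y h"
      "\<And>k s u x. k \<le> Suc p \<Longrightarrow> s \<in> {0..1} \<Longrightarrow> u \<in> {0..1} \<Longrightarrow> x \<in> ?D \<Longrightarrow>
        h (s, u, simplical_face k x) = snd (\<rho> k) (s, u, x)"
      using glue_double_prisms[of p Y "\<lambda>k. snd (\<rho> k)", OF \<rho>'(3) c2] by blast
    have \<rho>v: "fst (\<rho> k) (0, x) = \<sigma> (simplical_face k x)" "fst (\<rho> k) (1, x) = T (Suc p) ?fs (simplical_face k x)"
      "\<And>u. u \<in> {0..1} \<Longrightarrow> snd (\<rho> k) (0, u, x) = H (Suc p) ?fs (u, simplical_face k x)"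
      "\<And>u. u \<in> {0..1} \<Longrightarrow> snd (\<rho> k) (1, u, x) = f (fst (\<rho> k) (u, x))"
      "\<And>s. s \<in> {0..1} \<Longrightarrow> snd (\<rho> k) (s, 0, x) = f (\<sigma> (simplical_face k x))"
      "\<And>s. s \<in> {0..1} \<Longrightarrow> snd (\<rho> k) (s, 1, x) = f (T (Suc p) ?fs (simplical_face k x))"
      if k: "k \<le> Suc p" and x: "x \<in> ?D" for k x
    proof -
      have 1: "singular_face (Suc p) k \<sigma> x = \<sigma> (simplical_face k x)"
        using x by (simp add: singular_face_def)
      have 2: "T p (simplex_map p f (singular_face (Suc p) k \<sigma>)) x = T (Suc p) ?fs (simplical_face k x)"
        using fun_cong[OF Tface[OF fs k], of x] x by (simp add: singular_face_def[of _ _ "T _ _"] fsk[OF k])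
      have 3: "H p (simplex_map p f (singular_face (Suc p) k \<sigma>)) (u, x) = H (Suc p) ?fs (u, simplical_face k x)"
        if "u \<in> {0..1}" for u
        using fun_cong[OF Hface[OF fs k], of "(u, x)"] x that by (simp add: prism_face_def fsk[OF k])
      show "fst (\<rho> k) (0, x) = \<sigma> (simplical_face k x)" "fst (\<rho> k) (1, x) = T (Suc p) ?fs (simplical_face k x)"
        "\<And>u. u \<in> {0..1} \<Longrightarrow> snd (\<rho> k) (0, u, x) = H (Suc p) ?fs (u, simplical_face k x)"
        "\<And>u. u \<in> {0..1} \<Longrightarrow> snd (\<rho> k) (1, u, x) = f (fst (\<rho> k) (u, x))"
        "\<And>s. s \<in> {0..1} \<Longrightarrow> snd (\<rho> k) (s, 0, x) = f (\<sigma> (simplical_face k x))"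
        "\<And>s. s \<in> {0..1} \<Longrightarrow> snd (\<rho> k) (s, 1, x) = f (T (Suc p) ?fs (simplical_face k x))"
        using \<rho>[OF k] x unfolding good_def deform_data_def by (simp_all add: 1 2 3)
    qed
    have g01: "g (0, y) = \<sigma> y \<and> g (1, y) = T (Suc p) ?fs y" if y: "y \<in> simplex_boundary (Suc p)" for y
    proof -
      obtain k x where kx: "k \<le> Suc p" "x \<in> ?D" "y = simplical_face k x"
        using simplex_boundaryE[OF y] .
      then show ?thesis using g(2)[OF kx(1) _ kx(2)] \<rho>v[OF kx(1,2)] by simp
    qed
    have k01: "h (0, u, y) = H (Suc p) ?fs (u, y) \<and> h (1, u, y) = f (g (u, y))"
      if y: "y \<in> simplex_boundary (Suc p)" and u: "u \<in> {0..1}" for y u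
    proof -
      obtain k x where kx: "k \<le> Suc p" "x \<in> ?D" "y = simplical_face k x"
        using simplex_boundaryE[OF y] .
      then show ?thesis using g(2)[OF kx(1) u kx(2)] h(2)[OF kx(1) _ u kx(2)] \<rho>v[OF kx(1,2)] u by simp
    qed
    have ks: "h (s, 0, y) = f (\<sigma> y) \<and> h (s, 1, y) = f (T (Suc p) ?fs y)"
      if y: "y \<in> simplex_boundary (Suc p)" and s: "s \<in> {0..1}" for y s
    proof -
      obtain k x where kx: "k \<le> Suc p" "x \<in> ?D" "y = simplical_face k x"
        using simplex_boundaryE[OF y] .
      then show ?thesis using h(2)[OF kx(1) s _ kx(2)] \<rho>v[OF kx(1,2)] s by simp
    qed
    from deform_data_exists[OF w cont[OF \<sigma>] g(1) g01 h(1) k01 ks]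
    obtain r where r: "good (Suc p) \<sigma> r"
      "\<And>x u. x \<in> simplex_boundary (Suc p) \<Longrightarrow> u \<in> {0..1} \<Longrightarrow> fst r (u, x) = g (u, x)"
      "\<And>x u s. x \<in> simplex_boundary (Suc p) \<Longrightarrow> u \<in> {0..1} \<Longrightarrow> s \<in> {0..1} \<Longrightarrow> snd r (s, u, x) = h (s, u, x)"
      unfolding good_def by blast
    have "res (Suc p) k r = \<rho> k" if k: "k \<le> Suc p" for k
    proof -
      have "prism_face (Suc p) k (fst r) = fst (\<rho> k)"
        unfolding prism_face_def
        by (rule extensionalityI[of _ "{0..1} \<times> ?D"])
          (use \<rho>'(2)[OF k] r(2)[OF face_in_boundary[OF k]] g(2)[OF k] in auto)
      moreover have "double_prism_face (Suc p) k (snd r) = snd (\<rho> k)"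
        unfolding double_prism_face_def
        by (rule extensionalityI[of _ "{0..1} \<times> {0..1} \<times> ?D"])
          (use \<rho>'(4)[OF k] r(3)[OF face_in_boundary[OF k]] h(2)[OF k] in auto)
      ultimately show ?thesis by (simp add: res_def)
    qed
    with r(1) show ?thesis by (intro exI[of _ r] conjI allI impI)
  qed
  have base: "\<exists>r. good 0 \<sigma> r" if \<sigma>: "singular_simplex 0 X \<sigma>" for \<sigma>
  proof -
    have e: "\<not> x \<in> simplex_boundary 0" for x unfolding simplex_boundary_0 by simp
    have cW: "continuous_map (top_of_set ({0..1::real} \<times> {0..1::real} \<times> simplex_boundary 0)) Y undefined"
      unfolding simplex_boundary_0 Sigma_empty2 by (rule continuous_map_on_empty)
    have "\<exists>r. deform_data X Y f 0 \<sigma> (T 0 (simplex_map 0 f \<sigma>)) (H 0 (simplex_map 0 f \<sigma>)) r \<and> (\<forall>x \<in> simplex_boundary 0. \<forall>u \<in> {0..1}. fst r (u, x) = undefined (u, x) \<and>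
      (\<forall>s \<in> {0..1}. snd r (s, u, x) = undefined (s, u, x)))"
      by (rule deform_data_exists[OF w cont[OF \<sigma>] continuous_map_boundary_0(2) _ cW]) (use e in blast)+
    then show ?thesis unfolding good_def by blast
  qed
  obtain R where R: "\<And>p \<sigma>. \<sigma> \<in> Collect (singular_simplex p X) \<Longrightarrow> good p \<sigma> (R p \<sigma>)"
    "\<And>p \<sigma> k. \<sigma> \<in> Collect (singular_simplex (Suc p) X) \<Longrightarrow> k \<le> Suc p \<Longrightarrow> res (Suc p) k (R (Suc p) \<sigma>) = R p (singular_face (Suc p) k \<sigma>)"
    using simplexwise_choice_singular[of X good res, OF base step] by blast
  show ?thesis
  proof (rule that[of "\<lambda>p \<sigma>. fst (R p \<sigma>)"])
    fix p \<sigma> assume "singular_simplex p X \<sigma>"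
    then have "good p \<sigma> (R p \<sigma>)" using R(1) by simp
    then show "continuous_map (top_of_set ({0..1} \<times> standard_simplex p)) X (fst (R p \<sigma>))"
      "\<And>x. x \<in> standard_simplex p \<Longrightarrow> fst (R p \<sigma>) (0, x) = \<sigma> x \<and> fst (R p \<sigma>) (1, x) = T p (simplex_map p f \<sigma>) x"
      by (simp_all add: good_def deform_data_def)
  next
    fix p \<sigma> k assume "singular_simplex (Suc p) X \<sigma>" "k \<le> Suc p"
    then have "res (Suc p) k (R (Suc p) \<sigma>) = R p (singular_face (Suc p) k \<sigma>)" using R(2) by simp
    then show "prism_face (Suc p) k (fst (R (Suc p) \<sigma>)) = fst (R p (singular_face (Suc p) k \<sigma>))"
      unfolding res_def by (metis fst_conv)
  qed
qed

section \<open>Singular cochains: prism operator, cup product and cohomology ring\<close>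

section \<open>The prism operator\<close>

text \<open>The simplicial identity pairs \<open>(k, j)\<close> for \<open>j < k\<close> with
  \<open>(j, k - 1)\<close>, whose sign is opposite.\<close>

lemma alternating_face_sum:
  fixes a :: "nat \<Rightarrow> nat \<Rightarrow> 'k::comm_ring_1"
  assumes "\<And>j k. j < k \<Longrightarrow> k \<le> Suc p \<Longrightarrow> a k j = a j (k - 1)"
  shows "(\<Sum>k\<le>Suc p. \<Sum>j\<le>p. (-1) ^ (k + j) * a k j) = 0"
proof -
  let ?F = "\<lambda>(k, j). (-1) ^ (k + j) * a k j"
  let ?L = "{(k, j). k \<le> Suc p \<and> j < k}" and ?U = "{(k, j). k \<le> j \<and> j \<le> p}"
  have fin: "finite ?L" "finite ?U"
    by (rule finite_subset[of _ "{..Suc p} \<times> {..Suc p}"]; auto)+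
  have "(\<Sum>k\<le>Suc p. \<Sum>j\<le>p. (-1) ^ (k + j) * a k j) = sum ?F ({..Suc p} \<times> {..p})"
    by (simp add: sum.cartesian_product)
  also have "{..Suc p} \<times> {..p} = ?L \<union> ?U" by auto
  also have "sum ?F (?L \<union> ?U) = sum ?F ?L + sum ?F ?U"
    by (rule sum.union_disjoint[OF fin]) auto
  also have "sum ?F ?L = sum (\<lambda>z. - ?F z) ?U"
  proof (rule sum.reindex_bij_witness[where i = "\<lambda>(k, j). (Suc j, k)" and j = "\<lambda>(k, j). (j, k - 1)"])
    fix z assume "z \<in> ?L"
    then obtain k j where kj: "z = (Suc k, j)" "k \<le> p" "j \<le> k"
      by (cases z; cases "fst z") auto
    have "a (Suc k) j = a j k" using assms[of j "Suc k"] kj by simp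
    then show "- ?F ((\<lambda>(k, j). (j, k - 1)) z) = ?F z"
      by (simp add: kj power_add)
  qed auto
  finally show ?thesis by (simp add: sum_negf)
qed

lemma sum_atMost_split:
  fixes g :: "nat \<Rightarrow> 'k::comm_monoid_add"
  shows "k \<le> Suc n \<Longrightarrow> sum g {..n} = sum g {..<k} + sum g {k..n}"
proof -
  assume "k \<le> Suc n"
  then have "{..n} = {..<k} \<union> {k..n}" by auto
  moreover have "sum g ({..<k} \<union> {k..n}) = sum g {..<k} + sum g {k..n}"
    by (rule sum.union_disjoint) auto
  ultimately show ?thesis by simp
qed

text \<open>The prism identity in the abstract: \<open>a i j\<close> stands for face
  \<open>j\<close> of the \<open>i\<close>-th prism simplex and \<open>q\<close> for the prism
  simplices over faces. Off-diagonal faces are prisms over faces and cancel against the second sum,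
  interior diagonal faces are shared by neighbours and telescope, and the top and the bottom of the
  prism remain.\<close>

lemma prism_sum:
  fixes a q :: "nat \<Rightarrow> nat \<Rightarrow> 'k::comm_ring_1"
  assumes lo: "\<And>i j. j < i \<Longrightarrow> i \<le> p \<Longrightarrow> a i j = q (i - 1) j"
    and hi: "\<And>i j. Suc i < j \<Longrightarrow> j \<le> Suc p \<Longrightarrow> a i j = q i (j - 1)"
    and diag: "\<And>i. i < p \<Longrightarrow> a i (Suc i) = a (Suc i) (Suc i)"
  shows "(\<Sum>i\<le>p. (-1) ^ i * (\<Sum>j\<le>Suc p. (-1) ^ j * a i j)) + (\<Sum>j\<le>p. (-1) ^ j * (\<Sum>i<p. (-1) ^ i * q i j))
    = a 0 0 - a p (Suc p)"
proof -
  define d where "d = (\<lambda>i. a i i - a i (Suc i))"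
  have tele: "sum d {..p'} = a 0 0 - a p' (Suc p')" if "p' \<le> p" for p'
    using that by (induction p') (simp_all add: diag d_def)
  \<comment> \<open>Splits the faces into those with \<open>j < i\<close>, the two diagonal ones
    \<open>j = i\<close> and \<open>j = i + 1\<close>, and the rest, reindexed by one.\<close>
  have inner: "(-1) ^ i * (\<Sum>j\<le>Suc p. (-1) ^ j * a i j) =
    (\<Sum>j<i. (-1) ^ (i + j) * q (i - 1) j) + d i - (\<Sum>j\<in>{Suc i..p}. (-1) ^ (i + j) * q i j)"
    if i: "i \<le> p" for i
  proof -
    let ?G = "\<lambda>j. (-1) ^ (i + j) * a i j"
    have "(-1) ^ i * (\<Sum>j\<le>Suc p. (-1) ^ j * a i j) = sum ?G {..Suc p}"
      by (simp add: sum_distrib_left power_add mult.assoc del: sum.atMost_Suc)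
    also have "\<dots> = sum ?G {..<i} + sum ?G {i..Suc p}"
      using i by (intro sum_atMost_split) simp
    also have "sum ?G {i..Suc p} = ?G i + (?G (Suc i) + sum ?G {Suc (Suc i)..Suc p})"
      using i by (simp only: sum.atLeast_Suc_atMost[of i "Suc p"] sum.atLeast_Suc_atMost[of "Suc i" "Suc p"] le_SucI Suc_le_mono)
    also have "sum ?G {..<i} + (?G i + (?G (Suc i) + sum ?G {Suc (Suc i)..Suc p}))
       = sum ?G {..<i} + (?G i + ?G (Suc i)) + sum ?G {Suc (Suc i)..Suc p}"
      by (simp only: add.assoc)
    also have "sum ?G {..<i} = (\<Sum>j<i. (-1) ^ (i + j) * q (i - 1) j)"
      using i lo by (intro sum.cong) auto
    also have "sum ?G {Suc (Suc i)..Suc p} = (\<Sum>j\<in>{Suc i..p}. - ((-1) ^ (i + j) * q i j))"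
      unfolding sum.shift_bounds_cl_Suc_ivl using hi[of i] by (intro sum.cong) auto
    also have "?G i + ?G (Suc i) = d i"
      by (simp add: power_add d_def flip: power_mult_distrib)
    finally show ?thesis by (simp only: sum_negf add_uminus_conv_diff)
  qed
  have S1: "(\<Sum>i\<le>p. \<Sum>j<i. (-1) ^ (i + j) * q (i - 1) j) = - (\<Sum>i<p. \<Sum>j<Suc i. (-1) ^ (i + j) * q i j)"
  proof (cases p)
    case (Suc n)
    show ?thesis unfolding Suc sum.atMost_Suc_shift lessThan_Suc_atMost[of n] by (simp add: sum_negf del: sum.lessThan_Suc)
  qed simp
  have S2: "(\<Sum>i\<le>p. \<Sum>j\<in>{Suc i..p}. (-1) ^ (i + j) * q i j) = (\<Sum>i<p. \<Sum>j\<in>{Suc i..p}. (-1) ^ (i + j) * q i j)"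
    by (simp flip: lessThan_Suc_atMost)
  have "(\<Sum>i\<le>p. (-1) ^ i * (\<Sum>j\<le>Suc p. (-1) ^ j * a i j)) =
    (\<Sum>i\<le>p. (\<Sum>j<i. (-1) ^ (i + j) * q (i - 1) j) + d i - (\<Sum>j\<in>{Suc i..p}. (-1) ^ (i + j) * q i j))"
    by (intro sum.cong refl inner) simp
  also have "\<dots> = a 0 0 - a p (Suc p) - ((\<Sum>i<p. \<Sum>j<Suc i. (-1) ^ (i + j) * q i j) + (\<Sum>i<p. \<Sum>j\<in>{Suc i..p}. (-1) ^ (i + j) * q i j))"
    by (simp only: sum.distrib sum_subtractf S1 S2 tele[OF order_refl]) simp
  also have "(\<Sum>i<p. \<Sum>j<Suc i. (-1) ^ (i + j) * q i j) + (\<Sum>i<p. \<Sum>j\<in>{Suc i..p}. (-1) ^ (i + j) * q i j)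
    = (\<Sum>i<p. \<Sum>j\<le>p. (-1) ^ (i + j) * q i j)"
  proof -
    show ?thesis
      unfolding sum.distrib[symmetric] by (intro sum.cong refl sum_atMost_split[symmetric]) simp
  qed
  also have "\<dots> = (\<Sum>j\<le>p. (-1) ^ j * (\<Sum>i<p. (-1) ^ i * q i j))"
    by (subst sum.swap) (simp add: sum_distrib_left power_add mult_ac)
  finally show ?thesis by simp
qed

text \<open>The affine map of simplices that merges the vertices \<open>i\<close> and
  \<open>i + 1\<close>, written without reference to the dimension.\<close>

definition degenerate :: "nat \<Rightarrow> (nat \<Rightarrow> real) \<Rightarrow> nat \<Rightarrow> real" where
  "degenerate i y = (\<lambda>j. if j < i then y j else if j = i then y i + y (Suc i) else y (Suc j))"

text \<open>The affine map \<open>\<Delta>\<^sup>p\<^sup>+\<^sup>1 \<rightarrow> I \<times> \<Delta>\<^sup>p\<close> sending the vertices \<open>e\<^sub>0, \<dots>, e\<^sub>i\<close> to the bottom and the others to the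
  top; its first component is written so that it does not mention \<open>p\<close>.\<close>

definition prism_map :: "nat \<Rightarrow> (nat \<Rightarrow> real) \<Rightarrow> real \<times> (nat \<Rightarrow> real)" where
  "prism_map i y = (1 - (\<Sum>j\<le>i. y j), degenerate i y)"

lemma sum_degenerate: "i \<le> p \<Longrightarrow> (\<Sum>j\<le>p. degenerate i y j) = (\<Sum>j\<le>Suc p. y j)"
proof (induction p)
  case (Suc p)
  show ?case
  proof (cases "i \<le> p")
    case True then show ?thesis using Suc by (simp add: degenerate_def)
  next
    case False
    then have i: "i = Suc p" using Suc by simp
    have "(\<Sum>j\<le>p. degenerate i y j) = (\<Sum>j\<le>p. y j)"
      by (rule sum.cong) (auto simp: i degenerate_def)
    then show ?thesis by (simp add: i degenerate_def)
  qed
qed (simp add: degenerate_def)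

lemma prism_map_in:
  assumes y: "y \<in> standard_simplex (Suc p)" and i: "i \<le> p"
  shows "prism_map i y \<in> {0..1} \<times> standard_simplex p"
proof -
  have y0: "0 \<le> y j" for j using simplex_coord[OF y] by auto
  have sum1: "(\<Sum>j\<le>Suc p. y j) = 1" using y by (simp add: standard_simplex_def)
  have "(\<Sum>j\<le>i. y j) \<le> (\<Sum>j\<le>Suc p. y j)"
    by (rule sum_mono2) (use i y0 in auto)
  then have 1: "1 - (\<Sum>j\<le>i. y j) \<in> {0..1}" using sum1 y0 by (simp add: sum_nonneg)
  have d0: "0 \<le> degenerate i y j" for j using y0 by (simp add: degenerate_def)
  have dp: "degenerate i y j = 0" if "j > p" for j
    using that i simplex_coord(3)[OF y] by (simp add: degenerate_def)
  have s: "(\<Sum>j\<le>p. degenerate i y j) = 1" using sum_degenerate[OF i] sum1 by simp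
  have "degenerate i y j \<le> 1" for j
  proof (cases "j \<le> p")
    case True then show ?thesis using member_le_sum[of j "{..p}" "degenerate i y"] d0 s by simp
  qed (simp add: dp)
  with d0 dp s have "degenerate i y \<in> standard_simplex p" by (simp add: standard_simplex_def)
  with 1 show ?thesis by (simp add: prism_map_def)
qed

lemma continuous_on_prism_map: "continuous_on S (prism_map i)"
proof -
  have c: "continuous_on S (\<lambda>y::nat\<Rightarrow>real. y j)" for j by (rule continuous_on_coordinate[OF continuous_on_id])
  have "continuous_on S (degenerate i)"
  proof (rule continuous_on_coordinatewise_then_product)
    show "continuous_on S (\<lambda>y. degenerate i y j)" for j
      unfolding degenerate_def by (cases "j < i"; cases "j = i") (simp_all add: c continuous_on_add)
  qed
  then show ?thesis
    unfolding prism_map_def by (intro continuous_on_Pair continuous_on_diff continuous_on_const continuous_on_sum c)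
qed

lemma degenerate_face_lt:
  assumes "j < i" shows "degenerate i (simplical_face j x) = simplical_face j (degenerate (i - 1) x)"
proof
  fix l
  obtain m where i: "i = Suc m" using assms by (cases i) auto
  show "degenerate i (simplical_face j x) l = simplical_face j (degenerate (i - 1) x) l"
  proof (cases l)
    case 0 then show ?thesis using assms unfolding i by (cases "j = 0") (simp_all add: degenerate_def simplical_face_def)
  next
    case (Suc n)
    consider "Suc n < j" | "Suc n = j" | "j < Suc n" "n < m" | "n = m" | "m < n" by linarith
    then show ?thesis using assms unfolding i Suc by cases (simp_all add: degenerate_def simplical_face_def)
  qed
qed

lemma degenerate_face_gt:
  assumes "Suc i < j" shows "degenerate i (simplical_face j x) = simplical_face (j - 1) (degenerate i x)"
proof
  fix l
  obtain m where j: "j = Suc m" using assms by (cases j) auto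
  show "degenerate i (simplical_face j x) l = simplical_face (j - 1) (degenerate i x) l"
  proof (cases l)
    case 0 then show ?thesis using assms unfolding j by (cases "i = 0") (simp_all add: degenerate_def simplical_face_def)
  next
    case (Suc n)
    consider "Suc n < i" | "Suc n = i" | "i < Suc n" "Suc n < m" | "Suc n = m" | "m < Suc n" by linarith
    then show ?thesis using assms unfolding j Suc by cases (simp_all add: degenerate_def simplical_face_def)
  qed
qed

lemma degenerate_face_eq: "degenerate i (simplical_face i x) = x" "degenerate i (simplical_face (Suc i) x) = x"
  by (simp_all add: degenerate_def simplical_face_def fun_eq_iff)

lemma prism_map_face_lt:
  assumes "j < i"
  shows "prism_map i (simplical_face j x) = (fst (prism_map (i - 1) x), simplical_face j (snd (prism_map (i - 1) x)))"
proof -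
  obtain m where i: "i = Suc m" using assms by (cases i) auto
  show ?thesis
    using sum_simplical_face[of j m x] degenerate_face_lt[OF assms, of x] assms
    unfolding prism_map_def i by simp
qed

lemma sum_simplical_face_below: "i < j \<Longrightarrow> (\<Sum>l\<le>i. simplical_face j x l) = (\<Sum>l\<le>i. x l)"
  by (rule sum.cong) (auto simp: simplical_face_def)

lemma prism_map_face_gt:
  assumes "Suc i < j"
  shows "prism_map i (simplical_face j x) = (fst (prism_map i x), simplical_face (j - 1) (snd (prism_map i x)))"
  using sum_simplical_face_below[of i j x] degenerate_face_gt[OF assms, of x] assms by (simp add: prism_map_def)

lemma prism_map_face_mid:
  "prism_map i (simplical_face (Suc i) x) = (1 - (\<Sum>l\<le>i. x l), x)"
  "prism_map (Suc i) (simplical_face (Suc i) x) = (1 - (\<Sum>l\<le>i. x l), x)"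
  using sum_simplical_face_below[of i "Suc i" x] sum_simplical_face[of "Suc i" i x]
  by (simp_all add: prism_map_def degenerate_face_eq del: sum.atMost_Suc)

lemma prism_map_face_0: "prism_map 0 (simplical_face 0 x) = (1, x)"
  by (simp add: prism_map_def degenerate_face_eq) (simp add: simplical_face_def)

definition prism_simplex :: "nat \<Rightarrow> nat \<Rightarrow> (real \<times> (nat \<Rightarrow> real) \<Rightarrow> 'z) \<Rightarrow> (nat \<Rightarrow> real) \<Rightarrow> 'z" where
  "prism_simplex p i H = restrict (\<lambda>y. H (prism_map i y)) (standard_simplex (Suc p))"

lemma singular_simplex_prism_simplex:
  assumes "continuous_map (top_of_set ({0..1} \<times> standard_simplex p)) B H" "i \<le> p"
  shows "singular_simplex (Suc p) B (prism_simplex p i H)"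
  unfolding prism_simplex_def
  by (intro singular_simplex_restrict continuous_map_compose_on[OF assms(1) continuous_on_prism_map] prism_map_in assms(2))

lemma singular_face_prism_simplex:
  assumes j: "j \<le> Suc p"
  shows "singular_face (Suc p) j (prism_simplex p i H) = restrict (\<lambda>x. H (prism_map i (simplical_face j x))) (standard_simplex p)"
proof
  fix x show "singular_face (Suc p) j (prism_simplex p i H) x = restrict (\<lambda>x. H (prism_map i (simplical_face j x))) (standard_simplex p) x"
    using face_in_simplex[OF j, of x] by (simp add: singular_face_def prism_simplex_def)
qed

lemma singular_face_prism_lt:
  assumes "j < i" "i \<le> Suc p"
  shows "singular_face (Suc (Suc p)) j (prism_simplex (Suc p) i H) = prism_simplex p (i - 1) (prism_face (Suc p) j H)"
proof -
  have "singular_face (Suc (Suc p)) j (prism_simplex (Suc p) i H) = restrict (\<lambda>x. H (prism_map i (simplical_face j x))) (standard_simplex (Suc p))"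
    using assms by (intro singular_face_prism_simplex) simp
  also have "\<dots> = prism_simplex p (i - 1) (prism_face (Suc p) j H)"
  proof
    fix x
    have "prism_map (i - 1) x \<in> {0..1} \<times> standard_simplex p" if "x \<in> standard_simplex (Suc p)"
      using assms by (intro prism_map_in that) simp
    then show "restrict (\<lambda>x. H (prism_map i (simplical_face j x))) (standard_simplex (Suc p)) x = prism_simplex p (i - 1) (prism_face (Suc p) j H) x"
      by (simp add: prism_simplex_def prism_face_def prism_map_face_lt[OF assms(1)])
  qed
  finally show ?thesis .
qed

lemma singular_face_prism_gt:
  assumes "Suc i < j" "j \<le> Suc (Suc p)"
  shows "singular_face (Suc (Suc p)) j (prism_simplex (Suc p) i H) = prism_simplex p i (prism_face (Suc p) (j - 1) H)"
proof -
  have "singular_face (Suc (Suc p)) j (prism_simplex (Suc p) i H) = restrict (\<lambda>x. H (prism_map i (simplical_face j x))) (standard_simplex (Suc p))"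
    using assms by (intro singular_face_prism_simplex) simp
  also have "\<dots> = prism_simplex p i (prism_face (Suc p) (j - 1) H)"
  proof
    fix x
    have "prism_map i x \<in> {0..1} \<times> standard_simplex p" if "x \<in> standard_simplex (Suc p)"
      using assms by (intro prism_map_in that) simp
    then show "restrict (\<lambda>x. H (prism_map i (simplical_face j x))) (standard_simplex (Suc p)) x = prism_simplex p i (prism_face (Suc p) (j - 1) H) x"
      by (simp add: prism_simplex_def prism_face_def prism_map_face_gt[OF assms(1)])
  qed
  finally show ?thesis .
qed

lemma singular_face_prism_mid:
  assumes "Suc i \<le> p"
  shows "singular_face (Suc p) (Suc i) (prism_simplex p i H) = singular_face (Suc p) (Suc i) (prism_simplex p (Suc i) H)"
  using assms by (simp add: singular_face_prism_simplex prism_map_face_mid)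

lemma singular_face_prism_top:
  "singular_face (Suc p) 0 (prism_simplex p 0 H) = restrict (\<lambda>x. H (1, x)) (standard_simplex p)"
  by (simp add: singular_face_prism_simplex prism_map_face_0)

lemma singular_face_prism_bottom:
  "singular_face (Suc p) (Suc p) (prism_simplex p p H) = restrict (\<lambda>x. H (0, x)) (standard_simplex p)"
proof
  fix x
  have "(\<Sum>l\<le>p. x l) = 1" if "x \<in> standard_simplex p" using that by (simp add: standard_simplex_def)
  then show "singular_face (Suc p) (Suc p) (prism_simplex p p H) x = restrict (\<lambda>x. H (0, x)) (standard_simplex p) x"
    by (simp add: singular_face_prism_simplex prism_map_face_mid)
qed

text \<open>Dual to the prism operator on chains, hence it lowers the degree by one. The homotopies
  \<open>h p s\<close> are given simplex by simplex and need not come from a homotopy of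
  maps.\<close>

definition prism_cochain ::
    "'a topology \<Rightarrow> (nat \<Rightarrow> ((nat \<Rightarrow> real) \<Rightarrow> 'a) \<Rightarrow> real \<times> (nat \<Rightarrow> real) \<Rightarrow> 'b) \<Rightarrow> ('b, 'k::field) cochain \<Rightarrow> ('a, 'k) cochain" where
  "prism_cochain A h c = (\<lambda>p s. if singular_simplex p A s
     then \<Sum>i\<le>p. (-1) ^ i * c (Suc p) (prism_simplex p i (h p s)) else 0)"

lemma prism_cochain_homotopy:
  fixes c :: "('b, 'k::field) cochain"
  assumes cont: "\<And>p s. singular_simplex p A s \<Longrightarrow> continuous_map (top_of_set ({0..1} \<times> standard_simplex p)) B (h p s)"
    and face: "\<And>p s k. singular_simplex (Suc p) A s \<Longrightarrow> k \<le> Suc p \<Longrightarrow>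
      prism_face (Suc p) k (h (Suc p) s) = h p (singular_face (Suc p) k s)"
    and s: "singular_simplex p A s"
  shows "coboundary A (prism_cochain A h c) p s + prism_cochain A h (coboundary B c) p s =
    c p (restrict (\<lambda>x. h p s (1, x)) (standard_simplex p)) - c p (restrict (\<lambda>x. h p s (0, x)) (standard_simplex p))"
proof -
  define a where "a = (\<lambda>i j. c p (singular_face (Suc p) j (prism_simplex p i (h p s))))"
  \<comment> \<open>For \<open>p = 0\<close> the sums over \<open>i < p\<close> are empty, so
    \<open>p - 1\<close> only matters for positive \<open>p\<close>.\<close>
  define q where "q = (\<lambda>i j. c p (prism_simplex (p - 1) i (prism_face p j (h p s))))"
  have "prism_cochain A h (coboundary B c) p s = (\<Sum>i\<le>p. (-1) ^ i * (\<Sum>j\<le>Suc p. (-1) ^ j * a i j))"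
    unfolding prism_cochain_def using s singular_simplex_prism_simplex[OF cont[OF s]]
    by (auto simp: coboundary_def a_def simp del: sum.atMost_Suc intro!: sum.cong)
  moreover have "coboundary A (prism_cochain A h c) p s = (\<Sum>j\<le>p. (-1) ^ j * (\<Sum>i<p. (-1) ^ i * q i j))"
  proof (cases p)
    case (Suc n)
    have "prism_cochain A h c n (singular_face (Suc n) j s) = (\<Sum>i<p. (-1) ^ i * q i j)" if "j \<le> Suc n" for j
      using singular_simplex_face[OF s[unfolded Suc] that] face[OF s[unfolded Suc] that]
      by (simp add: prism_cochain_def q_def Suc lessThan_Suc_atMost del: sum.atMost_Suc)
    then show ?thesis
      using s by (auto simp: coboundary_def Suc simp del: sum.atMost_Suc sum.lessThan_Suc intro!: sum.cong)
  qed (simp add: coboundary_def)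
  moreover have "(\<Sum>i\<le>p. (-1) ^ i * (\<Sum>j\<le>Suc p. (-1) ^ j * a i j)) + (\<Sum>j\<le>p. (-1) ^ j * (\<Sum>i<p. (-1) ^ i * q i j))
    = a 0 0 - a p (Suc p)"
  proof (rule prism_sum)
    show "a i j = q (i - 1) j" if "j < i" "i \<le> p" for i j
    proof (cases p)
      case (Suc n)
      then show ?thesis using singular_face_prism_lt[of j i n "h p s"] that by (simp add: a_def q_def)
    qed (use that in simp)
    show "a i j = q i (j - 1)" if "Suc i < j" "j \<le> Suc p" for i j
    proof (cases p)
      case (Suc n)
      then show ?thesis using singular_face_prism_gt[of i j n "h p s"] that by (simp add: a_def q_def)
    qed (use that in simp)
    show "a i (Suc i) = a (Suc i) (Suc i)" if "i < p" for i
      using singular_face_prism_mid[of i p "h p s"] that by (simp add: a_def)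
  qed
  ultimately show ?thesis
    by (simp only: add.commute a_def singular_face_prism_top singular_face_prism_bottom)
qed

section \<open>The cochain algebra\<close>

lemma cochainsI: "(\<And>p s. \<not> singular_simplex p X s \<Longrightarrow> c p s = 0) \<Longrightarrow> finite {p. \<exists>s. c p s \<noteq> 0} \<Longrightarrow> c \<in> cochains X"
  by (simp add: cochains_def)

lemma cochains_simplex: "c \<in> cochains X \<Longrightarrow> \<not> singular_simplex p X s \<Longrightarrow> c p s = 0"
  by (simp add: cochains_def)

lemma cochains_finite: "c \<in> cochains X \<Longrightarrow> finite {p. \<exists>s. c p s \<noteq> 0}"
  by (simp add: cochains_def)

lemma cochains_zero: "(\<lambda>p s. 0) \<in> cochains X"
  by (simp add: cochains_def)

lemma cochains_add:
  assumes "c \<in> cochains X" "d \<in> cochains X" shows "(\<lambda>p s. c p s + d p s) \<in> cochains X"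
proof (rule cochainsI)
  show "finite {p. \<exists>s. c p s + d p s \<noteq> 0}"
    by (rule finite_subset[OF _ finite_UnI[OF cochains_finite[OF assms(1)] cochains_finite[OF assms(2)]]]) auto
qed (use assms in \<open>simp add: cochains_simplex\<close>)

lemma cochains_scale:
  assumes "c \<in> cochains X" shows "(\<lambda>p s. a p * c p s) \<in> cochains X"
proof (rule cochainsI)
  show "finite {p. \<exists>s. a p * c p s \<noteq> 0}"
    by (rule finite_subset[OF _ cochains_finite[OF assms]]) auto
qed (use assms in \<open>simp add: cochains_simplex\<close>)

lemma coboundary_add: "coboundary X (\<lambda>p s. c p s + d p s) = (\<lambda>p s. coboundary X c p s + coboundary X d p s)"
  by (simp add: coboundary_def fun_eq_iff sum.distrib distrib_left)

lemma coboundary_scale: "coboundary X (\<lambda>p s. a * c p s) = (\<lambda>p s. a * coboundary X c p s)"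
  by (simp add: coboundary_def fun_eq_iff sum_distrib_left mult_ac)

lemma coboundary_zero: "coboundary X (\<lambda>p s. 0) = (\<lambda>p s. 0)"
  by (simp add: coboundary_def fun_eq_iff)

lemma coboundary_Suc: "singular_simplex (Suc n) X s \<Longrightarrow>
    coboundary X c (Suc n) s = (\<Sum>k\<le>Suc n. (-1) ^ k * c n (singular_face (Suc n) k s))"
  by (simp add: coboundary_def del: sum.atMost_Suc)

lemma coboundary_0: "coboundary X c 0 s = 0"
  by (simp add: coboundary_def)

lemma coboundary_nonsimplex: "\<not> singular_simplex p X s \<Longrightarrow> coboundary X c p s = 0"
  by (simp add: coboundary_def)

lemma coboundary_in_cochains: assumes "c \<in> cochains X" shows "coboundary X c \<in> cochains X"
proof (rule cochainsI)
  have "p \<in> Suc ` {p. \<exists>s. c p s \<noteq> 0}" if "coboundary X c p s \<noteq> 0" for p s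
  proof (cases p)
    case (Suc n)
    have "\<exists>s. c n s \<noteq> 0"
    proof (rule ccontr)
      assume "\<not> ?thesis"
      then have "coboundary X c p s = 0" by (simp add: coboundary_def Suc)
      with that show False by simp
    qed
    then show ?thesis by (simp add: Suc)
  qed (use that in \<open>simp add: coboundary_0\<close>)
  then show "finite {p. \<exists>s. coboundary X c p s \<noteq> 0}"
    by (intro finite_subset[OF _ finite_imageI[OF cochains_finite[OF assms], of Suc]]) blast
qed (simp add: coboundary_def)

lemma coboundary_coboundary: "coboundary X (coboundary X c) = (\<lambda>p s. 0)"
proof (intro ext)
  fix p s
  show "coboundary X (coboundary X c) p s = 0"
  proof (cases "singular_simplex p X s")
    case s: True
    show ?thesis
    proof (cases p)
      case (Suc m)
      have sk: "singular_simplex m X (singular_face p k s)" if "k \<le> p" for k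
        using singular_simplex_face[of m X s k] s that Suc by simp
      show ?thesis
      proof (cases m)
        case 0
        then show ?thesis by (simp add: Suc coboundary_def)
      next
        case m: (Suc n)
        let ?a = "\<lambda>k j. c n (singular_face m j (singular_face p k s))"
        have "coboundary X (coboundary X c) p s = (\<Sum>k\<le>p. (-1) ^ k * coboundary X c m (singular_face p k s))"
          using s unfolding Suc by (rule coboundary_Suc)
        also have "\<dots> = (\<Sum>k\<le>p. \<Sum>j\<le>m. (-1) ^ (k + j) * ?a k j)"
          using sk by (intro sum.cong refl) (simp add: m coboundary_Suc sum_distrib_left power_add mult.assoc del: sum.atMost_Suc)
        also have "\<dots> = 0"
          unfolding Suc
        proof (rule alternating_face_sum)
          fix j k assume jk: "j < k" "k \<le> Suc m"
          show "c n (singular_face m j (singular_face (Suc m) k s)) = c n (singular_face m (k - 1) (singular_face (Suc m) j s))"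
            using singular_face_singular_face[OF jk, of s] m by simp
        qed
        finally show ?thesis .
      qed
    qed (simp add: coboundary_0)
  qed (simp add: coboundary_nonsimplex)
qed

definition simplex_shift :: "nat \<Rightarrow> (nat \<Rightarrow> real) \<Rightarrow> nat \<Rightarrow> real" where
  "simplex_shift p x = (\<lambda>i. if i < p then 0 else x (i - p))"

lemma back_face_eq: "back_face p q s = restrict (\<lambda>x. s (simplex_shift p x)) (standard_simplex q)"
  by (simp add: back_face_def simplex_shift_def)

lemma simplex_shift_in: assumes x: "x \<in> standard_simplex q" shows "simplex_shift p x \<in> standard_simplex (p + q)"
proof -
  have "(\<Sum>i\<le>p + q. simplex_shift p x i) = (\<Sum>i<p. simplex_shift p x i) + (\<Sum>i\<in>{p..p + q}. simplex_shift p x i)"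
    by (rule sum_atMost_split) simp
  also have "(\<Sum>i\<in>{p..p + q}. simplex_shift p x i) = (\<Sum>i\<in>{0..q}. x i)"
    using sum.shift_bounds_cl_nat_ivl[of "simplex_shift p x" 0 p q] by (simp add: simplex_shift_def add.commute)
  finally have "(\<Sum>i\<le>p + q. simplex_shift p x i) = 1"
    using x by (simp add: simplex_shift_def standard_simplex_def atMost_atLeast0)
  then show ?thesis using x by (auto simp: standard_simplex_def simplex_shift_def)
qed

lemma singular_simplex_front: "singular_simplex n X s \<Longrightarrow> p \<le> n \<Longrightarrow> singular_simplex p X (front_face p s)"
  unfolding front_face_def
  by (rule singular_simplex_restrict) (auto simp: singular_simplex_iff intro: continuous_map_on_subset dest: standard_simplex_mono)

lemma singular_simplex_back:
  assumes "singular_simplex (p + q) X s" shows "singular_simplex q X (back_face p q s)"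
  unfolding back_face_eq
proof (rule singular_simplex_restrict)
  have c: "continuous_on S (simplex_shift p)" for S
  proof (rule continuous_on_coordinatewise_then_product)
    show "continuous_on S (\<lambda>x. simplex_shift p x i)" for i
      unfolding simplex_shift_def by (cases "i < p") (simp_all add: continuous_on_coordinate[OF continuous_on_id])
  qed
  show "continuous_map (top_of_set (standard_simplex q)) X (\<lambda>x. s (simplex_shift p x))"
    by (rule continuous_map_compose_on[of "standard_simplex (p + q)", OF _ c simplex_shift_in])
      (use assms in \<open>simp add: singular_simplex_iff\<close>)
qed

lemma restrict_cong': "(\<And>x. x \<in> A \<Longrightarrow> f x = g x) \<Longrightarrow> restrict f A = restrict g A"
  by (rule restrict_ext)

lemma front_face_low:
  assumes "k \<le> p" "p \<le> n"
  shows "front_face p (singular_face (Suc n) k s) = singular_face (Suc p) k (front_face (Suc p) s)"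
proof -
  have "x \<in> standard_simplex n" "simplical_face k x \<in> standard_simplex (Suc p)" if "x \<in> standard_simplex p" for x
    using that assms standard_simplex_mono[of p n] face_in_simplex[of k p x] by auto
  then show ?thesis
    unfolding front_face_def singular_face_def diff_Suc_Suc diff_zero by (intro restrict_cong') simp
qed

lemma simplical_face_above: assumes "x \<in> standard_simplex p" "p < k" shows "simplical_face k x = x"
proof
  fix i show "simplical_face k x i = x i"
    using simplex_coord(3)[OF assms(1), of i] simplex_coord(3)[OF assms(1), of "i - 1"] assms(2)
    by (cases "i < k"; cases "i = k") (simp_all add: simplical_face_def)
qed

lemma front_face_high:
  assumes "p < k" "p \<le> n"
  shows "front_face p (singular_face (Suc n) k s) = front_face p s"
proof -
  have "x \<in> standard_simplex n" "simplical_face k x = x" if "x \<in> standard_simplex p" for x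
    using that assms standard_simplex_mono[of p n] simplical_face_above[OF that assms(1)] by auto
  then show ?thesis
    unfolding front_face_def singular_face_def diff_Suc_Suc diff_zero by (intro restrict_cong') simp
qed

lemma front_face_last: "singular_face (Suc p) (Suc p) (front_face (Suc p) s) = front_face p s"
proof -
  have "x \<in> standard_simplex (Suc p)" "simplical_face (Suc p) x = x" if "x \<in> standard_simplex p" for x
    using that standard_simplex_mono[of p "Suc p"] simplical_face_above[OF that, of "Suc p"] by auto
  then show ?thesis
    unfolding front_face_def singular_face_def diff_Suc_Suc diff_zero by (intro restrict_cong') simp
qed

lemma face_shift_low: assumes "k \<le> p" shows "simplical_face k (simplex_shift p x) = simplex_shift (Suc p) x"
proof
  fix i show "simplical_face k (simplex_shift p x) i = simplex_shift (Suc p) x i"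
    using assms by (cases i) (auto simp: simplical_face_def simplex_shift_def)
qed

lemma face_shift_high: assumes "p < k" shows "simplical_face k (simplex_shift p x) = simplex_shift p (simplical_face (k - p) x)"
proof
  fix i
  obtain m where k: "k = p + m" "m > 0" using assms less_imp_add_positive by blast
  show "simplical_face k (simplex_shift p x) i = simplex_shift p (simplical_face (k - p) x) i"
  proof (cases "i < p")
    case False
    then obtain l where i: "i = p + l" using le_Suc_ex not_less by blast
    show ?thesis unfolding i k using k(2) by (cases l) (simp_all add: simplical_face_def simplex_shift_def)
  qed (use assms in \<open>simp add: simplical_face_def simplex_shift_def\<close>)
qed

lemma back_face_low:
  assumes "k \<le> p"
  shows "back_face p q (singular_face (Suc (p + q)) k s) = back_face (Suc p) q s"
  unfolding back_face_eq singular_face_def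
  by (rule restrict_cong') (simp add: simplex_shift_in face_shift_low[OF assms])

lemma back_face_high:
  assumes "p < k" "k \<le> Suc (p + q)"
  shows "back_face p q (singular_face (Suc (p + q)) k s) = singular_face (Suc q) (k - p) (back_face p (Suc q) s)"
  unfolding back_face_eq singular_face_def diff_Suc_Suc diff_zero
proof (rule restrict_cong')
  fix x assume x: "x \<in> standard_simplex q"
  have "simplical_face (k - p) x \<in> standard_simplex (Suc q)" using assms x by (intro face_in_simplex) auto
  then show "restrict (s \<circ> simplical_face k) (standard_simplex (p + q)) (simplex_shift p x) =
    (restrict (\<lambda>x. s (simplex_shift p x)) (standard_simplex (Suc q)) \<circ> simplical_face (k - p)) x"
    using simplex_shift_in[OF x] face_shift_high[OF assms(1)] by simp
qed

lemma back_face_first: "singular_face (Suc q) 0 (back_face p (Suc q) s) = back_face (Suc p) q s"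
  unfolding back_face_eq singular_face_def diff_Suc_Suc diff_zero
proof (rule restrict_cong')
  fix x assume x: "x \<in> standard_simplex q"
  have "simplex_shift p (simplical_face 0 x) = simplex_shift (Suc p) x"
    by (auto simp: simplex_shift_def simplical_face_def fun_eq_iff)
  then show "(restrict (\<lambda>x. s (simplex_shift p x)) (standard_simplex (Suc q)) \<circ> simplical_face 0) x = s (simplex_shift (Suc p) x)"
    using face_in_simplex[of 0 q x] x by simp
qed

lemma cup_in_cochains:
  assumes c: "c \<in> cochains X" and d: "d \<in> cochains X"
  shows "cup_product X c d \<in> cochains X"
proof (rule cochainsI)
  let ?S = "{p. \<exists>s. c p s \<noteq> 0}" and ?T = "{p. \<exists>s. d p s \<noteq> 0}"
  have "n \<in> (\<lambda>(p, q). p + q) ` (?S \<times> ?T)" if "cup_product X c d n s \<noteq> 0" for n s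
  proof -
    from that have "\<exists>p\<in>{..n}. c p (front_face p s) * d (n - p) (back_face p (n - p) s) \<noteq> 0"
      unfolding cup_product_def by (metis (no_types, lifting) sum.neutral)
    then obtain p where "p \<le> n" "c p (front_face p s) \<noteq> 0" "d (n - p) (back_face p (n - p) s) \<noteq> 0" by auto
    then show ?thesis by (intro image_eqI[of _ _ "(p, n - p)"]) auto
  qed
  then show "finite {n. \<exists>s. cup_product X c d n s \<noteq> 0}"
    by (intro finite_subset[OF _ finite_imageI[OF finite_cartesian_product[OF cochains_finite[OF c] cochains_finite[OF d]]]]) blast
qed (simp add: cup_product_def)

lemma cup_add_left: "cup_product X (\<lambda>p s. c p s + c' p s) d = (\<lambda>p s. cup_product X c d p s + cup_product X c' d p s)"
  by (simp add: cup_product_def fun_eq_iff sum.distrib distrib_right)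

lemma cup_add_right: "cup_product X c (\<lambda>p s. d p s + d' p s) = (\<lambda>p s. cup_product X c d p s + cup_product X c d' p s)"
  by (simp add: cup_product_def fun_eq_iff sum.distrib distrib_left)

lemma cup_scale_left: "cup_product X (\<lambda>p s. a * c p s) d = (\<lambda>p s. a * cup_product X c d p s)"
  by (simp add: cup_product_def fun_eq_iff sum_distrib_left mult_ac)

lemma cup_scale_right: "cup_product X c (\<lambda>p s. a * d p s) = (\<lambda>p s. a * cup_product X c d p s)"
  by (simp add: cup_product_def fun_eq_iff sum_distrib_left mult_ac)

lemma cup_zero_right: "cup_product X c (\<lambda>p s. 0) = (\<lambda>p s. 0)"
  by (simp add: cup_product_def fun_eq_iff)

lemma cup_zero_left: "cup_product X (\<lambda>p s. 0) c = (\<lambda>p s. 0)"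
  by (simp add: cup_product_def fun_eq_iff)

text \<open>The Leibniz rule. Cochains are sums over all degrees, so the sign is a factor
  \<open>(-1) ^ p\<close> on the degree \<open>p\<close> part. A face with index at most
  \<open>p\<close> acts on the front factor and a later one on the back factor; the last face of the
  front and the first face of the back yield the same product and complete the two
  coboundaries.\<close>

lemma coboundary_cup:
  "coboundary X (cup_product X c d) =
    (\<lambda>p s. cup_product X (coboundary X c) d p s + cup_product X (\<lambda>p s. (-1) ^ p * c p s) (coboundary X d) p s)"
proof (intro ext)
  fix m s
  show "coboundary X (cup_product X c d) m s =
    cup_product X (coboundary X c) d m s + cup_product X (\<lambda>p s. (-1) ^ p * c p s) (coboundary X d) m s"
  proof (cases "singular_simplex m X s")
    case s: True
    show ?thesis
    proof (cases m)
      case 0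
      then show ?thesis using s by (simp add: cup_product_def coboundary_0)
    next
      case (Suc n)
      have sn: "singular_simplex (Suc n) X s" using s Suc by simp
      define F where "F = (\<lambda>p k. c p (singular_face (Suc p) k (front_face (Suc p) s)))"
      define G where "G = (\<lambda>p j. d (n - p) (singular_face (Suc (n - p)) j (back_face p (Suc (n - p)) s)))"
      define D where "D = (\<lambda>p. d (n - p) (back_face (Suc p) (n - p) s))"
      define C where "C = (\<lambda>p. c p (front_face p s))"
      have FC: "F p (Suc p) = C p" for p by (simp add: F_def C_def front_face_last)
      have GD: "G p 0 = D p" for p by (simp add: G_def D_def back_face_first)
      have low: "c p (front_face p (singular_face (Suc n) k s)) * d (n - p) (back_face p (n - p) (singular_face (Suc n) k s)) = F p k * D p"
        if "k \<le> p" "p \<le> n" for k p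
        using front_face_low[OF that, of s] back_face_low[OF that(1), of "n - p" s] that by (simp add: F_def D_def)
      have high: "c p (front_face p (singular_face (Suc n) k s)) * d (n - p) (back_face p (n - p) (singular_face (Suc n) k s)) = C p * G p (k - p)"
        if "p < k" "k \<le> Suc n" "p \<le> n" for k p
        using front_face_high[OF that(1,3), of s] back_face_high[OF that(1), of "n - p" s] that by (simp add: C_def G_def)
      have "coboundary X (cup_product X c d) m s = (\<Sum>k\<le>Suc n. (-1) ^ k * cup_product X c d n (singular_face (Suc n) k s))"
        unfolding Suc by (rule coboundary_Suc[OF sn])
      also have "\<dots> = (\<Sum>k\<le>Suc n. \<Sum>p\<le>n. (-1) ^ k * (c p (front_face p (singular_face (Suc n) k s)) *
         d (n - p) (back_face p (n - p) (singular_face (Suc n) k s))))"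
        using singular_simplex_face[OF sn] by (intro sum.cong refl) (simp add: cup_product_def sum_distrib_left)
      also have "\<dots> = (\<Sum>p\<le>n. \<Sum>k\<le>Suc n. (-1) ^ k * (c p (front_face p (singular_face (Suc n) k s)) *
         d (n - p) (back_face p (n - p) (singular_face (Suc n) k s))))"
        by (rule sum.swap)
      also have "\<dots> = (\<Sum>p\<le>n. (\<Sum>k\<le>Suc p. (-1) ^ k * F p k) * D p + (-1) ^ p * C p * (\<Sum>j\<le>Suc (n - p). (-1) ^ j * G p j))"
      proof (rule sum.cong[OF refl])
        fix p assume "p \<in> {..n}"
        then have p: "p \<le> n" by simp
        let ?t = "\<lambda>k. (-1) ^ k * (c p (front_face p (singular_face (Suc n) k s)) *
         d (n - p) (back_face p (n - p) (singular_face (Suc n) k s)))"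
        have "sum ?t {..Suc n} = sum ?t {..<Suc p} + sum ?t {Suc p..Suc n}"
          using p by (intro sum_atMost_split) simp
        also have "sum ?t {..<Suc p} = (\<Sum>k\<le>p. (-1) ^ k * F p k) * D p"
          using p low[OF _ p] unfolding lessThan_Suc_atMost sum_distrib_right by (intro sum.cong) auto
        also have "sum ?t {Suc p..Suc n} = (\<Sum>k\<in>{1 + p..Suc (n - p) + p}. (-1) ^ k * (C p * G p (k - p)))"
          using p high by (intro sum.cong) auto
        also have "\<dots> = (\<Sum>j\<in>{1..Suc (n - p)}. (-1) ^ (j + p) * (C p * G p j))"
          unfolding sum.shift_bounds_cl_nat_ivl by simp
        also have "\<dots> = (-1) ^ p * C p * (\<Sum>j\<in>{1..Suc (n - p)}. (-1) ^ j * G p j)"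
          by (simp add: sum_distrib_left power_add mult_ac del: sum.cl_ivl_Suc)
        \<comment> \<open>The two added terms are \<open>C p * D p\<close> with opposite signs: face
          \<open>p + 1\<close> of the front and face 0 of the back.\<close>
        also have "(\<Sum>k\<le>p. (-1) ^ k * F p k) * D p + (-1) ^ p * C p * (\<Sum>j\<in>{1..Suc (n - p)}. (-1) ^ j * G p j)
           = (\<Sum>k\<le>Suc p. (-1) ^ k * F p k) * D p + (-1) ^ p * C p * (\<Sum>j\<le>Suc (n - p). (-1) ^ j * G p j)"
        proof -
          have "(\<Sum>j\<le>Suc (n - p). (-1) ^ j * G p j) = D p + (\<Sum>j\<in>{1..Suc (n - p)}. (-1) ^ j * G p j)"
            using sum_atMost_split[of 1 "Suc (n - p)" "\<lambda>j. (-1) ^ j * G p j"] by (simp add: GD)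
          then show ?thesis by (simp add: FC algebra_simps)
        qed
        finally show "sum ?t {..Suc n} = (\<Sum>k\<le>Suc p. (-1) ^ k * F p k) * D p + (-1) ^ p * C p * (\<Sum>j\<le>Suc (n - p). (-1) ^ j * G p j)" .
      qed
      also have "\<dots> = (\<Sum>p\<le>n. (\<Sum>k\<le>Suc p. (-1) ^ k * F p k) * D p) + (\<Sum>p\<le>n. (-1) ^ p * C p * (\<Sum>j\<le>Suc (n - p). (-1) ^ j * G p j))"
        by (rule sum.distrib)
      also have "(\<Sum>p\<le>n. (\<Sum>k\<le>Suc p. (-1) ^ k * F p k) * D p) = cup_product X (coboundary X c) d m s"
      proof -
        have "cup_product X (coboundary X c) d m s = (\<Sum>p\<le>n. coboundary X c (Suc p) (front_face (Suc p) s) * D p)"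
          using sn unfolding Suc cup_product_def sum.atMost_Suc_shift by (simp add: coboundary_0 D_def)
        also have "\<dots> = (\<Sum>p\<le>n. (\<Sum>k\<le>Suc p. (-1) ^ k * F p k) * D p)"
          using singular_simplex_front[OF sn] by (intro sum.cong refl) (simp add: coboundary_Suc F_def del: sum.atMost_Suc)
        finally show ?thesis by simp
      qed
      also have "(\<Sum>p\<le>n. (-1) ^ p * C p * (\<Sum>j\<le>Suc (n - p). (-1) ^ j * G p j)) = cup_product X (\<lambda>p s. (-1) ^ p * c p s) (coboundary X d) m s"
      proof -
        have bk: "singular_simplex (Suc (n - p)) X (back_face p (Suc (n - p)) s)" if "p \<le> n" for p
          using singular_simplex_back[of p "Suc (n - p)" X s] sn that by simp
        have "cup_product X (\<lambda>p s. (-1) ^ p * c p s) (coboundary X d) m s =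
           (\<Sum>p\<le>n. (-1) ^ p * c p (front_face p s) * coboundary X d (Suc n - p) (back_face p (Suc n - p) s))"
          using sn unfolding Suc cup_product_def by (simp add: coboundary_0)
        also have "\<dots> = (\<Sum>p\<le>n. (-1) ^ p * C p * (\<Sum>j\<le>Suc (n - p). (-1) ^ j * G p j))"
          using bk by (intro sum.cong refl) (simp add: Suc_diff_le coboundary_Suc C_def G_def del: sum.atMost_Suc)
        finally show ?thesis by simp
      qed
      finally show ?thesis .
    qed
  qed (simp add: coboundary_nonsimplex cup_product_def)
qed

section \<open>Cochain maps induced by simplexwise maps\<close>

text \<open>Generalizes the pullback along a map to assignments of simplices, such as the lift
  \<open>T\<close>, that need not be induced by a map.\<close>

definition simplexwise_pullback ::
    "'a topology \<Rightarrow> (nat \<Rightarrow> ((nat \<Rightarrow> real) \<Rightarrow> 'a) \<Rightarrow> (nat \<Rightarrow> real) \<Rightarrow> 'b) \<Rightarrow> ('b, 'k::field) cochain \<Rightarrow> ('a, 'k) cochain" where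
  "simplexwise_pullback A \<tau> c = (\<lambda>p s. if singular_simplex p A s then c p (\<tau> p s) else 0)"

lemma cochain_pullback_eq: "cochain_pullback X f = simplexwise_pullback X (\<lambda>p. simplex_map p f)"
  by (simp add: cochain_pullback_def simplexwise_pullback_def fun_eq_iff)

lemma simplexwise_pullback_in_cochains:
  assumes c: "c \<in> cochains B" shows "simplexwise_pullback A \<tau> c \<in> cochains A"
proof (rule cochainsI)
  show "finite {p. \<exists>s. simplexwise_pullback A \<tau> c p s \<noteq> 0}"
    by (rule finite_subset[OF _ cochains_finite[OF c]]) (auto simp: simplexwise_pullback_def)
qed (simp add: simplexwise_pullback_def)

lemma coboundary_simplexwise_pullback:
  assumes simp: "\<And>p s. singular_simplex p A s \<Longrightarrow> singular_simplex p B (\<tau> p s)"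
    and face: "\<And>p s k. singular_simplex (Suc p) A s \<Longrightarrow> k \<le> Suc p \<Longrightarrow>
      singular_face (Suc p) k (\<tau> (Suc p) s) = \<tau> p (singular_face (Suc p) k s)"
  shows "coboundary A (simplexwise_pullback A \<tau> c) = simplexwise_pullback A \<tau> (coboundary B c)"
proof (intro ext)
  fix p s
  show "coboundary A (simplexwise_pullback A \<tau> c) p s = simplexwise_pullback A \<tau> (coboundary B c) p s"
  proof (cases "singular_simplex p A s")
    case True
    show ?thesis
    proof (cases p)
      case (Suc n)
      have s: "singular_simplex (Suc n) A s" using True Suc by simp
      show ?thesis
        unfolding Suc coboundary_Suc[OF s] using s simp[OF s] singular_simplex_face[OF s] face[OF s]
        by (auto simp: simplexwise_pullback_def coboundary_Suc simp del: sum.atMost_Suc intro!: sum.cong)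
    qed (simp add: simplexwise_pullback_def coboundary_0)
  qed (simp add: simplexwise_pullback_def coboundary_nonsimplex)
qed

lemma coboundary_pullback:
  assumes f: "continuous_map X Y f"
  shows "coboundary X (cochain_pullback X f c) = cochain_pullback X f (coboundary Y c)"
  unfolding cochain_pullback_eq
  by (rule coboundary_simplexwise_pullback) (use singular_simplex_simplex_map'[OF f] singular_face_simplex_map' in auto)

lemma front_face_simplex_map: "p \<le> n \<Longrightarrow> front_face p (simplex_map n f s) = simplex_map p f (front_face p s)"
  using standard_simplex_mono[of p n] unfolding front_face_def simplex_map_def by (intro restrict_cong') auto

lemma back_face_simplex_map: "back_face p q (simplex_map (p + q) f s) = simplex_map q f (back_face p q s)"
  unfolding back_face_eq simplex_map_def by (intro restrict_cong') (simp add: simplex_shift_in)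

lemma cup_pullback:
  assumes f: "continuous_map X Y f"
  shows "cochain_pullback X f (cup_product Y c d) = cup_product X (cochain_pullback X f c) (cochain_pullback X f d)"
proof (intro ext)
  fix n s
  show "cochain_pullback X f (cup_product Y c d) n s = cup_product X (cochain_pullback X f c) (cochain_pullback X f d) n s"
  proof (cases "singular_simplex n X s")
    case s: True
    have "c p (front_face p (simplex_map n f s)) * d (n - p) (back_face p (n - p) (simplex_map n f s))
      = cochain_pullback X f c p (front_face p s) * cochain_pullback X f d (n - p) (back_face p (n - p) s)" if "p \<le> n" for p
      using singular_simplex_front[OF s that] singular_simplex_back[of p "n - p" X s] s that
        front_face_simplex_map[OF that, of f s] back_face_simplex_map[of p "n - p" f s]
      by (simp add: cochain_pullback_def)
    then show ?thesis
      using s singular_simplex_simplex_map'[OF f s] by (auto simp: cup_product_def cochain_pullback_def[of X f "\<lambda>n s. _ n s"] intro!: sum.cong)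
  qed (simp add: cochain_pullback_def cup_product_def)
qed

lemma cochain_pullback_cong:
  assumes "\<And>x. x \<in> topspace X \<Longrightarrow> f x = g x"
  shows "cochain_pullback X f c = cochain_pullback X g c"
proof -
  have "simplex_map p f s = simplex_map p g s" if "singular_simplex p X s" for p s
    using that assms continuous_map_on_mem unfolding simplex_map_def singular_simplex_iff
    by (intro restrict_cong') fastforce
  then show ?thesis by (intro ext) (simp add: cochain_pullback_def)
qed

lemma cochain_pullback_compose:
  assumes f: "continuous_map X Y f"
  shows "cochain_pullback X f (cochain_pullback Y g c) = cochain_pullback X (g \<circ> f) c"
proof -
  have "simplex_map p g (simplex_map p f s) = simplex_map p (g \<circ> f) s" for p s
    unfolding simplex_map_def by (intro restrict_cong') simp
  then show ?thesis
    using singular_simplex_simplex_map'[OF f] by (intro ext) (simp add: cochain_pullback_def)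
qed

lemma cochain_pullback_add: "cochain_pullback X f (\<lambda>p s. c p s + d p s) = (\<lambda>p s. cochain_pullback X f c p s + cochain_pullback X f d p s)"
  by (simp add: cochain_pullback_def fun_eq_iff)

lemma cochain_pullback_scale: "cochain_pullback X f (\<lambda>p s. a * c p s) = (\<lambda>p s. a * cochain_pullback X f c p s)"
  by (simp add: cochain_pullback_def fun_eq_iff)

section \<open>The cohomology ring\<close>

lemma cocyclesI: "c \<in> cochains X \<Longrightarrow> coboundary X c = (\<lambda>p s. 0) \<Longrightarrow> c \<in> cocycles X"
  by (simp add: cocycles_def)

lemma cocyclesD: "c \<in> cocycles X \<Longrightarrow> c \<in> cochains X" "c \<in> cocycles X \<Longrightarrow> coboundary X c = (\<lambda>p s. 0)"
  by (simp_all add: cocycles_def)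

lemma coboundariesE:
  assumes "b \<in> coboundaries X" obtains e where "e \<in> cochains X" "b = coboundary X e"
  using assms by (auto simp: coboundaries_def)

lemma coboundariesI: "e \<in> cochains X \<Longrightarrow> coboundary X e \<in> coboundaries X"
  by (simp add: coboundaries_def)

lemma coboundaries_subset: "coboundaries X \<subseteq> cocycles X"
  by (auto simp: coboundaries_def cocycles_def coboundary_in_cochains coboundary_coboundary)

lemma cocycles_add: "c \<in> cocycles X \<Longrightarrow> d \<in> cocycles X \<Longrightarrow> (\<lambda>p s. c p s + d p s) \<in> cocycles X"
  by (simp add: cocycles_def cochains_add coboundary_add)

lemma cocycles_scale: "c \<in> cocycles X \<Longrightarrow> (\<lambda>p s. a * c p s) \<in> cocycles X"
  by (simp add: cocycles_def cochains_scale[where a = "\<lambda>_. a"] coboundary_scale)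

lemma cocycles_zero: "(\<lambda>p s. 0) \<in> cocycles X"
  by (simp add: cocycles_def cochains_zero coboundary_zero)

lemma coboundaries_zero: "(\<lambda>p s. 0) \<in> coboundaries X"
  using coboundariesI[OF cochains_zero[of X]] by (simp add: coboundary_zero)

lemma coboundaries_add:
  assumes "b \<in> coboundaries X" "b' \<in> coboundaries X" shows "(\<lambda>p s. b p s + b' p s) \<in> coboundaries X"
proof -
  obtain e e' where "e \<in> cochains X" "b = coboundary X e" "e' \<in> cochains X" "b' = coboundary X e'"
    using assms by (auto elim!: coboundariesE)
  then show ?thesis using coboundariesI[OF cochains_add[of e X e']] by (simp add: coboundary_add)
qed

lemma coboundaries_scale:
  assumes "b \<in> coboundaries X" shows "(\<lambda>p s. a * b p s) \<in> coboundaries X"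
proof -
  obtain e where "e \<in> cochains X" "b = coboundary X e" using assms by (auto elim!: coboundariesE)
  then show ?thesis using coboundariesI[OF cochains_scale[of e X "\<lambda>_. a"]] by (simp add: coboundary_scale)
qed

lemma coboundaries_diff:
  assumes "b \<in> coboundaries X" "b' \<in> coboundaries X" shows "(\<lambda>p s. b p s - b' p s) \<in> coboundaries X"
  using coboundaries_add[OF assms(1) coboundaries_scale[OF assms(2), of "-1"]] by simp

text \<open>The sign of the Leibniz rule as an involution on inhomogeneous cochains. It preserves
  cocycles, so for a cocycle \<open>c\<close> the product of \<open>c\<close> with the coboundary of
  \<open>e\<close> is the coboundary of the product of \<open>twist c\<close> with
  \<open>e\<close>.\<close>

definition twist :: "('a, 'k::field) cochain \<Rightarrow> ('a, 'k) cochain" where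
  "twist c = (\<lambda>p s. (-1) ^ p * c p s)"

lemma twist_twist: "twist (twist c) = c"
  by (simp add: twist_def fun_eq_iff flip: mult.assoc power_mult_distrib)

lemma coboundary_twist: assumes "coboundary X c = (\<lambda>p s. 0)" shows "coboundary X (twist c) = (\<lambda>p s. 0)"
proof (intro ext)
  fix p s show "coboundary X (twist c) p s = 0"
  proof (cases "singular_simplex p X s \<and> p \<noteq> 0")
    case True
    then obtain n where p: "p = Suc n" and s: "singular_simplex (Suc n) X s" by (cases p) auto
    have "coboundary X (twist c) p s = (-1) ^ n * coboundary X c (Suc n) s"
      unfolding p coboundary_Suc[OF s] by (simp add: twist_def sum_distrib_left mult_ac del: sum.atMost_Suc)
    then show ?thesis using assms by simp
  qed (auto simp: coboundary_0 coboundary_nonsimplex)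
qed

lemma twist_in_cochains: "c \<in> cochains X \<Longrightarrow> twist c \<in> cochains X"
  unfolding twist_def by (rule cochains_scale)

lemma coboundary_cup_twist: "coboundary X (cup_product X c d) =
    (\<lambda>p s. cup_product X (coboundary X c) d p s + cup_product X (twist c) (coboundary X d) p s)"
  by (simp add: coboundary_cup twist_def)

lemma cocycles_cup: "c \<in> cocycles X \<Longrightarrow> d \<in> cocycles X \<Longrightarrow> cup_product X c d \<in> cocycles X"
  by (simp add: cocycles_def cup_in_cochains coboundary_cup_twist cup_zero_left cup_zero_right)

lemma coboundaries_cup_left:
  assumes "b \<in> coboundaries X" "d \<in> cocycles X" shows "cup_product X b d \<in> coboundaries X"
proof -
  obtain e where e: "e \<in> cochains X" "b = coboundary X e" using assms by (auto elim!: coboundariesE)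
  have "cup_product X b d = coboundary X (cup_product X e d)"
    using cocyclesD(2)[OF assms(2)] by (simp add: coboundary_cup_twist cup_zero_right e(2))
  then show ?thesis using coboundariesI[OF cup_in_cochains[OF e(1) cocyclesD(1)[OF assms(2)]]] by simp
qed

lemma coboundaries_cup_right:
  assumes "c \<in> cocycles X" "b \<in> coboundaries X" shows "cup_product X c b \<in> coboundaries X"
proof -
  obtain e where e: "e \<in> cochains X" "b = coboundary X e" using assms by (auto elim!: coboundariesE)
  have "cup_product X c b = coboundary X (cup_product X (twist c) e)"
    using coboundary_twist[OF cocyclesD(2)[OF assms(1)]]
    by (simp add: coboundary_cup_twist cup_zero_left twist_twist e(2))
  then show ?thesis
    using coboundariesI[OF cup_in_cochains[OF twist_in_cochains[OF cocyclesD(1)[OF assms(1)]] e(1)]] by simp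
qed

definition unit_cochain :: "'a topology \<Rightarrow> ('a, 'k::field) cochain" where
  "unit_cochain X = (\<lambda>p s. if p = 0 \<and> singular_simplex 0 X s then 1 else 0)"

lemma unit_cochain_cocycle: "unit_cochain X \<in> cocycles X"
proof (rule cocyclesI)
  show "unit_cochain X \<in> cochains X"
    by (rule cochainsI) (auto simp: unit_cochain_def intro: finite_subset[of _ "{0}"])
  show "coboundary X (unit_cochain X) = (\<lambda>p s. 0)"
  proof (intro ext)
    fix p s show "coboundary X (unit_cochain X) p s = 0"
    proof (cases "singular_simplex p X s \<and> p \<noteq> 0")
      case True
      then obtain n where p: "p = Suc n" and s: "singular_simplex (Suc n) X s" by (cases p) auto
      show ?thesis
        using singular_simplex_face[OF s] unfolding p coboundary_Suc[OF s] by (cases n) (auto simp: unit_cochain_def)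
    qed (auto simp: coboundary_0 coboundary_nonsimplex)
  qed
qed

lemma cohomology_class_eq: "cohomology_class X c = {\<lambda>p s. b p s + c p s | b. b \<in> coboundaries X}"
  by (auto simp: cohomology_class_def a_r_coset_def' cocycle_ring_def)

lemma cohomology_class_mem: "d \<in> cohomology_class X c \<longleftrightarrow> (\<lambda>p s. d p s - c p s) \<in> coboundaries X"
proof
  assume "(\<lambda>p s. d p s - c p s) \<in> coboundaries X"
  then show "d \<in> cohomology_class X c"
    unfolding cohomology_class_eq by (intro CollectI exI[of _ "\<lambda>p s. d p s - c p s"]) simp
qed (auto simp: cohomology_class_eq)

lemma cohomology_class_self: "c \<in> cohomology_class X c"
  by (simp add: cohomology_class_mem coboundaries_zero)

lemma cohomology_class_eq_iff: "cohomology_class X c = cohomology_class X d \<longleftrightarrow> (\<lambda>p s. c p s - d p s) \<in> coboundaries X"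
proof
  assume "cohomology_class X c = cohomology_class X d"
  then have "c \<in> cohomology_class X d" using cohomology_class_self[of c X] by simp
  then show "(\<lambda>p s. c p s - d p s) \<in> coboundaries X" by (simp add: cohomology_class_mem)
next
  assume cd: "(\<lambda>p s. c p s - d p s) \<in> coboundaries X"
  have "x \<in> cohomology_class X c \<longleftrightarrow> x \<in> cohomology_class X d" for x
    using coboundaries_add[OF _ cd, of "\<lambda>p s. x p s - c p s"] coboundaries_diff[OF _ cd, of "\<lambda>p s. x p s - d p s"]
    by (auto simp: cohomology_class_mem)
  then show "cohomology_class X c = cohomology_class X d" by blast
qed

lemma cohomology_class_mem_cocycle:
  assumes "d \<in> cohomology_class X c" "c \<in> cocycles X" shows "d \<in> cocycles X"
proof -
  have "(\<lambda>p s. d p s - c p s) \<in> cocycles X" using assms(1) coboundaries_subset by (auto simp: cohomology_class_mem)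
  from cocycles_add[OF this assms(2)] show ?thesis by simp
qed

text \<open>Operations on classes are unions over representatives; they are well defined once the
  class of the result does not depend on the representative.\<close>

lemma UN_class_const:
  assumes "\<And>d. d \<in> cohomology_class X c \<Longrightarrow> F d = S" shows "(\<Union>d \<in> cohomology_class X c. F d) = S"
  using assms cohomology_class_self[of c X] by blast

lemma cohomology_carrier: "carrier (cohomology X) = cohomology_class X ` cocycles X"
  by (auto simp: cohomology_def ring.defs module.defs FactRing_def A_RCOSETS_def' cohomology_class_def cocycle_ring_def)

lemma cohomology_one: "\<one>\<^bsub>cohomology X\<^esub> = cohomology_class X (unit_cochain X)"
  by (simp add: cohomology_def ring.defs module.defs FactRing_def cohomology_class_def cocycle_ring_def unit_cochain_def)

lemma cohomology_zero: "\<zero>\<^bsub>cohomology X\<^esub> = cohomology_class X (\<lambda>p s. 0)"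
proof -
  have "\<zero>\<^bsub>cohomology X\<^esub> = coboundaries X"
    by (simp add: cohomology_def ring.defs module.defs FactRing_def)
  also have "\<dots> = cohomology_class X (\<lambda>p s. 0)" by (auto simp: cohomology_class_eq)
  finally show ?thesis .
qed

lemma cohomology_mult:
  assumes c: "c \<in> cocycles X" and d: "d \<in> cocycles X"
  shows "cohomology_class X c \<otimes>\<^bsub>cohomology X\<^esub> cohomology_class X d = cohomology_class X (cup_product X c d)"
proof -
  have "cohomology_class X c \<otimes>\<^bsub>cohomology X\<^esub> cohomology_class X d
    = (\<Union>a \<in> cohomology_class X c. \<Union>b \<in> cohomology_class X d. cohomology_class X (cup_product X a b))"
    by (simp add: cohomology_def ring.defs module.defs FactRing_def rcoset_mult_def)
      (simp add: cohomology_class_def[of X "cup_product X _ _"] cocycle_ring_def)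
  also have "\<dots> = cohomology_class X (cup_product X c d)"
  proof (intro UN_class_const)
    fix a b assume a: "a \<in> cohomology_class X c" and b: "b \<in> cohomology_class X d"
    \<comment> \<open>Writing products by juxtaposition,
      \<open>a b - c d = (a - c) b + c (b - d)\<close>, and both summands are coboundaries.\<close>
    have "cup_product X (\<lambda>p s. a p s - c p s) b \<in> coboundaries X"
      using a cohomology_class_mem_cocycle[OF b d] by (intro coboundaries_cup_left) (simp_all add: cohomology_class_mem)
    moreover have "cup_product X c (\<lambda>p s. b p s - d p s) \<in> coboundaries X"
      using b c by (intro coboundaries_cup_right) (simp_all add: cohomology_class_mem)
    moreover have "cup_product X (\<lambda>p s. a p s - c p s) b = (\<lambda>p s. cup_product X a b p s - cup_product X c b p s)"
      using cup_add_left[of X a "\<lambda>p s. - 1 * c p s" b] by (simp only: cup_scale_left) simp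
    moreover have "cup_product X c (\<lambda>p s. b p s - d p s) = (\<lambda>p s. cup_product X c b p s - cup_product X c d p s)"
      using cup_add_right[of X c b "\<lambda>p s. - 1 * d p s"] by (simp only: cup_scale_right) simp
    ultimately have "(\<lambda>p s. (cup_product X a b p s - cup_product X c b p s) + (cup_product X c b p s - cup_product X c d p s)) \<in> coboundaries X"
      using coboundaries_add by fastforce
    then show "cohomology_class X (cup_product X a b) = cohomology_class X (cup_product X c d)"
      by (simp add: cohomology_class_eq_iff)
  qed
  finally show ?thesis .
qed

text \<open>Unlike the product, the sum in the quotient ring is the setwise sum of two cosets, so
  both inclusions have to be checked.\<close>

lemma cohomology_add:
  "cohomology_class X c \<oplus>\<^bsub>cohomology X\<^esub> cohomology_class X d = cohomology_class X (\<lambda>p s. c p s + d p s)"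
proof -
  have "cohomology_class X c \<oplus>\<^bsub>cohomology X\<^esub> cohomology_class X d
    = (\<Union>a \<in> cohomology_class X c. \<Union>b \<in> cohomology_class X d. {\<lambda>p s. a p s + b p s})"
    by (simp add: cohomology_def ring.defs module.defs FactRing_def set_add_def' cocycle_ring_def)
  also have "\<dots> = cohomology_class X (\<lambda>p s. c p s + d p s)"
  proof (intro equalityI subsetI)
    fix x assume "x \<in> (\<Union>a \<in> cohomology_class X c. \<Union>b \<in> cohomology_class X d. {\<lambda>p s. a p s + b p s})"
    then obtain a b where "(\<lambda>p s. a p s - c p s) \<in> coboundaries X" "(\<lambda>p s. b p s - d p s) \<in> coboundaries X"
      "x = (\<lambda>p s. a p s + b p s)" by (auto simp: cohomology_class_mem)
    then show "x \<in> cohomology_class X (\<lambda>p s. c p s + d p s)"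
      using coboundaries_add[of "\<lambda>p s. a p s - c p s" X "\<lambda>p s. b p s - d p s"]
      by (simp add: cohomology_class_mem algebra_simps)
  next
    fix x assume "x \<in> cohomology_class X (\<lambda>p s. c p s + d p s)"
    then have "(\<lambda>p s. x p s - d p s) \<in> cohomology_class X c" by (simp add: cohomology_class_mem algebra_simps)
    moreover have "x = (\<lambda>p s. (x p s - d p s) + d p s)" by simp
    ultimately show "x \<in> (\<Union>a \<in> cohomology_class X c. \<Union>b \<in> cohomology_class X d. {\<lambda>p s. a p s + b p s})"
      using cohomology_class_self[of d X] by blast
  qed
  finally show ?thesis .
qed

lemma cohomology_smult:
  "a \<odot>\<^bsub>cohomology X\<^esub> cohomology_class X c = cohomology_class X (\<lambda>p s. a * c p s)"
proof -
  have "a \<odot>\<^bsub>cohomology X\<^esub> cohomology_class X c = (\<Union>d \<in> cohomology_class X c. cohomology_class X (\<lambda>p s. a * d p s))"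
    by (simp add: cohomology_def ring.defs module.defs)
  also have "\<dots> = cohomology_class X (\<lambda>p s. a * c p s)"
  proof (rule UN_class_const)
    fix d assume "d \<in> cohomology_class X c"
    then show "cohomology_class X (\<lambda>p s. a * d p s) = cohomology_class X (\<lambda>p s. a * c p s)"
      using coboundaries_scale[of "\<lambda>p s. d p s - c p s" X a]
      by (simp add: cohomology_class_mem cohomology_class_eq_iff right_diff_distrib)
  qed
  finally show ?thesis .
qed

lemma vectorspace_cohomology: "vectorspace field_ring (cohomology X :: ('k::field, ('a, 'k) cochain set) module)"
proof (rule vs_criteria[OF field_field_ring]; (intro allI ballI impI)?)
  show "\<exists>w\<in>carrier (cohomology X). v \<oplus>\<^bsub>cohomology X\<^esub> w = \<zero>\<^bsub>cohomology X\<^esub>"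
    if v: "v \<in> carrier (cohomology X :: ('k, ('a, 'k) cochain set) module)" for v
  proof -
    obtain c where c: "c \<in> cocycles X" "v = cohomology_class X c" using v by (auto simp: cohomology_carrier)
    show ?thesis
      by (rule bexI[of _ "cohomology_class X (\<lambda>p s. - 1 * c p s)"])
        (use cocycles_scale[OF c(1), of "- 1"] in \<open>auto simp: cohomology_add cohomology_zero cohomology_carrier c(2)\<close>)
  qed
qed (auto simp: cohomology_carrier cohomology_zero cohomology_add cohomology_smult cocycles_zero cocycles_add
    cocycles_scale algebra_simps)

lemma cohomology_map_class:
  assumes f: "continuous_map X Y f"
  shows "cohomology_map X f (cohomology_class Y c) = cohomology_class X (cochain_pullback X f c)"
  unfolding cohomology_map_def
proof (rule UN_class_const)
  fix d assume "d \<in> cohomology_class Y c"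
  then obtain e where e: "e \<in> cochains Y" "(\<lambda>p s. d p s - c p s) = coboundary Y e"
    by (auto simp: cohomology_class_mem elim: coboundariesE)
  have "cochain_pullback X f (\<lambda>p s. d p s - c p s) = coboundary X (cochain_pullback X f e)"
    using coboundary_pullback[OF f] e(2) by metis
  moreover have "cochain_pullback X f e \<in> cochains X"
    unfolding cochain_pullback_eq by (rule simplexwise_pullback_in_cochains[OF e(1)])
  ultimately have "cochain_pullback X f (\<lambda>p s. d p s - c p s) \<in> coboundaries X" by (simp add: coboundariesI)
  moreover have "cochain_pullback X f (\<lambda>p s. d p s - c p s) = (\<lambda>p s. cochain_pullback X f d p s - cochain_pullback X f c p s)"
    by (simp add: cochain_pullback_def fun_eq_iff)
  ultimately show "cohomology_class X (cochain_pullback X f d) = cohomology_class X (cochain_pullback X f c)"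
    by (simp add: cohomology_class_eq_iff)
qed

lemma pullback_cocycle:
  assumes "continuous_map X Y f" "c \<in> cocycles Y" shows "cochain_pullback X f c \<in> cocycles X"
proof (rule cocyclesI)
  show "cochain_pullback X f c \<in> cochains X"
    unfolding cochain_pullback_eq by (rule simplexwise_pullback_in_cochains[OF cocyclesD(1)[OF assms(2)]])
  show "coboundary X (cochain_pullback X f c) = (\<lambda>p s. 0)"
    using coboundary_pullback[OF assms(1), of c] cocyclesD(2)[OF assms(2)] by (simp add: cochain_pullback_def fun_eq_iff)
qed

lemma pullback_unit:
  assumes "continuous_map X Y f" shows "cochain_pullback X f (unit_cochain Y) = unit_cochain X"
  using singular_simplex_simplex_map'[OF assms, of 0] by (auto simp: cochain_pullback_def unit_cochain_def fun_eq_iff)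

section \<open>Weak equivalences induce isomorphisms on cohomology\<close>

lemma prism_cochain_in_cochains:
  assumes c: "c \<in> cochains B" shows "prism_cochain A h c \<in> cochains A"
proof (rule cochainsI)
  have "\<exists>s. c (Suc p) s \<noteq> 0" if "prism_cochain A h c p s \<noteq> 0" for p s
    using that unfolding prism_cochain_def by (metis (no_types, lifting) mult_zero_right sum.neutral)
  then have "{p. \<exists>s. prism_cochain A h c p s \<noteq> 0} \<subseteq> (\<lambda>n. n - 1) ` {p. \<exists>s. c p s \<noteq> 0}"
    by (force simp: image_iff)
  then show "finite {p. \<exists>s. prism_cochain A h c p s \<noteq> 0}"
    by (rule finite_subset) (intro finite_imageI cochains_finite[OF c])
qed (simp add: prism_cochain_def)

lemma prism_cochain_cocycle:
  assumes cont: "\<And>p s. singular_simplex p A s \<Longrightarrow> continuous_map (top_of_set ({0..1} \<times> standard_simplex p)) B (h p s)"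
    and face: "\<And>p s k. singular_simplex (Suc p) A s \<Longrightarrow> k \<le> Suc p \<Longrightarrow>
      prism_face (Suc p) k (h (Suc p) s) = h p (singular_face (Suc p) k s)"
    and c: "c \<in> cocycles B"
  shows "(\<lambda>p s. if singular_simplex p A s then c p (restrict (\<lambda>x. h p s (1, x)) (standard_simplex p))
    - c p (restrict (\<lambda>x. h p s (0, x)) (standard_simplex p)) else 0) \<in> coboundaries A" (is "?d \<in> _")
proof -
  have 0: "prism_cochain A h (\<lambda>p s. 0) = (\<lambda>p s. 0)" by (simp add: prism_cochain_def fun_eq_iff)
  have "coboundary A (prism_cochain A h c) p s = ?d p s" for p s
    using prism_cochain_homotopy[OF cont face, of A p s c] cocyclesD(2)[OF c]
    by (cases "singular_simplex p A s") (simp_all add: 0 coboundary_nonsimplex)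
  then have "coboundary A (prism_cochain A h c) = ?d" by blast
  then show ?thesis using coboundariesI[OF prism_cochain_in_cochains[OF cocyclesD(1)[OF c], of A h]] by metis
qed

text \<open>The prism operator of \<open>H\<close> shows that pulling back along \<open>f\<close>
  and then along \<open>T\<close> changes a cocycle of \<open>Y\<close> by a coboundary, which gives
  injectivity; the one of \<open>G\<close> does the same for cocycles of \<open>X\<close> in the
  opposite order, which gives surjectivity. The lift vanishes in every degree in which
  \<open>c\<close> vanishes, so homogeneous classes have homogeneous lifts and positive ones
  positive lifts.\<close>

lemma weak_equivalence_cochains:
  fixes X :: "'a topology" and Y :: "'b topology"
  assumes w: "weak_homotopy_equivalence X Y f"
  shows "\<And>c :: ('b, 'k::field) cochain. c \<in> cocycles Y \<Longrightarrow> cochain_pullback X f c \<in> coboundaries X \<Longrightarrow> c \<in> coboundaries Y"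
    and "\<And>c :: ('a, 'k) cochain. c \<in> cocycles X \<Longrightarrow> \<exists>d \<in> cocycles Y. (\<lambda>p s. cochain_pullback X f d p s - c p s) \<in> coboundaries X \<and>
      (\<forall>q. c q = (\<lambda>s. 0) \<longrightarrow> d q = (\<lambda>s. 0))"
proof -
  have f: "continuous_map X Y f" using w by (simp add: weak_homotopy_equivalence_def)
  obtain T H where TH: "\<And>p \<sigma>. singular_simplex p Y \<sigma> \<Longrightarrow> lift_data X Y f p \<sigma> (T p \<sigma>, H p \<sigma>)"
    and Tf: "\<And>p \<sigma> k. singular_simplex (Suc p) Y \<sigma> \<Longrightarrow> k \<le> Suc p \<Longrightarrow>
      singular_face (Suc p) k (T (Suc p) \<sigma>) = T p (singular_face (Suc p) k \<sigma>)"
    and Hf: "\<And>p \<sigma> k. singular_simplex (Suc p) Y \<sigma> \<Longrightarrow> k \<le> Suc p \<Longrightarrow>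
      prism_face (Suc p) k (H (Suc p) \<sigma>) = H p (singular_face (Suc p) k \<sigma>)"
    using simplexwise_lift[OF w] by blast
  obtain G where G: "\<And>p \<sigma>. singular_simplex p X \<sigma> \<Longrightarrow> continuous_map (top_of_set ({0..1} \<times> standard_simplex p)) X (G p \<sigma>)"
    and G01: "\<And>p \<sigma> x. singular_simplex p X \<sigma> \<Longrightarrow> x \<in> standard_simplex p \<Longrightarrow>
      G p \<sigma> (0, x) = \<sigma> x \<and> G p \<sigma> (1, x) = T p (simplex_map p f \<sigma>) x"
    and Gf: "\<And>p \<sigma> k. singular_simplex (Suc p) X \<sigma> \<Longrightarrow> k \<le> Suc p \<Longrightarrow>
      prism_face (Suc p) k (G (Suc p) \<sigma>) = G p (singular_face (Suc p) k \<sigma>)"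
    using simplexwise_deformation[OF w TH Tf Hf] by blast
  have Ts: "singular_simplex p X (T p \<sigma>)" if "singular_simplex p Y \<sigma>" for p \<sigma>
    using TH[OF that] by (simp add: lift_data_def)
  have Hc: "continuous_map (top_of_set ({0..1} \<times> standard_simplex p)) Y (H p \<sigma>)" if "singular_simplex p Y \<sigma>" for p \<sigma>
    using TH[OF that] by (simp add: lift_data_def)
  have ext: "restrict (\<lambda>x. g x) (standard_simplex p) = \<sigma>" if "singular_simplex p W \<sigma>" "\<And>x. x \<in> standard_simplex p \<Longrightarrow> g x = \<sigma> x"
    for p W \<sigma> and g :: "(nat \<Rightarrow> real) \<Rightarrow> 'z"
    using that by (auto simp: singular_simplex_iff restrict_def extensional_def fun_eq_iff)
  let ?T = "\<lambda>c. simplexwise_pullback Y T c"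
  have Tcob: "coboundary Y (?T c) = ?T (coboundary X c)" for c :: "('a, 'k) cochain"
    by (rule coboundary_simplexwise_pullback[OF Ts Tf])
  show "c \<in> coboundaries Y" if c: "c \<in> cocycles Y" and fc: "cochain_pullback X f c \<in> coboundaries X" for c :: "('b, 'k) cochain"
  proof -
    obtain e where e: "e \<in> cochains X" "cochain_pullback X f c = coboundary X e" using fc by (auto elim: coboundariesE)
    have "?T (cochain_pullback X f c) \<in> coboundaries Y"
      using coboundariesI[OF simplexwise_pullback_in_cochains[OF e(1), of Y T]] Tcob[of e] e(2) by simp
    moreover have "(\<lambda>p s. if singular_simplex p Y s then c p (restrict (\<lambda>x. H p s (1, x)) (standard_simplex p))
      - c p (restrict (\<lambda>x. H p s (0, x)) (standard_simplex p)) else 0) \<in> coboundaries Y"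
      by (rule prism_cochain_cocycle[OF Hc Hf c])
    moreover have "(if singular_simplex p Y s then c p (restrict (\<lambda>x. H p s (1, x)) (standard_simplex p))
      - c p (restrict (\<lambda>x. H p s (0, x)) (standard_simplex p)) else 0) = ?T (cochain_pullback X f c) p s - c p s" for p s
    proof (cases "singular_simplex p Y s")
      case True
      have "restrict (\<lambda>x. H p s (1, x)) (standard_simplex p) = simplex_map p f (T p s)"
        unfolding simplex_map_def using TH[OF True] by (intro restrict_cong') (simp add: lift_data_def)
      moreover have "restrict (\<lambda>x. H p s (0, x)) (standard_simplex p) = s"
        using TH[OF True] by (intro ext[OF True]) (simp add: lift_data_def)
      ultimately show ?thesis
        using True Ts[OF True] by (simp add: simplexwise_pullback_def cochain_pullback_def)
    next
      case False
      then show ?thesis using cochains_simplex[OF cocyclesD(1)[OF c]] by (simp add: simplexwise_pullback_def)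
    qed
    ultimately have "?T (cochain_pullback X f c) \<in> coboundaries Y"
      "(\<lambda>p s. ?T (cochain_pullback X f c) p s - c p s) \<in> coboundaries Y"
      by (simp_all only:)
    from coboundaries_diff[OF this] show ?thesis by simp
  qed
  show "\<exists>d \<in> cocycles Y. (\<lambda>p s. cochain_pullback X f d p s - c p s) \<in> coboundaries X \<and>
      (\<forall>q. c q = (\<lambda>s. 0) \<longrightarrow> d q = (\<lambda>s. 0))" if c: "c \<in> cocycles X" for c :: "('a, 'k) cochain"
  proof (rule bexI[of _ "?T c"], intro conjI)
    have "?T (\<lambda>p s. 0) = (\<lambda>p s. 0)" by (simp add: simplexwise_pullback_def fun_eq_iff)
    then show "?T c \<in> cocycles Y"
      using Tcob[of c] cocyclesD[OF c] simplexwise_pullback_in_cochains by (intro cocyclesI) auto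
    have "(\<lambda>p s. if singular_simplex p X s then c p (restrict (\<lambda>x. G p s (1, x)) (standard_simplex p))
      - c p (restrict (\<lambda>x. G p s (0, x)) (standard_simplex p)) else 0) \<in> coboundaries X"
      by (rule prism_cochain_cocycle[OF G Gf c])
    moreover have "(if singular_simplex p X s then c p (restrict (\<lambda>x. G p s (1, x)) (standard_simplex p))
      - c p (restrict (\<lambda>x. G p s (0, x)) (standard_simplex p)) else 0) = cochain_pullback X f (?T c) p s - c p s" for p s
    proof (cases "singular_simplex p X s")
      case True
      have fs: "singular_simplex p Y (simplex_map p f s)" by (rule singular_simplex_simplex_map'[OF f True])
      have "restrict (\<lambda>x. G p s (1, x)) (standard_simplex p) = T p (simplex_map p f s)"
        using G01[OF True] by (intro ext[OF Ts[OF fs]]) simp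
      moreover have "restrict (\<lambda>x. G p s (0, x)) (standard_simplex p) = s"
        using G01[OF True] by (intro ext[OF True]) simp
      ultimately show ?thesis
        using True fs by (simp add: simplexwise_pullback_def cochain_pullback_def)
    next
      case False
      then show ?thesis using cochains_simplex[OF cocyclesD(1)[OF c]] by (simp add: cochain_pullback_def)
    qed
    ultimately show "(\<lambda>p s. cochain_pullback X f (?T c) p s - c p s) \<in> coboundaries X" by (simp only:)
    show "\<forall>q. c q = (\<lambda>s. 0) \<longrightarrow> ?T c q = (\<lambda>s. 0)" by (simp add: simplexwise_pullback_def fun_eq_iff)
  qed
qed

section \<open>Cup powers, their persistent ranks, and erosion\<close>

section \<open>Cup powers and persistent rank\<close>

type_synonym ('a, 'k) coh = "('k, ('a, 'k) cochain set) module"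

lemma cohomologyE:
  assumes "A \<in> carrier (cohomology X :: ('a, 'k::field) coh)"
  obtains c where "c \<in> cocycles X" "A = cohomology_class X c"
  using assms by (auto simp: cohomology_carrier)

lemma cohomology_classI: "c \<in> cocycles X \<Longrightarrow> cohomology_class X c \<in> carrier (cohomology X)"
  by (simp add: cohomology_carrier)

lemma subspaceI:
  assumes "vectorspace field_ring V" "U \<subseteq> carrier V" "\<zero>\<^bsub>V\<^esub> \<in> U"
    "\<And>v w. v \<in> U \<Longrightarrow> w \<in> U \<Longrightarrow> v \<oplus>\<^bsub>V\<^esub> w \<in> U" "\<And>a v. v \<in> U \<Longrightarrow> a \<odot>\<^bsub>V\<^esub> v \<in> U"
  shows "subspace field_ring U (V :: ('k::field, 'v, 'm) module_scheme)"
  using assms vectorspace.axioms(1)[OF assms(1)] by (simp add: subspace_def submodule_def)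

lemma subspaceD:
  assumes "subspace field_ring U (V :: ('k::field, 'v, 'm) module_scheme)"
  shows "U \<subseteq> carrier V" "\<zero>\<^bsub>V\<^esub> \<in> U" "\<And>v w. v \<in> U \<Longrightarrow> w \<in> U \<Longrightarrow> v \<oplus>\<^bsub>V\<^esub> w \<in> U" "\<And>a v. v \<in> U \<Longrightarrow> a \<odot>\<^bsub>V\<^esub> v \<in> U"
  using assms by (auto simp: subspace_def submodule_def)

abbreviation kspan :: "('k::field, 'v, 'm) module_scheme \<Rightarrow> 'v set \<Rightarrow> 'v set" where
  "kspan \<equiv> LinearCombinations.module.span field_ring"

lemma subspace_span:
  assumes "vectorspace field_ring (V :: ('k::field, 'v, 'm) module_scheme)" "S \<subseteq> carrier V"
  shows "subspace field_ring (kspan V S) V"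
  using vectorspace.span_is_subspace[OF assms] .

lemma span_superset:
  assumes "vectorspace field_ring (V :: ('k::field, 'v, 'm) module_scheme)" "S \<subseteq> carrier V"
  shows "S \<subseteq> kspan V S"
  using module.in_own_span[OF vectorspace.axioms(1)[OF assms(1)] assms(2)] .

lemma span_minimal:
  assumes "vectorspace field_ring (V :: ('k::field, 'v, 'm) module_scheme)" "subspace field_ring U V" "S \<subseteq> U"
  shows "kspan V S \<subseteq> U"
  using module.span_is_subset[OF vectorspace.axioms(1)[OF assms(1)] assms(3)] assms(2) by (simp add: subspace_def)

lemma subspace_Int:
  assumes "subspace field_ring U (V :: ('k::field, 'v, 'm) module_scheme)" "subspace field_ring W V"
  shows "subspace field_ring (U \<inter> W) V"
  using subspaceD[OF assms(1)] subspaceD[OF assms(2)] assms(1) by (intro subspaceI) (auto simp: subspace_def)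

text \<open>The name refers to scalars and not to the grading: these are the linear maps between the
  carriers.\<close>

definition homogeneous_linear ::
    "('k::field, 'v, 'm) module_scheme \<Rightarrow> ('k, 'w, 'n) module_scheme \<Rightarrow> ('v \<Rightarrow> 'w) \<Rightarrow> bool" where
  "homogeneous_linear V W g \<longleftrightarrow> (\<forall>v \<in> carrier V. g v \<in> carrier W) \<and> g \<zero>\<^bsub>V\<^esub> = \<zero>\<^bsub>W\<^esub> \<and>
     (\<forall>v \<in> carrier V. \<forall>w \<in> carrier V. g (v \<oplus>\<^bsub>V\<^esub> w) = g v \<oplus>\<^bsub>W\<^esub> g w) \<and>
     (\<forall>a. \<forall>v \<in> carrier V. g (a \<odot>\<^bsub>V\<^esub> v) = a \<odot>\<^bsub>W\<^esub> g v)"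

lemma subspace_image:
  assumes W: "vectorspace field_ring W" and g: "homogeneous_linear V W g" and U: "subspace field_ring U V"
  shows "subspace field_ring (g ` U) W"
proof (rule subspaceI[OF W])
  note S = subspaceD[OF U]
  show "g ` U \<subseteq> carrier W" using g S(1) by (auto simp: homogeneous_linear_def)
  show "\<zero>\<^bsub>W\<^esub> \<in> g ` U" using g S(2) unfolding homogeneous_linear_def by (metis imageI)
  fix x assume "x \<in> g ` U"
  then obtain u where u: "u \<in> U" "x = g u" by blast
  show "x \<oplus>\<^bsub>W\<^esub> y \<in> g ` U" if y: "y \<in> g ` U" for y
  proof -
    obtain v where v: "v \<in> U" "y = g v" using y by blast
    have "g (u \<oplus>\<^bsub>V\<^esub> v) = x \<oplus>\<^bsub>W\<^esub> y"
      using g subsetD[OF S(1) u(1)] subsetD[OF S(1) v(1)] by (simp add: u(2) v(2) homogeneous_linear_def)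
    then show ?thesis using S(3)[OF u(1) v(1)] by (metis imageI)
  qed
  have "g (a \<odot>\<^bsub>V\<^esub> u) = a \<odot>\<^bsub>W\<^esub> x" for a
    using g subsetD[OF S(1) u(1)] by (simp add: u(2) homogeneous_linear_def)
  then show "a \<odot>\<^bsub>W\<^esub> x \<in> g ` U" for a using S(4)[OF u(1)] by (metis imageI)
qed

lemma subspace_preimage:
  assumes V: "vectorspace field_ring V" and g: "homogeneous_linear V W g" and U: "subspace field_ring U W"
  shows "subspace field_ring {v \<in> carrier V. g v \<in> U} V"
proof -
  interpret V: vectorspace field_ring V by (rule V)
  show ?thesis
    using g subspaceD[OF U] by (intro subspaceI[OF V]) (auto simp: homogeneous_linear_def)
qed

text \<open>Preimages and images of subspaces are subspaces, so minimality of the span gives one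
  inclusion each.\<close>

lemma span_image:
  assumes V: "vectorspace field_ring V" and W: "vectorspace field_ring W" and g: "homogeneous_linear V W g"
    and S: "S \<subseteq> carrier V"
  shows "g ` kspan V S = kspan W (g ` S)"
proof
  have gS: "g ` S \<subseteq> carrier W" using g S by (auto simp: homogeneous_linear_def)
  have "kspan V S \<subseteq> {v \<in> carrier V. g v \<in> kspan W (g ` S)}"
    using S span_superset[OF W gS] by (intro span_minimal[OF V subspace_preimage[OF V g subspace_span[OF W gS]]]) auto
  then show "g ` kspan V S \<subseteq> kspan W (g ` S)" by blast
  show "kspan W (g ` S) \<subseteq> g ` kspan V S"
    using span_superset[OF V S] by (intro span_minimal[OF W subspace_image[OF W g subspace_span[OF V S]]]) blast
qed

lemma cohomology_map_linear:
  assumes f: "continuous_map X Y f"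
  shows "homogeneous_linear (cohomology Y :: ('b, 'k::field) coh) (cohomology X) (cohomology_map X f)"
  unfolding homogeneous_linear_def
proof (intro conjI ballI allI)
  fix A assume "A \<in> carrier (cohomology Y :: ('b, 'k) coh)"
  then obtain c where c: "c \<in> cocycles Y" "A = cohomology_class Y c" by (rule cohomologyE)
  show "cohomology_map X f A \<in> carrier (cohomology X)"
    using pullback_cocycle[OF f c(1)] by (simp add: c(2) cohomology_map_class[OF f] cohomology_classI)
  show "cohomology_map X f (a \<odot>\<^bsub>cohomology Y\<^esub> A) = a \<odot>\<^bsub>cohomology X\<^esub> cohomology_map X f A" for a
    by (simp add: c(2) cohomology_smult cohomology_map_class[OF f] cochain_pullback_scale)
  fix B assume "B \<in> carrier (cohomology Y :: ('b, 'k) coh)"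
  then obtain d where d: "d \<in> cocycles Y" "B = cohomology_class Y d" by (rule cohomologyE)
  show "cohomology_map X f (A \<oplus>\<^bsub>cohomology Y\<^esub> B) = cohomology_map X f A \<oplus>\<^bsub>cohomology X\<^esub> cohomology_map X f B"
    by (simp add: c(2) d(2) cohomology_add cohomology_map_class[OF f] cochain_pullback_add)
next
  show "cohomology_map X f \<zero>\<^bsub>cohomology Y\<^esub> = \<zero>\<^bsub>cohomology X\<^esub>"
    by (simp add: cohomology_zero cohomology_map_class[OF f]) (simp add: cochain_pullback_def)
qed

lemma cohomology_map_mult:
  assumes f: "continuous_map X Y f" and "A \<in> carrier (cohomology Y :: ('b, 'k::field) coh)" "B \<in> carrier (cohomology Y)"
  shows "cohomology_map X f (A \<otimes>\<^bsub>cohomology Y\<^esub> B) = cohomology_map X f A \<otimes>\<^bsub>cohomology X\<^esub> cohomology_map X f B"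
proof -
  obtain c where c: "c \<in> cocycles Y" "A = cohomology_class Y c" using assms(2) by (rule cohomologyE)
  obtain d where d: "d \<in> cocycles Y" "B = cohomology_class Y d" using assms(3) by (rule cohomologyE)
  show ?thesis
    by (simp add: c(2) d(2) cohomology_mult c(1) d(1) cohomology_map_class[OF f] cup_pullback[OF f]
        pullback_cocycle[OF f c(1)] pullback_cocycle[OF f d(1)])
qed

lemma cohomology_map_one:
  assumes f: "continuous_map X Y f"
  shows "cohomology_map X f \<one>\<^bsub>cohomology Y\<^esub> = \<one>\<^bsub>cohomology X\<^esub>"
  by (simp add: cohomology_one cohomology_map_class[OF f] pullback_unit[OF f])

lemma cohomology_map_compose:
  assumes f: "continuous_map X Y f" and g: "continuous_map Y W g" and h: "continuous_map X W h"
    and eq: "\<And>x. x \<in> topspace X \<Longrightarrow> g (f x) = h x" and A: "A \<in> carrier (cohomology W)"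
  shows "cohomology_map X f (cohomology_map Y g A) = cohomology_map X h A"
proof -
  obtain c where c: "c \<in> cocycles W" "A = cohomology_class W c" using A by (rule cohomologyE)
  have "cochain_pullback X f (cochain_pullback Y g c) = cochain_pullback X h c"
    unfolding cochain_pullback_compose[OF f] by (rule cochain_pullback_cong) (simp add: eq)
  then show ?thesis by (simp add: c(2) cohomology_map_class[OF f] cohomology_map_class[OF g] cohomology_map_class[OF h])
qed

lemma cohomology_mult_closed:
  "A \<in> carrier (cohomology X) \<Longrightarrow> B \<in> carrier (cohomology X) \<Longrightarrow> A \<otimes>\<^bsub>cohomology X\<^esub> B \<in> carrier (cohomology X)"
  by (auto simp: cohomology_carrier cohomology_mult cocycles_cup)

lemma cohomology_one_closed: "\<one>\<^bsub>cohomology X\<^esub> \<in> carrier (cohomology X)"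
  by (simp add: cohomology_one cohomology_classI unit_cochain_cocycle)

abbreviation coh_prod :: "'a topology \<Rightarrow> ('a, 'k::field) cochain set list \<Rightarrow> ('a, 'k) cochain set" where
  "coh_prod X xs \<equiv> foldr (\<otimes>\<^bsub>cohomology X\<^esub>) xs \<one>\<^bsub>cohomology X\<^esub>"

lemma coh_prod_closed: "set xs \<subseteq> carrier (cohomology X) \<Longrightarrow> coh_prod X xs \<in> carrier (cohomology X)"
  by (induction xs) (auto simp: cohomology_one_closed cohomology_mult_closed)

lemma cohomology_map_prod:
  assumes f: "continuous_map X Y f" and "set xs \<subseteq> carrier (cohomology Y)"
  shows "cohomology_map X f (coh_prod Y xs) = coh_prod X (map (cohomology_map X f) xs)"
  using assms(2) by (induction xs) (simp_all add: cohomology_map_one[OF f] cohomology_map_mult[OF f] coh_prod_closed)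

lemma positive_subset: "positive_cohomology X \<subseteq> carrier (cohomology X)"
  by (auto simp: positive_cohomology_def cohomology_carrier)

lemma deg_subset: "cohomology_deg p X \<subseteq> carrier (cohomology X)"
  by (auto simp: cohomology_deg_def cohomology_carrier)

lemma deg_positive: "1 \<le> p \<Longrightarrow> cohomology_deg p X \<subseteq> positive_cohomology X"
  by (auto simp: cohomology_deg_def positive_cohomology_def)

definition positive_products :: "nat \<Rightarrow> 'a topology \<Rightarrow> ('a, 'k::field) cochain set set" where
  "positive_products l X = {coh_prod X xs | xs. length xs = l \<and> set xs \<subseteq> positive_cohomology X}"

lemma cup_power_eq: "cup_power l X = kspan (cohomology X) (positive_products l X)"
  by (simp add: cup_power_def positive_products_def Let_def)

lemma positive_products_subset: "positive_products l X \<subseteq> carrier (cohomology X)"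
  using coh_prod_closed positive_subset unfolding positive_products_def by blast

lemma subspace_cup_power: "subspace field_ring (cup_power l X) (cohomology X :: ('a, 'k::field) coh)"
  unfolding cup_power_eq by (rule subspace_span[OF vectorspace_cohomology positive_products_subset])

lemma subspace_deg: "subspace field_ring (cohomology_deg p X) (cohomology X :: ('a, 'k::field) coh)"
proof (rule subspaceI[OF vectorspace_cohomology deg_subset])
  let ?Z = "{c \<in> cocycles X. \<forall>q. q \<noteq> p \<longrightarrow> c q = (\<lambda>s. 0)} :: ('a, 'k) cochain set"
  have "(\<lambda>p s. 0) \<in> ?Z" by (simp add: cocycles_zero)
  then show "\<zero>\<^bsub>cohomology X\<^esub> \<in> (cohomology_deg p X :: ('a, 'k) cochain set set)"
    unfolding cohomology_zero cohomology_deg_def by (rule imageI)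
  fix A :: "('a, 'k) cochain set" assume "A \<in> cohomology_deg p X"
  then obtain c where c: "c \<in> ?Z" "A = cohomology_class X c" by (auto simp: cohomology_deg_def)
  have "(\<lambda>p s. a * c p s) \<in> ?Z" for a using c(1) by (auto simp: cocycles_scale)
  then show "a \<odot>\<^bsub>cohomology X\<^esub> A \<in> cohomology_deg p X" for a
    unfolding c(2) cohomology_smult cohomology_deg_def by (rule imageI)
  fix B :: "('a, 'k) cochain set" assume "B \<in> cohomology_deg p X"
  then obtain d where d: "d \<in> ?Z" "B = cohomology_class X d" by (auto simp: cohomology_deg_def)
  have "(\<lambda>p s. c p s + d p s) \<in> ?Z" using c(1) d(1) by (auto simp: cocycles_add)
  then show "A \<oplus>\<^bsub>cohomology X\<^esub> B \<in> cohomology_deg p X"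
    unfolding c(2) d(2) cohomology_add cohomology_deg_def by (rule imageI)
qed

lemma cohomology_map_deg:
  assumes f: "continuous_map X Y f" shows "cohomology_map X f ` cohomology_deg p Y \<subseteq> cohomology_deg p X"
proof
  fix B assume "B \<in> cohomology_map X f ` cohomology_deg p Y"
  then obtain c where c: "c \<in> cocycles Y" "\<forall>q. q \<noteq> p \<longrightarrow> c q = (\<lambda>s. 0)" "B = cohomology_map X f (cohomology_class Y c)"
    by (auto simp: cohomology_deg_def)
  then have "cochain_pullback X f c \<in> {c \<in> cocycles X. \<forall>q. q \<noteq> p \<longrightarrow> c q = (\<lambda>s. 0)}"
    using pullback_cocycle[OF f c(1)] by (simp add: cochain_pullback_def fun_eq_iff)
  then show "B \<in> cohomology_deg p X"
    unfolding c(3) cohomology_map_class[OF f] cohomology_deg_def by (rule imageI)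
qed

lemma cohomology_map_positive:
  assumes f: "continuous_map X Y f" shows "cohomology_map X f ` positive_cohomology Y \<subseteq> positive_cohomology X"
proof
  fix B assume "B \<in> cohomology_map X f ` positive_cohomology Y"
  then obtain c where c: "c \<in> cocycles Y" "c 0 = (\<lambda>s. 0)" "B = cohomology_map X f (cohomology_class Y c)"
    by (auto simp: positive_cohomology_def)
  then have "cochain_pullback X f c \<in> {c \<in> cocycles X. c 0 = (\<lambda>s. 0)}"
    using pullback_cocycle[OF f c(1)] by (simp add: cochain_pullback_def fun_eq_iff)
  then show "B \<in> positive_cohomology X"
    unfolding c(3) cohomology_map_class[OF f] positive_cohomology_def by (rule imageI)
qed

text \<open>Induced maps are multiplicative and preserve positivity. If every positive class lifts,
  products lift factor by factor, and the spans follow.\<close>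

lemma cohomology_map_cup_power:
  fixes f :: "'a \<Rightarrow> 'b"
  assumes f: "continuous_map X Y f"
  shows "cohomology_map X f ` (cup_power l Y :: ('b, 'k::field) cochain set set) \<subseteq> cup_power l X"
    and "cohomology_map X f ` (positive_cohomology Y :: ('b, 'k) cochain set set) = positive_cohomology X \<Longrightarrow>
      cohomology_map X f ` (cup_power l Y :: ('b, 'k) cochain set set) = cup_power l X"
proof -
  have eq: "cohomology_map X f ` (cup_power l Y :: ('b, 'k) cochain set set) =
      kspan (cohomology X) (cohomology_map X f ` positive_products l Y)"
    unfolding cup_power_eq
    by (rule span_image[OF vectorspace_cohomology vectorspace_cohomology cohomology_map_linear[OF f] positive_products_subset])
  have prod: "cohomology_map X f (coh_prod Y xs) = coh_prod X (map (cohomology_map X f) xs)"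
    if "set xs \<subseteq> positive_cohomology Y" for xs :: "('b, 'k) cochain set list"
    by (rule cohomology_map_prod[OF f order_trans[OF that positive_subset]])
  have sub: "cohomology_map X f ` (positive_products l Y :: ('b, 'k) cochain set set) \<subseteq> positive_products l X"
  proof
    fix B assume "B \<in> cohomology_map X f ` (positive_products l Y :: ('b, 'k) cochain set set)"
    then obtain xs :: "('b, 'k) cochain set list" where xs: "length xs = l" "set xs \<subseteq> positive_cohomology Y" "B = cohomology_map X f (coh_prod Y xs)"
      unfolding positive_products_def by (elim imageE CollectE exE conjE) simp
    have "set (map (cohomology_map X f) xs) \<subseteq> positive_cohomology X"
      unfolding list.set_map by (rule order_trans[OF image_mono[OF xs(2)] cohomology_map_positive[OF f]])
    then show "B \<in> positive_products l X"
      unfolding xs(3) prod[OF xs(2)] positive_products_def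
      by (intro CollectI exI[of _ "map (cohomology_map X f) xs"] conjI refl) (simp only: length_map xs(1), assumption)
  qed
  then show "cohomology_map X f ` (cup_power l Y :: ('b, 'k) cochain set set) \<subseteq> cup_power l X"
    unfolding eq unfolding cup_power_eq
    by (rule span_minimal[OF vectorspace_cohomology subspace_span[OF vectorspace_cohomology positive_products_subset]
          order_trans[OF _ span_superset[OF vectorspace_cohomology positive_products_subset]]])
  assume surj: "cohomology_map X f ` (positive_cohomology Y :: ('b, 'k) cochain set set) = positive_cohomology X"
  have "positive_products l X \<subseteq> cohomology_map X f ` (positive_products l Y :: ('b, 'k) cochain set set)"
  proof
    fix B :: "('a, 'k) cochain set" assume "B \<in> positive_products l X"
    then obtain ys :: "('a, 'k) cochain set list" where ys: "length ys = l" "set ys \<subseteq> positive_cohomology X" "B = coh_prod X ys"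
      unfolding positive_products_def by (elim CollectE exE conjE)
    have "\<forall>y\<in>set ys. \<exists>x. x \<in> positive_cohomology Y \<and> cohomology_map X f x = y"
    proof
      fix y assume "y \<in> set ys"
      then have "y \<in> cohomology_map X f ` (positive_cohomology Y :: ('b, 'k) cochain set set)"
        unfolding surj by (rule subsetD[OF ys(2)])
      then show "\<exists>x. x \<in> positive_cohomology Y \<and> cohomology_map X f x = y" by (elim imageE) blast
    qed
    from bchoice[OF this] obtain g where g: "\<forall>y\<in>set ys. g y \<in> positive_cohomology Y \<and> cohomology_map X f (g y) = y" ..
    have m: "map (cohomology_map X f) (map g ys) = ys" using g by (simp add: map_idI)
    have s: "set (map g ys) \<subseteq> positive_cohomology Y" using g by auto
    have "B = cohomology_map X f (coh_prod Y (map g ys))" using prod[OF s] m ys(3) by simp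
    moreover have "coh_prod Y (map g ys) \<in> positive_products l Y"
      unfolding positive_products_def
      by (intro CollectI exI[of _ "map g ys"] conjI refl) (simp only: length_map ys(1), rule s)
    ultimately show "B \<in> cohomology_map X f ` (positive_products l Y :: ('b, 'k) cochain set set)"
      by (rule image_eqI)
  qed
  with sub have "cohomology_map X f ` (positive_products l Y :: ('b, 'k) cochain set set) = positive_products l X"
    by (rule equalityI)
  then show "cohomology_map X f ` (cup_power l Y :: ('b, 'k) cochain set set) = cup_power l X"
    unfolding eq by (simp add: cup_power_eq)
qed

text \<open>Degree and cup power are matched separately; injectivity is what later allows their
  intersection to be matched.\<close>

lemma weak_equivalence_cohomology:
  fixes f :: "'a \<Rightarrow> 'b"
  assumes w: "weak_homotopy_equivalence X Y f"
  shows "inj_on (cohomology_map X f) (carrier (cohomology Y :: ('b, 'k::field) coh))"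
    and "cohomology_map X f ` (cohomology_deg p Y :: ('b, 'k) cochain set set) = cohomology_deg p X"
    and "cohomology_map X f ` (cup_power l Y :: ('b, 'k) cochain set set) = cup_power l X"
proof -
  have f: "continuous_map X Y f" using w by (simp add: weak_homotopy_equivalence_def)
  show inj: "inj_on (cohomology_map X f) (carrier (cohomology Y :: ('b, 'k::field) coh))"
  proof (rule inj_onI)
    fix A B assume AB: "A \<in> carrier (cohomology Y :: ('b, 'k) coh)" "B \<in> carrier (cohomology Y :: ('b, 'k) coh)"
      and eq: "cohomology_map X f A = cohomology_map X f B"
    obtain c where c: "c \<in> cocycles Y" "A = cohomology_class Y c" using AB(1) by (rule cohomologyE)
    obtain d where d: "d \<in> cocycles Y" "B = cohomology_class Y d" using AB(2) by (rule cohomologyE)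
    have "(\<lambda>p s. c p s + - 1 * d p s) \<in> cocycles Y" by (intro cocycles_add c cocycles_scale d)
    moreover have "cochain_pullback X f (\<lambda>p s. c p s + - 1 * d p s) \<in> coboundaries X"
      using eq unfolding c(2) d(2) cohomology_map_class[OF f] cohomology_class_eq_iff cochain_pullback_add
        cochain_pullback_scale by simp
    ultimately have "(\<lambda>p s. c p s + - 1 * d p s) \<in> coboundaries Y" by (rule weak_equivalence_cochains(1)[OF w])
    then show "A = B" by (simp add: c(2) d(2) cohomology_class_eq_iff)
  qed
  have lift: "\<exists>d \<in> cocycles Y. cohomology_map X f (cohomology_class Y d) = cohomology_class X c \<and>
      (\<forall>q. c q = (\<lambda>s. 0) \<longrightarrow> d q = (\<lambda>s. 0))" if c: "c \<in> cocycles X" for c :: "('a, 'k) cochain"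
    using weak_equivalence_cochains(2)[OF w c] unfolding cohomology_map_class[OF f] cohomology_class_eq_iff .
  show "cohomology_map X f ` (cohomology_deg p Y :: ('b, 'k) cochain set set) = cohomology_deg p X"
  proof (intro equalityI cohomology_map_deg[OF f] subsetI)
    fix A :: "('a, 'k) cochain set" assume "A \<in> cohomology_deg p X"
    then obtain c where c: "c \<in> cocycles X" "\<forall>q. q \<noteq> p \<longrightarrow> c q = (\<lambda>s. 0)" "A = cohomology_class X c"
      by (auto simp: cohomology_deg_def)
    obtain d where d: "d \<in> cocycles Y" "cohomology_map X f (cohomology_class Y d) = A" "\<forall>q. c q = (\<lambda>s. 0) \<longrightarrow> d q = (\<lambda>s. 0)"
      using lift[OF c(1)] c(3) by blast
    have "cohomology_class Y d \<in> cohomology_deg p Y"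
      unfolding cohomology_deg_def using d(1,3) c(2) by (intro imageI) simp
    then show "A \<in> cohomology_map X f ` (cohomology_deg p Y :: ('b, 'k) cochain set set)" using d(2) by blast
  qed
  have "cohomology_map X f ` (positive_cohomology Y :: ('b, 'k) cochain set set) = positive_cohomology X"
  proof (intro equalityI cohomology_map_positive[OF f] subsetI)
    fix A :: "('a, 'k) cochain set" assume "A \<in> positive_cohomology X"
    then obtain c where c: "c \<in> cocycles X" "c 0 = (\<lambda>s. 0)" "A = cohomology_class X c"
      by (auto simp: positive_cohomology_def)
    obtain d where d: "d \<in> cocycles Y" "cohomology_map X f (cohomology_class Y d) = A" "\<forall>q. c q = (\<lambda>s. 0) \<longrightarrow> d q = (\<lambda>s. 0)"
      using lift[OF c(1)] c(3) by blast
    have "cohomology_class Y d \<in> positive_cohomology Y"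
      unfolding positive_cohomology_def using d(1,3) c(2) by (intro imageI) simp
    then show "A \<in> cohomology_map X f ` (positive_cohomology Y :: ('b, 'k) cochain set set)" using d(2) by blast
  qed
  then show "cohomology_map X f ` (cup_power l Y :: ('b, 'k) cochain set set) = cup_power l X"
    by (rule cohomology_map_cup_power(2)[OF f])
qed

section \<open>The erosion distance of cup modules\<close>

abbreviation cup_deg :: "nat \<Rightarrow> nat \<Rightarrow> 'a topology \<Rightarrow> ('a, 'k::field) cochain set set" where
  "cup_deg l p X \<equiv> cup_power l X \<inter> cohomology_deg p X"

lemma subspace_cup_deg: "subspace field_ring (cup_deg l p X) (cohomology X :: ('a, 'k::field) coh)"
  by (rule subspace_Int[OF subspace_cup_power subspace_deg])

lemma cohomology_map_cup_deg:
  assumes "continuous_map X Y f"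
  shows "cohomology_map X f ` (cup_deg l p Y :: ('b, 'k::field) cochain set set) \<subseteq> cup_deg l p X"
  by (rule order_trans[OF image_Int_subset Int_mono[OF cohomology_map_cup_power(1)[OF assms] cohomology_map_deg[OF assms]]])

lemma vdim_le_linear_image:
  assumes V: "vectorspace field_ring V" and W: "vectorspace field_ring W" and g: "homogeneous_linear V W g"
    and U: "subspace field_ring U V" and S: "subspace field_ring S W" and sub: "S \<subseteq> g ` U"
  shows "vdim W S \<le> vdim V U"
  using subsetD[OF subspaceD(1)[OF U]] g
  by (intro vdim_le_image[OF W V S U _ _ _ sub]) (simp_all add: homogeneous_linear_def)

text \<open>One inequality uses \<open>g\<close>, the other its inverse, which is linear only on the
  range.\<close>

lemma vdim_inj_image:
  assumes V: "vectorspace field_ring V" and W: "vectorspace field_ring W" and g: "homogeneous_linear V W g"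
    and inj: "inj_on g (carrier V)" and U: "subspace field_ring U V"
  shows "vdim W (g ` U) = vdim V U"
proof (rule antisym)
  have gU: "subspace field_ring (g ` U) W" by (rule subspace_image[OF W g U])
  show "vdim W (g ` U) \<le> vdim V U" by (rule vdim_le_linear_image[OF V W g U gU order_refl])
  have UV: "u \<in> carrier V" if "u \<in> U" for u using subsetD[OF subspaceD(1)[OF U] that] .
  let ?h = "inv_into U g"
  have injU: "inj_on g U" by (rule inj_on_subset[OF inj subspaceD(1)[OF U]])
  have h: "?h (g u) = u" if "u \<in> U" for u by (rule inv_into_f_f[OF injU that])
  show "vdim V U \<le> vdim W (g ` U)"
  proof (rule vdim_le_image[OF V W U gU])
    show "?h w \<in> carrier V" if "w \<in> g ` U" for w using that h UV by auto
    show "U \<subseteq> ?h ` g ` U" using h by force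
    fix x assume "x \<in> g ` U" then obtain u where u: "u \<in> U" "x = g u" by blast
    show "?h (a \<odot>\<^bsub>W\<^esub> x) = a \<odot>\<^bsub>V\<^esub> ?h x" for a
      using h[OF subspaceD(4)[OF U u(1), of a]] g UV[OF u(1)] by (simp add: u(2) h[OF u(1)] homogeneous_linear_def)
    fix y assume "y \<in> g ` U" then obtain v where v: "v \<in> U" "y = g v" by blast
    show "?h (x \<oplus>\<^bsub>W\<^esub> y) = ?h x \<oplus>\<^bsub>V\<^esub> ?h y"
      using h[OF subspaceD(3)[OF U u(1) v(1)]] g UV[OF u(1)] UV[OF v(1)]
      by (simp add: u(2) v(2) h[OF u(1)] h[OF v(1)] homogeneous_linear_def)
  qed
qed

text \<open>On cohomology the map of \<open>h\<close> is the composite of those of \<open>g\<close>,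
  \<open>t\<close> and \<open>f\<close>, applied in this order. The first stays within the cup power
  and the degree, and the last can only lower the dimension of what the middle one produces.\<close>

lemma vdim_cup_deg_factor:
  fixes h :: "'a \<Rightarrow> 'b" and t :: "'c \<Rightarrow> 'd"
  assumes f: "continuous_map P R f" and t: "continuous_map R S t" and g: "continuous_map S Q g"
    and h: "continuous_map P Q h" and eq: "\<And>x. x \<in> topspace P \<Longrightarrow> g (t (f x)) = h x"
  shows "vdim (cohomology P :: ('a, 'k::field) coh) (cohomology_map P h ` cup_deg l p Q)
    \<le> vdim (cohomology R :: ('c, 'k) coh) (cohomology_map R t ` cup_deg l p S)"
proof (rule vdim_le_linear_image[OF vectorspace_cohomology vectorspace_cohomology cohomology_map_linear[OF f]])
  have sub: "subspace field_ring (cohomology_map A u ` cup_deg l p B :: ('x, 'k) cochain set set) (cohomology A)"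
    if "continuous_map A B u" for A :: "'x topology" and B :: "'y topology" and u
    by (rule subspace_image[OF vectorspace_cohomology cohomology_map_linear[OF that] subspace_cup_deg])
  show "subspace field_ring (cohomology_map P h ` cup_deg l p Q :: ('a, 'k) cochain set set) (cohomology P)"
    by (rule subspace_image[OF vectorspace_cohomology cohomology_map_linear[OF h] subspace_cup_deg])
  show "subspace field_ring (cohomology_map R t ` cup_deg l p S :: ('c, 'k) cochain set set) (cohomology R)"
    by (rule subspace_image[OF vectorspace_cohomology cohomology_map_linear[OF t] subspace_cup_deg])
  have gt: "continuous_map R Q (g \<circ> t)" by (rule continuous_map_compose[OF t g])
  show "cohomology_map P h ` (cup_deg l p Q :: ('b, 'k) cochain set set)
    \<subseteq> cohomology_map P f ` cohomology_map R t ` cup_deg l p S"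
  proof (rule image_subsetI)
    fix A :: "('b, 'k) cochain set" assume A: "A \<in> cup_deg l p Q"
    have Ac: "A \<in> carrier (cohomology Q)" by (rule subsetD[OF subspaceD(1)[OF subspace_cup_deg] A])
    have "cohomology_map P h A = cohomology_map P f (cohomology_map R (g \<circ> t) A)"
      by (rule cohomology_map_compose[OF f gt h _ Ac, symmetric]) (simp add: eq)
    also have "cohomology_map R (g \<circ> t) A = cohomology_map R t (cohomology_map S g A)"
      by (rule cohomology_map_compose[OF t g gt _ Ac, symmetric]) simp
    finally show "cohomology_map P h A \<in> cohomology_map P f ` cohomology_map R t ` cup_deg l p S"
      using subsetD[OF cohomology_map_cup_deg[OF g] imageI[OF A]] by (simp only: imageI)
  qed
qed

lemma persistent_spaceD:
  assumes "persistent_space X"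
  shows "s \<le> t \<Longrightarrow> continuous_map (space_at X s) (space_at X t) (trans_map X s t)"
    and "s \<le> t \<Longrightarrow> t \<le> u \<Longrightarrow> x \<in> topspace (space_at X s) \<Longrightarrow>
      trans_map X t u (trans_map X s t x) = trans_map X s u x"
  using assms by (simp_all add: persistent_space_def)

lemma interleaved_sym: "interleaved e X Y \<Longrightarrow> interleaved e Y X"
  unfolding interleaved_def by blast

lemma interleaved_cup_module_rank:
  assumes X: "persistent_space X" and Y: "persistent_space Y" and e: "0 \<le> e" and I: "interleaved e X Y" and ab: "a \<le> b"
  shows "cup_module_rank TYPE('k::field) Y (a - e) (b + e) \<le> cup_module_rank TYPE('k) X a b"
proof -
  obtain \<phi> \<psi> where phi: "shifted_map e X Y \<phi>" and psi: "shifted_map e Y X \<psi>"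
    and pp: "\<And>t y. y \<in> topspace (space_at Y t) \<Longrightarrow> \<phi> (t + e) (\<psi> t y) = trans_map Y t (t + 2 * e) y"
    using I by (auto simp: interleaved_def)
  have f: "continuous_map (space_at Y (a - e)) (space_at X a) (\<psi> (a - e))"
    using psi by (auto simp: shifted_map_def dest: spec[of _ "a - e"])
  have g: "continuous_map (space_at X b) (space_at Y (b + e)) (\<phi> b)" using phi by (auto simp: shifted_map_def)
  have t: "continuous_map (space_at X a) (space_at X b) (trans_map X a b)" by (rule persistent_spaceD(1)[OF X ab])
  have h: "continuous_map (space_at Y (a - e)) (space_at Y (b + e)) (trans_map Y (a - e) (b + e))"
    by (rule persistent_spaceD(1)[OF Y]) (use ab e in simp)
  \<comment> \<open>The route from \<open>Y\<close> at \<open>a - e\<close> to \<open>Y\<close> at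
    \<open>b + e\<close> through \<open>X\<close>: naturality moves \<open>\<phi>\<close> past the
    transition map, and the interleaving identity is used at \<open>a - e\<close>, where
    \<open>2 * e\<close> leads to \<open>a + e\<close>.\<close>
  have eq: "\<phi> b (trans_map X a b (\<psi> (a - e) y)) = trans_map Y (a - e) (b + e) y" if y: "y \<in> topspace (space_at Y (a - e))" for y
  proof -
    have "\<psi> (a - e) y \<in> topspace (space_at X a)" using f y by (auto simp: continuous_map_def)
    then have "\<phi> b (trans_map X a b (\<psi> (a - e) y)) = trans_map Y (a + e) (b + e) (\<phi> a (\<psi> (a - e) y))"
      using phi ab by (simp add: shifted_map_def)
    also have "\<phi> a (\<psi> (a - e) y) = trans_map Y (a - e) (a + e) y" using pp[OF y] by (simp add: add.commute)
    also have "trans_map Y (a + e) (b + e) (trans_map Y (a - e) (a + e) y) = trans_map Y (a - e) (b + e) y"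
      by (rule persistent_spaceD(2)[OF Y _ _ y]) (use ab e in simp_all)
    finally show ?thesis .
  qed
  show ?thesis
    unfolding le_fun_def cup_module_rank_def using vdim_cup_deg_factor[OF f t g h eq, where ?'k = 'k] by simp
qed

text \<open>Naturality identifies the image in \<open>Z\<close> with the image under
  \<open>\<eta> a\<close> of the corresponding image in \<open>X\<close>. The map on cohomology at
  \<open>a\<close> preserves dimension because it is injective, and the one at \<open>b\<close>
  reaches every class.\<close>

lemma objectwise_weak_equivalence_rank:
  assumes Z: "persistent_space Z" and X: "persistent_space X" and w: "objectwise_weak_equivalence Z X \<eta>" and ab: "a \<le> b"
  shows "cup_module_rank TYPE('k::field) Z a b = cup_module_rank TYPE('k) X a b"
proof -
  have wt: "weak_homotopy_equivalence (space_at Z t) (space_at X t) (\<eta> t)" for t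
    using w by (simp add: objectwise_weak_equivalence_def)
  then have cont: "continuous_map (space_at Z t) (space_at X t) (\<eta> t)" for t
    by (simp add: weak_homotopy_equivalence_def)
  have nat: "\<eta> b (trans_map Z a b z) = trans_map X a b (\<eta> a z)" if "z \<in> topspace (space_at Z a)" for z
    using w that ab by (simp add: objectwise_weak_equivalence_def shifted_map_def)
  note tZ = persistent_spaceD(1)[OF Z ab] and tX = persistent_spaceD(1)[OF X ab]
  let ?HZ = "cohomology (space_at Z a) :: (_, 'k) coh" and ?HX = "cohomology (space_at X a) :: (_, 'k) coh"
  have main: "vdim ?HZ (cohomology_map (space_at Z a) (trans_map Z a b) ` cup_deg l p (space_at Z b))
     = vdim ?HX (cohomology_map (space_at X a) (trans_map X a b) ` cup_deg l p (space_at X b))" for l p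
  proof -
    let ?A = "cup_deg l p (space_at X b) :: (_, 'k) cochain set set"
    have AX: "?A \<subseteq> carrier (cohomology (space_at X b))" by (rule subspaceD(1)[OF subspace_cup_deg])
    note we = weak_equivalence_cohomology[OF wt[of b], where ?'k = 'k]
    \<comment> \<open>An injective map commutes with the intersection of cup power and
      degree.\<close>
    have "cohomology_map (space_at Z b) (\<eta> b) ` ?A = cup_deg l p (space_at Z b)"
      unfolding we(2,3)[symmetric]
      by (rule inj_on_image_Int[OF we(1) subspaceD(1)[OF subspace_cup_power] subspaceD(1)[OF subspace_deg]])
    then have "cohomology_map (space_at Z a) (trans_map Z a b) ` cup_deg l p (space_at Z b)
       = (\<lambda>A. cohomology_map (space_at Z a) (trans_map Z a b) (cohomology_map (space_at Z b) (\<eta> b) A)) ` ?A"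
      by (metis image_image)
    also have "\<dots> = (\<lambda>A. cohomology_map (space_at Z a) (\<eta> a) (cohomology_map (space_at X a) (trans_map X a b) A)) ` ?A"
    proof (rule image_cong[OF refl])
      fix A assume "A \<in> ?A"
      then have A: "A \<in> carrier (cohomology (space_at X b))" using AX by blast
      note c = continuous_map_compose[OF tZ cont[of b]]
      have "cohomology_map (space_at Z a) (trans_map Z a b) (cohomology_map (space_at Z b) (\<eta> b) A)
          = cohomology_map (space_at Z a) (\<eta> b \<circ> trans_map Z a b) A"
        by (rule cohomology_map_compose[OF tZ cont c _ A]) simp
      also have "\<dots> = cohomology_map (space_at Z a) (\<eta> a) (cohomology_map (space_at X a) (trans_map X a b) A)"
        by (rule cohomology_map_compose[OF cont tX c _ A, symmetric]) (simp add: nat)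
      finally show "cohomology_map (space_at Z a) (trans_map Z a b) (cohomology_map (space_at Z b) (\<eta> b) A)
          = cohomology_map (space_at Z a) (\<eta> a) (cohomology_map (space_at X a) (trans_map X a b) A)" .
    qed
    also have "\<dots> = cohomology_map (space_at Z a) (\<eta> a) ` cohomology_map (space_at X a) (trans_map X a b) ` ?A"
      by (rule image_image[symmetric])
    finally show ?thesis
      using vdim_inj_image[OF vectorspace_cohomology vectorspace_cohomology cohomology_map_linear[OF cont]
          weak_equivalence_cohomology(1)[OF wt] subspace_image[OF vectorspace_cohomology cohomology_map_linear[OF tX] subspace_cup_deg]]
      by simp
  qed
  show ?thesis unfolding cup_module_rank_def main ..
qed

lemma weakly_equivalent_rank:
  assumes "persistent_space X'" "persistent_space X" "weakly_equivalent U X' X" "a \<le> b"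
  shows "cup_module_rank TYPE('k::field) X' a b = cup_module_rank TYPE('k) X a b"
  using assms objectwise_weak_equivalence_rank unfolding weakly_equivalent_def by metis

text \<open>Ranks of \<open>X'\<close> and \<open>X\<close> agree on the given interval and on the
  enlarged one, and likewise for \<open>Y\<close>, so an interleaving of the replacements erodes the
  ranks of \<open>X\<close> and \<open>Y\<close>.\<close>

lemma erosion_dist_rank_le:
  assumes X: "persistent_space X" and Y: "persistent_space Y"
  shows "erosion_dist (cup_module_rank TYPE('k::field) X) (cup_module_rank TYPE('k) Y)
    \<le> homotopy_interleaving_dist TYPE('u) X Y"
proof -
  have "eroded e (cup_module_rank TYPE('k) X) (cup_module_rank TYPE('k) Y)"
    if e: "0 \<le> e" and I: "interleaved e X' Y'" and X': "persistent_space X'" "weakly_equivalent TYPE('u) X' X"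
      and Y': "persistent_space Y'" "weakly_equivalent TYPE('u) Y' Y" for e and X' Y' :: "'u pspace"
    unfolding eroded_def
  proof (intro allI impI)
    fix a b :: real assume ab: "a \<le> b"
    have ab': "a - e \<le> b + e" using ab e by simp
    show "cup_module_rank TYPE('k) Y (a - e) (b + e) \<le> cup_module_rank TYPE('k) X a b \<and>
        cup_module_rank TYPE('k) X (a - e) (b + e) \<le> cup_module_rank TYPE('k) Y a b"
      using interleaved_cup_module_rank[OF X'(1) Y'(1) e I ab, where ?'k = 'k]
        interleaved_cup_module_rank[OF Y'(1) X'(1) e interleaved_sym[OF I] ab, where ?'k = 'k]
      unfolding weakly_equivalent_rank[OF X'(1) X X'(2) ab] weakly_equivalent_rank[OF Y'(1) Y Y'(2) ab]
        weakly_equivalent_rank[OF X'(1) X X'(2) ab'] weakly_equivalent_rank[OF Y'(1) Y Y'(2) ab'] by (rule conjI)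
  qed
  then show ?thesis
    unfolding homotopy_interleaving_dist_def interleaving_dist_def erosion_dist_def
    by (intro Inf_greatest Inf_superset_mono) (fastforce intro!: Inf_superset_mono)
qed

section \<open>Cup length and cup modules\<close>

text \<open>Cup length multiplies homogeneous classes, whereas \<open>cup_power\<close> admits all
  positive ones; passing to spans reconciles the two.\<close>

definition homogeneous_positive :: "'a topology \<Rightarrow> ('a, 'k::field) cochain set set" where
  "homogeneous_positive X = (\<Union>p\<in>{1..}. cohomology_deg p X)"

definition homogeneous_products :: "nat \<Rightarrow> 'a topology \<Rightarrow> ('a, 'k::field) cochain set set" where
  "homogeneous_products l X = {coh_prod X xs | xs. length xs = l \<and> set xs \<subseteq> homogeneous_positive X}"

lemma homogeneous_positive_subset: "homogeneous_positive X \<subseteq> positive_cohomology X"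
  unfolding homogeneous_positive_def using deg_positive by blast

lemma homogeneous_products_subset: "homogeneous_products l X \<subseteq> positive_products l X"
  unfolding homogeneous_products_def positive_products_def
  using order_trans[OF _ homogeneous_positive_subset] by blast

lemma coboundary_truncate:
  assumes "c \<in> cocycles X" shows "(\<lambda>p s. if p = n then c p s else 0) \<in> cocycles X"
proof (rule cocyclesI)
  let ?c = "\<lambda>p s. if p = n then c p s else 0"
  have c: "c \<in> cochains X" by (rule cocyclesD(1)[OF assms])
  have "finite {p. \<exists>s. ?c p s \<noteq> 0}" by (rule finite_subset[of _ "{n}"]) auto
  then show "?c \<in> cochains X" by (intro cochainsI) (use cochains_simplex[OF c] in auto)
  have "coboundary X ?c p s = (if p = Suc n then coboundary X c p s else 0)" for p s
  proof (cases p)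
    case (Suc m)
    then show ?thesis by (cases "m = n") (simp_all add: coboundary_def del: sum.atMost_Suc)
  qed (simp add: coboundary_0)
  then show "coboundary X ?c = (\<lambda>p s. 0)" unfolding cocyclesD(2)[OF assms] by (intro ext) simp
qed

text \<open>Cochains live in finitely many degrees: induction on a bound of the degrees, splitting
  off the top component, which is itself a cocycle.\<close>

lemma positive_subset_span: "positive_cohomology X \<subseteq> kspan (cohomology X :: ('a, 'k::field) coh) (homogeneous_positive X)"
proof -
  let ?S = "kspan (cohomology X :: ('a, 'k) coh) (homogeneous_positive X)"
  have sub: "homogeneous_positive X \<subseteq> carrier (cohomology X :: ('a, 'k) coh)"
    by (rule order_trans[OF homogeneous_positive_subset positive_subset])
  note S = subspaceD[OF subspace_span[OF vectorspace_cohomology sub]]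
  have main: "cohomology_class X c \<in> ?S"
    if "c \<in> cocycles X" "c 0 = (\<lambda>s. 0)" "\<And>p. n \<le> p \<Longrightarrow> c p = (\<lambda>s. 0)" for n and c :: "('a, 'k) cochain"
    using that
  proof (induction n arbitrary: c)
    case 0
    then have "c = (\<lambda>p s. 0)" by (simp add: fun_eq_iff)
    then show ?case using S(2) by (simp add: cohomology_zero)
  next
    case (Suc n)
    let ?t = "\<lambda>p s. if p = n then c p s else 0" let ?r = "\<lambda>p s. c p s + - 1 * ?t p s"
    have t: "?t \<in> cocycles X" by (rule coboundary_truncate[OF Suc.prems(1)])
    have r: "?r \<in> cocycles X" by (intro cocycles_add Suc.prems cocycles_scale t)
    have "cohomology_class X ?r \<in> ?S"
    proof (rule Suc.IH[OF r])
      show "?r 0 = (\<lambda>s. 0)" using Suc.prems(2) by (simp add: fun_eq_iff)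
      show "?r p = (\<lambda>s. 0)" if "n \<le> p" for p using Suc.prems(3)[of p] that by (auto simp: fun_eq_iff)
    qed
    moreover have "cohomology_class X ?t \<in> ?S"
    proof (cases "n = 0")
      case True
      then have "?t = (\<lambda>p s. 0)" using Suc.prems(2) by (auto simp: fun_eq_iff)
      then show ?thesis using S(2) by (simp only: cohomology_zero)
    next
      case False
      have "cohomology_class X ?t \<in> cohomology_deg n X"
        unfolding cohomology_deg_def using t by (intro imageI) (simp add: fun_eq_iff)
      then have "cohomology_class X ?t \<in> homogeneous_positive X" unfolding homogeneous_positive_def using False by auto
      then show ?thesis by (rule subsetD[OF span_superset[OF vectorspace_cohomology sub]])
    qed
    ultimately have "cohomology_class X (\<lambda>p s. ?r p s + ?t p s) \<in> ?S"
      unfolding cohomology_add[symmetric] by (rule S(3))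
    then show ?case by simp
  qed
  show ?thesis
  proof
    fix A :: "('a, 'k) cochain set" assume "A \<in> positive_cohomology X"
    then obtain c where c: "c \<in> cocycles X" "c 0 = (\<lambda>s. 0)" "A = cohomology_class X c" by (auto simp: positive_cohomology_def)
    obtain m where m: "\<forall>p \<in> {p. \<exists>s. c p s \<noteq> 0}. p < m"
      using cochains_finite[OF cocyclesD(1)[OF c(1)]] finite_nat_set_iff_bounded by blast
    show "A \<in> ?S" unfolding c(3)
    proof (rule main[OF c(1,2), of m])
      show "c p = (\<lambda>s. 0)" if "m \<le> p" for p
      proof
        show "c p s = 0" for s using m that by fastforce
      qed
    qed
  qed
qed

lemma cohomology_mult_linear:
  assumes A: "A \<in> carrier (cohomology X :: ('a, 'k::field) coh)"
  shows "homogeneous_linear (cohomology X :: ('a, 'k) coh) (cohomology X) (\<lambda>B. A \<otimes>\<^bsub>cohomology X\<^esub> B)" (is ?l)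
    and "homogeneous_linear (cohomology X :: ('a, 'k) coh) (cohomology X) (\<lambda>B. B \<otimes>\<^bsub>cohomology X\<^esub> A)" (is ?r)
proof -
  obtain c where c: "c \<in> cocycles X" "A = cohomology_class X c" using A by (rule cohomologyE)
  show ?l ?r unfolding homogeneous_linear_def c(2)
    by (auto simp: cohomology_carrier cohomology_zero cohomology_mult c(1) cocycles_zero cocycles_cup cohomology_add cohomology_smult
        cocycles_add cocycles_scale cup_zero_left cup_zero_right cup_add_left cup_add_right cup_scale_left cup_scale_right)
qed

text \<open>Multilinearity, one factor at a time: with one factor fixed, the elements whose product
  with it lies in the target span form a subspace, so it suffices to test generators.\<close>

lemma positive_products_subset_span:
  "positive_products l X \<subseteq> kspan (cohomology X :: ('a, 'k::field) coh) (homogeneous_products l X)"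
proof
  let ?H = "cohomology X :: ('a, 'k) coh"
  have HP: "homogeneous_products m X \<subseteq> carrier ?H" for m
    using homogeneous_products_subset positive_products_subset by (rule order_trans)
  have hp: "homogeneous_positive X \<subseteq> carrier ?H"
    using homogeneous_positive_subset positive_subset by (rule order_trans)
  note V = vectorspace_cohomology[of X, where ?'k = 'k]
  have step: "x \<otimes>\<^bsub>?H\<^esub> y \<in> kspan ?H (homogeneous_products (Suc m) X)"
    if x: "x \<in> kspan ?H (homogeneous_positive X)" and y: "y \<in> kspan ?H (homogeneous_products m X)" for x y m
  proof -
    let ?S = "kspan ?H (homogeneous_products (Suc m) X)"
    have S: "subspace field_ring ?S ?H" by (rule subspace_span[OF V HP])
    have yc: "y \<in> carrier ?H" by (rule subsetD[OF subspaceD(1)[OF subspace_span[OF V HP]] y])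
    have "u \<otimes>\<^bsub>?H\<^esub> y \<in> ?S" if u: "u \<in> homogeneous_positive X" for u
    proof -
      have uc: "u \<in> carrier ?H" using u hp by blast
      have "u \<otimes>\<^bsub>?H\<^esub> coh_prod X xs \<in> ?S" if xs: "length xs = m" "set xs \<subseteq> homogeneous_positive X" for xs
      proof -
        have "coh_prod X (u # xs) \<in> homogeneous_products (Suc m) X"
          unfolding homogeneous_products_def by (intro CollectI exI[of _ "u # xs"] conjI refl) (use xs u in simp_all)
        then have "coh_prod X (u # xs) \<in> ?S" by (rule subsetD[OF span_superset[OF V HP]])
        then show ?thesis by simp
      qed
      then have "homogeneous_products m X \<subseteq> {v \<in> carrier ?H. u \<otimes>\<^bsub>?H\<^esub> v \<in> ?S}"
        using HP[of m] unfolding homogeneous_products_def by blast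
      from span_minimal[OF V subspace_preimage[OF V cohomology_mult_linear(1)[OF uc] S] this] y
      show ?thesis by blast
    qed
    then have "homogeneous_positive X \<subseteq> {v \<in> carrier ?H. v \<otimes>\<^bsub>?H\<^esub> y \<in> ?S}" using hp by blast
    from span_minimal[OF V subspace_preimage[OF V cohomology_mult_linear(2)[OF yc] S] this] x
    show ?thesis by blast
  qed
  have main: "coh_prod X xs \<in> kspan ?H (homogeneous_products (length xs) X)" if "set xs \<subseteq> positive_cohomology X" for xs
    using that
  proof (induction xs)
    case Nil
    have "coh_prod X ([] :: ('a, 'k) cochain set list) \<in> homogeneous_products 0 X"
      unfolding homogeneous_products_def by (intro CollectI exI[of _ "[]"]) simp
    then have "coh_prod X ([] :: ('a, 'k) cochain set list) \<in> kspan ?H (homogeneous_products 0 X)"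
      by (rule subsetD[OF span_superset[OF V HP]])
    then show ?case by simp
  next
    case (Cons x xs)
    then have "x \<in> kspan ?H (homogeneous_positive X)" using positive_subset_span by auto
    from step[OF this Cons.IH] Cons.prems show ?case by simp
  qed
  fix B :: "('a, 'k) cochain set" assume "B \<in> positive_products l X"
  then show "B \<in> kspan ?H (homogeneous_products l X)" using main unfolding positive_products_def by blast
qed

lemma cohomology_deg_mult:
  assumes "A \<in> cohomology_deg p X" "B \<in> (cohomology_deg q X :: ('a, 'k::field) cochain set set)"
  shows "A \<otimes>\<^bsub>cohomology X\<^esub> B \<in> cohomology_deg (p + q) X"
proof -
  obtain c where c: "c \<in> cocycles X" "\<forall>i. i \<noteq> p \<longrightarrow> c i = (\<lambda>s. 0)" "A = cohomology_class X c"
    using assms(1) by (auto simp: cohomology_deg_def)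
  obtain d where d: "d \<in> cocycles X" "\<forall>i. i \<noteq> q \<longrightarrow> d i = (\<lambda>s. 0)" "B = cohomology_class X d"
    using assms(2) by (auto simp: cohomology_deg_def)
  have "cup_product X c d n s = 0" if n: "n \<noteq> p + q" for n s
  proof -
    have "c i (front_face i s) * d (n - i) (back_face i (n - i) s) = 0" if "i \<le> n" for i
      using c(2) d(2) n that by (cases "i = p") (simp_all add: algebra_simps)
    then have "(\<Sum>i\<le>n. c i (front_face i s) * d (n - i) (back_face i (n - i) s)) = 0" by (intro sum.neutral) simp
    then show ?thesis by (simp only: cup_product_def if_cancel)
  qed
  then show ?thesis
    unfolding c(3) d(3) cohomology_mult[OF c(1) d(1)] cohomology_deg_def
    using cocycles_cup[OF c(1) d(1)] by (intro imageI) (simp add: fun_eq_iff)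
qed

text \<open>Every factor has degree at least 1, so a nonempty product lies in a degree
  \<open>p \<ge> 1\<close>, which the rank matrix records.\<close>

lemma coh_prod_deg:
  assumes "set xs \<subseteq> (homogeneous_positive X :: ('a, 'k::field) cochain set set)"
  shows "\<exists>p\<ge>length xs. coh_prod X xs \<in> cohomology_deg p X"
  using assms
proof (induction xs)
  case Nil
  have "\<one>\<^bsub>cohomology X\<^esub> \<in> (cohomology_deg 0 X :: ('a, 'k) cochain set set)"
    unfolding cohomology_one cohomology_deg_def using unit_cochain_cocycle
    by (intro imageI) (auto simp: unit_cochain_def)
  then show ?case by auto
next
  case (Cons x xs)
  obtain p where p: "length xs \<le> p" "coh_prod X xs \<in> cohomology_deg p X" using Cons by auto
  obtain q where q: "1 \<le> q" "x \<in> cohomology_deg q X" using Cons.prems by (auto simp: homogeneous_positive_def)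
  show ?case using cohomology_deg_mult[OF q(2) p(2)] p(1) q(1) by (intro exI[of _ "q + p"]) simp
qed

text \<open>A product of homogeneous classes is homogeneous and so shows up in one entry with index
  \<open>l\<close>. Conversely, if all such products die under the map, so does their span, which
  contains the whole cup power.\<close>

lemma nonzero_product_iff:
  fixes f :: "'a \<Rightarrow> 'b"
  assumes f: "continuous_map X Y f" and l: "1 \<le> l"
  shows "(\<exists>xs. length xs = l \<and> set xs \<subseteq> cohomology_map X f ` homogeneous_positive Y \<and> coh_prod X xs \<noteq> (\<zero>\<^bsub>cohomology X :: ('a, 'k::field) coh\<^esub>))
    \<longleftrightarrow> (\<exists>p\<ge>1. vdim (cohomology X :: ('a, 'k) coh) (cohomology_map X f ` cup_deg l p Y) \<noteq> 0)" (is "?L \<longleftrightarrow> ?R")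
proof -
  let ?H = "cohomology X :: ('a, 'k) coh" let ?G = "cohomology Y :: ('b, 'k) coh"
  have z: "\<zero>\<^bsub>?H\<^esub> = cohomology_map X f \<zero>\<^bsub>?G\<^esub>" using cohomology_map_linear[OF f] by (auto simp: homogeneous_linear_def)
  have vd: "vdim ?H (cohomology_map X f ` cup_deg l p Y) \<noteq> 0 \<longleftrightarrow> (\<exists>A\<in>cup_deg l p Y. cohomology_map X f A \<noteq> \<zero>\<^bsub>?H\<^esub>)" for p
  proof -
    have "\<zero>\<^bsub>?H\<^esub> \<in> cohomology_map X f ` cup_deg l p Y" unfolding z by (rule imageI[OF subspaceD(2)[OF subspace_cup_deg]])
    then show ?thesis
      unfolding vdim_eq_0_iff[OF vectorspace_cohomology subspace_image[OF vectorspace_cohomology cohomology_map_linear[OF f] subspace_cup_deg]]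
      by blast
  qed
  have hp: "homogeneous_positive Y \<subseteq> carrier ?G"
    using homogeneous_positive_subset positive_subset by (rule order_trans)
  have ys: "\<exists>ys. xs = map (cohomology_map X f) ys \<and> set ys \<subseteq> homogeneous_positive Y"
    if "set xs \<subseteq> cohomology_map X f ` (homogeneous_positive Y :: ('b, 'k) cochain set set)" for xs
    using that
  proof (induction xs)
    case (Cons x xs)
    then obtain ys y where "xs = map (cohomology_map X f) ys" "set ys \<subseteq> homogeneous_positive Y"
      "x = cohomology_map X f y" "y \<in> (homogeneous_positive Y :: ('b, 'k) cochain set set)" by auto
    then show ?case by (intro exI[of _ "y # ys"]) simp
  qed simp
  show ?thesis
  proof
    assume ?L
    then obtain xs where xs: "length xs = l" "set xs \<subseteq> cohomology_map X f ` (homogeneous_positive Y :: ('b, 'k) cochain set set)"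
      "coh_prod X xs \<noteq> \<zero>\<^bsub>?H\<^esub>" by blast
    obtain ys where y: "xs = map (cohomology_map X f) ys" "set ys \<subseteq> homogeneous_positive Y" using ys[OF xs(2)] by blast
    have len: "length ys = l" using xs(1) y(1) by simp
    have e: "cohomology_map X f (coh_prod Y ys) = coh_prod X xs"
      unfolding y(1) by (rule cohomology_map_prod[OF f order_trans[OF y(2) hp]])
    obtain p where p: "l \<le> p" "coh_prod Y ys \<in> cohomology_deg p Y" using coh_prod_deg[OF y(2)] len by blast
    have "coh_prod Y ys \<in> positive_products l Y"
      unfolding positive_products_def
      by (intro CollectI exI[of _ ys] conjI refl len order_trans[OF y(2) homogeneous_positive_subset])
    then have "coh_prod Y ys \<in> cup_power l Y"
      unfolding cup_power_eq by (rule subsetD[OF span_superset[OF vectorspace_cohomology positive_products_subset]])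
    then have "coh_prod Y ys \<in> cup_deg l p Y" using p(2) by simp
    then have "vdim ?H (cohomology_map X f ` cup_deg l p Y) \<noteq> 0" unfolding vd using e xs(3) by metis
    then show ?R using l p(1) order_trans by blast
  next
    assume ?R
    then obtain A where A: "A \<in> cup_power l Y" "cohomology_map X f A \<noteq> \<zero>\<^bsub>?H\<^esub>" unfolding vd by blast
    show ?L
    proof (rule ccontr)
      assume no: "\<not> ?L"
      have zs: "subspace field_ring {\<zero>\<^bsub>?H\<^esub>} ?H"
        by (rule subspaceI[OF vectorspace_cohomology])
          (auto simp: cohomology_zero cohomology_carrier cocycles_zero cohomology_add cohomology_smult)
      note K = subspace_preimage[OF vectorspace_cohomology cohomology_map_linear[OF f] zs]
      have HP: "homogeneous_products l Y \<subseteq> carrier ?G"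
        using homogeneous_products_subset positive_products_subset by (rule order_trans)
      have "homogeneous_products l Y \<subseteq> {v \<in> carrier ?G. cohomology_map X f v \<in> {\<zero>\<^bsub>?H\<^esub>}}"
      proof
        fix B assume B: "B \<in> (homogeneous_products l Y :: ('b, 'k) cochain set set)"
        then obtain ys where y: "length ys = l" "set ys \<subseteq> homogeneous_positive Y" "B = coh_prod Y ys"
          unfolding homogeneous_products_def by blast
        have "coh_prod X (map (cohomology_map X f) ys) = \<zero>\<^bsub>?H\<^esub>"
        proof (rule ccontr)
          assume "coh_prod X (map (cohomology_map X f) ys) \<noteq> \<zero>\<^bsub>?H\<^esub>"
          moreover have "length (map (cohomology_map X f) ys) = l" using y(1) by simp
          moreover have "set (map (cohomology_map X f) ys) \<subseteq> cohomology_map X f ` homogeneous_positive Y"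
            unfolding list.set_map by (rule image_mono[OF y(2)])
          ultimately show False using no by blast
        qed
        then have "cohomology_map X f B = \<zero>\<^bsub>?H\<^esub>"
          unfolding y(3) cohomology_map_prod[OF f order_trans[OF y(2) hp]] .
        then show "B \<in> {v \<in> carrier ?G. cohomology_map X f v \<in> {\<zero>\<^bsub>?H\<^esub>}}" using subsetD[OF HP B] by simp
      qed
      then have "kspan ?G (homogeneous_products l Y) \<subseteq> {v \<in> carrier ?G. cohomology_map X f v \<in> {\<zero>\<^bsub>?H\<^esub>}}"
        by (rule span_minimal[OF vectorspace_cohomology K])
      with positive_products_subset_span have "positive_products l Y \<subseteq> {v \<in> carrier ?G. cohomology_map X f v \<in> {\<zero>\<^bsub>?H\<^esub>}}"
        by (rule order_trans)
      then have "cup_power l Y \<subseteq> {v \<in> carrier ?G. cohomology_map X f v \<in> {\<zero>\<^bsub>?H\<^esub>}}"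
        unfolding cup_power_eq by (rule span_minimal[OF vectorspace_cohomology K])
      then show False using A by blast
    qed
  qed
qed

text \<open>The empty product is the unit and contributes \<open>l = 0\<close> when the cohomology
  at \<open>a\<close> is nonzero; matrix entries with index 0 are set to 0, so this case is listed
  separately.\<close>

lemma cup_length_eq:
  fixes X :: "'a pspace"
  assumes X: "persistent_space X" and ab: "a \<le> b"
  shows "cup_length_invariant TYPE('k::field) X a b =
    Sup {enat l | l. (l = 0 \<and> (\<one>\<^bsub>cohomology (space_at X a) :: ('a, 'k) coh\<^esub>) \<noteq> \<zero>\<^bsub>cohomology (space_at X a)\<^esub>) \<or>
      (\<exists>p. cup_module_rank TYPE('k) X a b p l \<noteq> 0)}"
proof -
  let ?A = "space_at X a" and ?f = "trans_map X a b"
  let ?P = "\<lambda>xs. set xs \<subseteq> cohomology_map ?A ?f ` homogeneous_positive (space_at X b) \<and> coh_prod ?A xs \<noteq> \<zero>\<^bsub>cohomology ?A :: ('a, 'k) coh\<^esub>"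
  have hp: "(\<forall>x\<in>set xs. \<exists>p\<ge>1. x \<in> cohomology_map ?A ?f ` cohomology_deg p (space_at X b)) \<longleftrightarrow>
      set xs \<subseteq> cohomology_map ?A ?f ` homogeneous_positive (space_at X b)" for xs :: "('a, 'k) cochain set list"
    unfolding homogeneous_positive_def image_UN subset_iff UN_iff atLeast_iff by blast
  have l: "(\<exists>xs. length xs = l \<and> ?P xs) \<longleftrightarrow> (l = 0 \<and> (\<one>\<^bsub>cohomology ?A :: ('a, 'k) coh\<^esub>) \<noteq> \<zero>\<^bsub>cohomology ?A\<^esub>) \<or>
      (\<exists>p. cup_module_rank TYPE('k) X a b p l \<noteq> 0)" for l
  proof (cases "l = 0")
    case True then show ?thesis by (auto simp: cup_module_rank_def)
  next
    case False
    then have "1 \<le> l" by simp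
    from nonzero_product_iff[OF persistent_spaceD(1)[OF X ab] this, where ?'k = 'k] False
    show ?thesis by (simp add: cup_module_rank_def conj_commute cong: conj_cong)
  qed
  have "cup_length_invariant TYPE('k) X a b = Sup {enat (length xs) | xs. ?P xs}"
    by (simp add: cup_length_invariant_def ring_length_def hp Let_def del: One_nat_def)
  also have "{enat (length xs) | xs. ?P xs} = {enat l | l. \<exists>xs. length xs = l \<and> ?P xs}" by blast
  finally show ?thesis unfolding l .
qed

lemma cup_length_mono_rank:
  assumes "persistent_space X" "a \<le> b" "persistent_space Y" "c \<le> d"
    and le: "cup_module_rank TYPE('k::field) X a b \<le> cup_module_rank TYPE('k) Y c d"
  shows "cup_length_invariant TYPE('k) X a b \<le> cup_length_invariant TYPE('k) Y c d"
  unfolding cup_length_eq[OF assms(1,2)] cup_length_eq[OF assms(3,4)]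
proof (rule Sup_least)
  let ?S = "{enat l | l. (l = 0 \<and> (\<one>\<^bsub>cohomology (space_at Y c) :: (_, 'k) coh\<^esub>) \<noteq> \<zero>\<^bsub>cohomology (space_at Y c)\<^esub>) \<or>
      (\<exists>p. cup_module_rank TYPE('k) Y c d p l \<noteq> 0)}"
  fix x assume "x \<in> {enat l | l. (l = 0 \<and> (\<one>\<^bsub>cohomology (space_at X a) :: (_, 'k) coh\<^esub>) \<noteq> \<zero>\<^bsub>cohomology (space_at X a)\<^esub>) \<or>
      (\<exists>p. cup_module_rank TYPE('k) X a b p l \<noteq> 0)}"
  then consider "x = 0" | l p where "x = enat l" "cup_module_rank TYPE('k) X a b p l \<noteq> 0"
    by (auto simp: zero_enat_def)
  then show "x \<le> Sup ?S"
  proof cases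
    case 1 then show ?thesis by simp
  next
    case 2
    have "cup_module_rank TYPE('k) X a b p l \<le> cup_module_rank TYPE('k) Y c d p l" using le by (simp add: le_fun_def)
    then have "cup_module_rank TYPE('k) Y c d p l \<noteq> 0" using 2(2) by auto
    then show ?thesis unfolding 2(1) by (intro Sup_upper) blast
  qed
qed

lemma erosion_dist_cup_le:
  assumes X: "persistent_space X" and Y: "persistent_space Y"
  shows "erosion_dist (cup_length_invariant TYPE('k::field) X) (cup_length_invariant TYPE('k) Y)
    \<le> erosion_dist (cup_module_rank TYPE('k) X) (cup_module_rank TYPE('k) Y)"
proof -
  have "eroded e (cup_length_invariant TYPE('k) X) (cup_length_invariant TYPE('k) Y)"
    if e: "0 \<le> e" and "eroded e (cup_module_rank TYPE('k) X) (cup_module_rank TYPE('k) Y)" for e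
    unfolding eroded_def
  proof (intro allI impI)
    fix a b :: real assume ab: "a \<le> b"
    have ab': "a - e \<le> b + e" using ab e by simp
    show "cup_length_invariant TYPE('k) Y (a - e) (b + e) \<le> cup_length_invariant TYPE('k) X a b \<and>
        cup_length_invariant TYPE('k) X (a - e) (b + e) \<le> cup_length_invariant TYPE('k) Y a b"
      using that(2) ab unfolding eroded_def
      by (intro conjI cup_length_mono_rank[OF Y ab' X ab] cup_length_mono_rank[OF X ab' Y ab]) blast+
  qed
  then show ?thesis unfolding erosion_dist_def by (intro Inf_superset_mono) blast
qed

section \<open>Realizations: weak topology, homotopies and compact generation\<close>

section \<open>The realization of a simplicial complex\<close>

definition simplicial_complex :: "'a set set \<Rightarrow> bool" where
  "simplicial_complex K \<longleftrightarrow> (\<forall>\<sigma>\<in>K. finite \<sigma> \<and> \<sigma> \<noteq> {} \<and> (\<forall>\<tau>. \<tau> \<noteq> {} \<and> \<tau> \<subseteq> \<sigma> \<longrightarrow> \<tau> \<in> K))"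

lemma simplicial_complexD:
  assumes "simplicial_complex K" "\<sigma> \<in> K"
  shows "finite \<sigma>" "\<sigma> \<noteq> {}" "\<tau> \<noteq> {} \<Longrightarrow> \<tau> \<subseteq> \<sigma> \<Longrightarrow> \<tau> \<in> K"
  using assms unfolding simplicial_complex_def by blast+

lemma realization_pointsD:
  assumes "x \<in> realization_points K"
  shows "0 \<le> x v" "{v. x v \<noteq> 0} \<in> K" "(\<Sum>v | x v \<noteq> 0. x v) = 1"
  using assms by (auto simp: realization_points_def)

lemma closed_simplex_support: "x \<in> realization_points K \<Longrightarrow> x \<in> closed_simplex K {v. x v \<noteq> 0}"
  by (simp add: closed_simplex_def)

text \<open>Sums run over the fixed finite set \<open>\<sigma>\<close> instead of the support, which
  varies with \<open>x\<close>; in this form the conditions are closed and the formulas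
  continuous.\<close>

lemma closed_simplexI:
  assumes K: "simplicial_complex K" and s: "\<sigma> \<in> K" and x: "\<And>v. 0 \<le> x v" "\<And>v. v \<notin> \<sigma> \<Longrightarrow> x v = 0" "(\<Sum>v\<in>\<sigma>. x v) = 1"
  shows "x \<in> closed_simplex K \<sigma>"
proof -
  have sub: "{v. x v \<noteq> 0} \<subseteq> \<sigma>" using x(2) by blast
  have sum: "(\<Sum>v | x v \<noteq> 0. x v) = 1"
    unfolding x(3)[symmetric] by (rule sum.mono_neutral_left[OF simplicial_complexD(1)[OF K s] sub]) simp
  have "{v. x v \<noteq> 0} \<noteq> {}" using sum by (metis sum.empty zero_neq_one)
  then have "{v. x v \<noteq> 0} \<in> K" by (rule simplicial_complexD(3)[OF K s _ sub])
  then show ?thesis using sub sum x(1) by (simp add: closed_simplex_def realization_points_def)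
qed

lemma closed_simplexD:
  assumes K: "simplicial_complex K" and s: "\<sigma> \<in> K" and x: "x \<in> closed_simplex K \<sigma>"
  shows "x \<in> realization_points K" "0 \<le> x v" "v \<notin> \<sigma> \<Longrightarrow> x v = 0" "(\<Sum>v\<in>\<sigma>. x v) = 1"
proof -
  show xp: "x \<in> realization_points K" using x by (simp add: closed_simplex_def)
  show "0 \<le> x v" by (rule realization_pointsD(1)[OF xp])
  have sub: "{v. x v \<noteq> 0} \<subseteq> \<sigma>" using x by (simp add: closed_simplex_def)
  then show "v \<notin> \<sigma> \<Longrightarrow> x v = 0" by blast
  show "(\<Sum>v\<in>\<sigma>. x v) = 1"
    unfolding realization_pointsD(3)[OF xp, symmetric]
    by (rule sum.mono_neutral_right[OF simplicial_complexD(1)[OF K s] sub]) simp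
qed

lemma topspace_realization [simp]: "topspace (realization K) = realization_points K"
proof -
  have "realization_open K (realization_points K)"
    by (auto simp: realization_open_def closed_simplex_def Int_absorb1)
  then show ?thesis
    unfolding topspace_def openin_realization by (auto simp: realization_open_def)
qed

lemma closedin_realization:
  "closedin (realization K) S \<longleftrightarrow>
    S \<subseteq> realization_points K \<and> (\<forall>\<sigma>\<in>K. closedin (top_of_set (closed_simplex K \<sigma>)) (S \<inter> closed_simplex K \<sigma>))"
proof -
  have "openin (top_of_set (closed_simplex K \<sigma>)) ((realization_points K - S) \<inter> closed_simplex K \<sigma>) \<longleftrightarrow>
     closedin (top_of_set (closed_simplex K \<sigma>)) (S \<inter> closed_simplex K \<sigma>)" for \<sigma>
  proof -
    have "closed_simplex K \<sigma> - S \<inter> closed_simplex K \<sigma> = (realization_points K - S) \<inter> closed_simplex K \<sigma>"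
      by (auto simp: closed_simplex_def)
    then show ?thesis by (simp add: closedin_def)
  qed
  then show ?thesis by (simp add: closedin_def openin_realization realization_open_def)
qed

text \<open>By definition weakly open sets are Euclidean open on each simplex; conversely a
  Euclidean open set cut down to the realization meets all simplices in open sets.\<close>

lemma subtopology_realization:
  assumes s: "\<sigma> \<in> K"
  shows "subtopology (realization K) (closed_simplex K \<sigma>) = top_of_set (closed_simplex K \<sigma>)"
  unfolding topology_eq
proof (intro allI iffI)
  fix U assume "openin (subtopology (realization K) (closed_simplex K \<sigma>)) U"
  then show "openin (top_of_set (closed_simplex K \<sigma>)) U"
    using s by (auto simp: openin_subtopology openin_realization realization_open_def)
next
  fix U assume "openin (top_of_set (closed_simplex K \<sigma>)) U"
  then obtain T where T: "open T" "U = T \<inter> closed_simplex K \<sigma>" by (auto simp: openin_subtopology)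
  have e: "T \<inter> realization_points K \<inter> closed_simplex K \<tau> = closed_simplex K \<tau> \<inter> T" for \<tau>
    by (auto simp: closed_simplex_def)
  have "realization_open K (T \<inter> realization_points K)"
    unfolding realization_open_def e using T(1) by (auto intro: openin_open_Int)
  moreover have "U = T \<inter> realization_points K \<inter> closed_simplex K \<sigma>" unfolding e T(2) by blast
  ultimately show "openin (subtopology (realization K) (closed_simplex K \<sigma>)) U"
    by (auto simp: openin_subtopology openin_realization)
qed

lemma continuous_map_from_realization:
  assumes K: "simplicial_complex K" and f: "\<And>\<sigma>. \<sigma> \<in> K \<Longrightarrow> continuous_map (top_of_set (closed_simplex K \<sigma>)) Y f"
  shows "continuous_map (realization K) Y f"
  unfolding continuous_map_def
proof (intro conjI allI impI)
  show "f \<in> topspace (realization K) \<rightarrow> topspace Y"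
    using f[OF realization_pointsD(2)] closed_simplex_support continuous_map_on_mem by fastforce
  fix U assume U: "openin Y U"
  have "{x \<in> realization_points K. f x \<in> U} \<inter> closed_simplex K \<sigma> = {x \<in> closed_simplex K \<sigma>. f x \<in> U}" for \<sigma>
    by (auto simp: closed_simplex_def)
  then show "openin (realization K) {x \<in> topspace (realization K). f x \<in> U}"
    using f U by (auto simp: openin_realization realization_open_def continuous_map_def)
qed

text \<open>The weak topology is at least as fine as the Euclidean one, so continuity into the
  realization is checked where the values stay within one simplex.\<close>

lemma continuous_map_into_simplex:
  assumes s: "\<sigma> \<in> K" and g: "continuous_on S g" "\<And>x. x \<in> S \<Longrightarrow> g x \<in> closed_simplex K \<sigma>"
  shows "continuous_map (top_of_set S) (realization K) g"
proof -
  have "continuous_map (top_of_set S) (top_of_set (closed_simplex K \<sigma>)) g" using g by auto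
  then show ?thesis
    unfolding subtopology_realization[OF s, symmetric] by (rule continuous_map_into_fulltopology)
qed

lemma realization_mono:
  assumes K: "simplicial_complex K" and L: "simplicial_complex L" and sub: "K \<subseteq> L"
  shows "continuous_map (realization K) (realization L) (\<lambda>x. x)"
proof (rule continuous_map_from_realization[OF K], rule continuous_map_into_simplex)
  fix \<sigma> assume s: "\<sigma> \<in> K"
  then show "\<sigma> \<in> L" using sub by blast
  show "x \<in> closed_simplex L \<sigma>" if "x \<in> closed_simplex K \<sigma>" for x
    using that sub by (auto simp: closed_simplex_def realization_points_def)
qed (rule continuous_on_id)

lemma Hausdorff_euclidean_fun: "Hausdorff_space (euclidean :: ('a \<Rightarrow> real) topology)"
  unfolding euclidean_product_topology[symmetric] Hausdorff_space_product_topology by simp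

text \<open>The weak topology is at least as fine as the product topology, which is
  Hausdorff.\<close>

lemma Hausdorff_realization:
  assumes K: "simplicial_complex K" shows "Hausdorff_space (realization K)"
proof (rule Hausdorff_space_injective_preimage[OF Hausdorff_euclidean_fun])
  show "continuous_map (realization K) euclidean (\<lambda>x. x)"
    by (rule continuous_map_from_realization[OF K]) simp
qed (simp add: inj_on_def)

lemma compact_closed_simplex:
  fixes K :: "'a set set"
  assumes K: "simplicial_complex K" and s: "\<sigma> \<in> K" shows "compact (closed_simplex K \<sigma>)"
proof -
  let ?P = "PiE UNIV (\<lambda>v. if v \<in> \<sigma> then {0..1} else {0}) :: ('a \<Rightarrow> real) set"
  have "compactin (product_topology (\<lambda>i. euclidean) UNIV) ?P"
    by (subst compactin_PiE) (auto simp: compactin_euclidean_iff)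
  then have P: "compact ?P" by (simp add: euclidean_product_topology compactin_euclidean_iff)
  have "continuous_on UNIV (\<lambda>x :: 'a \<Rightarrow> real. \<Sum>v\<in>\<sigma>. x v)"
    by (intro continuous_on_sum continuous_on_product_coordinates)
  then have "closed ((\<lambda>x :: 'a \<Rightarrow> real. \<Sum>v\<in>\<sigma>. x v) -` {1})" by (rule closed_vimage[OF closed_singleton])
  then have "compact (?P \<inter> (\<lambda>x. \<Sum>v\<in>\<sigma>. x v) -` {1})" by (rule compact_Int_closed[OF P])
  moreover have "?P \<inter> (\<lambda>x. \<Sum>v\<in>\<sigma>. x v) -` {1} = closed_simplex K \<sigma>"
  proof (intro equalityI subsetI)
    fix x assume x: "x \<in> ?P \<inter> (\<lambda>x. \<Sum>v\<in>\<sigma>. x v) -` {1}"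
    then have p: "x v \<in> (if v \<in> \<sigma> then {0..1} else {0})" for v using PiE_mem[of x UNIV] by blast
    show "x \<in> closed_simplex K \<sigma>"
    proof (rule closed_simplexI[OF K s])
      show "0 \<le> x v" "v \<notin> \<sigma> \<Longrightarrow> x v = 0" for v using p[of v] by (auto split: if_splits)
      show "(\<Sum>v\<in>\<sigma>. x v) = 1" using x by simp
    qed
  next
    fix x assume x: "x \<in> closed_simplex K \<sigma>"
    note D = closed_simplexD[OF K s x]
    have "x v \<le> 1" if "v \<in> \<sigma>" for v
      using member_le_sum[OF that _ simplicial_complexD(1)[OF K s], of x] D(2,4) by simp
    then show "x \<in> ?P \<inter> (\<lambda>x. \<Sum>v\<in>\<sigma>. x v) -` {1}" using D(2-4) by (auto simp: PiE_def)
  qed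
  ultimately show ?thesis by simp
qed

lemma continuous_map_from_prod_sum:
  assumes h: "\<And>i. i \<in> I \<Longrightarrow> continuous_map (prod_topology Z (X i)) Y (\<lambda>(z, x). h (z, i, x))"
  shows "continuous_map (prod_topology Z (sum_topology X I)) Y h"
  unfolding continuous_map_def
proof (intro conjI allI impI)
  have "h (z, i, x) \<in> topspace Y" if "z \<in> topspace Z" "i \<in> I" "x \<in> topspace (X i)" for z i x
    using h[OF that(2)] that(1,3) by (auto simp: continuous_map_def Pi_iff)
  then show "h \<in> topspace (prod_topology Z (sum_topology X I)) \<rightarrow> topspace Y" by auto
  fix U assume U: "openin Y U"
  show "openin (prod_topology Z (sum_topology X I)) {x \<in> topspace (prod_topology Z (sum_topology X I)). h x \<in> U}" (is "openin _ ?S")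
    unfolding openin_prod_topology_alt
  proof (intro allI impI)
    fix z ix assume "(z, ix) \<in> ?S"
    then obtain i x where ix: "ix = (i, x)" and m: "z \<in> topspace Z" "i \<in> I" "x \<in> topspace (X i)" "h (z, i, x) \<in> U"
      by (cases ix) auto
    have "openin (prod_topology Z (X i)) {y \<in> topspace (prod_topology Z (X i)). (case y of (z, x) \<Rightarrow> h (z, i, x)) \<in> U}"
      using h[OF m(2)] U by (simp only: continuous_map_def)
    moreover have "(z, x) \<in> {y \<in> topspace (prod_topology Z (X i)). (case y of (z, x) \<Rightarrow> h (z, i, x)) \<in> U}" using m by simp
    ultimately obtain A B where AB: "openin Z A" "openin (X i) B" "z \<in> A" "x \<in> B"
      "A \<times> B \<subseteq> {y \<in> topspace (prod_topology Z (X i)). (case y of (z, x) \<Rightarrow> h (z, i, x)) \<in> U}"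
      unfolding openin_prod_topology_alt by meson
    have "openin (sum_topology X I) ((\<lambda>x. (i, x)) ` B)"
      using open_map_component_injection[OF m(2), of X] AB(2) by (simp add: open_map_def)
    moreover have "A \<times> (\<lambda>x. (i, x)) ` B \<subseteq> ?S" using AB(5) m(2) by auto
    ultimately show "\<exists>V W. openin Z V \<and> openin (sum_topology X I) W \<and> z \<in> V \<and> ix \<in> W \<and> V \<times> W \<subseteq> ?S"
      using AB(1,3,4) ix by blast
  qed
qed

text \<open>Homotopies out of a realization can be checked simplexwise: the realization is a
  quotient of the disjoint sum of its closed simplices, and the product of this quotient map with
  the locally compact Hausdorff interval is again a quotient map.\<close>

lemma continuous_map_from_prod_realization:
  assumes K: "simplicial_complex K"
    and h: "\<And>\<sigma>. \<sigma> \<in> K \<Longrightarrow> continuous_map (top_of_set ({0..1::real} \<times> closed_simplex K \<sigma>)) Y h"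
  shows "continuous_map (prod_topology (top_of_set {0..1::real}) (realization K)) Y h"
proof -
  let ?C = "\<lambda>\<sigma>. top_of_set (closed_simplex K \<sigma>)" let ?I = "top_of_set {0..1::real}"
  have "quotient_map (sum_topology ?C K) (realization K) snd"
    unfolding quotient_map_def
  proof (intro conjI allI impI)
    show "snd ` topspace (sum_topology ?C K) = topspace (realization K)"
    proof (intro equalityI subsetI)
      fix x assume x: "x \<in> topspace (realization K)"
      then have "({v. x v \<noteq> 0}, x) \<in> topspace (sum_topology ?C K)"
        using realization_pointsD(2) closed_simplex_support by auto
      then show "x \<in> snd ` topspace (sum_topology ?C K)" by force
    qed (auto simp: closed_simplex_def)
    fix U assume U: "U \<subseteq> topspace (realization K)"
    have "{x. (\<sigma>, x) \<in> {x \<in> topspace (sum_topology ?C K). snd x \<in> U}} = U \<inter> closed_simplex K \<sigma>" if "\<sigma> \<in> K" for \<sigma>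
      using that by auto
    then show "openin (sum_topology ?C K) {x \<in> topspace (sum_topology ?C K). snd x \<in> U} = openin (realization K) U"
      using U by (auto simp: openin_sum_topology openin_realization realization_open_def)
  qed
  moreover have "compact_space ?I" by (simp add: compact_space_subtopology compactin_euclidean_iff)
  ultimately have q: "quotient_map (prod_topology ?I (sum_topology ?C K)) (prod_topology ?I (realization K)) (\<lambda>(x, y). (x, snd y))"
    by (intro quotient_map_prod_right compact_imp_locally_compact_space disjI1 Hausdorff_space_subtopology) simp_all
  have "continuous_map (prod_topology ?I (sum_topology ?C K)) Y (h \<circ> (\<lambda>(x, y). (x, snd y)))"
  proof (rule continuous_map_from_prod_sum)
    fix \<sigma> assume "\<sigma> \<in> K"
    from h[OF this] show "continuous_map (prod_topology ?I (?C \<sigma>)) Y (\<lambda>(z, x). (h \<circ> (\<lambda>(x, y). (x, snd y))) (z, \<sigma>, x))"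
      by (simp add: case_prod_unfold flip: subtopology_Times)
  qed
  then show ?thesis unfolding continuous_compose_quotient_map_eq[OF q] .
qed

text \<open>Stated for a copy \<open>T\<close> of \<open>R\<close> in another type, since the
  replacement spaces live in the universe. Compact test spaces must have points of type
  \<open>'b set set\<close>, so each compact piece is copied there.\<close>

lemma cgwh_space_coherent:
  fixes T :: "'b topology" and \<iota> :: "'a \<Rightarrow> 'b"
  assumes H: "homeomorphic_maps R T \<iota> j" and R: "Hausdorff_space R"
    and C: "\<And>C. C \<in> \<C> \<Longrightarrow> compactin R C"
    and coh: "\<And>S. S \<subseteq> topspace R \<Longrightarrow> (\<And>C. C \<in> \<C> \<Longrightarrow> closedin (subtopology R C) (S \<inter> C)) \<Longrightarrow> closedin R S"
  shows "cgwh_space T"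
proof -
  have ij: "continuous_map R T \<iota>" "continuous_map T R j" "\<And>x. x \<in> topspace R \<Longrightarrow> j (\<iota> x) = x"
    "\<And>y. y \<in> topspace T \<Longrightarrow> \<iota> (j y) = y"
    using H by (auto simp: homeomorphic_maps_def)
  have T: "Hausdorff_space T"
    using R H homeomorphic_Hausdorff_space homeomorphic_space_def by blast
  have "weak_Hausdorff_space T"
    unfolding weak_Hausdorff_space_def compact_space_def
    by (meson T closedin_compact_space compactin_imp_closedin image_compactin)
  moreover have "compactly_generated_space T"
    unfolding compactly_generated_space_def
  proof (intro allI impI)
    fix S assume S: "S \<subseteq> topspace T" and test: "\<forall>(C :: 'b set set topology) u.
      compact_space C \<and> Hausdorff_space C \<and> continuous_map C T u \<longrightarrow> closedin C {c \<in> topspace C. u c \<in> S}"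
    have "closedin R {x \<in> topspace R. \<iota> x \<in> S}"
    proof (rule coh)
      fix C assume "C \<in> \<C>"
      then have C: "compactin R C" by (rule C)
      \<comment> \<open>A point is coded as the singleton of a singleton to reach the type of the
        test spaces; \<open>?k\<close> decodes it.\<close>
      let ?e = "\<lambda>x. {{\<iota> x}}" let ?k = "\<lambda>c. j (the_elem (the_elem c))"
      let ?D = "pullback_topology (?e ` C) ?k (subtopology R C)"
      have CR: "C \<subseteq> topspace R" using compactin_subset_topspace[OF C] .
      have ke: "?k (?e x) = x" if "x \<in> C" for x using ij(3) that CR by auto
      have tD: "topspace ?D = ?e ` C" using ke CR by (auto simp: topspace_pullback_topology)
      have cont_e: "continuous_map (subtopology R C) ?D ?e"
      proof (rule continuous_map_pullback')
        show "continuous_map (subtopology R C) (subtopology R C) (?k \<circ> ?e)"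
          by (rule continuous_map_eq[OF continuous_map_id]) (use ke in auto)
      qed auto
      have cont_k: "continuous_map ?D (subtopology R C) ?k"
        using continuous_map_pullback[OF continuous_map_id, of "?e ` C" ?k "subtopology R C"] by (simp add: comp_def)
      have hm: "homeomorphic_maps (subtopology R C) ?D ?e ?k"
        unfolding homeomorphic_maps_def using cont_e cont_k ke CR by (auto simp: tD)
      then have hs: "subtopology R C homeomorphic_space ?D" unfolding homeomorphic_space_def by blast
      have "compact_space ?D" using compact_space_subtopology[OF C] homeomorphic_compact_space[OF hs] by simp
      moreover have "Hausdorff_space ?D"
        using Hausdorff_space_subtopology[OF R] homeomorphic_Hausdorff_space[OF hs] by blast
      moreover have "continuous_map ?D T (\<iota> \<circ> ?k)"
        by (rule continuous_map_compose[OF continuous_map_into_fulltopology[OF cont_k] ij(1)])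
      ultimately have cl: "closedin ?D {c \<in> topspace ?D. (\<iota> \<circ> ?k) c \<in> S}" using test by blast
      have "closedin (subtopology R C) {x \<in> topspace (subtopology R C). ?e x \<in> {c \<in> topspace ?D. (\<iota> \<circ> ?k) c \<in> S}}"
        by (rule closedin_continuous_map_preimage[OF cont_e cl])
      moreover have "{x \<in> topspace (subtopology R C). ?e x \<in> {c \<in> topspace ?D. (\<iota> \<circ> ?k) c \<in> S}} = {x \<in> topspace R. \<iota> x \<in> S} \<inter> C"
        using ke CR unfolding tD by auto
      ultimately show "closedin (subtopology R C) ({x \<in> topspace R. \<iota> x \<in> S} \<inter> C)" by simp
    qed blast
    then have "closedin T {y \<in> topspace T. j y \<in> {x \<in> topspace R. \<iota> x \<in> S}}"
      by (rule closedin_continuous_map_preimage[OF ij(2)])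
    moreover have "{y \<in> topspace T. j y \<in> {x \<in> topspace R. \<iota> x \<in> S}} = S"
      using S ij(2,4) by (auto simp: continuous_map_def Pi_iff)
    ultimately show "closedin T S" by simp
  qed
  ultimately show ?thesis by (simp add: cgwh_space_def)
qed

lemma cgwh_space_realization:
  assumes K: "simplicial_complex K" and H: "homeomorphic_maps (realization K) T \<iota> j"
  shows "cgwh_space T"
proof (rule cgwh_space_coherent[OF H Hausdorff_realization[OF K], where \<C> = "closed_simplex K ` K"])
  show "compactin (realization K) C" if C: "C \<in> closed_simplex K ` K" for C
  proof -
    obtain \<sigma> where s: "\<sigma> \<in> K" "C = closed_simplex K \<sigma>" using C by blast
    have "compact_space (subtopology (realization K) C)"
      unfolding s(2) subtopology_realization[OF s(1)] using compact_closed_simplex[OF K s(1)]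
      by (simp add: compact_space_subtopology compactin_euclidean_iff)
    then show ?thesis by (auto simp: compactin_subspace s(2) closed_simplex_def)
  qed
  show "closedin (realization K) S" if "S \<subseteq> topspace (realization K)"
    "\<And>C. C \<in> closed_simplex K ` K \<Longrightarrow> closedin (subtopology (realization K) C) (S \<inter> C)" for S
    unfolding closedin_realization
  proof (intro conjI ballI)
    show "S \<subseteq> realization_points K" using that(1) by simp
    fix \<sigma> assume s: "\<sigma> \<in> K"
    from that(2)[OF imageI[OF s]] show "closedin (top_of_set (closed_simplex K \<sigma>)) (S \<inter> closed_simplex K \<sigma>)"
      unfolding subtopology_realization[OF s] .
  qed
qed

text \<open>Moves a space to another type along an injection, so that it can have its points in the
  universe.\<close>

lemma homeomorphic_maps_pullback:
  assumes "inj \<iota>" shows "homeomorphic_maps X (pullback_topology (range \<iota>) (inv_into UNIV \<iota>) X) \<iota> (inv_into UNIV \<iota>)"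
proof -
  have "inv_into UNIV \<iota> \<circ> \<iota> = id" using assms by (simp add: fun_eq_iff)
  then have "continuous_map X (pullback_topology (range \<iota>) (inv_into UNIV \<iota>) X) \<iota>"
    by (intro continuous_map_pullback') (auto simp: continuous_map_id)
  moreover have "continuous_map (pullback_topology (range \<iota>) (inv_into UNIV \<iota>) X) X (inv_into UNIV \<iota>)"
    using continuous_map_pullback[OF continuous_map_id, of "range \<iota>" "inv_into UNIV \<iota>" X] by (simp add: comp_def)
  ultimately show ?thesis
    using assms by (auto simp: homeomorphic_maps_def topspace_pullback_topology)
qed

section \<open>Blowups of complexes and Vietoris-Rips filtrations\<close>

section \<open>A criterion for weak equivalences\<close>

text \<open>A strict section through the base point, with a deformation of \<open>X\<close> onto its
  image that never moves the base point. Homotopy groups can then be compared without a change of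
  base point.\<close>

definition based_section :: "'a topology \<Rightarrow> 'b topology \<Rightarrow> ('a \<Rightarrow> 'b) \<Rightarrow> 'a \<Rightarrow> ('b \<Rightarrow> 'a) \<Rightarrow> (real \<times> 'a \<Rightarrow> 'a) \<Rightarrow> bool" where
  "based_section X Y F x s h \<longleftrightarrow> continuous_map Y X s \<and> (\<forall>y\<in>topspace Y. F (s y) = y) \<and> s (F x) = x \<and>
      continuous_map (prod_topology (top_of_set {0..1::real}) X) X h \<and>
      (\<forall>z\<in>topspace X. h (0, z) = z \<and> h (1, z) = s (F z)) \<and> (\<forall>u\<in>{0..1}. h (u, x) = x)"

lemma based_sectionD:
  assumes "based_section X Y F x s h"
  shows "continuous_map Y X s" "y \<in> topspace Y \<Longrightarrow> F (s y) = y" "s (F x) = x"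
    "continuous_map (prod_topology (top_of_set {0..1::real}) X) X h"
    "z \<in> topspace X \<Longrightarrow> h (0, z) = z" "z \<in> topspace X \<Longrightarrow> h (1, z) = s (F z)" "u \<in> {0..1} \<Longrightarrow> h (u, x) = x"
  using assms by (simp_all add: based_section_def)

text \<open>Composition with the section gives preimages of classes, and the deformation gives
  injectivity. The section may depend on the base point \<open>x\<close>, as no single one need pass
  through all of them. The hypothesis on nonempty spaces provides a first base point for
  surjectivity on path components.\<close>

lemma weak_homotopy_equivalenceI:
  assumes F: "continuous_map X Y F" and ne: "topspace Y \<noteq> {} \<Longrightarrow> topspace X \<noteq> {}"
    and S: "\<And>x. x \<in> topspace X \<Longrightarrow> \<exists>s h. based_section X Y F x s h"
  shows "weak_homotopy_equivalence X Y F"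
  unfolding weak_homotopy_equivalence_def
proof (intro conjI allI impI ballI F)
  let ?\<Phi> = "\<lambda>C. \<Union>x \<in> C. path_component_of_set Y (F x)"
  have Phi: "?\<Phi> (path_component_of_set X x) = path_component_of_set Y (F x)" if "x \<in> topspace X" for x
    by (rule weak_homotopy_equivalence_path_component_map[OF F that])
  have FX: "F x \<in> topspace Y" if "x \<in> topspace X" for x using F that by (auto simp: continuous_map_def)
  show "bij_betw ?\<Phi> (path_components_of X) (path_components_of Y)"
    unfolding bij_betw_def
  proof (rule conjI; (rule inj_onI | rule equalityI; rule subsetI))
    fix C C' assume C: "C \<in> path_components_of X" "C' \<in> path_components_of X" and eq: "?\<Phi> C = ?\<Phi> C'"
    obtain x where x: "x \<in> topspace X" "C = path_component_of_set X x" using C(1) unfolding path_components_of_def by blast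
    obtain x' where x': "x' \<in> topspace X" "C' = path_component_of_set X x'" using C(2) unfolding path_components_of_def by blast
    obtain s h where sh: "based_section X Y F x s h" using S[OF x(1)] by blast
    note sh = based_sectionD[OF sh]
    have "path_component_of_set Y (F x) = path_component_of_set Y (F x')" using eq unfolding x(2) x'(2) Phi[OF x(1)] Phi[OF x'(1)] .
    moreover have "F x' \<in> path_component_of_set Y (F x')" using FX[OF x'(1)] by (simp add: path_component_of_refl)
    ultimately have "F x' \<in> path_component_of_set Y (F x)" by (simp only:)
    then have "path_component_of Y (F x) (F x')" by simp
    then obtain g where g: "continuous_map (top_of_set {0..1::real}) Y g" "g 0 = F x" "g 1 = F x'"
      unfolding path_component_of_iff_path by blast
    have "path_component_of X x (s (F x'))"
      unfolding path_component_of_iff_path using continuous_map_compose[OF g(1) sh(1)] g(2,3) sh(3)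
      by (intro exI[of _ "s \<circ> g"]) simp
    moreover have "path_component_of X x' (s (F x'))"
    proof -
      have "continuous_map (top_of_set {0..1::real}) (prod_topology (top_of_set {0..1}) X) (\<lambda>u. (u, x'))"
        using x'(1) by (intro continuous_map_pairedI) (simp_all add: continuous_map_const)
      from continuous_map_compose[OF this sh(4)] show ?thesis
        unfolding path_component_of_iff_path using sh(5,6)[OF x'(1)] by (intro exI[of _ "h \<circ> (\<lambda>u. (u, x'))"]) simp
    qed
    ultimately have "path_component_of X x x'" by (meson path_component_of_sym path_component_of_trans)
    then show "C = C'" unfolding x(2) x'(2) by (simp add: path_component_of_equiv)
  next
    fix D assume "D \<in> ?\<Phi> ` path_components_of X"
    then obtain x where "x \<in> topspace X" "D = path_component_of_set Y (F x)" unfolding path_components_of_def by (auto simp only: image_iff Phi)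
    then show "D \<in> path_components_of Y" using FX[of x] unfolding path_components_of_def by blast
  next
    fix D assume "D \<in> path_components_of Y"
    then obtain y where y: "y \<in> topspace Y" "D = path_component_of_set Y y" unfolding path_components_of_def by blast
    then obtain x where "x \<in> topspace X" using ne by blast
    from S[OF this] obtain s h where "based_section X Y F x s h" by blast
    note s = based_sectionD(1,2)[OF this]
    have sy: "s y \<in> topspace X" using continuous_map_image_subset_topspace[OF s(1)] y(1) by blast
    have "D = ?\<Phi> (path_component_of_set X (s y))" unfolding Phi[OF sy] s(2)[OF y(1)] by (rule y(2))
    moreover have "path_component_of_set X (s y) \<in> path_components_of X" unfolding path_components_of_def by (rule imageI[OF sy])
    ultimately show "D \<in> ?\<Phi> ` path_components_of X" by (rule image_eqI)
  qed
  fix n :: nat and x assume x: "x \<in> topspace X"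
  obtain s h where sh: "based_section X Y F x s h" using S[OF x] by blast
  note s = based_sectionD(1-3)[OF sh] and h = based_sectionD(4-7)[OF sh]
  let ?H = "\<lambda>X x. homotopic_with (\<lambda>k. \<forall>u \<in> unit_cube_boundary n. k u = x) (cube_topology n) X"
  have top: "unit_cube n = topspace (cube_topology n)" by (simp add: cube_topology_eq)
  \<comment> \<open>The deformation fixes \<open>x\<close>, so applying it to a based cube leaves
    the boundary in place.\<close>
  have ret: "?H X x g (s \<circ> (F \<circ> g))" if g: "g \<in> based_cubes n X x" for g
    unfolding cube_topology_eq
  proof (rule homotopic_with_relI[where k = "\<lambda>z. h (fst z, g (snd z))"])
    have gc: "continuous_map (top_of_set (unit_cube n)) X g" and gb: "\<forall>u\<in>unit_cube_boundary n. g u = x"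
      using g by (auto simp: based_cubes_def cube_topology_eq)
    have "continuous_map (prod_topology (top_of_set {0..1::real}) (top_of_set (unit_cube n)))
        (prod_topology (top_of_set {0..1}) X) (\<lambda>z. (fst z, g (snd z)))"
      by (intro continuous_map_pairedI continuous_map_fst continuous_map_compose[OF continuous_map_snd gc, unfolded comp_def])
    from continuous_map_compose[OF this h(1)]
    show "continuous_map (top_of_set ({0..1::real} \<times> unit_cube n)) X (\<lambda>z. h (fst z, g (snd z)))"
      by (simp add: comp_def flip: subtopology_Times)
    show "h (fst (t, u), g (snd (t, u))) = x" if "t \<in> {0..1}" "u \<in> unit_cube_boundary n" for t u
      using that gb h(4) by simp
    show "h (fst (0, u), g (snd (0, u))) = g u" if "u \<in> unit_cube n" for u
      using h(2)[OF continuous_map_on_mem[OF gc that]] by simp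
    show "h (fst (1, u), g (snd (1, u))) = (s \<circ> (F \<circ> g)) u" if "u \<in> unit_cube n" for u
      using h(3)[OF continuous_map_on_mem[OF gc that]] by simp
  qed (rule unit_cube_boundary_subset)
  show "bij_betw (homotopy_group_map n Y F x) (homotopy_group n X x) (homotopy_group n Y (F x))"
    unfolding bij_betw_def
  proof (rule conjI; (rule inj_onI | rule equalityI; rule subsetI))
    fix A A' assume "A \<in> homotopy_group n X x" "A' \<in> homotopy_group n X x" and eq: "homotopy_group_map n Y F x A = homotopy_group_map n Y F x A'"
    then obtain g g' where g: "g \<in> based_cubes n X x" "A = homotopy_class n X x g" and g': "g' \<in> based_cubes n X x" "A' = homotopy_class n X x g'"
      by (auto simp: homotopy_group_def)
    have "?H Y (F x) (F \<circ> g) (F \<circ> g')"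
      using eq unfolding g(2) g'(2) homotopy_group_map_class[OF F g(1)] homotopy_group_map_class[OF F g'(1)]
        homotopy_class_eq_iff[OF based_cubes_comp[OF g(1) F]] .
    then have "?H X x (s \<circ> (F \<circ> g)) (s \<circ> (F \<circ> g'))"
      by (rule homotopic_with_compose_continuous_map_left) (use s(1,3) in auto)
    then have "?H X x g g'" using ret[OF g(1)] homotopic_with_symD[OF ret[OF g'(1)]] homotopic_with_trans by blast
    then show "A = A'" unfolding g(2) g'(2) homotopy_class_eq_iff[OF g(1)] .
  next
    fix B assume "B \<in> homotopy_group_map n Y F x ` homotopy_group n X x"
    then obtain g where g: "g \<in> based_cubes n X x" "B = homotopy_group_map n Y F x (homotopy_class n X x g)"
      by (auto simp: homotopy_group_def)
    show "B \<in> homotopy_group n Y (F x)"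
      unfolding g(2) homotopy_group_map_class[OF F g(1)] homotopy_group_def by (rule imageI[OF based_cubes_comp[OF g(1) F]])
  next
    fix B assume "B \<in> homotopy_group n Y (F x)"
    then obtain k where k: "k \<in> based_cubes n Y (F x)" "B = homotopy_class n Y (F x) k" by (auto simp: homotopy_group_def)
    have sk: "s \<circ> k \<in> based_cubes n X x" using based_cubes_comp[OF k(1) s(1)] s(3) by simp
    have "?H Y (F x) (F \<circ> (s \<circ> k)) k"
    proof (rule homotopic_with_equal)
      show "\<forall>u\<in>unit_cube_boundary n. (F \<circ> (s \<circ> k)) u = F x" using sk by (auto simp: based_cubes_def)
      show "continuous_map (cube_topology n) Y (F \<circ> (s \<circ> k))" using sk F by (auto simp: based_cubes_def intro: continuous_map_compose)
      show "(F \<circ> (s \<circ> k)) u = k u" if "u \<in> topspace (cube_topology n)" for u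
        using k(1) s(2) that by (auto simp: based_cubes_def continuous_map_def)
    qed (use k(1) in \<open>auto simp: based_cubes_def\<close>)
    then have "B = homotopy_group_map n Y F x (homotopy_class n X x (s \<circ> k))"
      unfolding k(2) homotopy_group_map_class[OF F sk] homotopy_class_eq_iff[OF k(1)] by (rule homotopic_with_symD)
    moreover have "homotopy_class n X x (s \<circ> k) \<in> homotopy_group n X x" unfolding homotopy_group_def by (rule imageI[OF sk])
    ultimately show "B \<in> homotopy_group_map n Y F x ` homotopy_group n X x" by (rule image_eqI)
  qed
qed

lemma weak_homotopy_equivalence_ident: "weak_homotopy_equivalence X X (\<lambda>x. x)"
proof (rule weak_homotopy_equivalenceI)
  fix x assume "x \<in> topspace X"
  show "\<exists>s h. based_section X X (\<lambda>x. x) x s h"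
    by (rule exI[of _ "\<lambda>x. x"], rule exI[of _ snd]) (simp add: based_section_def continuous_map_snd)
qed simp_all

lemma weak_homotopy_equivalenceI_copy:
  assumes H: "homeomorphic_maps R X \<iota> j"
    and F: "continuous_map R Y F" and ne: "topspace Y \<noteq> {} \<Longrightarrow> topspace R \<noteq> {}"
    and S: "\<And>x. x \<in> topspace R \<Longrightarrow> \<exists>s h. based_section R Y F x s h"
  shows "weak_homotopy_equivalence X Y (\<lambda>x. F (j x))"
proof (rule weak_homotopy_equivalenceI)
  have ij: "continuous_map R X \<iota>" "continuous_map X R j" "\<And>x. x \<in> topspace R \<Longrightarrow> j (\<iota> x) = x"
    "\<And>y. y \<in> topspace X \<Longrightarrow> \<iota> (j y) = y"
    using H by (auto simp: homeomorphic_maps_def)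
  have jX: "j x \<in> topspace R" if "x \<in> topspace X" for x using ij(2) that by (auto simp: continuous_map_def)
  show "continuous_map X Y (\<lambda>x. F (j x))" using continuous_map_compose[OF ij(2) F] by (simp add: comp_def)
  show "topspace X \<noteq> {}" if Y: "topspace Y \<noteq> {}"
  proof -
    obtain y where "y \<in> topspace R" using ne[OF Y] by blast
    then have "\<iota> y \<in> topspace X" using continuous_map_image_subset_topspace[OF ij(1)] by blast
    then show ?thesis by blast
  qed
  fix x assume x: "x \<in> topspace X"
  obtain s h where sh: "based_section R Y F (j x) s h" using S[OF jX[OF x]] by blast
  note s = based_sectionD(1-3)[OF sh] and h = based_sectionD(4-7)[OF sh]
  have sY: "s y \<in> topspace R" if "y \<in> topspace Y" for y using s(1) that by (auto simp: continuous_map_def)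
  have 1: "continuous_map Y X (\<lambda>y. \<iota> (s y))" using continuous_map_compose[OF s(1) ij(1)] by (simp add: comp_def)
  have "continuous_map (prod_topology (top_of_set {0..1::real}) X) (prod_topology (top_of_set {0..1}) R) (\<lambda>z. (fst z, j (snd z)))"
    by (intro continuous_map_pairedI continuous_map_fst continuous_map_compose[OF continuous_map_snd ij(2), unfolded comp_def])
  from continuous_map_compose[OF continuous_map_compose[OF this h(1)] ij(1)]
  have 2: "continuous_map (prod_topology (top_of_set {0..1::real}) X) X (\<lambda>z. \<iota> (h (fst z, j (snd z))))" by (simp add: comp_def)
  have "based_section X Y (\<lambda>x. F (j x)) x (\<lambda>y. \<iota> (s y)) (\<lambda>z. \<iota> (h (fst z, j (snd z))))"
    unfolding based_section_def
    by (intro conjI ballI 1 2) (simp_all add: ij(3,4) sY s(2,3) h(2-4) jX x)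
  then show "\<exists>s h. based_section X Y (\<lambda>x. F (j x)) x s h" by blast
qed

section \<open>Simplicial maps with contractible fibres\<close>

text \<open>The complex induced from \<open>B\<close> along \<open>p\<close>: over a vertex of
  \<open>B\<close> lies the full simplex on the points of \<open>V\<close> above it.\<close>

definition blowup :: "'v set \<Rightarrow> ('v \<Rightarrow> 'w) \<Rightarrow> 'w set set \<Rightarrow> 'v set set" where
  "blowup V p B = {\<sigma>. finite \<sigma> \<and> \<sigma> \<noteq> {} \<and> \<sigma> \<subseteq> V \<and> p ` \<sigma> \<in> B}"

lemma simplicial_complex_blowup:
  assumes B: "simplicial_complex B" shows "simplicial_complex (blowup V p B)"
  unfolding simplicial_complex_def
proof (intro ballI conjI allI impI)
  fix \<sigma> assume s: "\<sigma> \<in> blowup V p B"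
  then show "finite \<sigma>" "\<sigma> \<noteq> {}" by (auto simp: blowup_def)
  fix \<tau> assume t: "\<tau> \<noteq> {} \<and> \<tau> \<subseteq> \<sigma>"
  have "p ` \<tau> \<in> B"
    by (rule simplicial_complexD(3)[OF B, of "p ` \<sigma>"]) (use s t in \<open>auto simp: blowup_def\<close>)
  then show "\<tau> \<in> blowup V p B" using s t finite_subset by (auto simp: blowup_def)
qed

text \<open>The simplicial map of \<open>p\<close> in barycentric coordinates. The sum runs over the
  support so as to be finite; \<open>push_coords_eq\<close> replaces it by a sum over a fixed
  simplex, where continuity is visible.\<close>

definition push_coords :: "('v \<Rightarrow> 'w) \<Rightarrow> ('v \<Rightarrow> real) \<Rightarrow> 'w \<Rightarrow> real" where
  "push_coords p x = (\<lambda>w. \<Sum>v | x v \<noteq> 0 \<and> p v = w. x v)"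

lemma push_coords_eq:
  assumes "finite \<sigma>" "\<And>v. v \<notin> \<sigma> \<Longrightarrow> x v = 0"
  shows "push_coords p x w = (\<Sum>v | v \<in> \<sigma> \<and> p v = w. x v)"
  unfolding push_coords_def by (rule sum.mono_neutral_left) (use assms in auto)

lemma push_coords_simplex:
  assumes B: "simplicial_complex B" and s: "\<sigma> \<in> blowup V p B" and x: "x \<in> closed_simplex (blowup V p B) \<sigma>"
  shows "push_coords p x \<in> closed_simplex B (p ` \<sigma>)"
proof -
  note K = simplicial_complex_blowup[OF B, of V p]
  note D = closed_simplexD[OF K s x]
  have fin: "finite \<sigma>" by (rule simplicial_complexD(1)[OF K s])
  have e: "push_coords p x w = (\<Sum>v | v \<in> \<sigma> \<and> p v = w. x v)" for w by (rule push_coords_eq[OF fin D(3)])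
  show ?thesis
  proof (rule closed_simplexI[OF B])
    show "p ` \<sigma> \<in> B" using s by (simp add: blowup_def)
    show "0 \<le> push_coords p x w" for w unfolding e by (rule sum_nonneg) (rule D(2))
    show "push_coords p x w = 0" if "w \<notin> p ` \<sigma>" for w
    proof -
      have "{v. v \<in> \<sigma> \<and> p v = w} = {}" using that by blast
      then show ?thesis unfolding e by (simp only: sum.empty)
    qed
    show "(\<Sum>w\<in>p ` \<sigma>. push_coords p x w) = 1"
      unfolding e D(4)[symmetric] using sum.group[OF fin finite_imageI[OF fin] order_refl, of x p] by simp
  qed
qed

lemma continuous_on_push_coords:
  assumes B: "simplicial_complex B" and s: "\<sigma> \<in> blowup V p B"
  shows "continuous_on (closed_simplex (blowup V p B) \<sigma>) (push_coords p)"
proof (rule continuous_on_coordinatewise_then_product)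
  fix w
  note K = simplicial_complex_blowup[OF B, of V p]
  have "continuous_on (closed_simplex (blowup V p B) \<sigma>) (\<lambda>x. \<Sum>v | v \<in> \<sigma> \<and> p v = w. x v)"
    by (intro continuous_on_sum continuous_on_subset[OF continuous_on_product_coordinates]) simp
  then show "continuous_on (closed_simplex (blowup V p B) \<sigma>) (\<lambda>x. push_coords p x w)"
    by (rule continuous_on_eq) (rule push_coords_eq[symmetric, OF simplicial_complexD(1)[OF K s] closed_simplexD(3)[OF K s]])
qed

lemma continuous_map_push_coords:
  assumes B: "simplicial_complex B" shows "continuous_map (realization (blowup V p B)) (realization B) (push_coords p)"
proof (rule continuous_map_from_realization[OF simplicial_complex_blowup[OF B]], rule continuous_map_into_simplex)
  fix \<sigma> assume s: "\<sigma> \<in> blowup V p B"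
  show "p ` \<sigma> \<in> B" using s by (simp add: blowup_def)
qed (use continuous_on_push_coords[OF B] push_coords_simplex[OF B] in auto)

text \<open>The section through \<open>x\<close> sends the vertex \<open>w\<close> to the point of the fibre over \<open>w\<close> with
  barycentric coordinates proportional to those of \<open>x\<close>, or to a chosen vertex if they all vanish.\<close>

lemma push_coords_section:
  fixes p :: "'v \<Rightarrow> 'w"
  assumes B: "simplicial_complex B" and V: "\<Union>B \<subseteq> p ` V" and x: "x \<in> realization_points (blowup V p B)"
  shows "\<exists>s h. based_section (realization (blowup V p B)) (realization B) (push_coords p) x s h"
proof -
  let ?K = "blowup V p B" let ?y = "push_coords p x"
  note K = simplicial_complex_blowup[OF B, of V p]
  have supp: "{v. x v \<noteq> 0} \<in> ?K" by (rule realization_pointsD(2)[OF x])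
  then have suppV: "{v. x v \<noteq> 0} \<subseteq> V" and fsupp: "finite {v. x v \<noteq> 0}" by (auto simp: blowup_def)
  have x0: "0 \<le> x v" for v by (rule realization_pointsD(1)[OF x])
  define r where "r = inv_into V p"
  have r: "r w \<in> V \<and> p (r w) = w" if "w \<in> \<Union>B" for w
    unfolding r_def using inv_into_into[OF subsetD[OF V that]] f_inv_into_f[OF subsetD[OF V that]] by blast
  \<comment> \<open>The weight of \<open>v\<close> within its fibre. Fibres that carry mass of
    \<open>x\<close> divide it in proportion; the others put everything on the chosen vertex
    \<open>r (p v)\<close>.\<close>
  define c where "c v = (if v \<notin> V then 0 else if ?y (p v) \<noteq> 0 then x v / ?y (p v) else if v = r (p v) then 1 else 0)" for v
  define \<F> where "\<F> w = {v. c v \<noteq> 0 \<and> p v = w}" for w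
  have y0: "0 \<le> ?y w" for w unfolding push_coords_def by (rule sum_nonneg) (rule x0)
  have c0: "0 \<le> c v" for v using x0 y0 by (simp add: c_def)
  have FV: "\<F> w \<subseteq> V" for w by (auto simp: \<F>_def c_def)
  have F: "finite (\<F> w) \<and> \<F> w \<noteq> {} \<and> (\<Sum>v\<in>\<F> w. c v) = 1" if w: "w \<in> \<Union>B" for w
  proof (cases "?y w = 0")
    case True
    have "\<F> w = {r w}" using r[OF w] True by (auto simp: \<F>_def c_def)
    moreover have "c (r w) = 1" using r[OF w] True by (simp add: c_def)
    ultimately show ?thesis by simp
  next
    case False
    have e: "\<F> w = {v. x v \<noteq> 0 \<and> p v = w}" using False suppV by (auto simp: \<F>_def c_def)
    have fin: "finite (\<F> w)" unfolding e by (rule finite_subset[OF _ fsupp]) blast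
    have "(\<Sum>v\<in>\<F> w. c v) = (\<Sum>v\<in>\<F> w. x v / ?y w)"
      using suppV False by (intro sum.cong refl) (auto simp: e c_def)
    also have "\<dots> = ?y w / ?y w" unfolding sum_divide_distrib[symmetric] by (simp add: e push_coords_def)
    also have "\<dots> = 1" using False by simp
    finally have "(\<Sum>v\<in>\<F> w. c v) = 1" .
    moreover from this have "\<F> w \<noteq> {}" by auto
    ultimately show ?thesis using fin by blast
  qed
  have Fdisj: "\<F> w \<inter> \<F> w' = {}" if "w \<noteq> w'" for w w' using that by (auto simp: \<F>_def)
  \<comment> \<open>The vertices used by the section over \<open>\<tau>\<close>: finitely many, with
    image exactly \<open>\<tau>\<close>, hence a simplex of \<open>?K\<close>.\<close>
  define E where "E \<tau> = (\<Union>w\<in>\<tau>. \<F> w)" for \<tau>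
  have E: "finite (E \<tau>)" "E \<tau> \<subseteq> V" "p ` E \<tau> = \<tau>" if t: "\<tau> \<in> B" for \<tau>
  proof -
    have tB: "w \<in> \<Union>B" if "w \<in> \<tau>" for w using t that by blast
    show "finite (E \<tau>)" unfolding E_def using F tB simplicial_complexD(1)[OF B t] by (intro finite_UN_I) auto
    show "E \<tau> \<subseteq> V" unfolding E_def using FV by blast
    have "p ` \<F> w = {w}" if "w \<in> \<tau>" for w using F[OF tB[OF that]] by (auto simp: \<F>_def)
    then show "p ` E \<tau> = \<tau>" unfolding E_def image_UN by simp
  qed
  have EK: "E \<tau> \<in> ?K" if t: "\<tau> \<in> B" for \<tau>
    using E[OF t] t simplicial_complexD(2)[OF B t] by (auto simp: blowup_def)
  define s where "s b = (\<lambda>v. c v * b (p v))" for b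
  have s_simplex: "s b \<in> closed_simplex ?K (E \<tau>)" if t: "\<tau> \<in> B" and b: "b \<in> closed_simplex B \<tau>" for b \<tau>
  proof (rule closed_simplexI[OF K EK[OF t]])
    note D = closed_simplexD[OF B t b]
    show "0 \<le> s b v" for v unfolding s_def using c0 D(2) by simp
    show "s b v = 0" if "v \<notin> E \<tau>" for v
      using that D(3)[of "p v"] by (auto simp: s_def E_def \<F>_def)
    have "(\<Sum>v\<in>E \<tau>. s b v) = (\<Sum>w\<in>\<tau>. \<Sum>v\<in>\<F> w. s b v)"
      unfolding E_def by (rule sum.UNION_disjoint) (use simplicial_complexD(1)[OF B t] F t Fdisj in auto)
    also have "\<dots> = (\<Sum>w\<in>\<tau>. b w)"
    proof (rule sum.cong[OF refl])
      fix w assume w: "w \<in> \<tau>"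
      have "(\<Sum>v\<in>\<F> w. s b v) = (\<Sum>v\<in>\<F> w. c v * b w)" by (rule sum.cong[OF refl]) (simp add: s_def \<F>_def)
      then show "(\<Sum>v\<in>\<F> w. s b v) = b w" using F[of w] w t by (auto simp flip: sum_distrib_right)
    qed
    finally show "(\<Sum>v\<in>E \<tau>. s b v) = 1" using D(4) by simp
  qed
  have s_cont: "continuous_on S s" for S
  proof (rule continuous_on_coordinatewise_then_product)
    fix v show "continuous_on S (\<lambda>b. s b v)"
      unfolding s_def by (intro continuous_on_mult continuous_on_const continuous_on_subset[OF continuous_on_product_coordinates]) simp
  qed
  have sc: "continuous_map (realization B) (realization ?K) s"
    by (rule continuous_map_from_realization[OF B], rule continuous_map_into_simplex[OF EK]) (use s_simplex s_cont in auto)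
  have ps: "push_coords p (s y) = y" if "y \<in> topspace (realization B)" for y
  proof
    fix w
    have y: "y \<in> realization_points B" using that by simp
    let ?t = "{w. y w \<noteq> 0}"
    have t: "?t \<in> B" by (rule realization_pointsD(2)[OF y])
    show "push_coords p (s y) w = y w"
    proof (cases "y w = 0")
      case True
      then have "{v. s y v \<noteq> 0 \<and> p v = w} = {}" by (auto simp: s_def)
      then show ?thesis unfolding push_coords_def True by (simp only: sum.empty)
    next
      case False
      have "{v. s y v \<noteq> 0 \<and> p v = w} = \<F> w" using False by (auto simp: s_def \<F>_def)
      then have "push_coords p (s y) w = (\<Sum>v\<in>\<F> w. c v * y w)"
        unfolding push_coords_def by (intro sum.cong) (auto simp: s_def \<F>_def)
      moreover have "w \<in> \<Union>B" using t False by blast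
      ultimately show ?thesis using F[of w] by (simp flip: sum_distrib_right)
    qed
  qed
  \<comment> \<open>On \<open>V\<close> one has \<open>c v * ?y (p v) = x v\<close>: if
    \<open>?y (p v)\<close> vanishes, so does \<open>x v\<close>, because the coordinates are
    nonnegative.\<close>
  have sx: "s ?y = x"
  proof
    fix v
    have "x v = 0" if "?y (p v) = 0"
    proof (rule ccontr)
      assume v: "x v \<noteq> 0"
      have "x v \<le> ?y (p v)"
        unfolding push_coords_def by (rule member_le_sum) (use v x0 in \<open>auto intro: finite_subset[OF _ fsupp]\<close>)
      with x0[of v] v that show False by simp
    qed
    moreover have "x v = 0" if "v \<notin> V" using that suppV by blast
    ultimately show "s ?y v = x v" by (auto simp: s_def c_def)
  qed
  define h where "h z = (\<lambda>v. (1 - fst z) * snd z v + fst z * s (push_coords p (snd z)) v)" for z :: "real \<times> ('v \<Rightarrow> real)"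
  have hc: "continuous_map (prod_topology (top_of_set {0..1::real}) (realization ?K)) (realization ?K) h"
  proof (rule continuous_map_from_prod_realization[OF K])
    fix \<sigma> assume sK: "\<sigma> \<in> ?K"
    then have t: "p ` \<sigma> \<in> B" by (simp add: blowup_def)
    \<comment> \<open>Both ends of each segment lie in this simplex: joining \<open>\<sigma>\<close>
      with the vertices of the section over its image leaves the image unchanged.\<close>
    let ?s = "\<sigma> \<union> E (p ` \<sigma>)"
    have "p ` ?s = p ` \<sigma>" unfolding image_Un E(3)[OF t] by simp
    then have sK': "?s \<in> ?K" using sK E(1,2)[OF t] t by (auto simp: blowup_def)
    note fin' = simplicial_complexD(1)[OF K sK']
    show "continuous_map (top_of_set ({0..1} \<times> closed_simplex ?K \<sigma>)) (realization ?K) h"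
    proof (rule continuous_map_into_simplex[OF sK'])
      have pc: "continuous_on ({0..1::real} \<times> closed_simplex ?K \<sigma>) (\<lambda>z. s (push_coords p (snd z)))"
        by (rule continuous_on_compose2[OF s_cont[of UNIV] continuous_on_compose2[OF continuous_on_push_coords[OF B sK]
                continuous_on_snd[OF continuous_on_id]]]) auto
      show "continuous_on ({0..1} \<times> closed_simplex ?K \<sigma>) h"
      proof (rule continuous_on_coordinatewise_then_product)
        fix v
        have "continuous_on ({0..1::real} \<times> closed_simplex ?K \<sigma>) (\<lambda>z. snd z v)"
          by (rule continuous_on_product_then_coordinatewise[OF continuous_on_snd[OF continuous_on_id]])
        moreover have "continuous_on ({0..1::real} \<times> closed_simplex ?K \<sigma>) (\<lambda>z. s (push_coords p (snd z)) v)"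
          by (rule continuous_on_product_then_coordinatewise[OF pc])
        ultimately show "continuous_on ({0..1} \<times> closed_simplex ?K \<sigma>) (\<lambda>z. h z v)"
          unfolding h_def by (intro continuous_on_add continuous_on_mult continuous_on_diff continuous_on_const continuous_on_fst continuous_on_id)
      qed
      fix z assume "z \<in> {0..1::real} \<times> closed_simplex ?K \<sigma>"
      then obtain u a where z: "z = (u, a)" "0 \<le> u" "u \<le> 1" "a \<in> closed_simplex ?K \<sigma>" by auto
      note D = closed_simplexD[OF K sK z(4)]
      note D' = closed_simplexD[OF K EK[OF t] s_simplex[OF t push_coords_simplex[OF B sK z(4)]]]
      show "h z \<in> closed_simplex ?K ?s"
      proof (rule closed_simplexI[OF K sK'])
        show "0 \<le> h z v" for v using z(2,3) D(2) D'(2) by (simp add: h_def z(1))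
        show "h z v = 0" if "v \<notin> ?s" for v using that D(3)[of v] D'(3)[of v] by (simp add: h_def z(1))
        have "(\<Sum>v\<in>?s. a v) = 1"
          unfolding D(4)[symmetric] by (rule sum.mono_neutral_right[OF fin']) (use D(3) in auto)
        moreover have "(\<Sum>v\<in>?s. s (push_coords p a) v) = 1"
          unfolding D'(4)[symmetric] by (rule sum.mono_neutral_right[OF fin']) (use D'(3) in auto)
        ultimately show "(\<Sum>v\<in>?s. h z v) = 1"
          by (simp add: h_def z(1) sum.distrib flip: sum_distrib_left)
      qed
    qed
  qed
  have "based_section (realization ?K) (realization B) (push_coords p) x s h"
    unfolding based_section_def by (intro conjI ballI sc ps sx hc) (simp_all add: h_def sx algebra_simps)
  then show ?thesis by blast
qed

lemma weak_homotopy_equivalence_blowup: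
  assumes B: "simplicial_complex B" and V: "\<Union>B \<subseteq> p ` V" and H: "homeomorphic_maps (realization (blowup V p B)) X \<iota> j"
  shows "weak_homotopy_equivalence X (realization B) (\<lambda>x. push_coords p (j x))"
proof (rule weak_homotopy_equivalenceI_copy[OF H continuous_map_push_coords[OF B]])
  assume "topspace (realization B) \<noteq> {}"
  then obtain y where "y \<in> realization_points B" by auto
  then have t: "{w. y w \<noteq> 0} \<in> B" by (rule realization_pointsD(2))
  then obtain w where w: "w \<in> {w. y w \<noteq> 0}" using simplicial_complexD(2)[OF B] by blast
  then have wB: "{w} \<in> B" using simplicial_complexD(3)[OF B t, of "{w}"] by simp
  then obtain v where v: "v \<in> V" "p v = w" using V by blast
  have vK: "{v} \<in> blowup V p B" using v wB by (simp add: blowup_def)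
  have "(\<lambda>u. if u = v then 1 else 0 :: real) \<in> closed_simplex (blowup V p B) {v}"
    by (rule closed_simplexI[OF simplicial_complex_blowup[OF B] vK]) auto
  then show "topspace (realization (blowup V p B)) \<noteq> {}" by (auto simp: closed_simplex_def)
qed (use push_coords_section[OF B V] in simp)

section \<open>Vietoris-Rips filtrations\<close>

lemma simplicial_complex_vietoris_rips: "simplicial_complex (vietoris_rips M t)"
  unfolding simplicial_complex_def
proof (intro ballI conjI allI impI)
  fix \<sigma> \<tau> assume s: "\<sigma> \<in> vietoris_rips M t"
  then show "finite \<sigma>" "\<sigma> \<noteq> {}" by (simp_all add: vietoris_rips_def)
  assume t: "\<tau> \<noteq> {} \<and> \<tau> \<subseteq> \<sigma>"
  then have "finite \<tau>" using s finite_subset by (auto simp: vietoris_rips_def)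
  then show "\<tau> \<in> vietoris_rips M t" using s t unfolding vietoris_rips_def by blast
qed

lemma vietoris_rips_mono: "s \<le> t \<Longrightarrow> vietoris_rips M s \<subseteq> vietoris_rips M t"
  unfolding vietoris_rips_def by (auto intro: order_trans)

lemma VR_simps [simp]: "space_at (VR M) t = realization (vietoris_rips M t)" "trans_map (VR M) s t x = x"
  by (simp_all add: VR_def)

lemma persistent_space_VR: "persistent_space (VR M)"
proof -
  have "homeomorphic_maps (realization (vietoris_rips M t)) (realization (vietoris_rips M t)) (\<lambda>x. x) (\<lambda>x. x)" for t
    by (simp add: homeomorphic_maps_def)
  from cgwh_space_realization[OF simplicial_complex_vietoris_rips this]
  show ?thesis
    unfolding persistent_space_def VR_simps
    by (intro conjI allI impI ballI realization_mono simplicial_complex_vietoris_rips vietoris_rips_mono refl)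
qed

text \<open>Points are barycentric coordinates on the fixed vertex set \<open>V\<close>, relocated
  by \<open>\<iota>\<close>, so the complexes are nested and the transition maps are
  identities.\<close>

definition VR_copy :: "(('v \<Rightarrow> real) \<Rightarrow> 'u) \<Rightarrow> 'v set \<Rightarrow> ('v \<Rightarrow> 'm) \<Rightarrow> 'm metric \<Rightarrow> 'u pspace" where
  "VR_copy \<iota> V p M = \<lparr>space_at = (\<lambda>t. pullback_topology (range \<iota>) (inv_into UNIV \<iota>) (realization (blowup V p (vietoris_rips M t)))),
     trans_map = (\<lambda>s t x. x)\<rparr>"

lemma VR_copy_simps:
  "space_at (VR_copy \<iota> V p M) t = pullback_topology (range \<iota>) (inv_into UNIV \<iota>) (realization (blowup V p (vietoris_rips M t)))"
  "trans_map (VR_copy \<iota> V p M) s t x = x"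
  by (simp_all add: VR_copy_def)

lemma simplicial_complex_VR_blowup: "simplicial_complex (blowup V p (vietoris_rips M t))"
  by (rule simplicial_complex_blowup[OF simplicial_complex_vietoris_rips])

lemma pullback_realization_mono:
  assumes i: "inj \<iota>" and K: "simplicial_complex K" "simplicial_complex L" and sub: "K \<subseteq> L"
  shows "continuous_map (pullback_topology (range \<iota>) (inv_into UNIV \<iota>) (realization K))
    (pullback_topology (range \<iota>) (inv_into UNIV \<iota>) (realization L)) (\<lambda>x. x)"
proof -
  have H: "homeomorphic_maps (realization K) (pullback_topology (range \<iota>) (inv_into UNIV \<iota>) (realization K)) \<iota> (inv_into UNIV \<iota>)" for K
    by (rule homeomorphic_maps_pullback[OF i])
  have 1: "continuous_map (pullback_topology (range \<iota>) (inv_into UNIV \<iota>) (realization K)) (realization K) (inv_into UNIV \<iota>)"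
    using H[of K] by (simp add: homeomorphic_maps_def)
  have 2: "continuous_map (realization L) (pullback_topology (range \<iota>) (inv_into UNIV \<iota>) (realization L)) \<iota>"
    using H[of L] by (simp add: homeomorphic_maps_def)
  show ?thesis
    by (rule continuous_map_eq[OF continuous_map_compose[OF continuous_map_compose[OF 1 realization_mono[OF K sub]] 2]])
      (use H[of K] in \<open>auto simp: homeomorphic_maps_def\<close>)
qed

lemma persistent_space_VR_copy:
  assumes i: "inj \<iota>" shows "persistent_space (VR_copy \<iota> V p M)"
proof -
  have c: "cgwh_space (pullback_topology (range \<iota>) (inv_into UNIV \<iota>) (realization (blowup V p (vietoris_rips M t))))" for t
    by (rule cgwh_space_realization[OF simplicial_complex_VR_blowup homeomorphic_maps_pullback[OF i]])
  have "blowup V p (vietoris_rips M s) \<subseteq> blowup V p (vietoris_rips M t)" if "s \<le> t" for s t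
    using vietoris_rips_mono[OF that, of M] unfolding blowup_def by blast
  then show ?thesis
    unfolding persistent_space_def VR_copy_simps
    by (intro conjI allI impI ballI c pullback_realization_mono[OF i] simplicial_complex_VR_blowup refl)
qed

text \<open>In the required span the middle object is the copy itself: one leg is the identity, the
  other is induced by \<open>p\<close>.\<close>

lemma weakly_equivalent_VR_copy:
  fixes \<iota> :: "('v \<Rightarrow> real) \<Rightarrow> 'u"
  assumes i: "inj \<iota>" and V: "mspace M \<subseteq> p ` V"
  shows "weakly_equivalent TYPE('u) (VR_copy \<iota> V p M) (VR M)"
proof -
  have sub: "\<Union>(vietoris_rips M t) \<subseteq> p ` V" for t using V by (auto simp: vietoris_rips_def)
  have 1: "objectwise_weak_equivalence (VR_copy \<iota> V p M) (VR_copy \<iota> V p M) (\<lambda>t x. x)"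
    by (simp add: objectwise_weak_equivalence_def shifted_map_def VR_copy_simps weak_homotopy_equivalence_ident)
  have w: "weak_homotopy_equivalence (space_at (VR_copy \<iota> V p M) t) (space_at (VR M) t) (\<lambda>x. push_coords p (inv_into UNIV \<iota> x))" for t
    unfolding VR_copy_simps VR_simps
    by (rule weak_homotopy_equivalence_blowup[OF simplicial_complex_vietoris_rips sub homeomorphic_maps_pullback[OF i]])
  then have "continuous_map (space_at (VR_copy \<iota> V p M) t) (space_at (VR M) t) (\<lambda>x. push_coords p (inv_into UNIV \<iota> x))" for t
    by (simp add: weak_homotopy_equivalence_def)
  with w have "objectwise_weak_equivalence (VR_copy \<iota> V p M) (VR M) (\<lambda>t x. push_coords p (inv_into UNIV \<iota> x))"
    by (simp add: objectwise_weak_equivalence_def shifted_map_def VR_copy_simps(2))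
  with 1 persistent_space_VR_copy[OF i] show ?thesis unfolding weakly_equivalent_def by blast
qed

text \<open>A distortion of at most \<open>e\<close> makes each complex a subcomplex of the other
  one \<open>e\<close> later. All maps are identities on points, so the interleaving equations hold
  at once.\<close>

lemma interleaved_VR_copy:
  fixes \<iota> :: "('v \<Rightarrow> real) \<Rightarrow> 'u"
  assumes i: "inj \<iota>" and pq: "\<And>v. v \<in> V \<Longrightarrow> p v \<in> mspace M" "\<And>v. v \<in> V \<Longrightarrow> q v \<in> mspace N"
    and d: "\<And>v w. v \<in> V \<Longrightarrow> w \<in> V \<Longrightarrow> \<bar>mdist M (p v) (p w) - mdist N (q v) (q w)\<bar> \<le> e"
  shows "interleaved e (VR_copy \<iota> V p M) (VR_copy \<iota> V q N)"
proof -
  have 1: "blowup V p (vietoris_rips M t) \<subseteq> blowup V q (vietoris_rips N (t + e))" for t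
  proof
    fix \<sigma> assume s: "\<sigma> \<in> blowup V p (vietoris_rips M t)"
    have "mdist N (q v) (q w) \<le> t + e" if vw: "v \<in> \<sigma>" "w \<in> \<sigma>" for v w
    proof -
      have "mdist M (p v) (p w) \<le> t" using s vw by (auto simp: blowup_def vietoris_rips_def)
      moreover have "v \<in> V" "w \<in> V" using s vw by (auto simp: blowup_def)
      ultimately show ?thesis using d[of v w] by linarith
    qed
    then show "\<sigma> \<in> blowup V q (vietoris_rips N (t + e))" using s pq(2) by (auto simp: blowup_def vietoris_rips_def)
  qed
  have 2: "blowup V q (vietoris_rips N t) \<subseteq> blowup V p (vietoris_rips M (t + e))" for t
  proof
    fix \<sigma> assume s: "\<sigma> \<in> blowup V q (vietoris_rips N t)"
    have "mdist M (p v) (p w) \<le> t + e" if vw: "v \<in> \<sigma>" "w \<in> \<sigma>" for v w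
    proof -
      have "mdist N (q v) (q w) \<le> t" using s vw by (auto simp: blowup_def vietoris_rips_def)
      moreover have "v \<in> V" "w \<in> V" using s vw by (auto simp: blowup_def)
      ultimately show ?thesis using d[of v w] by linarith
    qed
    then show "\<sigma> \<in> blowup V p (vietoris_rips M (t + e))" using s pq(1) by (auto simp: blowup_def vietoris_rips_def)
  qed
  have "shifted_map e (VR_copy \<iota> V p M) (VR_copy \<iota> V q N) (\<lambda>t x. x)" "shifted_map e (VR_copy \<iota> V q N) (VR_copy \<iota> V p M) (\<lambda>t x. x)"
    unfolding shifted_map_def VR_copy_simps
    by (simp_all add: pullback_realization_mono[OF i simplicial_complex_VR_blowup simplicial_complex_VR_blowup] 1 2)
  then show ?thesis unfolding interleaved_def by (intro exI[of _ "\<lambda>t x. x"]) (simp add: VR_copy_simps)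
qed

text \<open>Because the bound is strict, the infima, which need not be attained, are undercut by
  actual points.\<close>

lemma Hausdorff_dist_less:
  assumes "Hausdorff_dist Z A B < ennreal r" and r: "0 < r"
  shows "a \<in> A \<Longrightarrow> \<exists>b\<in>B. mdist Z a b < r" and "b \<in> B \<Longrightarrow> \<exists>a\<in>A. mdist Z a b < r"
proof -
  have m: "(SUP a \<in> A. INF b \<in> B. ennreal (mdist Z a b)) < ennreal r" "(SUP b \<in> B. INF a \<in> A. ennreal (mdist Z a b)) < ennreal r"
    using assms(1) by (simp_all add: Hausdorff_dist_def)
  show "\<exists>b\<in>B. mdist Z a b < r" if "a \<in> A"
  proof -
    have "(INF b \<in> B. ennreal (mdist Z a b)) < ennreal r" by (rule le_less_trans[OF SUP_upper[OF that] m(1)])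
    then show ?thesis using r by (auto simp: INF_less_iff ennreal_less_iff)
  qed
  show "\<exists>a\<in>A. mdist Z a b < r" if "b \<in> B"
  proof -
    have "(INF a \<in> A. ennreal (mdist Z a b)) < ennreal r" by (rule le_less_trans[OF SUP_upper[OF that] m(2)])
    then show ?thesis using r by (auto simp: INF_less_iff ennreal_less_iff)
  qed
qed

lemma homotopy_interleaving_dist_VR_le:
  fixes \<iota> :: "('m + 'n \<Rightarrow> real) \<Rightarrow> 'u" and M :: "'m metric" and N :: "'n metric"
  assumes i: "inj \<iota>" and f: "isometric_embedding M Z f" and g: "isometric_embedding N Z g"
    and H: "Hausdorff_dist Z (f ` mspace M) (g ` mspace N) < ennreal r" and r: "0 < r"
  shows "homotopy_interleaving_dist TYPE('u) (VR M) (VR N) \<le> ennreal (2 * r)"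
proof -
  have fZ: "f x \<in> mspace Z" if "x \<in> mspace M" for x using f that by (auto simp: isometric_embedding_def)
  have gZ: "g y \<in> mspace Z" if "y \<in> mspace N" for y using g that by (auto simp: isometric_embedding_def)
  have "\<forall>x\<in>mspace M. \<exists>y. y \<in> mspace N \<and> mdist Z (f x) (g y) < r" using Hausdorff_dist_less(1)[OF H r] by blast
  from bchoice[OF this] obtain \<phi> where phi: "\<forall>x\<in>mspace M. \<phi> x \<in> mspace N \<and> mdist Z (f x) (g (\<phi> x)) < r" ..
  have "\<forall>y\<in>mspace N. \<exists>x. x \<in> mspace M \<and> mdist Z (f x) (g y) < r" using Hausdorff_dist_less(2)[OF H r] by blast
  from bchoice[OF this] obtain \<psi> where psi: "\<forall>y\<in>mspace N. \<psi> y \<in> mspace M \<and> mdist Z (f (\<psi> y)) (g y) < r" ..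
  \<comment> \<open>Every point is listed with a partner in the other space: \<open>p\<close> fixes
    the points of \<open>M\<close> and moves those of \<open>N\<close> by \<open>\<psi>\<close>, and
    \<open>q\<close> does the opposite.\<close>
  define V where "V = Inl ` mspace M \<union> Inr ` mspace N"
  define p where "p = case_sum (\<lambda>x. x) \<psi>"
  define q where "q = case_sum \<phi> (\<lambda>y. y)"
  have pq: "p v \<in> mspace M" "q v \<in> mspace N" "mdist Z (f (p v)) (g (q v)) < r" if "v \<in> V" for v
    using that phi psi by (auto simp: V_def p_def q_def)
  \<comment> \<open>In \<open>Z\<close> both endpoints move by less than \<open>r\<close>, and each
    move costs at most \<open>r\<close> in the triangle inequality.\<close>
  have "\<bar>mdist M (p v) (p w) - mdist N (q v) (q w)\<bar> \<le> 2 * r" if v: "v \<in> V" and w: "w \<in> V" for v w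
  proof -
    note P = fZ[OF pq(1)[OF v]] fZ[OF pq(1)[OF w]] gZ[OF pq(2)[OF v]] gZ[OF pq(2)[OF w]]
    have "mdist Z (f (p v)) (f (p w)) = mdist M (p v) (p w)" "mdist Z (g (q v)) (g (q w)) = mdist N (q v) (q w)"
      using f g pq(1,2) v w by (auto simp: isometric_embedding_def)
    then show ?thesis
      using mdist_triangle[OF P(1) P(3) P(2)] mdist_triangle[OF P(3) P(4) P(2)] mdist_triangle[OF P(3) P(1) P(4)]
        mdist_triangle[OF P(1) P(2) P(4)] pq(3)[OF v] pq(3)[OF w] mdist_commute[of Z] by (smt (verit))
  qed
  from interleaved_VR_copy[OF i pq(1,2) this]
  have "interleaved (2 * r) (VR_copy \<iota> V p M) (VR_copy \<iota> V q N)" by simp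
  then have "interleaving_dist (VR_copy \<iota> V p M) (VR_copy \<iota> V q N) \<le> ennreal (2 * r)"
    unfolding interleaving_dist_def using r by (intro Inf_lower CollectI exI[of _ "2 * r"]) simp
  moreover have "weakly_equivalent TYPE('u) (VR_copy \<iota> V p M) (VR M)" "weakly_equivalent TYPE('u) (VR_copy \<iota> V q N) (VR N)"
    by (rule weakly_equivalent_VR_copy[OF i]; force simp: V_def p_def q_def image_iff)+
  then have "homotopy_interleaving_dist TYPE('u) (VR M) (VR N) \<le> interleaving_dist (VR_copy \<iota> V p M) (VR_copy \<iota> V q N)"
    unfolding homotopy_interleaving_dist_def
    by (intro Inf_lower CollectI exI[of _ "VR_copy \<iota> V p M"] exI[of _ "VR_copy \<iota> V q N"] conjI refl
        persistent_space_VR_copy[OF i])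
  ultimately show ?thesis by (rule order_trans[rotated])
qed

lemma homotopy_interleaving_dist_VR_le_Gromov_Hausdorff:
  fixes \<iota> :: "('m + 'n \<Rightarrow> real) \<Rightarrow> 'u" and M :: "'m metric" and N :: "'n metric"
  assumes i: "inj \<iota>"
  shows "homotopy_interleaving_dist TYPE('u) (VR M) (VR N) \<le> 2 * Gromov_Hausdorff_dist M N"
proof -
  let ?d = "homotopy_interleaving_dist TYPE('u) (VR M) (VR N)"
  \<comment> \<open>Halving lets every real \<open>r\<close> above the Gromov-Hausdorff distance be
    used as it stands; the bound \<open>z = \<infinity>\<close> is trivial.\<close>
  have "?d / 2 \<le> Gromov_Hausdorff_dist M N"
  proof (rule dense_ge)
    fix z assume z: "Gromov_Hausdorff_dist M N < z"
    show "?d / 2 \<le> z"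
    proof (cases z)
      case (real r)
      have r: "0 < r" using le_less_trans[OF zero_le z] real by simp
      from z obtain Z f g where "isometric_embedding M Z f" "isometric_embedding N (Z :: ('m + 'n) metric) g"
        "Hausdorff_dist Z (f ` mspace M) (g ` mspace N) < ennreal r"
        unfolding Gromov_Hausdorff_dist_def Inf_less_iff real(2) by blast
      from homotopy_interleaving_dist_VR_le[OF i this r] r
      have "?d \<le> 2 * z" by (simp add: real(2) ennreal_mult)
      then show ?thesis by (intro divide_le_posI_ennreal) simp_all
    qed simp
  qed
  then have "2 * (?d / 2) \<le> 2 * Gromov_Hausdorff_dist M N" by (intro mult_left_mono) simp_all
  moreover have "2 * (?d / 2) = ?d"
    unfolding ennreal_times_divide mult.commute[of 2 ?d] by (rule mult_divide_eq_ennreal) simp_all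
  ultimately show ?thesis by simp
qed

lemma inj_pair_real: "\<exists>\<pi> :: real \<times> real \<Rightarrow> real. inj \<pi>"
proof -
  have "infinite (UNIV :: real set)" by (rule infinite_UNIV_char_0)
  from card_of_Times_same_infinite[OF this] have "|UNIV :: (real \<times> real) set| \<le>o |UNIV :: real set|"
    unfolding UNIV_Times_UNIV by (rule ordIso_imp_ordLeq)
  then show ?thesis unfolding card_of_ordLeq[symmetric] by blast
qed

text \<open>A function on the sum is a pair of functions. The one on \<open>'m\<close> is moved to
  the index type \<open>'n\<close> along a left inverse of \<open>e\<close>, and the two values at
  each index are coded as one real number.\<close>

lemma inj_sum_fun:
  assumes e: "inj (e :: 'm \<Rightarrow> 'n)" shows "\<exists>\<iota> :: ('m + 'n \<Rightarrow> real) \<Rightarrow> ('n \<Rightarrow> real). inj \<iota>"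
proof -
  obtain \<pi> :: "real \<times> real \<Rightarrow> real" where pi: "inj \<pi>" using inj_pair_real by blast
  let ?i = "\<lambda>(x :: 'm + 'n \<Rightarrow> real) n. \<pi> (x (Inr n), x (Inl (inv_into UNIV e n)))"
  have "inj ?i"
  proof (rule injI)
    fix x y assume "?i x = ?i y"
    then have "\<pi> (x (Inr n), x (Inl (inv_into UNIV e n))) = \<pi> (y (Inr n), y (Inl (inv_into UNIV e n)))" for n by (rule fun_cong)
    then have eq: "x (Inr n) = y (Inr n)" "x (Inl (inv_into UNIV e n)) = y (Inl (inv_into UNIV e n))" for n
      using injD[OF pi] by blast+
    show "x = y"
    proof
      fix v show "x v = y v"
        by (cases v) (use eq(1) eq(2)[of "e _"] e in \<open>simp_all\<close>)
    qed
  qed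
  then show ?thesis by blast
qed

text \<open>The blowups have points of type \<open>'m + 'n \<Rightarrow> real\<close>, but only the
  two realizations are known to fit into the universe. As cardinals are comparable, one of the
  vertex types injects into the other, and functions on the sum then fit where functions on the
  larger type do.\<close>

lemma inj_sum_universe:
  assumes i: "inj (i :: ('m \<Rightarrow> real) \<Rightarrow> 'u)" and j: "inj (j :: ('n \<Rightarrow> real) \<Rightarrow> 'u)"
  shows "\<exists>\<iota> :: ('m + 'n \<Rightarrow> real) \<Rightarrow> 'u. inj \<iota>"
proof -
  consider e where "inj (e :: 'm \<Rightarrow> 'n)" | e where "inj (e :: 'n \<Rightarrow> 'm)"
  proof -
    have "|UNIV :: 'm set| \<le>o |UNIV :: 'n set| \<or> |UNIV :: 'n set| \<le>o |UNIV :: 'm set|"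
      by (rule ordLeq_total[OF card_of_Well_order card_of_Well_order])
    then show thesis unfolding card_of_ordLeq[symmetric] using that by blast
  qed
  then show ?thesis
  proof cases
    case 1
    obtain k :: "('m + 'n \<Rightarrow> real) \<Rightarrow> ('n \<Rightarrow> real)" where "inj k" using inj_sum_fun[OF 1] by blast
    then show ?thesis using inj_compose[OF j] by blast
  next
    case 2
    obtain k :: "('n + 'm \<Rightarrow> real) \<Rightarrow> ('m \<Rightarrow> real)" where k: "inj k" using inj_sum_fun[OF 2] by blast
    have "inj (\<lambda>(x :: 'm + 'n \<Rightarrow> real) v. x (case_sum Inr Inl v))"
    proof (rule injI)
      fix x y :: "'m + 'n \<Rightarrow> real" assume eq: "(\<lambda>v. x (case_sum Inr Inl v)) = (\<lambda>v. y (case_sum Inr Inl v))"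
      show "x = y"
      proof
        fix v show "x v = y v" using fun_cong[OF eq, of "case_sum Inr Inl v"] by (cases v) simp_all
      qed
    qed
    then show ?thesis using inj_compose[OF i inj_compose[OF k]] by blast
  qed
qed

theorem theorem3:
  fixes X :: "'a pspace" and Y :: "'b pspace" and M :: "'m metric" and N :: "'n metric"
  shows
    "(persistent_space X \<and> persistent_space Y \<and>
      q_tame TYPE('k::field) X \<and> q_tame TYPE('k) Y \<longrightarrow>
        erosion_dist (cup_length_invariant TYPE('k) X) (cup_length_invariant TYPE('k) Y)
          \<le> erosion_dist (cup_module_rank TYPE('k) X) (cup_module_rank TYPE('k) Y) \<and>
        erosion_dist (cup_module_rank TYPE('k) X) (cup_module_rank TYPE('k) Y)
          \<le> homotopy_interleaving_dist TYPE('u) X Y)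
     \<and>
     (q_tame TYPE('k) (VR M) \<and> q_tame TYPE('k) (VR N) \<and>
      (\<exists>i :: ('m \<Rightarrow> real) \<Rightarrow> 'u. inj i) \<and> (\<exists>j :: ('n \<Rightarrow> real) \<Rightarrow> 'u. inj j) \<longrightarrow>
        erosion_dist (cup_length_invariant TYPE('k) (VR M)) (cup_length_invariant TYPE('k) (VR N))
          \<le> 2 * Gromov_Hausdorff_dist M N \<and>
        erosion_dist (cup_module_rank TYPE('k) (VR M)) (cup_module_rank TYPE('k) (VR N))
          \<le> 2 * Gromov_Hausdorff_dist M N \<and>
        homotopy_interleaving_dist TYPE('u) (VR M) (VR N)
          \<le> 2 * Gromov_Hausdorff_dist M N)"
proof (intro conjI impI)
  assume "persistent_space X \<and> persistent_space Y \<and> q_tame TYPE('k) X \<and> q_tame TYPE('k) Y"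
  then show "erosion_dist (cup_length_invariant TYPE('k) X) (cup_length_invariant TYPE('k) Y)
      \<le> erosion_dist (cup_module_rank TYPE('k) X) (cup_module_rank TYPE('k) Y)"
    and "erosion_dist (cup_module_rank TYPE('k) X) (cup_module_rank TYPE('k) Y)
      \<le> homotopy_interleaving_dist TYPE('u) X Y"
    by (simp_all add: erosion_dist_cup_le erosion_dist_rank_le)
next
  assume "q_tame TYPE('k) (VR M) \<and> q_tame TYPE('k) (VR N) \<and>
      (\<exists>i :: ('m \<Rightarrow> real) \<Rightarrow> 'u. inj i) \<and> (\<exists>j :: ('n \<Rightarrow> real) \<Rightarrow> 'u. inj j)"
  then obtain \<iota> :: "('m + 'n \<Rightarrow> real) \<Rightarrow> 'u" where "inj \<iota>" using inj_sum_universe by blast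
  then show hi: "homotopy_interleaving_dist TYPE('u) (VR M) (VR N) \<le> 2 * Gromov_Hausdorff_dist M N"
    by (rule homotopy_interleaving_dist_VR_le_Gromov_Hausdorff)
  note VR = persistent_space_VR[of M] persistent_space_VR[of N]
  show rk: "erosion_dist (cup_module_rank TYPE('k) (VR M)) (cup_module_rank TYPE('k) (VR N)) \<le> 2 * Gromov_Hausdorff_dist M N"
    by (rule order_trans[OF erosion_dist_rank_le[OF VR] hi])
  show "erosion_dist (cup_length_invariant TYPE('k) (VR M)) (cup_length_invariant TYPE('k) (VR N)) \<le> 2 * Gromov_Hausdorff_dist M N"
    by (rule order_trans[OF erosion_dist_cup_le[OF VR] rk])
qed

end
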